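(* Let $n\in\mathbb{N}$, and let $f:\mathcal{F}(V,\mathbb{R}^n)\to\mathcal{F}(W,\mathbb{R}^n)$ be a linear bijection with $$f(\mathcal{F}(V,\mathbb{R}^n\setminus\{\mathbf{0}\}))=\mathcal{F}(W,\mathbb{R}^n\setminus\{\mathbf{0}\}).$$ Then there exist a bi-$\mathcal{F}$ map $\phi:W\to V$ and an $\mathcal{F}$ map $\tilde\gamma:W\to GL(n,\mathbb{R})$ such that $$f(x)(w)=\tilde\gamma(w)(x\circ\phi(w)),\qquad w\in W,\ x\in\mathcal{F}(V,\mathbb{R}^n).$$
   Context: All manifolds are Hausdorff. $V$ and $W$ are finite dimensional $C^\infty$ manifolds, possibly with boundary, not necessarily paracompact or connected. $\mathbb{N}=\{1,2,\dots\}$. Smoothness class: $\mathcal{F}$ is a fixed class among $C^k$, $k=0,1,\dots,\infty$ (in the Michal–Bastiani or the Fréchet sense), locally Hölder $C^{k,\alpha}$, $k=0,1,\dots$, $0\le\alpha\le1$ ($C^{k,0}=C^k$), or locally Sobolev $W^{k,p}$, $k=1,2,\dots$, $1\le p<\infty$, where for $m=\dim_{\mathbb{R}}V$ and for $m=\dim_{\mathbb{R}}W$ one has $kp>m$, or $k=m$ and $p=1$. $\mathcal{F}(V,\mathbb{R}^n)$ is the vector space of $\mathcal{F}$ maps $V\to\mathbb{R}^n$, and $\mathcal{F}(V,\mathbb{R}^n\setminus\{\mathbf{0}\})$ is the subset of nowhere vanishing ones; similarly for $W$. A bijection $\phi:W\to V$ is a bi-$\mathcal{F}$ map if both $\phi$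 and $\phi^{-1}$ are $\mathcal{F}$ maps. *)

theory Defs
  imports "HOL-Analysis.Analysis"
begin

section \<open>Smoothness classes on subsets of a Euclidean space\<close>

text \<open>Throughout, the set \<open>U\<close> on which a class is considered is relatively open in
  a Euclidean space, in a closed half-space, or in the one-point space \<open>{0}\<close> (the model
  of dimension 0). On \<open>{0}\<close> all classes below reduce to a void condition.\<close>

text \<open>\<open>C\<^sup>k\<close> in the Frechet sense. Derivatives are taken within \<open>U\<close>; since the domain is
  finite dimensional, continuity of the derivative in operator norm is the same as
  continuity of all directional derivatives \<open>\<lambda>x. g' x v\<close>.\<close>

primrec frechet_Ck_on ::
  "nat \<Rightarrow> 'a::euclidean_space set \<Rightarrow> ('a \<Rightarrow> 'c::euclidean_space) \<Rightarrow> bool" where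
  "frechet_Ck_on 0 U g \<longleftrightarrow> continuous_on U g"
| "frechet_Ck_on (Suc k) U g \<longleftrightarrow>
     (\<exists>g'. (\<forall>x\<in>U. (g has_derivative g' x) (at x within U)) \<and>
           (\<forall>v. frechet_Ck_on k U (\<lambda>x. g' x v)))"

text \<open>\<open>C\<^sup>k\<close> in the Michal-Bastiani sense: on the interior of \<open>U\<close> the iterated directional
  derivatives \<open>D j h x = (d/dh\<^sub>j\<^sub>-\<^sub>1) \<dots> (d/dh\<^sub>0) g (x)\<close> exist, and they extend to jointly
  continuous maps on \<open>U\<close> times the space of directions. The directions are collected in a
  sequence \<open>h\<close> (with the product topology), of which \<open>D j\<close> depends only on
  \<open>h 0, \<dots>, h (j - 1)\<close>.\<close>

definition bastiani_Ck_on ::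
  "enat \<Rightarrow> 'a::euclidean_space set \<Rightarrow> ('a \<Rightarrow> 'c::euclidean_space) \<Rightarrow> bool" where
  "bastiani_Ck_on k U g \<longleftrightarrow>
     (\<exists>D :: nat \<Rightarrow> (nat \<Rightarrow> 'a) \<Rightarrow> 'a \<Rightarrow> 'c.
        (\<forall>h. \<forall>x\<in>U. D 0 h x = g x) \<and>
        (\<forall>j. enat (Suc j) \<le> k \<longrightarrow>
          (\<forall>h. \<forall>x\<in>interior U.
             ((\<lambda>t. D j h (x + t *\<^sub>R h j)) has_vector_derivative D (Suc j) h x) (at 0))) \<and>
        (\<forall>j. enat j \<le> k \<longrightarrow>
          continuous_on (U \<times> UNIV) (\<lambda>(x, h). D j h x)))"

definition locally_holder_on ::
  "real \<Rightarrow> 'a::euclidean_space set \<Rightarrow> ('a \<Rightarrow> 'c::euclidean_space) \<Rightarrow> bool" where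
  "locally_holder_on \<alpha> U g \<longleftrightarrow>
     (\<forall>x\<in>U. \<exists>e>0. \<exists>C. \<forall>y\<in>U \<inter> ball x e. \<forall>z\<in>U \<inter> ball x e.
        dist (g y) (g z) \<le> C * dist y z powr \<alpha>)"

text \<open>For \<open>\<alpha> = 0\<close> the local Hoelder condition says no more than local boundedness, so that
  \<open>C\<^bsup>k,0\<^esup> = C\<^sup>k\<close>.\<close>

primrec holder_Ck_on ::
  "nat \<Rightarrow> real \<Rightarrow> 'a::euclidean_space set \<Rightarrow> ('a \<Rightarrow> 'c::euclidean_space) \<Rightarrow> bool" where
  "holder_Ck_on 0 \<alpha> U g \<longleftrightarrow> continuous_on U g \<and> locally_holder_on \<alpha> U g"
| "holder_Ck_on (Suc k) \<alpha> U g \<longleftrightarrow>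
     (\<exists>g'. (\<forall>x\<in>U. (g has_derivative g' x) (at x within U)) \<and>
           (\<forall>v. holder_Ck_on k \<alpha> U (\<lambda>x. g' x v)))"

definition test_function :: "'a::euclidean_space set \<Rightarrow> ('a \<Rightarrow> real) \<Rightarrow> bool" where
  "test_function \<Omega> \<phi> \<longleftrightarrow>
     (\<forall>k. frechet_Ck_on k UNIV \<phi>) \<and>
     (\<exists>K. compact K \<and> K \<subseteq> \<Omega> \<and> (\<forall>x. x \<notin> K \<longrightarrow> \<phi> x = 0))"

definition weak_partial ::
  "'a::euclidean_space set \<Rightarrow> 'a \<Rightarrow> ('a \<Rightarrow> 'c::euclidean_space) \<Rightarrow> ('a \<Rightarrow> 'c) \<Rightarrow> bool" where
  "weak_partial \<Omega> i g h \<longleftrightarrow>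
     (\<forall>\<phi>. test_function \<Omega> \<phi> \<longrightarrow>
        (LINT x:\<Omega>|lebesgue. frechet_derivative \<phi> (at x) i *\<^sub>R g x) =
        - (LINT x:\<Omega>|lebesgue. \<phi> x *\<^sub>R h x))"

definition Lp_on ::
  "real \<Rightarrow> 'a::euclidean_space set \<Rightarrow> ('a \<Rightarrow> 'c::euclidean_space) \<Rightarrow> bool" where
  "Lp_on p \<Omega> g \<longleftrightarrow>
     g \<in> borel_measurable (lebesgue_on \<Omega>) \<and>
     set_integrable lebesgue \<Omega> (\<lambda>x. norm (g x) powr p)"

text \<open>\<open>W\<^bsup>k,p\<^esup>(\<Omega>)\<close> for open \<open>\<Omega>\<close>: the weak derivatives of order up to \<open>k\<close> exist in \<open>L\<^sup>p(\<Omega>)\<close>.\<close>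

primrec sobolev ::
  "nat \<Rightarrow> real \<Rightarrow> 'a::euclidean_space set \<Rightarrow> ('a \<Rightarrow> 'c::euclidean_space) \<Rightarrow> bool" where
  "sobolev 0 p \<Omega> g \<longleftrightarrow> Lp_on p \<Omega> g"
| "sobolev (Suc k) p \<Omega> g \<longleftrightarrow>
     Lp_on p \<Omega> g \<and> (\<forall>i\<in>Basis. \<exists>h. weak_partial \<Omega> i g h \<and> sobolev k p \<Omega> h)"

text \<open>In the admissible range of exponents every locally Sobolev class has a unique continuous
  representative, and this representative is what is meant by a Sobolev map. Integrability is
  required up to the boundary points belonging to \<open>U\<close>.\<close>

definition locally_sobolev_on ::
  "nat \<Rightarrow> real \<Rightarrow> 'a::euclidean_space set \<Rightarrow> ('a \<Rightarrow> 'c::euclidean_space) \<Rightarrow> bool" where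
  "locally_sobolev_on k p U g \<longleftrightarrow>
     continuous_on U g \<and>
     (\<forall>x\<in>U. \<exists>e>0. sobolev k p (interior (U \<inter> ball x e)) g)"

datatype smoothness =
    Frechet_C enat
  | Bastiani_C enat
  | Holder nat real
  | Sobolev nat real

text \<open>Admissibility on manifolds of dimension \<open>m\<close>.\<close>

fun admissible :: "smoothness \<Rightarrow> nat \<Rightarrow> bool" where
  "admissible (Frechet_C k) m \<longleftrightarrow> True"
| "admissible (Bastiani_C k) m \<longleftrightarrow> True"
| "admissible (Holder k \<alpha>) m \<longleftrightarrow> 0 \<le> \<alpha> \<and> \<alpha> \<le> 1"
| "admissible (Sobolev k p) m \<longleftrightarrow>
     1 \<le> k \<and> 1 \<le> p \<and> (real k * p > real m \<or> (k = m \<and> p = 1))"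

fun class_on ::
  "smoothness \<Rightarrow> 'a::euclidean_space set \<Rightarrow> ('a \<Rightarrow> 'c::euclidean_space) \<Rightarrow> bool" where
  "class_on (Frechet_C k) U g \<longleftrightarrow> (\<forall>j. enat j \<le> k \<longrightarrow> frechet_Ck_on j U g)"
| "class_on (Bastiani_C k) U g \<longleftrightarrow> bastiani_Ck_on k U g"
| "class_on (Holder k \<alpha>) U g \<longleftrightarrow> holder_Ck_on k \<alpha> U g"
| "class_on (Sobolev k p) U g \<longleftrightarrow> locally_sobolev_on k p U g"


section \<open>Smooth manifolds with boundary\<close>

text \<open>Euclidean types have positive dimension. A manifold of dimension \<open>m > 0\<close> is modelled on a
  Euclidean type with \<open>DIM('a) = m\<close>; a manifold of dimension 0 is modelled on the subset
  \<open>{0}\<close> of an arbitrary Euclidean type.\<close>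

definition models :: "nat \<Rightarrow> 'a::euclidean_space set set" where
  "models m = (if m = 0 then {{0}} else insert UNIV ((\<lambda>b. {x. 0 \<le> x \<bullet> b}) ` Basis))"

type_synonym ('v, 'a) chart = "'v set \<times> ('v \<Rightarrow> 'a)"

definition manifold_chart ::
  "nat \<Rightarrow> 'v topology \<Rightarrow> ('v, 'a::euclidean_space) chart \<Rightarrow> bool" where
  "manifold_chart m V = (\<lambda>(U, c).
     openin V U \<and>
     (\<exists>H\<in>models m. openin (top_of_set H) (c ` U)) \<and>
     homeomorphic_map (subtopology V U) (top_of_set (c ` U)) c)"

text \<open>The atlas need not be maximal. Second countability and connectedness are not required, and
  the manifold may be empty.\<close>

definition smooth_manifold ::
  "nat \<Rightarrow> 'v topology \<Rightarrow> ('v, 'a::euclidean_space) chart set \<Rightarrow> bool" where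
  "smooth_manifold m V A \<longleftrightarrow>
     (m = 0 \<or> m = DIM('a)) \<and>
     Hausdorff_space V \<and>
     (\<forall>C\<in>A. manifold_chart m V C) \<and>
     (\<Union>(U, c)\<in>A. U) = topspace V \<and>
     (\<forall>(U, c)\<in>A. \<forall>(U', c')\<in>A.
        class_on (Frechet_C \<infinity>) (c ` (U \<inter> U')) (c' \<circ> inv_into U c))"

definition F_map ::
  "smoothness \<Rightarrow> 'v topology \<Rightarrow> ('v, 'a::euclidean_space) chart set \<Rightarrow>
   'w topology \<Rightarrow> ('w, 'b::euclidean_space) chart set \<Rightarrow> ('v \<Rightarrow> 'w) \<Rightarrow> bool" where
  "F_map F V A W B g \<longleftrightarrow>
     continuous_map V W g \<and>
     (\<forall>(U, c)\<in>A. \<forall>(U', c')\<in>B.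
        class_on F (c ` {v \<in> U. g v \<in> U'}) (c' \<circ> g \<circ> inv_into U c))"

definition bi_F_map ::
  "smoothness \<Rightarrow> 'v topology \<Rightarrow> ('v, 'a::euclidean_space) chart set \<Rightarrow>
   'w topology \<Rightarrow> ('w, 'b::euclidean_space) chart set \<Rightarrow> ('v \<Rightarrow> 'w) \<Rightarrow> bool" where
  "bi_F_map F V A W B g \<longleftrightarrow>
     bij_betw g (topspace V) (topspace W) \<and>
     F_map F V A W B g \<and>
     F_map F W B V A (inv_into (topspace V) g)"

text \<open>The elements of \<open>\<F>(V, \<real>\<^sup>n)\<close> are represented by functions that are \<open>undefined\<close>
  outside the carrier of \<open>V\<close>.\<close>

definition F_space ::
  "smoothness \<Rightarrow> 'v topology \<Rightarrow> ('v, 'a::euclidean_space) chart set \<Rightarrow>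
   ('v \<Rightarrow> 'e::euclidean_space) set" where
  "F_space F V A = {x \<in> extensional (topspace V). F_map F V A euclidean {(UNIV, id)} x}"

definition F_space_nz ::
  "smoothness \<Rightarrow> 'v topology \<Rightarrow> ('v, 'a::euclidean_space) chart set \<Rightarrow>
   ('v \<Rightarrow> 'e::euclidean_space) set" where
  "F_space_nz F V A = {x \<in> F_space F V A. \<forall>v\<in>topspace V. x v \<noteq> 0}"

text \<open>Linearity with respect to the pointwise vector space operations.\<close>

definition linear_on_F ::
  "smoothness \<Rightarrow> 'v topology \<Rightarrow> ('v, 'a::euclidean_space) chart set \<Rightarrow> 'w topology \<Rightarrow>
   (('v \<Rightarrow> 'e::euclidean_space) \<Rightarrow> ('w \<Rightarrow> 'e)) \<Rightarrow> bool" where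
  "linear_on_F F V A W f \<longleftrightarrow>
     (\<forall>x\<in>F_space F V A. \<forall>y\<in>F_space F V A.
        f (\<lambda>v\<in>topspace V. x v + y v) = (\<lambda>w\<in>topspace W. f x w + f y w)) \<and>
     (\<forall>r. \<forall>x\<in>F_space F V A.
        f (\<lambda>v\<in>topspace V. r *\<^sub>R x v) = (\<lambda>w\<in>topspace W. r *\<^sub>R f x w))"

text \<open>\<open>GL(n, \<real>)\<close>, as an open submanifold of the space of matrices (with the single
  chart given by the identity).\<close>

definition GL :: "(real ^ 'n ^ 'n) set" where
  "GL = {M. invertible M}"

end

theory Submission
  imports Defs
begin

text \<open>
  Subtracting constant maps turns preservation of nowhere vanishing maps into a statement about
  values: with \<open>\<Gamma> w a = f (const_map V a) w\<close>, which is linear and injective in \<open>a\<close>, every \<open>w\<close> admits a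
  \<open>v\<close> with \<open>f x w = \<Gamma> w (x v)\<close>, and every \<open>v\<close> admits such a \<open>w\<close>. A map of the form \<open>s \<cdot> a\<close> with scalar
  \<open>s\<close> is therefore sent at \<open>w\<close> to a multiple of \<open>\<Gamma> w a\<close>, and the factor, being independent of \<open>a\<close>,
  defines a unital functional \<open>\<lambda>s. G s w\<close> that is positive on nonnegative functions. To see that it is a
  point evaluation, pull back a smooth \<open>k \<ge> 0\<close> whose only zero is \<open>w\<close> to some \<open>s \<ge> 0\<close>, and
  let \<open>v\<close> be a zero of \<open>s\<close>. If \<open>x v = 0\<close>, then \<open>x\<^sup>2 + s\<close> vanishes at \<open>v\<close>, so its image, which is at least \<open>k\<close>,
  has a zero, necessarily \<open>w\<close>; hence \<open>G (x\<^sup>2) w = 0\<close>, and \<open>G x w = 0\<close> by Cauchy-Schwarz.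
  The point \<open>v\<close> is \<open>\<phi> w\<close>. Finally \<open>\<phi>\<close> is an \<open>\<F>\<close> map because for smooth \<open>s\<close> and constant \<open>e\<close> the function
  \<open>(s \<circ> \<phi>) e\<close> is the image of \<open>s\<close> times the preimage of \<open>e\<close>.

  All this uses of the class \<open>\<F>\<close> only that it is local, contains products of smooth and \<open>\<F>\<close>
  functions, and is closed under squaring. For Sobolev classes the latter does not need
  Sobolev embeddings: a continuous \<open>g\<close> is locally bounded, and the one-dimensional Gagliardo-Nirenberg
  inequality on lines yields an integrable \<open>\<zeta> \<ge> 1\<close> such that the derivatives of order \<open>j \<le> k\<close> are
  bounded by a multiple of \<open>\<zeta>\<close> to the power \<open>j / (k p)\<close>, so that each Leibniz term of \<open>g\<^sup>2\<close> is
  bounded by a multiple of \<open>\<zeta>\<close> to the power \<open>1 / p\<close>.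
\<close>

section \<open>Hoelder classes on relatively open subsets of half-spaces\<close>

text \<open>The functional at \<open>w\<close> takes at each function one of its own values, since a
  map that is not nowhere vanishing has an actual zero; unitality and positivity follow from this.
  The obstacle is to find one point \<open>v\<close> for all functions simultaneously. Without
  compactness the usual argument with maximal ideals fails, and without paracompactness there is no
  proper function or embedding to replace it; a single smooth \<open>k\<close> with exactly one
  zero, made in one chart and constant outside, does. Multiplication is used only with a smooth
  factor or as a square, because Cauchy-Schwarz against constants involves no other product. For the
  analysis, the Frechet and Michal-Bastiani classes are rewritten as Hoelder classes of exponent 0,
  which leaves two families, Hoelder and Sobolev. The exponent \<open>j / (k * p)\<close> comes from
  scaling: of a bounded function with derivatives of order \<open>k\<close> in L^p, those of order
  \<open>j\<close> are expected in L^q with \<open>q = k * p / j\<close>, and \<open>\<zeta>\<close>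
  bounds all the corresponding powers at once.\<close>

definition half_spaces :: "'a::euclidean_space set set" where
  "half_spaces = insert UNIV ((\<lambda>b. {x. 0 \<le> x \<bullet> b}) ` Basis)"

definition full_domain :: "'a::euclidean_space set \<Rightarrow> bool" where
  "full_domain X \<longleftrightarrow> (\<exists>H\<in>half_spaces. openin (top_of_set H) X)"

lemma half_spaces_convex: "H \<in> half_spaces \<Longrightarrow> convex H"
  using convex_halfspace_ge[of 0] by (auto simp: half_spaces_def inner_commute)

text \<open>Translation along the inner normal carries the whole closed half-space into its
  interior. Facts known only on the interior are transported to boundary points along this one
  direction.\<close>

lemma half_spaces_inward:
  fixes H :: "'a::euclidean_space set"
  assumes "H \<in> half_spaces"
  obtains b :: 'a where "norm b = 1" "\<And>y t. y \<in> H \<Longrightarrow> 0 < t \<Longrightarrow> y + t *\<^sub>R b \<in> interior H"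
proof (cases "H = UNIV")
  case True
  obtain b :: 'a where "b \<in> Basis" using nonempty_Basis by blast
  with True that[of b] show ?thesis by simp
next
  case False
  then obtain b where b: "b \<in> Basis" "H = {x. 0 \<le> x \<bullet> b}"
    using assms by (auto simp: half_spaces_def)
  have "open {x. 0 < x \<bullet> b}"
    by (intro open_Collect_less continuous_intros)
  then have sub: "{x. 0 < x \<bullet> b} \<subseteq> interior H"
    using b by (intro interior_maximal) auto
  show ?thesis
    using b sub by (intro that[of b]) (auto simp: inner_add_left intro!: subsetD[OF sub])
qed

lemma full_domain_ball:
  assumes "full_domain X" "x \<in> X"
  obtains H e where "H \<in> half_spaces" "0 < e" "X \<inter> ball x e = H \<inter> ball x e" "X \<subseteq> H"
proof -
  obtain H T where H: "H \<in> half_spaces" and T: "open T" "X = H \<inter> T"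
    using assms by (auto simp: full_domain_def openin_open)
  obtain e where "0 < e" "ball x e \<subseteq> T"
    using T assms(2) by (metis Int_iff openE)
  then show ?thesis using that[OF H, of e] T by auto
qed

lemma full_domain_openin:
  assumes "full_domain X" "openin (top_of_set X) Y"
  shows "full_domain Y"
  using assms openin_trans unfolding full_domain_def by blast

lemma full_domain_Int_ball: "full_domain X \<Longrightarrow> full_domain (X \<inter> ball x e)"
  by (rule full_domain_openin) (auto simp: openin_open_Int)

lemma full_domain_open: "open X \<Longrightarrow> full_domain X"
  by (auto simp: full_domain_def half_spaces_def)

text \<open>Near \<open>x\<close> the set contains \<open>x + t *\<^sub>R i\<close> for every
  coordinate direction and all small positive \<open>t\<close>, also when \<open>x\<close> is a
  boundary point, since increasing a coordinate never leaves the half-space. The derivative within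
  \<open>X\<close> is thus determined, which allows local derivatives to be glued.\<close>

lemma full_domain_derivative_unique:
  assumes X: "full_domain X" "x \<in> X"
    and D: "(g has_derivative g') (at x within X)" "(g has_derivative g'') (at x within X)"
  shows "g' = g''"
proof (rule frechet_derivative_unique_within[OF D])
  fix i :: 'a and e :: real
  assume i: "i \<in> Basis" and e: "0 < e"
  obtain H d where H: "H \<in> half_spaces" and d: "0 < d" "X \<inter> ball x d = H \<inter> ball x d" "X \<subseteq> H"
    using full_domain_ball[OF X] .
  define t where "t = min d e / 2"
  have t: "0 < t" "t < d" "t < e" using d e by (auto simp: t_def)
  have "x + t *\<^sub>R i \<in> H"
    using H i t X(2) d(3) by (auto simp: half_spaces_def inner_add_left inner_Basis subset_eq)
  moreover have "x + t *\<^sub>R i \<in> ball x d"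
    using t i by (simp add: dist_norm)
  ultimately have "x + t *\<^sub>R i \<in> X" using d by blast
  then show "\<exists>d. 0 < \<bar>d\<bar> \<and> \<bar>d\<bar> < e \<and> x + d *\<^sub>R i \<in> X"
    using t by (intro exI[of _ t]) auto
qed

lemma at_within_Int_ball: "0 < e \<Longrightarrow> at x within (X \<inter> ball x e) = at x within X"
  by (rule at_within_nhd[of _ "ball x e"]) auto

lemma has_derivative_within_Int_ball:
  assumes "(g has_derivative g') (at z within X \<inter> ball x e)" "z \<in> ball x e"
  shows "(g has_derivative g') (at z within X)"
proof -
  have "at z within (X \<inter> ball x e) = at z within X"
    using assms(2) by (intro at_within_nhd[of _ "ball x e"]) auto
  then show ?thesis using assms by simp
qed

lemma holder_Ck_on_cong:
  assumes "\<And>x. x \<in> X \<Longrightarrow> g x = h x"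
  shows "holder_Ck_on k \<alpha> X g \<longleftrightarrow> holder_Ck_on k \<alpha> X h"
proof (cases k)
  case 0
  have "locally_holder_on \<alpha> X g \<longleftrightarrow> locally_holder_on \<alpha> X h"
    unfolding locally_holder_on_def using assms by simp
  moreover have "continuous_on X g \<longleftrightarrow> continuous_on X h"
    using assms by (rule continuous_on_cong[OF refl])
  ultimately show ?thesis using 0 by simp
next
  case (Suc k)
  have "((g has_derivative D) (at x within X)) = ((h has_derivative D) (at x within X))" if "x \<in> X" for x D
    using assms that has_derivative_transform by metis
  then show ?thesis by (simp add: Suc)
qed

lemma holder_Ck_on_subset:
  assumes "holder_Ck_on k \<alpha> X g" "Y \<subseteq> X"
  shows "holder_Ck_on k \<alpha> Y g"
  using assms
proof (induction k arbitrary: g)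
  case 0
  have "locally_holder_on \<alpha> Y g"
    unfolding locally_holder_on_def
  proof
    fix x assume "x \<in> Y"
    then obtain e C where "0 < e" "\<forall>y\<in>X \<inter> ball x e. \<forall>z\<in>X \<inter> ball x e. dist (g y) (g z) \<le> C * dist y z powr \<alpha>"
      using 0 unfolding holder_Ck_on.simps locally_holder_on_def by (meson subsetD)
    then show "\<exists>e>0. \<exists>C. \<forall>y\<in>Y \<inter> ball x e. \<forall>z\<in>Y \<inter> ball x e. dist (g y) (g z) \<le> C * dist y z powr \<alpha>"
      using 0(2) by (intro exI[of _ e] exI[of _ C] conjI) auto
  qed
  with 0 show ?case by (auto intro: continuous_on_subset)
next
  case (Suc k)
  then obtain g' where "\<forall>x\<in>X. (g has_derivative g' x) (at x within X)"
      "\<forall>v. holder_Ck_on k \<alpha> X (\<lambda>x. g' x v)" by auto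
  with Suc show ?case
    unfolding holder_Ck_on.simps by (meson has_derivative_subset subsetD)
qed

lemma holder_Ck_on_trivial: "X \<subseteq> {0} \<Longrightarrow> holder_Ck_on k \<alpha> X g"
proof (induction k arbitrary: g)
  case 0
  then show ?case
    by (auto simp: locally_holder_on_def subset_singleton_iff intro!: exI[of _ 1])
next
  case (Suc k g)
  have "(g has_derivative (\<lambda>v. 0)) (at x within X)" if "x \<in> X" for x
  proof -
    have "X = {x}" using that Suc by auto
    then show ?thesis by (simp add: has_derivative_within_singleton_iff)
  qed
  moreover have "\<forall>v. holder_Ck_on k \<alpha> X (\<lambda>x. 0::'b)" using Suc by simp
  ultimately show ?case unfolding holder_Ck_on.simps by (intro exI[of _ "\<lambda>_ _. 0"]) auto
qed

lemma holder_Ck_on_Suc: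
  assumes "full_domain X" "\<And>x. x \<in> X \<Longrightarrow> (g has_derivative g' x) (at x within X)"
  shows "holder_Ck_on (Suc k) \<alpha> X g \<longleftrightarrow> (\<forall>v. holder_Ck_on k \<alpha> X (\<lambda>x. g' x v))"
proof
  assume "holder_Ck_on (Suc k) \<alpha> X g"
  then obtain h where h: "\<forall>x\<in>X. (g has_derivative h x) (at x within X)"
    and H: "\<forall>v. holder_Ck_on k \<alpha> X (\<lambda>x. h x v)" by auto
  have "h x = g' x" if "x \<in> X" for x
    using full_domain_derivative_unique[OF assms(1) that] h assms(2) that by blast
  with H show "\<forall>v. holder_Ck_on k \<alpha> X (\<lambda>x. g' x v)"
    using holder_Ck_on_cong[of X "\<lambda>x. h x v" "\<lambda>x. g' x v" k \<alpha> for v] by auto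
next
  assume "\<forall>v. holder_Ck_on k \<alpha> X (\<lambda>x. g' x v)"
  then show "holder_Ck_on (Suc k) \<alpha> X g"
    unfolding holder_Ck_on.simps using assms(2) by blast
qed

lemma holder_Ck_on_local:
  assumes "full_domain X"
    and "\<And>x. x \<in> X \<Longrightarrow> \<exists>e>0. holder_Ck_on k \<alpha> (X \<inter> ball x e) g"
  shows "holder_Ck_on k \<alpha> X g"
  using assms(2)
proof (induction k arbitrary: g)
  case 0
  show ?case
  proof (simp, intro conjI)
    show "continuous_on X g"
      unfolding continuous_on_eq_continuous_within
    proof
      fix x assume x: "x \<in> X"
      then obtain e where "0 < e" "continuous_on (X \<inter> ball x e) g"
        using 0[OF x] unfolding holder_Ck_on.simps by blast
      then have "continuous (at x within X \<inter> ball x e) g"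
        using x unfolding continuous_on_eq_continuous_within by auto
      then show "continuous (at x within X) g"
        using at_within_Int_ball[OF \<open>0 < e\<close>, of x X] by simp
    qed
    show "locally_holder_on \<alpha> X g"
      unfolding locally_holder_on_def
    proof
      fix x assume x: "x \<in> X"
      then obtain e where e: "0 < e" "locally_holder_on \<alpha> (X \<inter> ball x e) g"
        using 0[OF x] unfolding holder_Ck_on.simps by blast
      then obtain d C where d: "0 < d" "\<forall>y\<in>X \<inter> ball x e \<inter> ball x d. \<forall>z\<in>X \<inter> ball x e \<inter> ball x d.
          dist (g y) (g z) \<le> C * dist y z powr \<alpha>"
        unfolding locally_holder_on_def using x by (metis Int_iff centre_in_ball)
      show "\<exists>e>0. \<exists>C. \<forall>y\<in>X \<inter> ball x e. \<forall>z\<in>X \<inter> ball x e. dist (g y) (g z) \<le> C * dist y z powr \<alpha>"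
        using d e by (intro exI[of _ "min d e"] conjI exI[of _ C]) auto
    qed
  qed
next
  case (Suc k)
  \<comment> \<open>The canonical derivative gives one candidate on all of \<open>X\<close>; by
    uniqueness it coincides with each derivative that is given locally.\<close>
  define g' where "g' x = frechet_derivative g (at x within X)" for x
  have loc: "\<exists>e>0. (\<forall>z\<in>X \<inter> ball x e. (g has_derivative g' z) (at z within X)) \<and>
      (\<forall>v. holder_Ck_on k \<alpha> (X \<inter> ball x e) (\<lambda>z. g' z v))" if x: "x \<in> X" for x
  proof -
    obtain e where e: "0 < e" "holder_Ck_on (Suc k) \<alpha> (X \<inter> ball x e) g" using Suc.prems x by blast
    then obtain h where h: "\<forall>z\<in>X \<inter> ball x e. (g has_derivative h z) (at z within X \<inter> ball x e)"
      and H: "\<forall>v. holder_Ck_on k \<alpha> (X \<inter> ball x e) (\<lambda>z. h z v)" by auto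
    have h': "(g has_derivative h z) (at z within X)" if "z \<in> X \<inter> ball x e" for z
      using that h has_derivative_within_Int_ball by blast
    have "h z = g' z \<and> (g has_derivative g' z) (at z within X)" if z: "z \<in> X \<inter> ball x e" for z
    proof -
      have "(g has_derivative g' z) (at z within X)"
        unfolding g'_def using h'[OF z] frechet_derivative_works differentiable_def by blast
      then show ?thesis
        using full_domain_derivative_unique[OF assms(1), of z] z h'[OF z] by blast
    qed
    moreover have "holder_Ck_on k \<alpha> (X \<inter> ball x e) (\<lambda>z. g' z v)" for v
      using holder_Ck_on_cong[of "X \<inter> ball x e" "\<lambda>z. h z v" "\<lambda>z. g' z v" k \<alpha>] H calculation
      by metis
    ultimately show ?thesis using e(1) by blast
  qed
  have "(g has_derivative g' x) (at x within X)" if "x \<in> X" for x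
    using loc[OF that] that by (metis IntI centre_in_ball)
  moreover have "holder_Ck_on k \<alpha> X (\<lambda>x. g' x v)" for v
    using loc by (intro Suc.IH) blast
  ultimately show ?case unfolding holder_Ck_on.simps by blast
qed

lemma locally_holder_on_continuous:
  assumes "continuous_on X g"
  shows "locally_holder_on 0 X g"
  unfolding locally_holder_on_def
proof
  fix x assume "x \<in> X"
  then obtain e where e: "0 < e" "\<And>y. y \<in> X \<Longrightarrow> dist y x < e \<Longrightarrow> dist (g y) (g x) < 1"
    using assms unfolding continuous_on_iff by (metis zero_less_one)
  have "dist (g y) (g z) \<le> 2 * dist y z powr 0" if "y \<in> X \<inter> ball x e" "z \<in> X \<inter> ball x e" for y z
  \<comment> \<open>\<open>r powr 0\<close> is 1 for \<open>r > 0\<close> but 0 for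
    \<open>r = 0\<close>, so equal points are treated apart; for them both sides vanish.\<close>
  proof (cases "y = z")
    case False
    have "dist (g y) (g z) \<le> dist (g y) (g x) + dist (g z) (g x)"
      by (metis dist_commute dist_triangle)
    also have "\<dots> \<le> 1 + 1" using e(2)[of y] e(2)[of z] that by (simp add: dist_commute)
    finally show ?thesis using False by simp
  qed simp
  with e show "\<exists>e>0. \<exists>C. \<forall>y\<in>X \<inter> ball x e. \<forall>z\<in>X \<inter> ball x e. dist (g y) (g z) \<le> C * dist y z powr 0"
    by blast
qed

text \<open>At exponent 0 the Hoelder condition follows from the continuity demanded alongside it,
  so results on Hoelder classes cover the Frechet classes.\<close>

lemma frechet_eq_holder_0: "frechet_Ck_on k X g \<longleftrightarrow> holder_Ck_on k 0 X g"
  by (induction k arbitrary: g) (auto simp: locally_holder_on_continuous)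

lemma holder_Ck_on_linear:
  assumes L: "bounded_linear L" and g: "holder_Ck_on k \<alpha> X g"
  shows "holder_Ck_on k \<alpha> X (\<lambda>x. L (g x))"
  using g
proof (induction k arbitrary: g)
  case 0
  obtain K where K: "0 < K" "\<And>x. norm (L x) \<le> norm x * K"
    using bounded_linear.pos_bounded[OF L] by blast
  have *: "dist (L a) (L b) \<le> K * dist a b" for a b
    using K(2)[of "a - b"] by (simp add: dist_norm linear_diff[OF bounded_linear.linear[OF L]] mult.commute)
  have "locally_holder_on \<alpha> X (\<lambda>x. L (g x))"
    unfolding locally_holder_on_def
  proof
    fix x assume "x \<in> X"
    then obtain e C where e: "0 < e" "\<forall>y\<in>X \<inter> ball x e. \<forall>z\<in>X \<inter> ball x e. dist (g y) (g z) \<le> C * dist y z powr \<alpha>"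
      using 0 by (auto simp: locally_holder_on_def)
    have "dist (L (g y)) (L (g z)) \<le> (K * C) * dist y z powr \<alpha>" if "y\<in>X \<inter> ball x e" "z\<in>X \<inter> ball x e" for y z
    proof -
      have "dist (L (g y)) (L (g z)) \<le> K * dist (g y) (g z)" by (rule *)
      also have "\<dots> \<le> K * (C * dist y z powr \<alpha>)" using e that K by (intro mult_left_mono) auto
      finally show ?thesis by (simp add: mult.assoc)
    qed
    with e show "\<exists>e>0. \<exists>C. \<forall>y\<in>X \<inter> ball x e. \<forall>z\<in>X \<inter> ball x e.
          dist (L (g y)) (L (g z)) \<le> C * dist y z powr \<alpha>" by blast
  qed
  moreover have "continuous_on X (\<lambda>x. L (g x))"
    using 0 by (auto intro: bounded_linear.continuous_on[OF L])
  ultimately show ?case by simp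
next
  case (Suc k)
  then obtain g' where "\<forall>x\<in>X. (g has_derivative g' x) (at x within X)"
      "\<forall>v. holder_Ck_on k \<alpha> X (\<lambda>x. g' x v)" by auto
  with Suc.IH show ?case
    unfolding holder_Ck_on.simps
    by (intro exI[of _ "\<lambda>x v. L (g' x v)"]) (blast intro: bounded_linear.has_derivative[OF L])
qed

lemma holder_Ck_on_add:
  assumes "holder_Ck_on k \<alpha> X g" "holder_Ck_on k \<alpha> X h"
  shows "holder_Ck_on k \<alpha> X (\<lambda>x. g x + h x)"
  using assms
proof (induction k arbitrary: g h)
  case 0
  have "locally_holder_on \<alpha> X (\<lambda>x. g x + h x)"
    unfolding locally_holder_on_def
  proof
    fix x assume "x \<in> X"
    then obtain e C d D
      where e: "0 < e" "\<forall>y\<in>X \<inter> ball x e. \<forall>z\<in>X \<inter> ball x e. dist (g y) (g z) \<le> C * dist y z powr \<alpha>"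
        and d: "0 < d" "\<forall>y\<in>X \<inter> ball x d. \<forall>z\<in>X \<inter> ball x d. dist (h y) (h z) \<le> D * dist y z powr \<alpha>"
      using 0 unfolding holder_Ck_on.simps locally_holder_on_def by meson
    have "dist (g y + h y) (g z + h z) \<le> (C + D) * dist y z powr \<alpha>"
      if "y\<in>X \<inter> ball x (min e d)" "z\<in>X \<inter> ball x (min e d)" for y z
    proof -
      have "dist (g y + h y) (g z + h z) \<le> dist (g y) (g z) + dist (h y) (h z)"
        by (rule dist_triangle_add)
      also have "\<dots> \<le> C * dist y z powr \<alpha> + D * dist y z powr \<alpha>"
        using e d that by (intro add_mono) auto
      finally show ?thesis by (simp add: algebra_simps)
    qed
    with e d show "\<exists>e>0. \<exists>C. \<forall>y\<in>X \<inter> ball x e. \<forall>z\<in>X \<inter> ball x e.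
          dist (g y + h y) (g z + h z) \<le> C * dist y z powr \<alpha>"
      by (intro exI[of _ "min e d"] conjI exI[of _ "C + D"]) auto
  qed
  with 0 show ?case by (auto intro: continuous_on_add)
next
  case (Suc k)
  then obtain g' h' where "\<forall>x\<in>X. (g has_derivative g' x) (at x within X)"
      "\<forall>v. holder_Ck_on k \<alpha> X (\<lambda>x. g' x v)" "\<forall>x\<in>X. (h has_derivative h' x) (at x within X)"
      "\<forall>v. holder_Ck_on k \<alpha> X (\<lambda>x. h' x v)" by auto
  with Suc.IH show ?case
    unfolding holder_Ck_on.simps
    by (intro exI[of _ "\<lambda>x v. g' x v + h' x v"]) (blast intro: has_derivative_add)
qed

lemma holder_Ck_on_const: "holder_Ck_on k \<alpha> X (\<lambda>x. c)"
proof (induction k arbitrary: c)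
  case 0
  have "\<exists>e>0. \<exists>C. \<forall>y\<in>X \<inter> ball x e. \<forall>z\<in>X \<inter> ball x e. dist c c \<le> C * dist y z powr \<alpha>" for x
    by (intro exI[of _ 1] conjI exI[of _ 0]) auto
  then show ?case by (simp add: locally_holder_on_def)
next
  case (Suc k)
  then show ?case
    unfolding holder_Ck_on.simps by (intro exI[of _ "\<lambda>_ _. 0"]) auto
qed

lemma holder_Ck_on_sum:
  assumes "finite I" "\<And>i. i \<in> I \<Longrightarrow> holder_Ck_on k \<alpha> X (g i)"
  shows "holder_Ck_on k \<alpha> X (\<lambda>x. \<Sum>i\<in>I. g i x)"
  using assms
  by (induction I rule: finite_induct) (auto intro: holder_Ck_on_add holder_Ck_on_const)

text \<open>One derivative gains the local Hoelder condition, as \<open>X\<close> is locally convex.\<close>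

lemma locally_holder_on_C1:
  assumes X: "full_domain X" and a: "0 \<le> \<alpha>" "\<alpha> \<le> 1"
    and D: "\<And>x. x \<in> X \<Longrightarrow> (g has_derivative g' x) (at x within X)"
    and C: "\<And>v. continuous_on X (\<lambda>x. g' x v)"
  shows "locally_holder_on \<alpha> X g"
  unfolding locally_holder_on_def
proof
  fix x assume x: "x \<in> X"
  obtain H d where H: "H \<in> half_spaces" and d: "0 < d" "X \<inter> ball x d = H \<inter> ball x d" "X \<subseteq> H"
    using full_domain_ball[OF X x] .
  have "\<exists>e>0. \<forall>y\<in>X. dist y x < e \<longrightarrow> dist (g' y i) (g' x i) < 1" if "i \<in> Basis" for i
    using C[of i] x unfolding continuous_on_iff by (metis zero_less_one)
  then obtain r where r: "\<And>i. i \<in> Basis \<Longrightarrow> 0 < r i"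
     "\<And>i y. i \<in> Basis \<Longrightarrow> y \<in> X \<Longrightarrow> dist y x < r i \<Longrightarrow> dist (g' y i) (g' x i) < 1"
    by metis
  \<comment> \<open>A radius of at most 1/2 keeps all distances at most 1, where
    \<open>r powr 1 \<le> r powr \<alpha>\<close>. The bounds \<open>r i\<close> keep each
    derivative along a basis vector within 1 of its value at \<open>x\<close>, and \<open>d\<close>
    makes the piece of \<open>X\<close> convex.\<close>
  define e where "e = min (min d (1/2)) (Min (r ` Basis))"
  have e: "0 < e" "e \<le> d" "e \<le> 1/2" "\<And>i. i \<in> Basis \<Longrightarrow> e \<le> r i"
    using r(1) d(1) by (auto simp: e_def intro: min.coboundedI2)
  define S where "S = X \<inter> ball x e"
  have "S = (X \<inter> ball x d) \<inter> ball x e" using e by (auto simp: S_def)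
  also have "\<dots> = H \<inter> ball x e" using d e by auto
  finally have S: "convex S" using half_spaces_convex[OF H] by (simp add: convex_Int)
  define B where "B = (\<Sum>i\<in>Basis. norm (g' x i) + 1)"
  have on: "onorm (g' y) \<le> B" if y: "y \<in> S" for y
  proof (rule onorm_le)
    fix v
    have bl: "bounded_linear (g' y)" using D y by (auto simp: S_def intro: has_derivative_bounded_linear)
    have "norm (g' y v) = norm (g' y (\<Sum>i\<in>Basis. (v \<bullet> i) *\<^sub>R i))" by (simp add: euclidean_representation)
    also have "\<dots> = norm (\<Sum>i\<in>Basis. (v \<bullet> i) *\<^sub>R g' y i)"
      using bl by (simp add: linear_sum[OF bounded_linear.linear] linear_cmul[OF bounded_linear.linear] o_def)
    also have "\<dots> \<le> (\<Sum>i\<in>Basis. \<bar>v \<bullet> i\<bar> * norm (g' y i))"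
      by (rule order_trans[OF norm_sum]) simp
    also have "\<dots> \<le> (\<Sum>i\<in>Basis. norm v * (norm (g' x i) + 1))"
    proof (intro sum_mono mult_mono)
      fix i :: 'a assume i: "i \<in> Basis"
      have "dist (g' y i) (g' x i) < 1"
        using y r(2)[OF i, of y] e(4)[OF i] by (auto simp: S_def dist_commute)
      then show "norm (g' y i) \<le> norm (g' x i) + 1"
        by norm
      show "\<bar>v \<bullet> i\<bar> \<le> norm v" using i by (rule Basis_le_norm)
    qed auto
    also have "\<dots> = B * norm v" by (simp add: B_def sum_distrib_left mult.commute)
    finally show "norm (g' y v) \<le> B * norm v" .
  qed
  have "dist (g y) (g z) \<le> B * dist y z powr \<alpha>" if "y \<in> S" "z \<in> S" for y z
  proof -
    have "norm (g y - g z) \<le> B * norm (y - z)"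
    proof (rule differentiable_bound[OF S])
      show "(g has_derivative g' u) (at u within S)" if "u \<in> S" for u
        using D that by (auto simp: S_def intro: has_derivative_subset)
    qed (use on that in auto)
    also have "\<dots> \<le> B * dist y z powr \<alpha>"
    proof (intro mult_left_mono)
      have "dist y z \<le> dist y x + dist x z" by (rule dist_triangle)
      also have "\<dots> \<le> 1" using that e by (auto simp: S_def dist_commute)
      finally have "dist y z powr 1 \<le> dist y z powr \<alpha>"
        using a by (intro powr_mono') auto
      then show "norm (y - z) \<le> dist y z powr \<alpha>" by (simp add: dist_norm)
      show "0 \<le> B" by (auto simp: B_def intro: sum_nonneg)
    qed
    finally show ?thesis by (simp add: dist_norm)
  qed
  then show "\<exists>e>0. \<exists>C. \<forall>y\<in>X \<inter> ball x e. \<forall>z\<in>X \<inter> ball x e. dist (g y) (g z) \<le> C * dist y z powr \<alpha>"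
    using e(1) unfolding S_def by blast
qed

lemma holder_Ck_on_continuous:
  "holder_Ck_on k \<alpha> X g \<Longrightarrow> continuous_on X g"
  by (cases k) (auto intro: has_derivative_continuous_on)

lemma holder_Ck_on_SucD:
  assumes "full_domain X" "0 \<le> \<alpha>" "\<alpha> \<le> 1" "holder_Ck_on (Suc k) \<beta> X g"
  shows "holder_Ck_on k \<alpha> X g"
  using assms(4)
proof (induction k arbitrary: g)
  case 0
  then obtain g' where g': "\<forall>x\<in>X. (g has_derivative g' x) (at x within X)"
      "\<forall>v. holder_Ck_on 0 \<beta> X (\<lambda>x. g' x v)" by auto
  then have "locally_holder_on \<alpha> X g"
    using locally_holder_on_C1[OF assms(1-3), of g g'] by auto
  moreover have "continuous_on X g" using g' by (auto intro: has_derivative_continuous_on)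
  ultimately show ?case by simp
next
  case (Suc k)
  then obtain g' where g': "\<forall>x\<in>X. (g has_derivative g' x) (at x within X)"
      "\<forall>v. holder_Ck_on (Suc k) \<beta> X (\<lambda>x. g' x v)" by auto
  then show ?case using Suc.IH unfolding holder_Ck_on.simps(2)[of k] by blast
qed

lemma holder_Ck_on_scaleR:
  fixes s :: "'a::euclidean_space \<Rightarrow> real" and g :: "'a \<Rightarrow> 'c::euclidean_space"
  assumes X: "full_domain X" "0 \<le> \<alpha>" "\<alpha> \<le> 1"
    and s: "holder_Ck_on k \<alpha> X s" and g: "holder_Ck_on k \<alpha> X g"
  shows "holder_Ck_on k \<alpha> X (\<lambda>x. s x *\<^sub>R g x)"
  using s g
proof (induction k arbitrary: g s)
  case 0
  have "locally_holder_on \<alpha> X (\<lambda>x. s x *\<^sub>R g x)"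
    unfolding locally_holder_on_def
  proof
    fix x assume x: "x \<in> X"
    obtain e C d D
      where e: "0 < e" "\<forall>y\<in>X \<inter> ball x e. \<forall>z\<in>X \<inter> ball x e. dist (s y) (s z) \<le> C * dist y z powr \<alpha>"
        and d: "0 < d" "\<forall>y\<in>X \<inter> ball x d. \<forall>z\<in>X \<inter> ball x d. dist (g y) (g z) \<le> D * dist y z powr \<alpha>"
      using 0 x unfolding holder_Ck_on.simps locally_holder_on_def by meson
    obtain e' where e': "0 < e'" "\<And>y. y \<in> X \<Longrightarrow> dist y x < e' \<Longrightarrow> dist (s y) (s x) < 1"
      using 0(1) x unfolding holder_Ck_on.simps continuous_on_iff by (metis zero_less_one)
    obtain d' where d': "0 < d'" "\<And>y. y \<in> X \<Longrightarrow> dist y x < d' \<Longrightarrow> dist (g y) (g x) < 1"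
      using 0(2) x unfolding holder_Ck_on.simps continuous_on_iff by (metis zero_less_one)
    define r where "r = min (min e d) (min e' d')"
    have "dist (s y *\<^sub>R g y) (s z *\<^sub>R g z) \<le> ((\<bar>s x\<bar> + 1) * \<bar>D\<bar> + (norm (g x) + 1) * \<bar>C\<bar>) * dist y z powr \<alpha>"
      if "y\<in>X \<inter> ball x r" "z\<in>X \<inter> ball x r" for y z
    proof -
      have "\<bar>s y\<bar> \<le> \<bar>s x\<bar> + 1" using e'(2)[of y] that by (auto simp: r_def dist_commute dist_real_def)
      moreover have "norm (g z) \<le> norm (g x) + 1"
        using d'(2)[of z] that by (auto simp: r_def dist_commute) norm
      moreover have "dist (s y) (s z) \<le> \<bar>C\<bar> * dist y z powr \<alpha>"
        using e that by (auto simp: r_def intro: order_trans[OF _ mult_right_mono[OF abs_ge_self]])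
      moreover have "dist (g y) (g z) \<le> \<bar>D\<bar> * dist y z powr \<alpha>"
        using d that by (auto simp: r_def intro: order_trans[OF _ mult_right_mono[OF abs_ge_self]])
      ultimately have "\<bar>s y\<bar> * dist (g y) (g z) + dist (s y) (s z) * norm (g z) \<le>
        (\<bar>s x\<bar> + 1) * (\<bar>D\<bar> * dist y z powr \<alpha>) + (\<bar>C\<bar> * dist y z powr \<alpha>) * (norm (g x) + 1)"
        by (intro add_mono mult_mono) auto
      moreover have "s y *\<^sub>R g y - s z *\<^sub>R g z = s y *\<^sub>R (g y - g z) + (s y - s z) *\<^sub>R g z"
        by (simp add: algebra_simps)
      then have "dist (s y *\<^sub>R g y) (s z *\<^sub>R g z) \<le> \<bar>s y\<bar> * dist (g y) (g z) + dist (s y) (s z) * norm (g z)"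
        by (auto simp: dist_norm intro: order_trans[OF norm_triangle_ineq])
      ultimately show ?thesis by (simp add: algebra_simps)
    qed
    moreover have "0 < r" using e d e' d' by (auto simp: r_def)
    ultimately show "\<exists>e>0. \<exists>C. \<forall>y\<in>X \<inter> ball x e. \<forall>z\<in>X \<inter> ball x e.
          dist (s y *\<^sub>R g y) (s z *\<^sub>R g z) \<le> C * dist y z powr \<alpha>"
      by blast
  qed
  with 0 show ?case by (auto intro: continuous_on_scaleR)
next
  case (Suc k)
  obtain g' s' where g': "\<forall>x\<in>X. (g has_derivative g' x) (at x within X)"
      "\<forall>v. holder_Ck_on k \<alpha> X (\<lambda>x. g' x v)" and s': "\<forall>x\<in>X. (s has_derivative s' x) (at x within X)"
      "\<forall>v. holder_Ck_on k \<alpha> X (\<lambda>x. s' x v)" using Suc.prems by auto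
  \<comment> \<open>The Leibniz formula also contains the undifferentiated factors; they are needed
    with one derivative less and the same exponent.\<close>
  have "holder_Ck_on k \<alpha> X s" "holder_Ck_on k \<alpha> X g"
    using holder_Ck_on_SucD[OF X] Suc.prems by blast+
  then have "holder_Ck_on k \<alpha> X (\<lambda>x. s x *\<^sub>R g' x v + s' x v *\<^sub>R g x)" for v
    using g' s' Suc.IH by (intro holder_Ck_on_add Suc.IH) auto
  moreover have "((\<lambda>x. s x *\<^sub>R g x) has_derivative (\<lambda>v. s x *\<^sub>R g' x v + s' x v *\<^sub>R g x)) (at x within X)"
    if "x \<in> X" for x
    using that g'(1) s'(1) by (intro has_derivative_scaleR) auto
  ultimately show ?case
    unfolding holder_Ck_on.simps
    by (intro exI[of _ "\<lambda>x v. s x *\<^sub>R g' x v + s' x v *\<^sub>R g x"] conjI ballI allI)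
qed

text \<open>Expanding the chain rule in a basis writes a derivative of the composite as a sum of
  smooth coefficients times derivatives of \<open>\<sigma>\<close> along basis vectors, again
  composed with \<open>T\<close>; so the induction on the order keeps \<open>T\<close> fixed.
  Transition maps and cutoffs are composed in this way.\<close>

lemma smooth_comp:
  fixes T :: "'a::euclidean_space \<Rightarrow> 'b::euclidean_space" and \<sigma> :: "'b \<Rightarrow> 'c::euclidean_space"
  assumes X: "full_domain X" and T: "\<And>k. holder_Ck_on k 0 X T" and Y: "T ` X \<subseteq> Y"
    and s: "holder_Ck_on k 0 Y \<sigma>"
  shows "holder_Ck_on k 0 X (\<lambda>x. \<sigma> (T x))"
  using s
proof (induction k arbitrary: \<sigma>)
  case 0
  then have "continuous_on X (\<lambda>x. \<sigma> (T x))"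
    using T[of 0] Y by (auto intro: continuous_on_compose2)
  then show ?case by (simp add: locally_holder_on_continuous)
next
  case (Suc k)
  then obtain \<sigma>' where \<sigma>': "\<forall>x\<in>Y. (\<sigma> has_derivative \<sigma>' x) (at x within Y)"
      "\<forall>v. holder_Ck_on k 0 Y (\<lambda>x. \<sigma>' x v)" by auto
  obtain T' where T': "\<forall>x\<in>X. (T has_derivative T' x) (at x within X)"
      "\<forall>v. holder_Ck_on k 0 X (\<lambda>x. T' x v)" using T[of "Suc k"] by auto
  have D: "((\<lambda>x. \<sigma> (T x)) has_derivative (\<lambda>v. \<sigma>' (T x) (T' x v))) (at x within X)" if x: "x \<in> X" for x
  proof (rule has_derivative_in_compose[where f=T and g=\<sigma> and f'="T' x" and g'="\<sigma>' (T x)"])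
    show "(T has_derivative T' x) (at x within X)" using T' x by blast
    have "(\<sigma> has_derivative \<sigma>' (T x)) (at (T x) within Y)" using \<sigma>' Y x by blast
    then show "(\<sigma> has_derivative \<sigma>' (T x)) (at (T x) within T ` X)"
      using Y by (rule has_derivative_subset)
  qed
  have "holder_Ck_on k 0 X (\<lambda>x. \<sigma>' (T x) (T' x v))" for v
  proof -
    have eq: "\<sigma>' (T x) (T' x v) = (\<Sum>i\<in>Basis. (T' x v \<bullet> i) *\<^sub>R \<sigma>' (T x) i)" if "x \<in> X" for x
    proof -
      have "T x \<in> Y" using that Y by blast
      then have bl: "bounded_linear (\<sigma>' (T x))" using \<sigma>' by (blast intro: has_derivative_bounded_linear)
      have "\<sigma>' (T x) (T' x v) = \<sigma>' (T x) (\<Sum>i\<in>Basis. (T' x v \<bullet> i) *\<^sub>R i)" by (simp add: euclidean_representation)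
      also have "\<dots> = (\<Sum>i\<in>Basis. (T' x v \<bullet> i) *\<^sub>R \<sigma>' (T x) i)"
        using bl by (simp add: linear_sum[OF bounded_linear.linear] linear_cmul[OF bounded_linear.linear] o_def)
      finally show ?thesis .
    qed
    have "holder_Ck_on k 0 X (\<lambda>x. \<Sum>i\<in>Basis. (T' x v \<bullet> i) *\<^sub>R \<sigma>' (T x) i)"
      using T'(2) Suc.IH[OF spec[OF \<sigma>'(2)]]
      by (intro holder_Ck_on_sum holder_Ck_on_scaleR X
        holder_Ck_on_linear[OF bounded_linear_inner_left]) auto
    then show ?thesis
      using holder_Ck_on_cong[of X "\<lambda>x. \<sigma>' (T x) (T' x v)", OF eq] by blast
  qed
  with D show ?case
    unfolding holder_Ck_on.simps
    by (intro exI[of _ "\<lambda>x v. \<sigma>' (T x) (T' x v)"] conjI ballI allI)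
qed

section \<open>Michal-Bastiani differentiability\<close>

declare holder_Ck_on.simps(2) [simp del]

lemma full_domain_inward:
  fixes X :: "'a::euclidean_space set"
  assumes "full_domain X"
  obtains b :: 'a where "\<And>y. y \<in> X \<Longrightarrow> \<forall>\<^sub>F t in at_right 0. y + t *\<^sub>R b \<in> interior X"
proof -
  obtain H T where H: "H \<in> half_spaces" and T: "open T" "X = H \<inter> T"
    using assms by (auto simp: full_domain_def openin_open)
  obtain b :: 'a where b: "\<And>y t. y \<in> H \<Longrightarrow> 0 < t \<Longrightarrow> y + t *\<^sub>R b \<in> interior H"
    using half_spaces_inward[OF H] by metis
  show ?thesis
  proof
    fix y assume y: "y \<in> X"
    have "((\<lambda>t. y + t *\<^sub>R b) \<longlongrightarrow> y + 0 *\<^sub>R b) (at_right 0)"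
      by (intro tendsto_intros)
    then have "\<forall>\<^sub>F t in at_right 0. y + t *\<^sub>R b \<in> T"
      using T y by (intro topological_tendstoD[of _ y]) auto
    moreover have "\<forall>\<^sub>F t::real in at_right 0. 0 < t"
      by (rule eventually_at_right_less)
    ultimately show "\<forall>\<^sub>F t in at_right 0. y + t *\<^sub>R b \<in> interior X"
    proof eventually_elim
      case (elim t)
      then show ?case using b[of y t] y T by (simp add: interior_open)
    qed
  qed
qed

lemma full_domain_tendsto_inward:
  fixes g :: "'a::euclidean_space \<Rightarrow> 'b::topological_space"
  assumes "continuous_on X g" "y \<in> X" "\<forall>\<^sub>F t in at_right 0. y + t *\<^sub>R b \<in> interior X"
  shows "((\<lambda>t. g (y + t *\<^sub>R b)) \<longlongrightarrow> g y) (at_right 0)"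
proof (rule continuous_on_tendsto_compose[OF assms(1) _ assms(2)])
  have "((\<lambda>t. y + t *\<^sub>R b) \<longlongrightarrow> y + 0 *\<^sub>R b) (at_right 0)"
    by (intro tendsto_intros)
  then show "((\<lambda>t. y + t *\<^sub>R b) \<longlongrightarrow> y) (at_right 0)" by simp
  show "\<forall>\<^sub>F t in at_right 0. y + t *\<^sub>R b \<in> X"
    using assms(3) by eventually_elim (use interior_subset in auto)
qed

lemma full_domain_eq_if_interior_eq:
  fixes g :: "'a::euclidean_space \<Rightarrow> 'b::t2_space"
  assumes X: "full_domain X" and "continuous_on X g" "continuous_on X h"
    and "\<And>x. x \<in> interior X \<Longrightarrow> g x = h x" "y \<in> X"
  shows "g y = h y"
proof -
  obtain b where b: "\<forall>\<^sub>F t in at_right 0. y + t *\<^sub>R b \<in> interior X"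
    using full_domain_inward[OF X] assms(5) by blast
  have "((\<lambda>t. g (y + t *\<^sub>R b)) \<longlongrightarrow> g y) (at_right 0)" "((\<lambda>t. h (y + t *\<^sub>R b)) \<longlongrightarrow> h y) (at_right 0)"
    using full_domain_tendsto_inward[OF _ assms(5) b] assms by blast+
  moreover have "\<forall>\<^sub>F t in at_right 0. g (y + t *\<^sub>R b) = h (y + t *\<^sub>R b)"
    using b by eventually_elim (use assms(4) in auto)
  ultimately have "((\<lambda>t. h (y + t *\<^sub>R b)) \<longlongrightarrow> g y) (at_right 0)"
    using tendsto_cong by fast
  with \<open>((\<lambda>t. h (y + t *\<^sub>R b)) \<longlongrightarrow> h y) (at_right 0)\<close> show ?thesis
    by (intro tendsto_unique[of "at_right (0::real)"]) auto
qed

lemma full_domain_cball: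
  assumes "full_domain X" "x \<in> X"
  obtains e where "0 < e" "compact (X \<inter> cball x e)" "convex (X \<inter> cball x e)"
    "\<And>d. 0 < d \<Longrightarrow> d \<le> e \<Longrightarrow> convex (interior X \<inter> ball x d)"
proof -
  obtain H e where H: "H \<in> half_spaces" and e: "0 < e" "X \<inter> ball x e = H \<inter> ball x e" "X \<subseteq> H"
    using full_domain_ball[OF assms] .
  have cH: "closed H" using H closed_halfspace_component_ge[of 0]
    by (auto simp: half_spaces_def)
  have eq: "X \<inter> cball x (e/2) = H \<inter> cball x (e/2)"
    using e by auto
  have "interior X \<inter> ball x d = interior H \<inter> ball x d" if "0 < d" "d \<le> e/2" for d
  proof -
    have "X \<inter> ball x d = (X \<inter> ball x e) \<inter> ball x d" using that e by auto
    also have "\<dots> = H \<inter> ball x d" using that e by auto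
    finally show ?thesis by (metis interior_Int interior_open open_ball)
  qed
  then show ?thesis
    using e cH half_spaces_convex[OF H] eq
    by (intro that[of "e/2"]) (auto simp: convex_Int convex_interior closed_Int_compact)
qed

text \<open>Joint continuity in point and direction makes the directional derivatives near
  \<open>x\<close> close to \<open>D v x\<close>, uniformly over unit directions. The mean value
  inequality along segments in the interior then bounds all increments near \<open>x\<close>, and
  continuity extends the bound to boundary points. Additivity in \<open>v\<close>, which separate
  directional derivatives do not provide, is read off from this bound.\<close>

lemma has_derivative_if_directional:
  fixes g :: "'a::euclidean_space \<Rightarrow> 'c::euclidean_space"
  assumes X: "full_domain X" and g: "continuous_on X g"
    and D: "\<And>v x. x \<in> interior X \<Longrightarrow> ((\<lambda>t. g (x + t *\<^sub>R v)) has_vector_derivative D v x) (at 0)"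
    and C: "continuous_on (X \<times> UNIV) (\<lambda>(x, v). D v x)"
    and x: "x \<in> X"
  shows "(g has_derivative (\<lambda>v. D v x)) (at x within X)"
proof -
  have Cv: "continuous_on X (D v)" for v
  proof -
    have "continuous_on X (\<lambda>x. (\<lambda>(x, v). D v x) (x, v))"
      by (rule continuous_on_compose2[OF C]) (auto intro!: continuous_intros)
    then show ?thesis by simp
  qed
  have scale: "D (c *\<^sub>R v) y = c *\<^sub>R D v y" if y: "y \<in> X" for c v y
  proof (rule full_domain_eq_if_interior_eq[OF X Cv _ _ y])
    show "continuous_on X (\<lambda>x. c *\<^sub>R D v x)" by (intro continuous_intros Cv)
    fix z assume z: "z \<in> interior X"
    have "((\<lambda>t. g (z + t *\<^sub>R v)) \<circ> (\<lambda>t. c * t) has_vector_derivative c *\<^sub>R D v z) (at 0)"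
      by (rule vector_diff_chain_at) (auto intro!: derivative_eq_intros D[OF z])
    moreover have "(\<lambda>t. g (z + t *\<^sub>R v)) \<circ> (\<lambda>t. c * t) = (\<lambda>t. g (z + t *\<^sub>R (c *\<^sub>R v)))"
      by (auto simp: mult.commute)
    ultimately show "D (c *\<^sub>R v) z = c *\<^sub>R D v z"
      using D[OF z, of "c *\<^sub>R v"] vector_derivative_unique_at by metis
  qed
  have est: "\<exists>d>0. \<forall>y\<in>X \<inter> ball x d. \<forall>z\<in>X \<inter> ball x d. norm (g y - g z - D (y - z) x) \<le> e * norm (y - z)"
    if x: "x \<in> X" and e: "0 < e" for x and e :: real
  proof -
    obtain r where r: "0 < r" "compact (X \<inter> cball x r)"
      "\<And>d. 0 < d \<Longrightarrow> d \<le> r \<Longrightarrow> convex (interior X \<inter> ball x d)"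
      using full_domain_cball[OF X x] by metis
    \<comment> \<open>The unit sphere is compact, so one radius serves all unit directions;
      homogeneity extends this to every \<open>v\<close> in \<open>near\<close>.\<close>
    have "uniformly_continuous_on ((X \<inter> cball x r) \<times> sphere 0 1) (\<lambda>(x, v). D v x)"
      using r by (intro compact_uniformly_continuous compact_Times continuous_on_subset[OF C]) auto
    then obtain d' where d': "0 < d'" "\<And>p q. p \<in> (X \<inter> cball x r) \<times> sphere 0 1 \<Longrightarrow>
        q \<in> (X \<inter> cball x r) \<times> sphere 0 1 \<Longrightarrow> dist p q < d' \<Longrightarrow>
        dist ((\<lambda>(x, v). D v x) p) ((\<lambda>(x, v). D v x) q) < e"
      unfolding uniformly_continuous_on_def using e by metis
    define d where "d = min d' r"
    have d: "0 < d" "d \<le> d'" "d \<le> r" using d' r by (auto simp: d_def)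
    have near: "norm (D v y - D v x) \<le> e * norm v" if y: "y \<in> X \<inter> ball x d" for y v
    proof (cases "v = 0")
      case True
      then show ?thesis using scale[of y 0 v] scale[of x 0 v] x y by auto
    next
      case False
      define u where "u = v /\<^sub>R norm v"
      have u: "norm u = 1" "v = norm v *\<^sub>R u" using False by (auto simp: u_def)
      have "dist (y, u) (x, u) < d'"
        using y d by (auto simp: dist_Pair_Pair dist_commute)
      then have "dist (D u y) (D u x) < e"
        using d'(2)[of "(y, u)" "(x, u)"] y d x r u by auto
      moreover have "D v y - D v x = norm v *\<^sub>R (D u y - D u x)"
        using scale[of y "norm v" u] scale[of x "norm v" u] x y u by (auto simp: scaleR_diff_right)
      ultimately show ?thesis
        by (simp add: dist_norm mult.commute[of e] mult_left_mono)
    qed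
    have int: "norm (g y - g z - D (y - z) x) \<le> e * norm (y - z)"
      if y: "y \<in> interior X \<inter> ball x d" and z: "z \<in> interior X \<inter> ball x d" for y z
    proof -
      \<comment> \<open>\<open>G\<close> is \<open>g\<close> along the segment minus the predicted
        linear part, so a bound on its derivative bounds the error of the whole increment.\<close>
      define G where "G t = g (z + t *\<^sub>R (y - z)) - t *\<^sub>R D (y - z) x" for t
      have seg: "z + t *\<^sub>R (y - z) \<in> interior X \<inter> ball x d" if "t \<in> {0..1}" for t
        using convexD_alt[OF r(3)[OF d(1,3)] z y, of t] that by (auto simp: algebra_simps)
      have "(G has_vector_derivative (D (y - z) (z + t *\<^sub>R (y - z)) - D (y - z) x)) (at t within {0..1})"
        if t: "t \<in> {0..1}" for t
      proof -
        have "((\<lambda>s. g ((z + t *\<^sub>R (y - z)) + s *\<^sub>R (y - z))) \<circ> (\<lambda>s. s - t) has_vector_derivative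
            1 *\<^sub>R D (y - z) (z + t *\<^sub>R (y - z))) (at t)"
          using seg[OF t] by (intro vector_diff_chain_at) (auto intro!: derivative_eq_intros D)
        moreover have "(\<lambda>s. g ((z + t *\<^sub>R (y - z)) + s *\<^sub>R (y - z))) \<circ> (\<lambda>s. s - t) = (\<lambda>s. g (z + s *\<^sub>R (y - z)))"
          by (auto simp: fun_eq_iff algebra_simps)
        ultimately have "((\<lambda>s. g (z + s *\<^sub>R (y - z))) has_vector_derivative D (y - z) (z + t *\<^sub>R (y - z))) (at t)"
          by simp
        moreover have "((\<lambda>t. t *\<^sub>R D (y - z) x) has_vector_derivative D (y - z) x) (at t)"
          unfolding has_vector_derivative_def by (auto intro!: derivative_eq_intros)
        ultimately show ?thesis
          unfolding G_def by (intro has_vector_derivative_at_within[OF has_vector_derivative_diff])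
      qed
      note G = this
      have "norm (G 1 - G 0) \<le> (e * norm (y - z)) * norm (1 - 0 :: real)"
      proof (rule differentiable_bound[where S="{0..1}"])
        show "(G has_derivative (\<lambda>s. s *\<^sub>R (D (y - z) (z + t *\<^sub>R (y - z)) - D (y - z) x))) (at t within {0..1})"
          if "t \<in> {0..1}" for t
          using G[OF that] by (simp add: has_vector_derivative_def)
        show "onorm (\<lambda>s. s *\<^sub>R (D (y - z) (z + t *\<^sub>R (y - z)) - D (y - z) x)) \<le> e * norm (y - z)"
          if t: "t \<in> {0..1}" for t
        proof (rule onorm_le)
          fix s :: real
          have "norm (D (y - z) (z + t *\<^sub>R (y - z)) - D (y - z) x) \<le> e * norm (y - z)"
            using near seg[OF t] interior_subset by blast
          then show "norm (s *\<^sub>R (D (y - z) (z + t *\<^sub>R (y - z)) - D (y - z) x)) \<le> e * norm (y - z) * norm s"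
            by (simp add: mult.commute[of _ "\<bar>s\<bar>"] mult_left_mono)
        qed
      qed auto
      then show ?thesis by (simp add: G_def algebra_simps)
    qed
    \<comment> \<open>Moving both end points by the same \<open>t *\<^sub>R b\<close> keeps their
      difference and puts them into the interior; the estimate survives the limit.\<close>
    obtain b where b: "\<And>y. y \<in> X \<Longrightarrow> \<forall>\<^sub>F t in at_right 0. y + t *\<^sub>R b \<in> interior X"
      using full_domain_inward[OF X] by metis
    have "norm (g y - g z - D (y - z) x) \<le> e * norm (y - z)"
      if y: "y \<in> X \<inter> ball x d" and z: "z \<in> X \<inter> ball x d" for y z
    proof (rule tendsto_upperbound)
      show "((\<lambda>t. norm (g (y + t *\<^sub>R b) - g (z + t *\<^sub>R b) - D (y - z) x)) \<longlongrightarrow> norm (g y - g z - D (y - z) x)) (at_right 0)"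
        using y z by (intro tendsto_intros full_domain_tendsto_inward[OF g] b) auto
      have ev: "\<forall>\<^sub>F t in at_right 0. y + t *\<^sub>R b \<in> ball x d" if "y \<in> ball x d" for y
      proof -
        have "((\<lambda>t. y + t *\<^sub>R b) \<longlongrightarrow> y + 0 *\<^sub>R b) (at_right 0)" by (intro tendsto_intros)
        then show ?thesis using that by (intro topological_tendstoD[of _ y]) auto
      qed
      have "\<forall>\<^sub>F t in at_right 0. y + t *\<^sub>R b \<in> interior X" "\<forall>\<^sub>F t in at_right 0. z + t *\<^sub>R b \<in> interior X"
          "\<forall>\<^sub>F t in at_right 0. y + t *\<^sub>R b \<in> ball x d" "\<forall>\<^sub>F t in at_right 0. z + t *\<^sub>R b \<in> ball x d"
        using b y z ev by auto
      then show "\<forall>\<^sub>F t in at_right 0. norm (g (y + t *\<^sub>R b) - g (z + t *\<^sub>R b) - D (y - z) x) \<le> e * norm (y - z)"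
      proof eventually_elim
        case (elim t)
        then show ?case using int[of "y + t *\<^sub>R b" "z + t *\<^sub>R b"] by auto
      qed
    qed auto
    then show ?thesis using d(1) by blast
  qed
  have add: "D (v + w) y = D v y + D w y" if y: "y \<in> X" for v w y
  proof (rule full_domain_eq_if_interior_eq[OF X Cv _ _ y])
    show "continuous_on X (\<lambda>x. D v x + D w x)" by (intro continuous_intros Cv)
    fix z assume z: "z \<in> interior X"
    have "norm (D (v + w) z - (D v z + D w z)) \<le> e" if e: "0 < e" for e
    proof -
      \<comment> \<open>The estimate is used on the three sides of the triangle \<open>z\<close>,
        \<open>z + t *\<^sub>R v\<close>, \<open>z + t *\<^sub>R (v + w)\<close>. Their lengths add
        up to less than \<open>t * N\<close>, so the tolerance \<open>e / N\<close> leaves a total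
        error of at most \<open>t * e\<close>.\<close>
      define N where "N = norm (v + w) + norm v + norm w + 1"
      have N: "0 < N" by (simp add: N_def add_nonneg_pos)
      obtain d where d: "0 < d" "\<And>y y'. y \<in> X \<inter> ball z d \<Longrightarrow> y' \<in> X \<inter> ball z d \<Longrightarrow>
          norm (g y - g y' - D (y - y') z) \<le> (e / N) * norm (y - y')"
        using est[of z "e / N"] z e N interior_subset by (metis divide_pos_pos subsetD)
      obtain r where r: "0 < r" "ball z r \<subseteq> X \<inter> ball z d"
      proof -
        have "open (interior X \<inter> ball z d)" "z \<in> interior X \<inter> ball z d" using z d by auto
        then obtain r where "0 < r" "ball z r \<subseteq> interior X \<inter> ball z d" by (meson openE)
        then show ?thesis using that interior_subset by blast
      qed
      define t where "t = r / (2 * N)"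
      have t: "0 < t" using r N by (simp add: t_def)
      have "t * norm (v + w) < r" "t * norm v < r"
      proof -
        have "t * norm (v + w) \<le> t * N" "t * norm v \<le> t * N"
          using t by (auto intro!: mult_left_mono simp: N_def)
        moreover have "t * N < r" using r N by (simp add: t_def)
        ultimately show "t * norm (v + w) < r" "t * norm v < r" by linarith+
      qed
      then have in_ball: "z \<in> X \<inter> ball z d" "z + t *\<^sub>R v \<in> X \<inter> ball z d" "z + t *\<^sub>R (v + w) \<in> X \<inter> ball z d"
        using r(1) t by (intro subsetD[OF r(2)], simp add: dist_norm del: scaleR_add_right)+
      have 1: "norm (g (z + t *\<^sub>R (v + w)) - g z - t *\<^sub>R D (v + w) z) \<le> (e / N) * (t * norm (v + w))"
        using d(2)[OF in_ball(3,1)] t scale[of z t "v + w"] in_ball(1) by auto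
      have 2: "norm (g (z + t *\<^sub>R v) - g z - t *\<^sub>R D v z) \<le> (e / N) * (t * norm v)"
        using d(2)[OF in_ball(2,1)] t scale[of z t v] in_ball(1) by auto
      have 3: "norm (g (z + t *\<^sub>R (v + w)) - g (z + t *\<^sub>R v) - t *\<^sub>R D w z) \<le> (e / N) * (t * norm w)"
        using d(2)[OF in_ball(3,2)] t scale[of z t w] in_ball(1) by (auto simp: scaleR_add_right)
      have "t *\<^sub>R (D (v + w) z - (D v z + D w z)) =
          (g (z + t *\<^sub>R v) - g z - t *\<^sub>R D v z) + (g (z + t *\<^sub>R (v + w)) - g (z + t *\<^sub>R v) - t *\<^sub>R D w z)
          - (g (z + t *\<^sub>R (v + w)) - g z - t *\<^sub>R D (v + w) z)"
        by (simp add: algebra_simps)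
      then have "norm (t *\<^sub>R (D (v + w) z - (D v z + D w z))) \<le>
          (e / N) * (t * norm v) + (e / N) * (t * norm w) + (e / N) * (t * norm (v + w))"
        using 1 2 3 by (metis (no_types, lifting) add_mono norm_triangle_le norm_triangle_le_diff)
      also have "\<dots> = (e / N) * t * (norm v + norm w + norm (v + w))"
        by (simp add: algebra_simps)
      also have "\<dots> \<le> (e / N) * t * N"
        using e N t by (intro mult_left_mono) (auto simp: N_def)
      also have "\<dots> = t * e" using N by simp
      finally show ?thesis using t by simp
    qed
    then have "norm (D (v + w) z - (D v z + D w z)) \<le> 0"
      by (rule field_le_epsilon) simp
    then show "D (v + w) z = D v z + D w z" by simp
  qed
  have "linear (\<lambda>v. D v x)"
    using add[OF x] scale[OF x] by (rule linearI)
  then have "bounded_linear (\<lambda>v. D v x)" by (simp add: linear_conv_bounded_linear)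
  moreover have "\<exists>d>0. \<forall>y\<in>X. norm (y - x) < d \<longrightarrow> norm (g y - g x - D (y - x) x) \<le> e * norm (y - x)"
    if "0 < e" for e
    using est[OF x that] x by (metis (no_types, opaque_lifting) IntI centre_in_ball dist_commute dist_norm mem_ball)
  ultimately show ?thesis
    by (simp add: has_derivative_within_alt)
qed

text \<open>Induction on the order: the first derivative in a direction \<open>v\<close> is again of
  Michal-Bastiani class, of one order less, with \<open>v\<close> put in front of the sequence of
  directions.\<close>

lemma bastiani_imp_holder:
  assumes X: "full_domain X" and g: "bastiani_Ck_on (enat k) X g"
  shows "holder_Ck_on k 0 X g"
  using g
proof (induction k arbitrary: g)
  case 0
  then obtain D :: "nat \<Rightarrow> (nat \<Rightarrow> 'a) \<Rightarrow> 'a \<Rightarrow> 'b" where D: "\<forall>h. \<forall>x\<in>X. D 0 h x = g x"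
    "continuous_on (X \<times> UNIV) (\<lambda>(x, h). D 0 h x)"
    unfolding bastiani_Ck_on_def by (metis order_refl)
  have "continuous_on X (\<lambda>x. (\<lambda>(x, h). D 0 h x) (x, \<lambda>_. 0))"
    by (rule continuous_on_compose2[OF D(2)]) (auto intro!: continuous_intros)
  then have "continuous_on X g" using D(1) by (auto cong: continuous_on_cong)
  then show ?case by (simp add: locally_holder_on_continuous)
next
  case (Suc k)
  from Suc.prems obtain D :: "nat \<Rightarrow> (nat \<Rightarrow> 'a) \<Rightarrow> 'a \<Rightarrow> 'b" where
      D0': "\<forall>h. \<forall>x\<in>X. D 0 h x = g x"
    and DS': "\<forall>j. enat (Suc j) \<le> enat (Suc k) \<longrightarrow> (\<forall>h. \<forall>x\<in>interior X.
             ((\<lambda>t. D j h (x + t *\<^sub>R h j)) has_vector_derivative D (Suc j) h x) (at 0))"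
    and DC': "\<forall>j. enat j \<le> enat (Suc k) \<longrightarrow> continuous_on (X \<times> UNIV) (\<lambda>(x, h). D j h x)"
    unfolding bastiani_Ck_on_def by (elim exE conjE) blast
  have D0: "D 0 h x = g x" if "x \<in> X" for h x using D0' that by blast
  have DS: "((\<lambda>t. D j h (x + t *\<^sub>R h j)) has_vector_derivative D (Suc j) h x) (at 0)"
    if "j \<le> k" "x \<in> interior X" for j h x using DS' that by simp
  have DC: "continuous_on (X \<times> UNIV) (\<lambda>(x, h). D j h x)" if "j \<le> Suc k" for j
    using DC' that by simp
  have DCh: "continuous_on X (D j h)" if "j \<le> Suc k" for j h
  proof -
    have "continuous_on X (\<lambda>x. (\<lambda>(x, h). D j h x) (x, h))"
      by (rule continuous_on_compose2[OF DC[OF that]]) (auto intro!: continuous_intros)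
    then show ?thesis by simp
  qed
  have D1: "((\<lambda>t. g (x + t *\<^sub>R h 0)) has_vector_derivative D 1 h x) (at 0)" if x: "x \<in> interior X" for x h
  proof -
    have "((\<lambda>t. D 0 h (x + t *\<^sub>R h 0)) has_vector_derivative D 1 h x) (at 0)"
      using DS[of 0, OF _ x] by simp
    then show ?thesis
    proof (rule has_vector_derivative_transform_within_open)
      show "open ((\<lambda>t. x + t *\<^sub>R h 0) -` interior X)"
        by (intro open_vimage continuous_intros) auto
      show "D 0 h (x + t *\<^sub>R h 0) = g (x + t *\<^sub>R h 0)" if "t \<in> (\<lambda>t. x + t *\<^sub>R h 0) -` interior X" for t
        using that D0 interior_subset by blast
    qed (use x in auto)
  qed
  \<comment> \<open>That \<open>D 1 h\<close> depends on \<open>h 0\<close> alone is not a clause of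
    the definition. On the interior it is a derivative along \<open>h 0\<close>, and continuity
    carries the equality to the boundary.\<close>
  have D1eq: "D 1 h x = D 1 (\<lambda>_. h 0) x" if "x \<in> X" for h x
  proof (rule full_domain_eq_if_interior_eq[OF X DCh DCh _ that])
    fix y assume y: "y \<in> interior X"
    show "D 1 h y = D 1 (\<lambda>_. h 0) y"
      using D1[OF y, of h] D1[OF y, of "\<lambda>_. h 0"] vector_derivative_unique_at by metis
  qed auto
  have "continuous_on (X \<times> UNIV) (\<lambda>p. (\<lambda>(x, h). D 1 h x) (fst p, \<lambda>_. snd p))"
    by (rule continuous_on_compose2[OF DC]) (auto intro!: continuous_intros)
  then have "continuous_on (X \<times> UNIV) (\<lambda>(x, v). D 1 (\<lambda>_. v) x)"
    by (simp add: case_prod_unfold)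
  moreover have "continuous_on X g"
    using DCh[of 0 "\<lambda>_. 0"] D0 by (auto cong: continuous_on_cong)
  ultimately have der: "(g has_derivative (\<lambda>v. D 1 (\<lambda>_. v) x)) (at x within X)" if "x \<in> X" for x
    using D1[of _ "\<lambda>_. v" for v] by (intro has_derivative_if_directional[OF X _ _ _ that]) auto
  have "holder_Ck_on k 0 X (\<lambda>x. D 1 (\<lambda>_. v) x)" for v
  proof (rule Suc.IH)
    show "bastiani_Ck_on (enat k) X (\<lambda>x. D 1 (\<lambda>_. v) x)"
      unfolding bastiani_Ck_on_def
    \<comment> \<open>\<open>case_nat v h\<close> is the sequence \<open>v, h 0, h 1, ...\<close>,
      so differentiating along \<open>h j\<close> at stage \<open>j\<close> is stage
      \<open>Suc j\<close> of the given family.\<close>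
    proof (intro exI[of _ "\<lambda>j h x. D (Suc j) (case_nat v h) x"] conjI allI ballI impI)
      fix h x assume "x \<in> X"
      then show "D (Suc 0) (case_nat v h) x = D 1 (\<lambda>_. v) x"
        using D1eq[of x "case_nat v h"] by simp
    next
      fix j h x assume "enat (Suc j) \<le> enat k" "x \<in> interior X"
      then show "((\<lambda>t. D (Suc j) (case_nat v h) (x + t *\<^sub>R h j)) has_vector_derivative
          D (Suc (Suc j)) (case_nat v h) x) (at 0)"
        using DS[of "Suc j" x "case_nat v h"] by simp
    next
      fix j assume j: "enat j \<le> enat k"
      have "continuous_on (X \<times> UNIV) (\<lambda>p :: 'a \<times> (nat \<Rightarrow> 'a). case_nat v (snd p) i)" for i
        by (cases i) (auto intro!: continuous_intros continuous_on_product_then_coordinatewise[OF continuous_on_snd])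
      then have "continuous_on (X \<times> UNIV) (\<lambda>p :: 'a \<times> (nat \<Rightarrow> 'a). (fst p, case_nat v (snd p)))"
        by (intro continuous_on_Pair continuous_on_coordinatewise_then_product continuous_on_fst continuous_on_id)
      then have "continuous_on (X \<times> UNIV) (\<lambda>p. (\<lambda>(x, h). D (Suc j) h x) (fst p, case_nat v (snd p)))"
        by (rule continuous_on_compose2[OF DC, rotated]) (use j in auto)
      then show "continuous_on (X \<times> UNIV) (\<lambda>(x, h). D (Suc j) (case_nat v h) x)"
        by (simp add: case_prod_unfold)
    qed
  qed
  with der show ?case
    unfolding holder_Ck_on.simps by (intro exI[of _ "\<lambda>x v. D 1 (\<lambda>_. v) x"] conjI ballI allI)
qed

section \<open>Iterated Frechet derivatives as Michal-Bastiani derivatives\<close>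

primrec iterated_derivative ::
  "'a::euclidean_space set \<Rightarrow> nat \<Rightarrow> ('a \<Rightarrow> 'c::euclidean_space) \<Rightarrow> (nat \<Rightarrow> 'a) \<Rightarrow> 'a \<Rightarrow> 'c" where
  "iterated_derivative X 0 g h = g"
| "iterated_derivative X (Suc j) g h =
     iterated_derivative X j (\<lambda>x. frechet_derivative g (at x within X) (h 0)) (\<lambda>i. h (Suc i))"

lemma holder_derivative:
  assumes "full_domain X" "holder_Ck_on (Suc k) 0 X g"
  shows "x \<in> X \<Longrightarrow> (g has_derivative frechet_derivative g (at x within X)) (at x within X)"
    and "holder_Ck_on k 0 X (\<lambda>x. frechet_derivative g (at x within X) v)"
proof -
  show D: "(g has_derivative frechet_derivative g (at x within X)) (at x within X)" if "x \<in> X" for x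
    using assms(2) that frechet_derivative_works unfolding holder_Ck_on.simps differentiable_def by blast
  show "holder_Ck_on k 0 X (\<lambda>x. frechet_derivative g (at x within X) v)"
    using holder_Ck_on_Suc[OF assms(1) D] assms(2) by blast
qed

lemma iterated_derivative_cong:
  assumes "\<And>x. x \<in> X \<Longrightarrow> g x = g' x" "x \<in> X"
  shows "iterated_derivative X j g h x = iterated_derivative X j g' h x"
  using assms
proof (induction j arbitrary: g g' h x)
  case (Suc j)
  have "frechet_derivative g (at y within X) = frechet_derivative g' (at y within X)" if "y \<in> X" for y
  proof -
    have "(g has_derivative D) (at y within X) = (g' has_derivative D) (at y within X)" for D
      using Suc.prems(1) that has_derivative_transform by metis
    then show ?thesis by (simp add: frechet_derivative_def)
  qed
  then show ?case
    unfolding iterated_derivative.simps by (intro Suc.IH Suc.prems(2)) metis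
qed auto

lemma iterated_derivative_sum:
  fixes g :: "'i \<Rightarrow> 'a::euclidean_space \<Rightarrow> 'c::euclidean_space"
  assumes X: "full_domain X" and "finite I" "\<And>i. i \<in> I \<Longrightarrow> holder_Ck_on j 0 X (g i)" "x \<in> X"
  shows "iterated_derivative X j (\<lambda>x. \<Sum>i\<in>I. c i *\<^sub>R g i x) h x = (\<Sum>i\<in>I. c i *\<^sub>R iterated_derivative X j (g i) h x)"
  using assms(3,4)
proof (induction j arbitrary: g h x)
  case (Suc j)
  let ?D = "\<lambda>i y. frechet_derivative (g i) (at y within X)"
  have eq: "frechet_derivative (\<lambda>x. \<Sum>i\<in>I. c i *\<^sub>R g i x) (at y within X) = (\<lambda>v. \<Sum>i\<in>I. c i *\<^sub>R ?D i y v)"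
    if "y \<in> X" for y
  proof -
    have "((\<lambda>x. \<Sum>i\<in>I. c i *\<^sub>R g i x) has_derivative (\<lambda>v. \<Sum>i\<in>I. c i *\<^sub>R ?D i y v)) (at y within X)"
      using that Suc.prems(1) holder_derivative(1)[OF X]
      by (intro has_derivative_sum has_derivative_scaleR_right) blast
    then show ?thesis
      using full_domain_derivative_unique[OF X that] frechet_derivative_works differentiable_def by blast
  qed
  have "iterated_derivative X (Suc j) (\<lambda>x. \<Sum>i\<in>I. c i *\<^sub>R g i x) h x =
      iterated_derivative X j (\<lambda>y. \<Sum>i\<in>I. c i *\<^sub>R ?D i y (h 0)) (\<lambda>i. h (Suc i)) x"
    unfolding iterated_derivative.simps
    by (rule iterated_derivative_cong[OF _ Suc.prems(2)]) (simp add: eq)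
  also have "\<dots> = (\<Sum>i\<in>I. c i *\<^sub>R iterated_derivative X j (\<lambda>y. ?D i y (h 0)) (\<lambda>i. h (Suc i)) x)"
    using holder_derivative(2)[OF X] Suc.prems by (intro Suc.IH) blast+
  finally show ?case by simp
qed auto

text \<open>Each derivative is linear in its direction. Expanding \<open>h 0\<close> in the basis
  leaves finitely many iterated derivatives of lower order, with coefficients continuous in
  \<open>h\<close>; the remaining directions are treated by induction.\<close>

lemma iterated_derivative_continuous:
  assumes X: "full_domain X" and "holder_Ck_on j 0 X g"
  shows "continuous_on (X \<times> UNIV) (\<lambda>(x, h). iterated_derivative X j g h x)"
  using assms(2)
proof (induction j arbitrary: g)
  case 0
  then show ?case
    by (auto simp: case_prod_unfold intro: continuous_on_compose2[OF _ continuous_on_fst[OF continuous_on_id]])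
next
  case (Suc j)
  let ?D = "\<lambda>b y. frechet_derivative g (at y within X) b"
  have eq: "iterated_derivative X (Suc j) g h x =
      (\<Sum>b\<in>Basis. (h 0 \<bullet> b) *\<^sub>R iterated_derivative X j (?D b) (\<lambda>i. h (Suc i)) x)" if x: "x \<in> X" for x h
  proof -
    have "?D (h 0) y = (\<Sum>b\<in>Basis. (h 0 \<bullet> b) *\<^sub>R ?D b y)" if "y \<in> X" for y
    proof -
      have lin: "linear (frechet_derivative g (at y within X))"
        using holder_derivative(1)[OF X Suc.prems that] by (rule has_derivative_linear)
      have "?D (h 0) y = ?D (\<Sum>b\<in>Basis. (h 0 \<bullet> b) *\<^sub>R b) y" by (simp add: euclidean_representation)
      also have "\<dots> = (\<Sum>b\<in>Basis. (h 0 \<bullet> b) *\<^sub>R ?D b y)"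
        using lin by (simp add: linear_sum linear_cmul o_def)
      finally show ?thesis .
    qed
    then have "iterated_derivative X (Suc j) g h x =
      iterated_derivative X j (\<lambda>y. \<Sum>b\<in>Basis. (h 0 \<bullet> b) *\<^sub>R ?D b y) (\<lambda>i. h (Suc i)) x"
      using x by (auto intro: iterated_derivative_cong)
    also have "\<dots> = (\<Sum>b\<in>Basis. (h 0 \<bullet> b) *\<^sub>R iterated_derivative X j (?D b) (\<lambda>i. h (Suc i)) x)"
      using holder_derivative(2)[OF X Suc.prems] x by (intro iterated_derivative_sum X) auto
    finally show ?thesis .
  qed
  have coord: "continuous_on A (\<lambda>p :: 'a \<times> (nat \<Rightarrow> 'a). snd p i)" for A i
    by (rule continuous_on_product_then_coordinatewise[OF continuous_on_snd[OF continuous_on_id]])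
  have "continuous_on (X \<times> UNIV) (\<lambda>p. \<Sum>b\<in>Basis. (snd p 0 \<bullet> b) *\<^sub>R
      iterated_derivative X j (?D b) (\<lambda>i. snd p (Suc i)) (fst p))"
  proof (intro continuous_on_sum continuous_on_scaleR continuous_on_inner coord continuous_on_const)
    fix b :: 'a
    have "continuous_on (X \<times> UNIV) (\<lambda>p :: 'a \<times> (nat \<Rightarrow> 'a). (fst p, \<lambda>i. snd p (Suc i)))"
      by (intro continuous_on_Pair continuous_on_coordinatewise_then_product coord continuous_on_fst continuous_on_id)
    then show "continuous_on (X \<times> UNIV) (\<lambda>p. iterated_derivative X j (?D b) (\<lambda>i. snd p (Suc i)) (fst p))"
      by (rule continuous_on_compose2[OF Suc.IH[OF holder_derivative(2)[OF X Suc.prems]],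
        unfolded case_prod_unfold, of "X \<times> UNIV" "\<lambda>p. (fst p, \<lambda>i. snd p (Suc i))", unfolded fst_conv snd_conv])
        auto
  qed
  also have "?this \<longleftrightarrow> ?case"
    by (rule continuous_on_cong) (auto simp: eq simp del: iterated_derivative.simps)
  finally show ?case .
qed

text \<open>The recursion differentiates along \<open>h 0\<close> innermost, so peeling off the
  first direction passes from \<open>g\<close> to its derivative and lowers the stage by one, until
  the claim is the definition of the derivative at an interior point.\<close>

lemma iterated_derivative_derivative:
  assumes X: "full_domain X" and "holder_Ck_on (Suc j) 0 X g" and x: "x \<in> interior X"
  shows "((\<lambda>t. iterated_derivative X j g h (x + t *\<^sub>R h j)) has_vector_derivative
    iterated_derivative X (Suc j) g h x) (at 0)"
  using assms(2)
proof (induction j arbitrary: g h)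
  case 0
  have "(g has_derivative frechet_derivative g (at x within X)) (at x within X)"
    using holder_derivative(1)[OF X 0] x interior_subset by blast
  then have D: "(g has_derivative frechet_derivative g (at x within X)) (at (x + 0 *\<^sub>R h 0))"
    using x by (simp add: at_within_interior[OF x])
  have "((\<lambda>t. x + t *\<^sub>R h 0) has_derivative (\<lambda>t. t *\<^sub>R h 0)) (at 0)"
    by (auto intro!: derivative_eq_intros)
  from has_derivative_compose[OF this D]
  show ?case
    by (simp add: has_vector_derivative_def linear_cmul[OF has_derivative_linear[OF D]])
next
  case (Suc j)
  have "holder_Ck_on (Suc j) 0 X (\<lambda>x. frechet_derivative g (at x within X) (h 0))"
    using holder_derivative(2)[OF X Suc.prems] .
  from Suc.IH[OF this, of "\<lambda>i. h (Suc i)"] show ?case by simp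
qed

lemma bastiani_eq_holder:
  assumes X: "full_domain X"
  shows "bastiani_Ck_on k X g \<longleftrightarrow> (\<forall>j. enat j \<le> k \<longrightarrow> holder_Ck_on j 0 X g)"
proof (intro iffI allI impI)
  fix j assume "bastiani_Ck_on k X g" "enat j \<le> k"
  then have "bastiani_Ck_on (enat j) X g"
    unfolding bastiani_Ck_on_def using order_trans[OF _ \<open>enat j \<le> k\<close>]
    by (elim ex_forward conj_forward all_forward impCE) auto
  then show "holder_Ck_on j 0 X g" by (rule bastiani_imp_holder[OF X])
next
  assume g: "\<forall>j. enat j \<le> k \<longrightarrow> holder_Ck_on j 0 X g"
  show "bastiani_Ck_on k X g"
    unfolding bastiani_Ck_on_def
  proof (intro exI[of _ "\<lambda>j. iterated_derivative X j g"] conjI allI ballI impI)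
    show "iterated_derivative X 0 g h x = g x" for h x by simp
    show "((\<lambda>t. iterated_derivative X j g h (x + t *\<^sub>R h j)) has_vector_derivative
        iterated_derivative X (Suc j) g h x) (at 0)"
      if "enat (Suc j) \<le> k" "x \<in> interior X" for j h x
      using iterated_derivative_derivative[OF X _ that(2)] g that(1) by blast
    show "continuous_on (X \<times> UNIV) (\<lambda>(x, h). iterated_derivative X j g h x)" if "enat j \<le> k" for j
      using iterated_derivative_continuous[OF X] g that by blast
  qed
qed

section \<open>The Gagliardo-Nirenberg inequality on an interval\<close>

text \<open>\<open>v 0\<close>, ..., \<open>v n\<close> are successive classical derivatives, while
  the derivative of order \<open>n + 1\<close> exists only in integrated form: \<open>v n\<close> is
  absolutely continuous with density \<open>w\<close>. This is what a Sobolev function of order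
  \<open>n + 1\<close> looks like on almost every line.\<close>

definition deriv_chain :: "nat \<Rightarrow> (nat \<Rightarrow> real \<Rightarrow> real) \<Rightarrow> (real \<Rightarrow> real) \<Rightarrow> real \<Rightarrow> real \<Rightarrow> bool" where
  "deriv_chain n v w a b \<longleftrightarrow>
     (\<forall>m<n. \<forall>t\<in>{a..b}. (v m has_real_derivative v (Suc m) t) (at t within {a..b})) \<and>
     w absolutely_integrable_on {a..b} \<and>
     (\<forall>s t. a \<le> s \<longrightarrow> s \<le> t \<longrightarrow> t \<le> b \<longrightarrow> v n t - v n s = integral {s..t} w)"

lemma deriv_chain_subinterval:
  assumes "deriv_chain n v w a b" "a \<le> a'" "b' \<le> b"
  shows "deriv_chain n v w a' b'"
proof -
  have sub: "{a'..b'} \<subseteq> {a..b}" using assms(2,3) by auto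
  then have "w absolutely_integrable_on {a'..b'}"
    using assms(1) absolutely_integrable_on_subinterval unfolding deriv_chain_def by blast
  moreover have "(v m has_real_derivative v (Suc m) t) (at t within {a'..b'})" if "m < n" "t \<in> {a'..b'}" for m t
    using assms(1) that sub DERIV_subset[OF _ sub] unfolding deriv_chain_def by blast
  ultimately show ?thesis
    using assms unfolding deriv_chain_def by auto
qed

lemma deriv_chain_continuous:
  assumes "deriv_chain n v w a b" "m \<le> n"
  shows "continuous_on {a..b} (v m)"
proof (cases "m < n")
  case True
  then show ?thesis using assms DERIV_continuous_on[of "{a..b}" "v m" "v (Suc m)"]
    unfolding deriv_chain_def by blast
next
  case False
  then have m: "m = n" using assms by simp
  show ?thesis
  proof (cases "a \<le> b")
    case True
    have "continuous_on {a..b} (\<lambda>t. v n a + integral {a..t} w)"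
      using assms set_lebesgue_integral_eq_integral(1)
      by (intro continuous_intros indefinite_integral_continuous_1) (auto simp: deriv_chain_def)
    also have "?this \<longleftrightarrow> continuous_on {a..b} (v n)"
      using assms(1) unfolding deriv_chain_def by (intro continuous_on_cong) force+
    finally show ?thesis using m by simp
  qed auto
qed

text \<open>A function with small integral is small somewhere. For the next derivative, take such
  points in the first and in the last third: they are at least a third of the interval apart, and
  the mean value theorem turns the difference of the values into a small value in between. The two
  points give the factor 2, the thirds the powers of 3.\<close>

lemma deriv_chain_small_point:
  "\<exists>C>0. \<forall>n v w a b. m \<le> n \<longrightarrow> deriv_chain n v w a b \<longrightarrow> a < b \<longrightarrow>
     (\<exists>s\<in>{a..b}. \<bar>v m s\<bar> * (b - a) ^ Suc m \<le> C * integral {a..b} (\<lambda>t. \<bar>v 0 t\<bar>))"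
proof (induction m)
  case 0
  have "\<exists>s\<in>{a..b}. \<bar>v 0 s\<bar> * (b - a) \<le> integral {a..b} (\<lambda>t. \<bar>v 0 t\<bar>)"
    if c: "deriv_chain n v w a b" "a < b" for n v w a b
  proof -
    have cont: "continuous_on {a..b} (\<lambda>t. \<bar>v 0 t\<bar>)"
      using deriv_chain_continuous[OF c(1), of 0] by (intro continuous_intros) auto
    then obtain s where s: "s \<in> {a..b}" "\<And>t. t \<in> {a..b} \<Longrightarrow> \<bar>v 0 s\<bar> \<le> \<bar>v 0 t\<bar>"
      using continuous_attains_inf[of "{a..b}" "\<lambda>t. \<bar>v 0 t\<bar>"] c(2) by auto
    have "integral {a..b} (\<lambda>t. \<bar>v 0 s\<bar>) \<le> integral {a..b} (\<lambda>t. \<bar>v 0 t\<bar>)"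
      using s cont by (intro integral_le integrable_continuous_real) auto
    then show ?thesis using s(1) c(2) by (auto simp: mult.commute)
  qed
  then show ?case by (intro exI[of _ 1]) auto
next
  case (Suc m)
  then obtain C where C: "C > 0" "\<And>n v w a b. m \<le> n \<Longrightarrow> deriv_chain n v w a b \<Longrightarrow> a < b \<Longrightarrow>
     \<exists>s\<in>{a..b}. \<bar>v m s\<bar> * (b - a) ^ Suc m \<le> C * integral {a..b} (\<lambda>t. \<bar>v 0 t\<bar>)" by blast
  have "\<exists>s\<in>{a..b}. \<bar>v (Suc m) s\<bar> * (b - a) ^ Suc (Suc m) \<le> (2 * 3 ^ Suc (Suc m) * C) * integral {a..b} (\<lambda>t. \<bar>v 0 t\<bar>)"
    if mn: "Suc m \<le> n" and c: "deriv_chain n v w a b" and ab: "a < b" for n v w a b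
  proof -
    define l where "l = (b - a) / 3"
    have l: "0 < l" "b = a + 3 * l" using ab by (auto simp: l_def field_simps)
    define A where "A = integral {a..b} (\<lambda>t. \<bar>v 0 t\<bar>)"
    have cont: "continuous_on {a..b} (\<lambda>t. \<bar>v 0 t\<bar>)"
      using deriv_chain_continuous[OF c, of 0] by (intro continuous_intros) auto
    have sub: "C * integral {a'..b'} (\<lambda>t. \<bar>v 0 t\<bar>) \<le> C * A" if "a \<le> a'" "b' \<le> b" for a' b'
      unfolding A_def using that C(1)
      by (intro mult_left_mono integral_subset_le integrable_continuous_real continuous_on_subset[OF cont]) auto
    obtain s1 where s1: "s1 \<in> {a..a+l}" "\<bar>v m s1\<bar> * (a + l - a) ^ Suc m \<le> C * integral {a..a+l} (\<lambda>t. \<bar>v 0 t\<bar>)"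
    proof -
      have "deriv_chain n v w a (a + l)" "a < a + l" using deriv_chain_subinterval[OF c] l by auto
      then show ?thesis using C(2)[of n v w a "a + l"] mn that by auto
    qed
    obtain s2 where s2: "s2 \<in> {b-l..b}" "\<bar>v m s2\<bar> * (b - (b - l)) ^ Suc m \<le> C * integral {b-l..b} (\<lambda>t. \<bar>v 0 t\<bar>)"
    proof -
      have "deriv_chain n v w (b - l) b" "b - l < b" using deriv_chain_subinterval[OF c] l by auto
      then show ?thesis using C(2)[of n v w "b - l" b] mn that by auto
    qed
    have b1: "\<bar>v m s1\<bar> * l ^ Suc m \<le> C * A" using s1(2) sub[of a "a + l"] l by auto
    have b2: "\<bar>v m s2\<bar> * l ^ Suc m \<le> C * A" using s2(2) sub[of "b - l" b] l by auto
    have s12: "l \<le> s2 - s1" "a \<le> s1" "s2 \<le> b" "s1 < s2" using s1 s2 l by auto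
    have "\<exists>s\<in>{s1<..<s2}. v m s2 - v m s1 = (s2 - s1) * v (Suc m) s"
    proof -
      have der: "(v m has_derivative times (v (Suc m) t)) (at t)" if t: "s1 < t" "t < s2" for t
      proof -
        have "(v m has_real_derivative v (Suc m) t) (at t within {a..b})"
          using c mn t s12 by (auto simp: deriv_chain_def)
        moreover have "at t within {a..b} = at t"
          using t s12 by (intro at_within_interior) auto
        ultimately show ?thesis by (simp add: has_field_derivative_def)
      qed
      have "continuous_on {s1..s2} (v m)"
        using deriv_chain_continuous[OF c, of m] mn s12 by (auto intro: continuous_on_subset)
      then obtain \<xi> where "s1 < \<xi>" "\<xi> < s2" "v m s2 - v m s1 = v (Suc m) \<xi> * (s2 - s1)"
        using mvt[OF s12(4) _ der] by metis
      then show ?thesis by (intro bexI[of _ \<xi>]) (simp_all add: mult.commute)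
    qed
    then obtain s where s: "s \<in> {s1<..<s2}" "v m s2 - v m s1 = (s2 - s1) * v (Suc m) s" by blast
    have "\<bar>v (Suc m) s\<bar> * l \<le> \<bar>v (Suc m) s\<bar> * (s2 - s1)" using s12 by (intro mult_left_mono) auto
    also have "\<dots> = \<bar>v m s2 - v m s1\<bar>" using s(2) s12 by (simp add: abs_mult)
    also have "\<dots> \<le> \<bar>v m s1\<bar> + \<bar>v m s2\<bar>" by linarith
    finally have "\<bar>v (Suc m) s\<bar> * l * l ^ Suc m \<le> (\<bar>v m s1\<bar> + \<bar>v m s2\<bar>) * l ^ Suc m"
      using l by (intro mult_right_mono) auto
    also have "\<dots> \<le> 2 * (C * A)" using b1 b2 by (simp add: algebra_simps)
    finally have "\<bar>v (Suc m) s\<bar> * l ^ Suc (Suc m) \<le> 2 * C * A" by (simp add: mult.assoc)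
    then have le: "\<bar>v (Suc m) s\<bar> * (3 * l) ^ Suc (Suc m) \<le> 3 ^ Suc (Suc m) * (2 * C * A)"
      by (simp add: power_mult_distrib mult_ac)
    have "3 * l = b - a" by (simp add: l_def)
    from le[unfolded this] show ?thesis
      using s s12 by (intro bexI[of _ s]) (auto simp: A_def mult_ac)
  qed
  moreover have "2 * 3 ^ Suc (Suc m) * C > 0" using C(1) by simp
  ultimately show ?case by blast
qed

text \<open>Without integrability the integral is 0 by convention, so no integrability has to be
  shown where only the sign matters.\<close>

lemma integral_abs_nonneg: "0 \<le> integral S (\<lambda>t. \<bar>f t :: real\<bar>)"
  by (cases "(\<lambda>t. \<bar>f t\<bar>) integrable_on S")
     (auto intro: Henstock_Kurzweil_Integration.integral_nonneg simp: not_integrable_integral)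

lemma deriv_chain_sup_top:
  assumes "deriv_chain n v w a b" "s \<in> {a..b}" "t \<in> {a..b}"
  shows "\<bar>v n t - v n s\<bar> \<le> integral {a..b} (\<lambda>t. \<bar>w t\<bar>)"
proof -
  have w: "w absolutely_integrable_on {a..b}" using assms(1) by (simp add: deriv_chain_def)
  have "\<bar>v n t - v n s\<bar> \<le> integral {a..b} (\<lambda>t. \<bar>w t\<bar>)" if st: "a \<le> s" "s \<le> t" "t \<le> b" for s t
  proof -
    have w': "w absolutely_integrable_on {s..t}"
      using w st by (meson absolutely_integrable_on_subinterval atLeastatMost_subset_iff)
    have "\<bar>v n t - v n s\<bar> = norm (integral {s..t} w)" using assms(1) st by (simp add: deriv_chain_def)
    also have "\<dots> \<le> integral {s..t} (\<lambda>t. \<bar>w t\<bar>)"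
      using w' by (intro integral_norm_bound_integral) (auto simp: absolutely_integrable_on_def)
    also have "\<dots> \<le> integral {a..b} (\<lambda>t. \<bar>w t\<bar>)"
      using w w' st by (intro integral_subset_le) (auto simp: absolutely_integrable_on_def)
    finally show ?thesis .
  qed
  from this[of s t] this[of t s] assms show ?thesis by (cases "s \<le> t") auto
qed

text \<open>Downward induction on \<open>m\<close>, each time from a point where \<open>v m\<close>
  is small. At the top the deviation from that value is at most the integral of \<open>|w|\<close>;
  below, it is at most the length of the interval times the bound already found for order
  \<open>m + 1\<close>. The constant is the same for all intervals, which the later choice of their
  lengths relies on.\<close>

lemma deriv_chain_sup:
  assumes "m \<le> n"
  shows "\<exists>C>0. \<forall>v w a b t. deriv_chain n v w a b \<longrightarrow> a < b \<longrightarrow> t \<in> {a..b} \<longrightarrow>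
     \<bar>v m t\<bar> \<le> C * (integral {a..b} (\<lambda>t. \<bar>v 0 t\<bar>) / (b - a) ^ Suc m + (b - a) ^ (n - m) * integral {a..b} (\<lambda>t. \<bar>w t\<bar>))"
  using assms
proof (induction m rule: inc_induct)
  case base
  obtain C where C: "C > 0" "\<And>v w a b. deriv_chain n v w a b \<Longrightarrow> a < b \<Longrightarrow>
     \<exists>s\<in>{a..b}. \<bar>v n s\<bar> * (b - a) ^ Suc n \<le> C * integral {a..b} (\<lambda>t. \<bar>v 0 t\<bar>)"
    using deriv_chain_small_point[of n] by blast
  have "\<bar>v n t\<bar> \<le> (C + 1) * (integral {a..b} (\<lambda>t. \<bar>v 0 t\<bar>) / (b - a) ^ Suc n + integral {a..b} (\<lambda>t. \<bar>w t\<bar>))"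
    if c: "deriv_chain n v w a b" and ab: "a < b" and t: "t \<in> {a..b}" for v w a b t
  proof -
    obtain s where s: "s\<in>{a..b}" "\<bar>v n s\<bar> * (b - a) ^ Suc n \<le> C * integral {a..b} (\<lambda>t. \<bar>v 0 t\<bar>)"
      using C(2)[OF c ab] by blast
    have "\<bar>v n s\<bar> \<le> C * (integral {a..b} (\<lambda>t. \<bar>v 0 t\<bar>) / (b - a) ^ Suc n)"
      using s(2) ab by (simp add: pos_le_divide_eq del: power_Suc)
    moreover have "\<bar>v n t\<bar> \<le> \<bar>v n s\<bar> + integral {a..b} (\<lambda>t. \<bar>w t\<bar>)"
      using deriv_chain_sup_top[OF c s(1) t] by linarith
    moreover have nonneg: "0 \<le> integral {a..b} (\<lambda>t. \<bar>v 0 t\<bar>) / (b - a) ^ Suc n" "0 \<le> integral {a..b} (\<lambda>t. \<bar>w t\<bar>)"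
      using ab by (auto intro!: divide_nonneg_nonneg integral_abs_nonneg)
    moreover have "0 \<le> C * integral {a..b} (\<lambda>t. \<bar>w t\<bar>)" using C(1) nonneg by simp
    ultimately show ?thesis unfolding distrib_right distrib_left by linarith
  qed
  then show ?case using C(1) by (intro exI[of _ "C + 1"]) auto
next
  case (step m)
  obtain C where C: "C > 0" "\<And>v w a b. deriv_chain n v w a b \<Longrightarrow> a < b \<Longrightarrow>
     \<exists>s\<in>{a..b}. \<bar>v m s\<bar> * (b - a) ^ Suc m \<le> C * integral {a..b} (\<lambda>t. \<bar>v 0 t\<bar>)"
    using deriv_chain_small_point[of m] step(2) by (meson order_less_imp_le)
  obtain C' where C': "C' > 0" "\<And>v w a b t. deriv_chain n v w a b \<Longrightarrow> a < b \<Longrightarrow> t \<in> {a..b} \<Longrightarrow>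
     \<bar>v (Suc m) t\<bar> \<le> C' * (integral {a..b} (\<lambda>t. \<bar>v 0 t\<bar>) / (b - a) ^ Suc (Suc m) + (b - a) ^ (n - Suc m) * integral {a..b} (\<lambda>t. \<bar>w t\<bar>))"
    using step(3) by blast
  have "\<bar>v m t\<bar> \<le> (C + C') * (integral {a..b} (\<lambda>t. \<bar>v 0 t\<bar>) / (b - a) ^ Suc m + (b - a) ^ (n - m) * integral {a..b} (\<lambda>t. \<bar>w t\<bar>))"
    if c: "deriv_chain n v w a b" and ab: "a < b" and t: "t \<in> {a..b}" for v w a b t
  proof -
    define A where "A = integral {a..b} (\<lambda>t. \<bar>v 0 t\<bar>)"
    define B where "B = integral {a..b} (\<lambda>t. \<bar>w t\<bar>)"
    define l where "l = b - a"
    have l: "0 < l" using ab by (simp add: l_def)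
    have AB: "0 \<le> A" "0 \<le> B" by (auto simp: A_def B_def intro!: integral_abs_nonneg)
    obtain s where s: "s\<in>{a..b}" "\<bar>v m s\<bar> * l ^ Suc m \<le> C * A"
      using C(2)[OF c ab] by (auto simp: A_def l_def)
    have vs: "\<bar>v m s\<bar> \<le> C * (A / l ^ Suc m)"
      using s(2) l by (simp add: pos_le_divide_eq del: power_Suc)
    define M where "M = C' * (A / l ^ Suc (Suc m) + l ^ (n - Suc m) * B)"
    have "norm (v m t - v m s) \<le> M * norm (t - s)"
    proof (rule field_differentiable_bound[where S="{a..b}"])
      show "(v m has_field_derivative v (Suc m) z) (at z within {a..b})" if "z \<in> {a..b}" for z
        using c step(2) that by (auto simp: deriv_chain_def)
      show "norm (v (Suc m) z) \<le> M" if "z \<in> {a..b}" for z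
        using C'(2)[OF c ab that] by (simp add: M_def A_def B_def l_def)
    qed (use s t in auto)
    also have "\<dots> \<le> M * l"
      using s t l AB C'(1) by (intro mult_left_mono) (auto simp: l_def M_def)
    also have "M * l = C' * (A / l ^ Suc m + l ^ (n - m) * B)"
    proof -
      have "l ^ (n - m) = l ^ (n - Suc m) * l" using step(2) by (metis Suc_diff_Suc power_Suc2)
      then show ?thesis using l by (simp add: M_def algebra_simps)
    qed
    finally have "\<bar>v m t\<bar> \<le> C * (A / l ^ Suc m) + C' * (A / l ^ Suc m + l ^ (n - m) * B)"
      using vs by simp
    also have "\<dots> \<le> (C + C') * (A / l ^ Suc m + l ^ (n - m) * B)"
    proof -
      have "0 \<le> C * (l ^ (n - m) * B)" using C(1) l AB by simp
      then show ?thesis unfolding distrib_right distrib_left by linarith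
    qed
    finally show ?thesis by (simp add: A_def B_def l_def)
  qed
  then show ?case using C(1) C'(1) by (intro exI[of _ "C + C'"]) auto
qed

text \<open>From the left, intervals with
  \<open>(b - a) powr (N - 1) * integral {a..b} \<zeta> = 1\<close> are cut off one after another;
  as they do not overlap, they contribute at most \<open>D\<close> times the total integral of
  \<open>\<zeta>\<close>. A remainder too short for this is covered by a balanced interval ending at
  \<open>L\<close>, which overlaps earlier ones, or by all of \<open>{0..L}\<close>, at the cost of
  a second copy of the total.\<close>

lemma greedy_intervals:
  fixes N L D :: real and \<zeta> g :: "real \<Rightarrow> real"
  assumes N: "1 < N" and L: "0 < L"
    and z: "\<zeta> integrable_on {0..L}" "\<And>t. 1 \<le> \<zeta> t"
    and g: "g integrable_on {0..L}" "\<And>t. 0 \<le> g t" and D: "0 \<le> D"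
    and le: "\<And>a b. 0 \<le> a \<Longrightarrow> a < b \<Longrightarrow> b \<le> L \<Longrightarrow>
        (b - a) powr (N - 1) * integral {a..b} \<zeta> \<le> 1 \<Longrightarrow>
        (b - a) powr (N - 1) * integral {a..b} \<zeta> = 1 \<or> a = 0 \<and> b = L \<Longrightarrow>
        integral {a..b} g \<le> D * integral {a..b} \<zeta>"
  shows "integral {0..L} g \<le> 2 * D * integral {0..L} \<zeta>"
proof -
  define Z where "Z a b = integral {a..b} \<zeta>" for a b
  define h where "h a b = (b - a) powr (N - 1) * Z a b" for a b
  have zi: "\<zeta> integrable_on {a..b}" if "0 \<le> a" "b \<le> L" for a b
    using z(1) that by (auto intro: integrable_subinterval_real)
  have gi: "g integrable_on {a..b}" if "0 \<le> a" "b \<le> L" for a b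
    using g(1) that by (auto intro: integrable_subinterval_real)
  have Zge: "b - a \<le> Z a b" if "0 \<le> a" "a \<le> b" "b \<le> L" for a b
  proof -
    have "integral {a..b} (\<lambda>t. 1) \<le> Z a b"
      unfolding Z_def using zi that z(2) by (intro integral_le) auto
    then show ?thesis using that by simp
  qed
  have Zmono: "Z a b \<le> Z 0 L" if "0 \<le> a" "b \<le> L" for a b
    unfolding Z_def using that zi z(2) order_trans[OF zero_le_one]
    by (intro integral_subset_le) auto
  have gmono: "integral {a..b} g \<le> integral {a'..b} g" if "0 \<le> a'" "a' \<le> a" "b \<le> L" for a a' b
    using that gi g(2) by (intro integral_subset_le) auto
  have Zadd: "Z a c = Z a b + Z b c" if "0 \<le> a" "a \<le> b" "b \<le> c" "c \<le> L" for a b c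
    unfolding Z_def using Henstock_Kurzweil_Integration.integral_combine[OF that(2,3) zi] that by simp
  have contb: "continuous_on {a..L} (h a)" if "0 \<le> a" for a
    unfolding h_def Z_def using N zi that
    by (intro continuous_intros continuous_on_powr' indefinite_integral_continuous_1) auto
  have conta: "continuous_on {0..L} (\<lambda>a. h a L)"
    unfolding h_def Z_def using N zi
    by (intro continuous_intros continuous_on_powr' indefinite_integral_continuous_1') auto
  \<comment> \<open>\<open>n\<close> bounds the number of intervals that can still be cut off, since
    each uses up at least \<open>L powr (1 - N)\<close> of the integral of \<open>\<zeta>\<close>.
    The summand \<open>D * Z 0 L\<close> is reserved for the last, overlapping interval.\<close>
  have key: "integral {a..L} g \<le> D * Z a L + D * Z 0 L"
    if "0 \<le> a" "a \<le> L" "Z a L \<le> real n * L powr (1 - N)" for a n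
    using that
  proof (induction n arbitrary: a)
    case 0
    then have "a = L" using Zge[of a L] by auto
    then show ?case using D Zge[of 0 L] Zge[of L L] L by simp
  next
    case (Suc n)
    show ?case
    proof (cases "h a L \<ge> 1")
      case True
      have "h a a = 0" by (simp add: h_def Z_def)
      then obtain b where b: "a \<le> b" "b \<le> L" "h a b = 1"
        using IVT'[of "h a" a 1 L] True contb Suc.prems by auto
      have ab: "a < b" using b \<open>h a a = 0\<close> by (cases "a = b") auto
      have Zab: "Z a b = (b - a) powr (1 - N)"
        using b(3) ab by (simp add: h_def powr_diff divide_simps mult.commute)
      have "L powr (1 - N) \<le> Z a b"
        unfolding Zab using ab b Suc.prems N by (intro powr_mono2') auto
      then have "Z b L \<le> real n * L powr (1 - N)"
        using Zadd[of a b L] Suc.prems ab b by (simp add: algebra_simps)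
      then have "integral {b..L} g \<le> D * Z b L + D * Z 0 L"
        using Suc.IH[of b] b Suc.prems ab by simp
      moreover have "integral {a..b} g \<le> D * Z a b"
        using le[of a b] b ab Suc.prems by (simp add: h_def Z_def)
      moreover have "integral {a..L} g = integral {a..b} g + integral {b..L} g"
        using Henstock_Kurzweil_Integration.integral_combine[OF b(1,2) gi] Suc.prems by simp
      ultimately show ?thesis using Zadd[of a b L] b Suc.prems by (simp add: algebra_simps)
    next
      case False
      have nonneg: "0 \<le> D * Z a L" "0 \<le> D * Z 0 L"
        using D Zge[of a L] Zge[of 0 L] Suc.prems L by auto
      have "integral {a..L} g \<le> D * Z 0 L"
      proof (cases "h 0 L \<le> 1")
        case True
        then have "integral {0..L} g \<le> D * Z 0 L"
          using le[of 0 L] L by (simp add: h_def Z_def)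
        then show ?thesis using gmono[of 0 a L] Suc.prems by simp
      next
        case F: False
        \<comment> \<open>With the right end fixed at \<open>L\<close>, the quantity is below 1 for
          the left end \<open>a\<close> and above 1 for the left end 0.\<close>
        then obtain c where c: "0 \<le> c" "c \<le> a" "h c L = 1"
          using IVT2'[of "\<lambda>a. h a L" a 1 0] False Suc.prems continuous_on_subset[OF conta] by auto
        have "c < L" using c Suc.prems by (cases "c = L") (auto simp: h_def)
        then have "integral {c..L} g \<le> D * Z c L"
          using le[of c L] c by (simp add: h_def Z_def)
        also have "\<dots> \<le> D * Z 0 L" using Zmono[of c L] D c by (intro mult_left_mono) auto
        finally show ?thesis using gmono[of c a L] c by simp
      qed
      then show ?thesis using nonneg by simp
    qed
  qed
  obtain n :: nat where "Z 0 L / L powr (1 - N) \<le> real n" using real_arch_simple by blast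
  then have "Z 0 L \<le> real n * L powr (1 - N)" using L by (simp add: pos_divide_le_eq)
  from key[OF _ _ this] L show ?thesis by (simp add: Z_def)
qed

text \<open>Jensen's inequality for a concave power: \<open>pt\<close> compares the power with its
  tangent line at the mean \<open>m\<close>, by Young's inequality, and integrating the tangent line
  gives the power of the mean.\<close>

lemma integral_powr_le:
  fixes \<zeta> :: "real \<Rightarrow> real"
  assumes ab: "a < b" and al: "0 \<le> \<alpha>" "\<alpha> \<le> 1"
    and z: "\<zeta> integrable_on {a..b}" "\<And>t. 1 \<le> \<zeta> t" "(\<lambda>t. \<zeta> t powr \<alpha>) integrable_on {a..b}"
  shows "integral {a..b} (\<lambda>t. \<zeta> t powr \<alpha>) \<le> (b - a) * (integral {a..b} \<zeta> / (b - a)) powr \<alpha>"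
proof -
  define m where "m = integral {a..b} \<zeta> / (b - a)"
  have "integral {a..b} (\<lambda>t. 1) \<le> integral {a..b} \<zeta>"
    using z by (intro integral_le) auto
  then have m: "1 \<le> m" using ab by (simp add: m_def)
  have pt: "\<zeta> t powr \<alpha> \<le> \<alpha> * m powr (\<alpha> - 1) * \<zeta> t + (1 - \<alpha>) * m powr \<alpha>" for t
  proof -
    have "\<zeta> t powr \<alpha> * m powr (1 - \<alpha>) \<le> \<alpha> * \<zeta> t + (1 - \<alpha>) * m"
      using Youngs_inequality_0[of \<alpha> "1 - \<alpha>" "\<zeta> t" m] al m z(2)[of t] by simp
    then have "\<zeta> t powr \<alpha> * m powr (1 - \<alpha>) * m powr (\<alpha> - 1) \<le> (\<alpha> * \<zeta> t + (1 - \<alpha>) * m) * m powr (\<alpha> - 1)"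
      by (intro mult_right_mono) auto
    moreover have "m powr (1 - \<alpha>) * m powr (\<alpha> - 1) = 1" using m by (simp add: powr_add[symmetric])
    moreover have "m * m powr (\<alpha> - 1) = m powr \<alpha>" using m by (simp add: powr_mult_base)
    ultimately show ?thesis by (simp add: algebra_simps)
  qed
  have "integral {a..b} (\<lambda>t. \<zeta> t powr \<alpha>) \<le> integral {a..b} (\<lambda>t. \<alpha> * m powr (\<alpha> - 1) * \<zeta> t + (1 - \<alpha>) * m powr \<alpha>)"
    using z pt by (intro integral_le integrable_add integrable_on_mult_right) auto
  also have "\<dots> = \<alpha> * m powr (\<alpha> - 1) * integral {a..b} \<zeta> + (b - a) * ((1 - \<alpha>) * m powr \<alpha>)"
    using z ab by (subst Henstock_Kurzweil_Integration.integral_add) (auto intro: integrable_on_mult_right)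
  also have "integral {a..b} \<zeta> = (b - a) * m" using ab by (simp add: m_def)
  also have "\<alpha> * m powr (\<alpha> - 1) * ((b - a) * m) = (b - a) * (\<alpha> * m powr \<alpha>)"
    using m powr_mult_base[of m "\<alpha> - 1"] by (simp add: mult_ac)
  finally show ?thesis by (simp add: m_def algebra_simps)
qed

text \<open>On an interval of length \<open>l\<close> with
  \<open>l powr N * (mean of \<zeta>) = 1\<close> the two terms of \<open>deriv_chain_sup\<close> balance.\<close>

lemma gagliardo_nirenberg_line:
  fixes p L K :: real
  assumes p: "1 \<le> p" and L: "0 < L" and K: "0 \<le> K" and n: "1 \<le> n" and k: "k = j + Suc n"
  defines "N \<equiv> real k * p"
  shows "\<exists>D\<ge>0. \<forall>v w \<zeta> S. deriv_chain n v w 0 L \<longrightarrow> \<zeta> \<in> borel_measurable borel \<longrightarrow>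
     \<zeta> integrable_on {0..L} \<longrightarrow> (\<forall>t. 1 \<le> \<zeta> t) \<longrightarrow> negligible S \<longrightarrow>
     (\<forall>t\<in>{0..L} - S. \<bar>v 0 t\<bar> \<le> K * \<zeta> t powr (real j / N)) \<longrightarrow>
     (\<forall>t\<in>{0..L}. \<bar>w t\<bar> \<le> \<zeta> t powr (real k / N)) \<longrightarrow>
     integral {0..L} (\<lambda>t. \<bar>v 1 t\<bar> powr (N / real (Suc j))) \<le> D * integral {0..L} \<zeta>"
proof -
  obtain C where C0: "C > 0" "\<forall>v w a b t. deriv_chain n v w a b \<longrightarrow> a < b \<longrightarrow> t \<in> {a..b} \<longrightarrow>
     \<bar>v 1 t\<bar> \<le> C * (integral {a..b} (\<lambda>t. \<bar>v 0 t\<bar>) / (b - a) ^ Suc 1 + (b - a) ^ (n - 1) * integral {a..b} (\<lambda>t. \<bar>w t\<bar>))"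
    using deriv_chain_sup[OF n] by blast
  have C: "\<bar>v 1 t\<bar> \<le> C * (integral {a..b} (\<lambda>t. \<bar>v 0 t\<bar>) / (b - a) ^ 2 + (b - a) ^ (n - 1) * integral {a..b} (\<lambda>t. \<bar>w t\<bar>))"
    if "deriv_chain n v w a b" "a < b" "t \<in> {a..b}" for v w a b t
    using C0(2)[rule_format, OF that] by (simp add: power2_eq_square)
  have kN: "2 \<le> real k" using n k by simp
  then have N: "2 \<le> N" "real k \<le> N" using p unfolding N_def
    by (auto intro: order_trans[OF _ mult_mono[of 2 "real k" 1 p]] mult_left_mono[of 1 p "real k", simplified])
  have jN: "0 \<le> real j / N" "real j / N \<le> 1" "0 \<le> real k / N" "real k / N \<le> 1"
    using N k by (auto simp: divide_le_eq)
  define r where "r = N / real (Suc j)"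
  have r: "0 < r" using N by (simp add: r_def)
  define M where "M = C * (K + 1)"
  have M: "0 < M" using C0(1) K by (simp add: M_def)
  \<comment> \<open>On a balanced interval \<open>l * l powr (- N)\<close> equals the integral of
    \<open>\<zeta>\<close>. On the whole interval it is at most \<open>L powr (- N)\<close> times
    that integral, because \<open>\<zeta> \<ge> 1\<close>. The maximum covers both cases.\<close>
  define D where "D = M powr r * max 1 (L powr (- N))"
  have D: "0 \<le> D" by (simp add: D_def)
  have "integral {0..L} (\<lambda>t. \<bar>v 1 t\<bar> powr r) \<le> 2 * D * integral {0..L} \<zeta>"
    if ch: "deriv_chain n v w 0 L" and zm: "\<zeta> \<in> borel_measurable borel" and zi: "\<zeta> integrable_on {0..L}"
      and z1: "\<And>t. 1 \<le> \<zeta> t" and S: "negligible S"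
      and v0: "\<And>t. t \<in> {0..L} - S \<Longrightarrow> \<bar>v 0 t\<bar> \<le> K * \<zeta> t powr (real j / N)"
      and w: "\<And>t. t \<in> {0..L} \<Longrightarrow> \<bar>w t\<bar> \<le> \<zeta> t powr (real k / N)"
    for v w \<zeta> S
  proof (rule greedy_intervals[OF _ L zi z1 _ _ D])
    have cont1: "continuous_on {0..L} (\<lambda>t. \<bar>v 1 t\<bar> powr r)"
      using deriv_chain_continuous[OF ch n] r by (intro continuous_on_powr' continuous_intros) auto
    then show "(\<lambda>t. \<bar>v 1 t\<bar> powr r) integrable_on {0..L}" by (rule integrable_continuous_real)
    fix a b assume ab: "0 \<le> a" "a < b" "b \<le> L"
      and h: "(b - a) powr (N - 1) * integral {a..b} \<zeta> \<le> 1"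
      and or: "(b - a) powr (N - 1) * integral {a..b} \<zeta> = 1 \<or> a = 0 \<and> b = L"
    define l where "l = b - a"
    have l: "0 < l" using ab by (simp add: l_def)
    have zi': "\<zeta> integrable_on {a..b}" using zi ab by (auto intro: integrable_subinterval_real)
    have pi: "(\<lambda>t. \<zeta> t powr \<alpha>) integrable_on {a..b}" if "0 \<le> \<alpha>" "\<alpha> \<le> 1" for \<alpha>
    proof (rule measurable_bounded_by_integrable_imp_integrable[where g=\<zeta>])
      show "(\<lambda>t. \<zeta> t powr \<alpha>) \<in> borel_measurable (lebesgue_on {a..b})"
        using zm by (intro measurable_restrict_space1 measurable_completion) measurable
      show "norm (\<zeta> t powr \<alpha>) \<le> \<zeta> t" for t
        using z1[of t] that powr_mono[of \<alpha> 1 "\<zeta> t"] by simp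
    qed (use zi' in auto)
    define Zl where "Zl = integral {a..b} \<zeta> / l"
    have "integral {a..b} (\<lambda>t. 1) \<le> integral {a..b} \<zeta>"
      using zi' z1 by (intro integral_le) auto
    then have Zge: "l \<le> integral {a..b} \<zeta>" using ab by (simp add: l_def)
    then have Zl: "1 \<le> Zl" using l by (simp add: Zl_def)
    have "l powr N * Zl = l powr (N - 1) * integral {a..b} \<zeta>"
      using l by (simp add: Zl_def powr_diff divide_simps)
    then have "l powr N * Zl \<le> 1" using h by (simp add: l_def)
    then have Zle: "Zl \<le> l powr (- N)" using l by (simp add: powr_minus divide_simps mult.commute)
    \<comment> \<open>The inequality \<open>l powr N * Zl \<le> 1\<close> bounds the powers of the
      mean of \<open>\<zeta>\<close> by powers of \<open>1 / l\<close>: order \<open>i\<close> of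
      differentiation costs \<open>l\<close> to the power \<open>-i\<close>.\<close>
    have Zp: "Zl powr (real i / N) \<le> 1 / l ^ i" for i
    proof -
      have "Zl powr (real i / N) \<le> (l powr (- N)) powr (real i / N)"
        using Zl Zle N by (intro powr_mono2) auto
      also have "\<dots> = l powr (- real i)" using N by (simp add: powr_powr)
      also have "\<dots> = 1 / l ^ i" using l by (simp add: powr_minus powr_realpow divide_simps)
      finally show ?thesis .
    qed
    have ch': "deriv_chain n v w a b" using deriv_chain_subinterval[OF ch] ab by simp
    have v0i: "(\<lambda>t. \<bar>v 0 t\<bar>) integrable_on {a..b}"
      using deriv_chain_continuous[OF ch', of 0] by (intro integrable_continuous_real continuous_intros) auto
    have A: "integral {a..b} (\<lambda>t. \<bar>v 0 t\<bar>) \<le> K * (l * (1 / l ^ j))"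
    proof -
      have "integral {a..b} (\<lambda>t. \<bar>v 0 t\<bar>) = integral {a..b} (\<lambda>t. if t \<in> S then 0 else \<bar>v 0 t\<bar>)"
        by (rule integral_spike[OF S]) auto
      also have "\<dots> \<le> integral {a..b} (\<lambda>t. K * \<zeta> t powr (real j / N))"
      proof (rule integral_le)
        show "(\<lambda>t. if t \<in> S then 0 else \<bar>v 0 t\<bar>) integrable_on {a..b}"
          by (rule integrable_spike[OF v0i S]) auto
        show "(if t \<in> S then 0 else \<bar>v 0 t\<bar>) \<le> K * \<zeta> t powr (real j / N)" if "t \<in> {a..b}" for t
          using v0[of t] that ab K by auto
      qed (use pi[OF jN(1,2)] in \<open>auto intro: integrable_on_mult_right\<close>)
      also have "\<dots> = K * integral {a..b} (\<lambda>t. \<zeta> t powr (real j / N))" by simp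
      also have "\<dots> \<le> K * (l * Zl powr (real j / N))"
        using integral_powr_le[OF ab(2) jN(1,2) zi' z1 pi[OF jN(1,2)]] K
        by (intro mult_left_mono) (auto simp: l_def Zl_def)
      also have "\<dots> \<le> K * (l * (1 / l ^ j))"
        using Zp[of j] K l by (intro mult_left_mono) auto
      finally show ?thesis .
    qed
    have B: "integral {a..b} (\<lambda>t. \<bar>w t\<bar>) \<le> l * (1 / l ^ k)"
    proof -
      have "integral {a..b} (\<lambda>t. \<bar>w t\<bar>) \<le> integral {a..b} (\<lambda>t. \<zeta> t powr (real k / N))"
        using ch' w ab pi[OF jN(3,4)]
        by (intro integral_le) (auto simp: deriv_chain_def absolutely_integrable_on_def)
      also have "\<dots> \<le> l * Zl powr (real k / N)"
        using integral_powr_le[OF ab(2) jN(3,4) zi' z1 pi[OF jN(3,4)]] by (simp add: l_def Zl_def)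
      also have "\<dots> \<le> l * (1 / l ^ k)"
        using Zp[of k] l by (intro mult_left_mono) auto
      finally show ?thesis .
    qed
    \<comment> \<open>Both terms of the interpolation bound have become multiples of
      \<open>1 / l ^ Suc j\<close>: the first through one factor \<open>l\<close> from the integral,
      \<open>1 / l ^ j\<close> from the bound on \<open>v 0\<close> and \<open>1 / l ^ 2\<close>,
      the second through \<open>k = j + Suc n\<close>.\<close>
    have sup: "\<bar>v 1 t\<bar> \<le> M / l ^ Suc j" if "t \<in> {a..b}" for t
    proof -
      have "\<bar>v 1 t\<bar> \<le> C * (integral {a..b} (\<lambda>t. \<bar>v 0 t\<bar>) / l ^ 2 + l ^ (n - 1) * integral {a..b} (\<lambda>t. \<bar>w t\<bar>))"
        using C[OF ch' ab(2) that] by (simp add: l_def)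
      also have "\<dots> \<le> C * (K * (l * (1 / l ^ j)) / l ^ 2 + l ^ (n - 1) * (l * (1 / l ^ k)))"
        using A B C0(1) l by (intro mult_left_mono add_mono divide_right_mono) auto
      also have "l ^ (n - 1) * (l * (1 / l ^ k)) = 1 / l ^ Suc j"
      proof -
        have "l ^ k = l ^ (n - 1) * l * l ^ Suc j"
          unfolding k using n by (simp add: power_add[symmetric] flip: power_Suc2) (simp add: add.commute)
        then show ?thesis using l by (simp add: divide_simps)
      qed
      also have "K * (l * (1 / l ^ j)) / l ^ 2 = K / l ^ Suc j"
        using l by (simp add: field_simps power2_eq_square)
      finally show ?thesis by (simp add: M_def add_divide_distrib[symmetric])
    qed
    \<comment> \<open>The exponent \<open>r\<close> is chosen so that this bound, raised to it,
      becomes a multiple of \<open>l powr (- N)\<close> for every \<open>j\<close>.\<close>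
    have pow: "(M / l ^ Suc j) powr r = M powr r * l powr (- N)"
    proof -
      have "(M / l ^ Suc j) powr r = M powr r * (l powr (- real (Suc j))) powr r"
        using M l by (simp add: powr_minus powr_realpow powr_mult divide_inverse del: power_Suc of_nat_Suc)
      also have "(l powr (- real (Suc j))) powr r = l powr (- N)"
        by (simp add: powr_powr r_def del: of_nat_Suc)
      finally show ?thesis .
    qed
    have "integral {a..b} (\<lambda>t. \<bar>v 1 t\<bar> powr r) \<le> integral {a..b} (\<lambda>t. M powr r * l powr (- N))"
    proof (rule integral_le)
      show "(\<lambda>t. \<bar>v 1 t\<bar> powr r) integrable_on {a..b}"
        using cont1 ab by (intro integrable_continuous_real) (auto intro: continuous_on_subset)
      show "\<bar>v 1 t\<bar> powr r \<le> M powr r * l powr (- N)" if "t \<in> {a..b}" for t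
        using sup[OF that] r unfolding pow[symmetric] by (intro powr_mono2) auto
    qed auto
    also have "\<dots> = M powr r * (l * l powr (- N))" using ab by (simp add: l_def)
    also have "\<dots> \<le> M powr r * (max 1 (L powr (- N)) * integral {a..b} \<zeta>)"
    proof (intro mult_left_mono)
      show "l * l powr (- N) \<le> max 1 (L powr (- N)) * integral {a..b} \<zeta>"
        using or
      proof
        assume "(b - a) powr (N - 1) * integral {a..b} \<zeta> = 1"
        then have "integral {a..b} \<zeta> = l * l powr (- N)"
          using l by (simp add: l_def[symmetric] powr_diff powr_minus divide_simps mult.commute)
        moreover have "1 * integral {a..b} \<zeta> \<le> max 1 (L powr (- N)) * integral {a..b} \<zeta>"
          using Zge l by (intro mult_right_mono) auto
        ultimately show ?thesis by simp
      next
        assume "a = 0 \<and> b = L"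
        then have "l = L" by (simp add: l_def)
        then show ?thesis using Zge l
          by (subst mult.commute) (intro mult_mono, auto)
      qed
    qed auto
    finally show "integral {a..b} (\<lambda>t. \<bar>v 1 t\<bar> powr r) \<le> D * integral {a..b} \<zeta>"
      by (simp add: D_def mult.assoc)
  qed (use N in auto)
  note main = this[unfolded r_def]
  show ?thesis
  proof (intro exI[of _ "2 * D"] conjI allI impI)
    show "0 \<le> 2 * D" using D by simp
    fix v w \<zeta> S
    assume "deriv_chain n v w 0 L" "\<zeta> \<in> borel_measurable borel" "\<zeta> integrable_on {0..L}"
      "\<forall>t. 1 \<le> \<zeta> t" "negligible S"
      "\<forall>t\<in>{0..L} - S. \<bar>v 0 t\<bar> \<le> K * \<zeta> t powr (real j / N)"
      "\<forall>t\<in>{0..L}. \<bar>w t\<bar> \<le> \<zeta> t powr (real k / N)"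
    then show "integral {0..L} (\<lambda>t. \<bar>v 1 t\<bar> powr (N / real (Suc j))) \<le> 2 * D * integral {0..L} \<zeta>"
      by (intro main[of v w \<zeta> S]) auto
  qed
qed

section \<open>Smooth functions and test functions\<close>

definition smooth_on :: "'a::euclidean_space set \<Rightarrow> ('a \<Rightarrow> 'c::euclidean_space) \<Rightarrow> bool" where
  "smooth_on X g \<longleftrightarrow> (\<forall>k. holder_Ck_on k 0 X g)"

lemma full_domain_UNIV [simp]: "full_domain UNIV"
  by (rule full_domain_open) simp

lemma smooth_on_const: "smooth_on X (\<lambda>x. c)"
  by (simp add: smooth_on_def holder_Ck_on_const)

lemma smooth_on_linear: "bounded_linear L \<Longrightarrow> smooth_on X g \<Longrightarrow> smooth_on X (\<lambda>x. L (g x))"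
  by (simp add: smooth_on_def holder_Ck_on_linear)

lemma smooth_on_id: "smooth_on X (\<lambda>x. x)"
  unfolding smooth_on_def
proof
  fix k
  have "\<forall>x\<in>X. ((\<lambda>x. x) has_derivative (\<lambda>v. v)) (at x within X)"
    "\<forall>j v. holder_Ck_on j 0 X (\<lambda>x::'a. v::'a)" by (auto intro: holder_Ck_on_const)
  then have "holder_Ck_on (Suc j) 0 X (\<lambda>x. x)" for j
    unfolding holder_Ck_on.simps by (intro exI[of _ "\<lambda>x v. v"]) blast
  moreover have "holder_Ck_on 0 0 X (\<lambda>x. x)" by (simp add: locally_holder_on_continuous)
  ultimately show "holder_Ck_on k 0 X (\<lambda>x. x)" by (cases k) auto
qed

lemma smooth_on_add: "smooth_on X g \<Longrightarrow> smooth_on X h \<Longrightarrow> smooth_on X (\<lambda>x. g x + h x)"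
  by (simp add: smooth_on_def holder_Ck_on_add)

lemma smooth_on_sum:
  "finite I \<Longrightarrow> (\<And>i. i \<in> I \<Longrightarrow> smooth_on X (g i)) \<Longrightarrow> smooth_on X (\<lambda>x. \<Sum>i\<in>I. g i x)"
  by (simp add: smooth_on_def holder_Ck_on_sum)

lemma smooth_on_uminus: "smooth_on X g \<Longrightarrow> smooth_on X (\<lambda>x. - g x)"
  by (rule smooth_on_linear[OF bounded_linear_minus[OF bounded_linear_ident]])

lemma smooth_on_diff: "smooth_on X g \<Longrightarrow> smooth_on X h \<Longrightarrow> smooth_on X (\<lambda>x. g x - h x)"
  using smooth_on_add[of X g "\<lambda>x. - h x"] by (simp add: smooth_on_uminus)

lemma smooth_on_scaleR:
  "full_domain X \<Longrightarrow> smooth_on X s \<Longrightarrow> smooth_on X g \<Longrightarrow> smooth_on X (\<lambda>x. s x *\<^sub>R g x)"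
  by (simp add: smooth_on_def holder_Ck_on_scaleR)

lemma smooth_on_mult:
  fixes g h :: "'a::euclidean_space \<Rightarrow> real"
  shows "full_domain X \<Longrightarrow> smooth_on X g \<Longrightarrow> smooth_on X h \<Longrightarrow> smooth_on X (\<lambda>x. g x * h x)"
  using smooth_on_scaleR[of X g h] by simp

lemma smooth_on_prod:
  fixes g :: "'i \<Rightarrow> 'a::euclidean_space \<Rightarrow> real"
  assumes "full_domain X" "finite I" "\<And>i. i \<in> I \<Longrightarrow> smooth_on X (g i)"
  shows "smooth_on X (\<lambda>x. \<Prod>i\<in>I. g i x)"
  using assms(2,3) by (induction I) (auto intro: smooth_on_mult[OF assms(1)] smooth_on_const)

lemma smooth_on_compose:
  "full_domain X \<Longrightarrow> smooth_on X T \<Longrightarrow> T ` X \<subseteq> Y \<Longrightarrow> smooth_on Y \<sigma> \<Longrightarrow> smooth_on X (\<lambda>x. \<sigma> (T x))"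
  using smooth_comp unfolding smooth_on_def by blast

lemma smooth_on_subset: "smooth_on X g \<Longrightarrow> Y \<subseteq> X \<Longrightarrow> smooth_on Y g"
  using holder_Ck_on_subset unfolding smooth_on_def by blast

lemma smooth_on_cong: "(\<And>x. x \<in> X \<Longrightarrow> g x = h x) \<Longrightarrow> smooth_on X g \<longleftrightarrow> smooth_on X h"
  using holder_Ck_on_cong unfolding smooth_on_def by blast

lemma smooth_on_inner: "smooth_on X g \<Longrightarrow> smooth_on X (\<lambda>x. g x \<bullet> b)"
  by (rule smooth_on_linear[OF bounded_linear_inner_left])

lemma smooth_on_continuous: "smooth_on X g \<Longrightarrow> continuous_on X g"
  unfolding smooth_on_def using holder_Ck_on_continuous by blast

lemma smooth_on_local:
  assumes "full_domain X" "\<And>x. x \<in> X \<Longrightarrow> \<exists>e>0. smooth_on (X \<inter> ball x e) g"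
  shows "smooth_on X g"
  using assms holder_Ck_on_local[OF assms(1)] unfolding smooth_on_def by meson

lemma smooth_on_derivative:
  assumes "full_domain X" "smooth_on X g"
  shows "x \<in> X \<Longrightarrow> (g has_derivative frechet_derivative g (at x within X)) (at x within X)"
    and "smooth_on X (\<lambda>x. frechet_derivative g (at x within X) v)"
  using holder_derivative[OF assms(1)] assms(2) unfolding smooth_on_def by blast+

section \<open>A smooth plateau from exp(-1/t)\<close>

definition flat_exp :: "nat \<Rightarrow> real \<Rightarrow> real" where
  "flat_exp m t = (if t \<le> 0 then 0 else exp (- inverse t) * inverse t ^ m)"

lemma flat_exp_lim: "(flat_exp m \<longlongrightarrow> 0) (at 0)"
proof (rule filterlim_split_at)
  show "(flat_exp m \<longlongrightarrow> 0) (at_left 0)"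
  proof (rule Lim_transform_eventually[OF tendsto_const])
    show "\<forall>\<^sub>F t in at_left 0. 0 = flat_exp m t"
      using eventually_at_left_real[of "-1" 0] by (auto elim!: eventually_mono simp: flat_exp_def)
  qed
  have "((\<lambda>t. inverse t ^ m / exp (inverse t)) \<longlongrightarrow> 0) (at_right (0::real))"
    using filterlim_compose[OF tendsto_power_div_exp_0 filterlim_inverse_at_top_right] .
  then show "(flat_exp m \<longlongrightarrow> 0) (at_right 0)"
  proof (rule Lim_transform_eventually)
    show "\<forall>\<^sub>F t in at_right 0. inverse t ^ m / exp (inverse t) = flat_exp m t"
      using eventually_at_right_less[of 0]
      by (auto elim!: eventually_mono simp: flat_exp_def exp_minus field_simps)
  qed
qed

text \<open>The factors \<open>inverse t ^ m\<close> are part of the family to make it closed under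
  differentiation up to linear combinations. At 0 the exponential beats every power, so the same
  formula holds there.\<close>

lemma flat_exp_deriv:
  "(flat_exp m has_real_derivative flat_exp (m + 2) t - real m * flat_exp (m + 1) t) (at t)"
proof -
  consider "t < 0" | "t = 0" | "0 < t" by linarith
  then show ?thesis
  proof cases
    case 1
    have "((\<lambda>t. 0) has_real_derivative 0) (at t)" by simp
    then have "(flat_exp m has_real_derivative 0) (at t)"
      by (rule has_field_derivative_transform_within_open[where S="{..<0}"]) (use 1 in \<open>auto simp: flat_exp_def\<close>)
    then show ?thesis using 1 by (simp add: flat_exp_def)
  next
    case 2
    have "(\<lambda>h. (flat_exp m (0 + h) - flat_exp m 0) / h) = flat_exp (m + 1)"
      by (auto simp: flat_exp_def fun_eq_iff divide_inverse)
    then show ?thesis using flat_exp_lim[of "m + 1"] 2 by (simp add: DERIV_def flat_exp_def)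
  next
    case 3
    have "((\<lambda>t. exp (- inverse t) * inverse t ^ m) has_real_derivative
        exp (- inverse t) * inverse t ^ (m + 2) - real m * (exp (- inverse t) * inverse t ^ (m + 1))) (at t)"
    proof -
      have "((\<lambda>t. exp (- inverse t)) has_real_derivative exp (- inverse t) * inverse t ^ 2) (at t)"
        using 3 by (auto intro!: derivative_eq_intros simp: power2_eq_square)
      moreover have "((\<lambda>t. inverse t ^ m) has_real_derivative - real m * inverse t ^ (m + 1)) (at t)"
      proof (cases m)
        case (Suc k)
        have "((\<lambda>t. inverse t ^ Suc k) has_real_derivative
            real (Suc k) * (- (inverse t ^ 2) * inverse t ^ (Suc k - 1))) (at t)"
          using DERIV_power[OF DERIV_inverse[of t UNIV], of "Suc k"] 3 by (simp add: numeral_2_eq_2)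
        also have "real (Suc k) * (- (inverse t ^ 2) * inverse t ^ (Suc k - 1)) =
            - real (Suc k) * inverse t ^ (Suc k + 1)"
          by (simp add: power2_eq_square algebra_simps)
        finally show ?thesis unfolding Suc .
      qed simp
      ultimately have "((\<lambda>t. exp (- inverse t) * inverse t ^ m) has_real_derivative
          exp (- inverse t) * (- real m * inverse t ^ (m + 1)) + exp (- inverse t) * inverse t ^ 2 * inverse t ^ m) (at t)"
        by (rule DERIV_mult')
      then show ?thesis by (simp add: power_add algebra_simps power2_eq_square)
    qed
    then have "(flat_exp m has_real_derivative
        exp (- inverse t) * inverse t ^ (m + 2) - real m * (exp (- inverse t) * inverse t ^ (m + 1))) (at t)"
      by (rule has_field_derivative_transform_within_open[where S="{0<..}"]) (use 3 in \<open>auto simp: flat_exp_def\<close>)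
    then show ?thesis using 3 by (simp add: flat_exp_def)
  qed
qed

lemma flat_exp_smooth: "smooth_on UNIV (flat_exp m)"
proof -
  have "holder_Ck_on k 0 UNIV (flat_exp m)" for k m
  proof (induction k arbitrary: m)
    case 0
    have "continuous_on UNIV (flat_exp m)"
      using flat_exp_deriv by (intro DERIV_continuous_on) (auto intro: DERIV_subset)
    then show ?case by (simp add: locally_holder_on_continuous)
  next
    case (Suc k)
    have "holder_Ck_on k 0 UNIV (\<lambda>t. (flat_exp (m + 2) t + (- real m) * flat_exp (m + 1) t) * v)" for v
      using holder_Ck_on_linear[OF bounded_linear_mult_left,
          OF holder_Ck_on_add[OF Suc holder_Ck_on_linear[OF bounded_linear_mult_right Suc]]] .
    then show ?case
      using flat_exp_deriv[of m] unfolding holder_Ck_on.simps has_field_derivative_def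
      by (intro exI[of _ "\<lambda>t v. (flat_exp (m + 2) t - real m * flat_exp (m + 1) t) * v"]) auto
  qed
  then show ?thesis by (simp add: smooth_on_def)
qed

lemma flat_exp_0: "t \<le> 0 \<Longrightarrow> flat_exp 0 t = 0" "0 < t \<Longrightarrow> 0 < flat_exp 0 t" "0 \<le> flat_exp 0 t" "flat_exp 0 t < 1"
  by (auto simp: flat_exp_def)

lemma flat_exp_mono: "s \<le> t \<Longrightarrow> flat_exp 0 s \<le> flat_exp 0 t"
  by (auto simp: flat_exp_def intro: le_imp_inverse_le)

lemma flat_exp_tendsto_1: "(flat_exp 0 \<longlongrightarrow> 1) at_top"
proof (rule Lim_transform_eventually)
  have "((\<lambda>t. exp (- inverse t)) \<longlongrightarrow> exp (- 0)) (at_top :: real filter)"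
    by (intro tendsto_intros tendsto_inverse_0_at_top filterlim_ident)
  then show "((\<lambda>t. exp (- inverse t)) \<longlongrightarrow> 1) (at_top :: real filter)" by simp
  show "\<forall>\<^sub>F t in at_top. exp (- inverse t) = flat_exp 0 t"
    using eventually_gt_at_top[of 0] by eventually_elim (simp add: flat_exp_def)
qed

lemma smooth_plateau:
  fixes p :: "'a::euclidean_space"
  assumes "0 < e"
  obtains \<theta> :: "'a \<Rightarrow> real" where "smooth_on UNIV \<theta>" "\<And>x. 0 \<le> \<theta> x" "\<And>x. \<theta> x \<le> 1"
    "\<And>x. dist x p \<le> e / 2 \<Longrightarrow> \<theta> x = 1" "\<And>x. e \<le> dist x p \<Longrightarrow> \<theta> x = 0"
proof -
  define E where "E = flat_exp 0"
  \<comment> \<open>The inner argument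
    \<open>2 * ((x - p) \<bullet> (x - p)) / e\<^sup>2 - 1\<close> is at most 0 up to distance
    \<open>e / 2\<close> and at least 1 from distance \<open>e\<close> on. The outer argument is
    then \<open>E 1\<close> or at most 0, and division by \<open>E (E 1)\<close> normalizes the
    plateau to 1. The squared distance keeps the function smooth at \<open>p\<close>.\<close>
  define \<theta> where "\<theta> x = E (E 1 - E (2 * ((x - p) \<bullet> (x - p)) / e\<^sup>2 - 1)) * inverse (E (E 1))" for x
  have E: "E t = 0" if "t \<le> 0" for t using that by (simp add: E_def flat_exp_0)
  have E': "0 < E t" if "0 < t" for t using that by (simp add: E_def flat_exp_0)
  have E'': "0 \<le> E t" for t by (simp add: E_def flat_exp_0)
  have Em: "E s \<le> E t" if "s \<le> t" for s t using that by (simp add: E_def flat_exp_mono)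
  have EE: "0 < E (E 1)" by (intro E') simp
  have ip: "(x - p) \<bullet> (x - p) = (dist x p)\<^sup>2" for x by (simp add: dist_norm power2_norm_eq_inner)
  have sm: "smooth_on UNIV E" by (simp add: E_def flat_exp_smooth)
  have ipsm: "smooth_on UNIV (\<lambda>x. (x - p) \<bullet> (x - p))"
  proof -
    have "(\<lambda>x. (x - p) \<bullet> (x - p)) = (\<lambda>x. \<Sum>i\<in>Basis. ((x - p) \<bullet> i) * ((x - p) \<bullet> i))"
      by (simp add: euclidean_inner[of "_ - p" "_ - p"])
    moreover have "smooth_on UNIV (\<lambda>x. \<Sum>i\<in>Basis. ((x - p) \<bullet> i) * ((x - p) \<bullet> i))"
      by (intro smooth_on_sum smooth_on_mult smooth_on_inner smooth_on_diff smooth_on_id smooth_on_const) auto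
    ultimately show ?thesis by simp
  qed
  have "smooth_on UNIV (\<lambda>x. 2 * ((x - p) \<bullet> (x - p)) * inverse (e\<^sup>2) - 1)"
    by (intro smooth_on_diff smooth_on_mult smooth_on_const ipsm) auto
  then have "smooth_on UNIV \<theta>"
    unfolding \<theta>_def divide_inverse
    by (intro smooth_on_mult smooth_on_const smooth_on_compose[OF _ _ _ sm] smooth_on_diff ipsm) auto
  moreover have "0 \<le> \<theta> x" for x using EE E'' by (simp add: \<theta>_def)
  moreover have "\<theta> x \<le> 1" for x
  proof -
    have "E (E 1 - E (2 * ((x - p) \<bullet> (x - p)) / e\<^sup>2 - 1)) \<le> E (E 1)"
      by (intro Em) (use E'' in auto)
    then show ?thesis using EE by (simp add: \<theta>_def field_simps)
  qed
  moreover have "\<theta> x = 1" if "dist x p \<le> e / 2" for x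
  proof -
    have "(dist x p)\<^sup>2 \<le> (e / 2)\<^sup>2" using that by (intro power_mono) auto
    also have "\<dots> \<le> e\<^sup>2 / 2" by (simp add: power_divide)
    finally have "2 * (dist x p)\<^sup>2 / e\<^sup>2 - 1 \<le> 0" using assms by (simp add: field_simps)
    then show ?thesis using EE by (simp add: \<theta>_def ip E)
  qed
  moreover have "\<theta> x = 0" if "e \<le> dist x p" for x
  proof -
    have "e\<^sup>2 \<le> (dist x p)\<^sup>2" using that assms by (intro power_mono) auto
    then have "1 \<le> 2 * (dist x p)\<^sup>2 / e\<^sup>2 - 1" using assms by (simp add: field_simps)
    then have "E 1 - E (2 * (dist x p)\<^sup>2 / e\<^sup>2 - 1) \<le> 0" using Em by simp
    then show ?thesis by (simp add: \<theta>_def ip E)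
  qed
  ultimately show ?thesis by (rule that)
qed

section \<open>Test functions and the fundamental lemma of the calculus of variations\<close>

lemma test_function_smooth:
  "test_function \<Omega> \<phi> \<longleftrightarrow> smooth_on UNIV \<phi> \<and> (\<exists>K. compact K \<and> K \<subseteq> \<Omega> \<and> (\<forall>x. x \<notin> K \<longrightarrow> \<phi> x = 0))"
  by (simp add: test_function_def smooth_on_def frechet_eq_holder_0)

lemma test_function_mono: "test_function \<Omega> \<phi> \<Longrightarrow> \<Omega> \<subseteq> \<Omega>' \<Longrightarrow> test_function \<Omega>' \<phi>"
  unfolding test_function_def by blast

lemma test_function_bounded:
  assumes "test_function \<Omega> \<phi>"
  obtains C where "\<And>x. \<bar>\<phi> x\<bar> \<le> C" "0 \<le> C"
proof -
  obtain K where K: "compact K" "\<forall>x. x \<notin> K \<longrightarrow> \<phi> x = 0" "smooth_on UNIV \<phi>"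
    using assms by (auto simp: test_function_smooth)
  have "bounded (\<phi> ` K)"
    using K smooth_on_continuous[OF K(3)]
    by (intro compact_imp_bounded compact_continuous_image) (auto intro: continuous_on_subset)
  then obtain C where "\<And>x. x \<in> K \<Longrightarrow> \<bar>\<phi> x\<bar> \<le> C" by (auto simp: bounded_iff)
  then show ?thesis using that[of "max C 0"] K(2) by (metis abs_zero max.cobounded1 max.cobounded2 order.trans)
qed

lemma test_function_derivative:
  assumes "test_function \<Omega> \<phi>"
  shows "(\<phi> has_derivative frechet_derivative \<phi> (at x)) (at x)"
    and "test_function \<Omega> (\<lambda>x. frechet_derivative \<phi> (at x) i)"
proof -
  obtain K where K: "compact K" "K \<subseteq> \<Omega>" "\<forall>x. x \<notin> K \<longrightarrow> \<phi> x = 0" and sm: "smooth_on UNIV \<phi>"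
    using assms by (auto simp: test_function_smooth)
  show "(\<phi> has_derivative frechet_derivative \<phi> (at x)) (at x)"
    using smooth_on_derivative(1)[OF full_domain_UNIV sm] by simp
  have "frechet_derivative \<phi> (at x) i = 0" if "x \<notin> K" for x
  proof -
    have "((\<lambda>x. 0) has_derivative (\<lambda>v. 0)) (at x)" by simp
    then have "(\<phi> has_derivative (\<lambda>v. 0)) (at x)"
      by (rule has_derivative_transform_within_open[where s="- K"])
         (use that K compact_imp_closed in auto)
    then have "frechet_derivative \<phi> (at x) = (\<lambda>v. 0)" by (rule frechet_derivative_at[symmetric])
    then show ?thesis by simp
  qed
  then show "test_function \<Omega> (\<lambda>x. frechet_derivative \<phi> (at x) i)"
    unfolding test_function_smooth using smooth_on_derivative(2)[OF full_domain_UNIV sm, of i] K by auto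
qed

lemma test_function_translate:
  assumes "test_function \<Omega> \<phi>" "\<And>K. K \<subseteq> \<Omega> \<Longrightarrow> (\<lambda>x. x + c) ` K \<subseteq> \<Omega>'"
  shows "test_function \<Omega>' (\<lambda>x. \<phi> (x - c))"
    and "frechet_derivative (\<lambda>x. \<phi> (x - c)) (at x) = frechet_derivative \<phi> (at (x - c))"
proof -
  obtain K where K: "compact K" "K \<subseteq> \<Omega>" "\<forall>x. x \<notin> K \<longrightarrow> \<phi> x = 0" and sm: "smooth_on UNIV \<phi>"
    using assms by (auto simp: test_function_smooth)
  have "smooth_on UNIV (\<lambda>x. \<phi> (x - c))"
    by (rule smooth_on_compose[OF _ _ _ sm]) (auto intro: smooth_on_diff smooth_on_id smooth_on_const)
  moreover have "compact ((\<lambda>x. x + c) ` K)"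
    using K by (intro compact_continuous_image continuous_intros)
  moreover have "\<phi> (x - c) = 0" if "x \<notin> (\<lambda>x. x + c) ` K" for x
  proof -
    have "x - c \<notin> K" using that by (metis diff_add_cancel imageI)
    then show ?thesis using K by blast
  qed
  ultimately show "test_function \<Omega>' (\<lambda>x. \<phi> (x - c))"
    unfolding test_function_smooth using assms(2)[OF K(2)] by blast
  have D: "(\<phi> has_derivative frechet_derivative \<phi> (at (x - c))) (at (x - c))"
    using test_function_derivative(1)[OF assms(1)] .
  have "((\<lambda>x. x - c) has_derivative (\<lambda>v. v)) (at x)"
    by (auto intro!: derivative_eq_intros)
  from has_derivative_compose[OF this D]
  show "frechet_derivative (\<lambda>x. \<phi> (x - c)) (at x) = frechet_derivative \<phi> (at (x - c))"
    by (rule frechet_derivative_at[symmetric])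
qed

text \<open>\<open>P\<close> is positive exactly on the box. Subtracting 1 from
  \<open>real n * P x\<close> cuts the support back to the set where
  \<open>real n * P x \<ge> 1\<close>, which is closed, bounded and inside the box; wherever
  \<open>P\<close> is positive the argument of \<open>flat_exp\<close> tends to infinity with
  \<open>n\<close> and the value to 1.\<close>

lemma test_function_box_approx:
  fixes c d :: "'a::euclidean_space"
  obtains \<phi> :: "nat \<Rightarrow> 'a \<Rightarrow> real" where "\<And>n. test_function (box c d) (\<phi> n)" "\<And>n x. \<bar>\<phi> n x\<bar> \<le> 1"
    "\<And>x. (\<lambda>n. \<phi> n x) \<longlonglongrightarrow> indicator (box c d) x"
proof -
  define P where "P x = (\<Prod>i\<in>Basis. flat_exp 0 ((x - c) \<bullet> i) * flat_exp 0 ((d - x) \<bullet> i))" for x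
  define \<phi> where "\<phi> n x = flat_exp 0 (real n * P x - 1)" for n x
  have Psm: "smooth_on UNIV P"
    unfolding P_def
    by (intro smooth_on_prod smooth_on_mult smooth_on_compose[OF _ _ _ flat_exp_smooth] smooth_on_inner
      smooth_on_diff smooth_on_id smooth_on_const) auto
  have sm: "smooth_on UNIV (\<phi> n)" for n
    unfolding \<phi>_def
    by (intro smooth_on_mult smooth_on_compose[OF _ _ _ flat_exp_smooth]
      smooth_on_diff smooth_on_const Psm) auto
  have P0: "P x = 0" if x: "x \<notin> box c d" for x
  proof -
    obtain i where "i \<in> Basis" "x \<bullet> i \<le> c \<bullet> i \<or> d \<bullet> i \<le> x \<bullet> i"
      using x by (auto simp: box_def not_less)
    then show ?thesis unfolding P_def
      by (intro prod_zero) (auto intro!: bexI[of _ i] simp: inner_diff_left flat_exp_0)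
  qed
  have Ppos: "0 < P x" if x: "x \<in> box c d" for x
    unfolding P_def using x by (intro prod_pos) (auto simp: box_def inner_diff_left intro!: mult_pos_pos flat_exp_0)
  have tf: "test_function (box c d) (\<phi> n)" for n
    unfolding test_function_smooth
  proof (intro conjI sm exI)
    let ?K = "{x. 1 \<le> real n * P x}"
    show sub: "?K \<subseteq> box c d" using P0 by fastforce
    have "closed ?K"
      using smooth_on_continuous[OF Psm] by (intro closed_Collect_le continuous_intros) auto
    moreover have "bounded ?K" using sub bounded_box bounded_subset by blast
    ultimately show "compact ?K" by (simp add: compact_eq_bounded_closed)
    show "\<forall>x. x \<notin> ?K \<longrightarrow> \<phi> n x = 0" by (auto simp: \<phi>_def flat_exp_0)
  qed
  have lim: "(\<lambda>n. \<phi> n x) \<longlonglongrightarrow> indicator (box c d) x" for x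
  proof (cases "x \<in> box c d")
    case True
    have "filterlim (\<lambda>n. real n * P x - 1) at_top sequentially"
    proof -
      have "filterlim (\<lambda>n. real n * P x) at_top sequentially"
        using filterlim_tendsto_pos_mult_at_top[OF tendsto_const Ppos[OF True] filterlim_real_sequentially]
        by (simp add: mult.commute)
      from filterlim_tendsto_add_at_top[OF tendsto_const[of "-1"] this] show ?thesis by simp
    qed
    from filterlim_compose[OF flat_exp_tendsto_1 this] show ?thesis
      using True by (simp add: \<phi>_def)
  next
    case False
    then show ?thesis by (simp add: \<phi>_def P0 flat_exp_0)
  qed
  show ?thesis
    using that[OF tf _ lim] flat_exp_0(3,4) by (simp add: \<phi>_def less_imp_le)
qed

text \<open>Dominated convergence replaces test functions by indicators of boxes. Boxes are stable
  under intersection and generate the Borel sets, so the integral of \<open>v\<close> over every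
  Borel set is 0, and a density is determined by such integrals.\<close>

lemma test_function_fundamental:
  fixes u :: "'a::euclidean_space \<Rightarrow> real"
  assumes u: "integrable lborel u"
    and zero: "\<And>\<phi>. test_function (box a b) \<phi> \<Longrightarrow> (\<integral>x. \<phi> x * u x \<partial>lborel) = 0"
  shows "AE x in lborel. x \<in> box a b \<longrightarrow> u x = 0"
proof -
  define v where "v x = indicator (box a b) x * u x" for x
  have v: "integrable lborel v"
    unfolding v_def using integrable_mult_indicator[OF _ u, of "box a b"] by simp
  have box: "(\<integral>x. indicator (box c d) x * v x \<partial>lborel) = 0" for c d
  proof -
    obtain c' d' where cd: "box a b \<inter> box c d = box c' d'" using box_Int_box by blast
    obtain \<phi> where \<phi>: "\<And>n. test_function (box c' d') (\<phi> n)" "\<And>n x. \<bar>\<phi> n x\<bar> \<le> (1::real)"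
      "\<And>x. (\<lambda>n. \<phi> n x) \<longlonglongrightarrow> indicator (box c' d') x"
      using test_function_box_approx[of c' d'] by metis
    have "(\<lambda>n. \<integral>x. \<phi> n x * u x \<partial>lborel) \<longlonglongrightarrow> (\<integral>x. indicator (box c' d') x * u x \<partial>lborel)"
    proof (rule integral_dominated_convergence[where w="\<lambda>x. \<bar>u x\<bar>"])
      show "(\<lambda>x. \<phi> n x * u x) \<in> borel_measurable lborel" for n
      proof -
        have "smooth_on UNIV (\<phi> n)" using \<phi>(1) by (simp add: test_function_smooth)
        then have "\<phi> n \<in> borel_measurable borel"
          by (intro borel_measurable_continuous_onI smooth_on_continuous)
        then show ?thesis using u by measurable
      qed
      show "AE x in lborel. norm (\<phi> n x * u x) \<le> \<bar>u x\<bar>" for n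
        using \<phi>(2) by (auto simp: abs_mult intro!: mult_left_le_one_le)
      show "AE x in lborel. (\<lambda>n. \<phi> n x * u x) \<longlonglongrightarrow> indicator (box c' d') x * u x"
        using \<phi>(3) by (auto intro!: tendsto_intros)
    qed (use u in auto)
    moreover have "test_function (box a b) (\<phi> n)" for n
      using \<phi>(1) cd by (auto intro: test_function_mono)
    ultimately have "(\<integral>x. indicator (box c' d') x * u x \<partial>lborel) = 0"
      using zero by (simp add: LIMSEQ_const_iff)
    moreover have "indicator (box c' d') x * u x = indicator (box c d) x * v x" for x
      unfolding cd[symmetric] by (auto simp add: v_def indicator_def)
    ultimately show ?thesis by simp
  qed
  have "(\<integral>x. indicator UNIV x * v x \<partial>lborel) = 0"
  proof -
    have "(\<lambda>x. indicator (box a b) x * v x) = v" by (auto simp: v_def indicator_def)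
    then show ?thesis using box[of a b] by simp
  qed
  note uni = this
  have ind: "integrable lborel (\<lambda>x. indicator A x * v x)" if "A \<in> sets borel" for A
    using integrable_mult_indicator[OF _ v, of A] that by simp
  have all: "(\<integral>x. indicator A x * v x \<partial>lborel) = 0" if "A \<in> sigma_sets UNIV (range (\<lambda>(a, b). box a b))" for A :: "'a set"
  proof (rule sigma_sets_induct_disjoint[OF _ _ that])
    show "Int_stable (range (\<lambda>(a, b). box a b :: 'a set))"
    proof (rule Int_stableI_image)
      fix p q :: "'a \<times> 'a"
      obtain c d where "box (fst p) (snd p) \<inter> box (fst q) (snd q) = box c d" using box_Int_box by blast
      then show "\<exists>k\<in>UNIV. (case p of (a, b) \<Rightarrow> box a b) \<inter> (case q of (a, b) \<Rightarrow> box a b) = (case k of (a, b) \<Rightarrow> box a b)"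
        by (intro bexI[of _ "(c, d)"]) (auto simp: case_prod_unfold)
    qed
    show "range (\<lambda>(a, b). box a b) \<subseteq> Pow (UNIV :: 'a set)" by simp
    show "(\<integral>x. indicator A x * v x \<partial>lborel) = 0" if "A \<in> range (\<lambda>(a, b). box a b)" for A
      using that box by auto
    show "(\<integral>x. indicator {} x * v x \<partial>lborel) = 0" by simp
  next
    fix A :: "'a set" assume A: "A \<in> sigma_sets UNIV (range (\<lambda>(a, b). box a b))" "(\<integral>x. indicator A x * v x \<partial>lborel) = 0"
    have "A \<in> sets borel" using A(1) by (simp add: borel_eq_box)
    moreover have "indicator (UNIV - A) x * v x = indicator UNIV x * v x - indicator A x * v x" for x
      by (simp add: indicator_def)
    ultimately show "(\<integral>x. indicator (UNIV - A) x * v x \<partial>lborel) = 0"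
      using A(2) uni ind[of A] ind[of UNIV] by (simp add: Bochner_Integration.integral_diff)
  next
    fix A :: "nat \<Rightarrow> 'a set"
    assume A: "disjoint_family A" "range A \<subseteq> sigma_sets UNIV (range (\<lambda>(a, b). box a b))"
      "\<And>i. (\<integral>x. indicator (A i) x * v x \<partial>lborel) = 0"
    have m: "A i \<in> sets lborel" for i using A(2) by (auto simp: borel_eq_box)
    have "set_integrable lborel (\<Union>i. A i) v"
      unfolding set_integrable_def using integrable_mult_indicator[OF _ v] m by auto
    from lebesgue_integral_countable_add[OF m _ this] A(1,3)
    show "(\<integral>x. indicator (\<Union>i. A i) x * v x \<partial>lborel) = 0"
      by (simp add: set_lebesgue_integral_def disjoint_family_on_def)
  qed
  have "AE x in lborel. v x = 0"
  proof (rule density_unique_real[OF v integrable_zero])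
    show "set_lebesgue_integral lborel A v = set_lebesgue_integral lborel A (\<lambda>x. 0)" if "A \<in> sets lborel" for A
      using all[of A] that by (simp add: set_lebesgue_integral_def borel_eq_box)
  qed
  then show ?thesis by eventually_elim (auto simp: v_def)
qed

section \<open>Weak derivatives and absolute continuity on lines\<close>

lemma integrable_lborel_shift:
  fixes f :: "'a::euclidean_space \<Rightarrow> 'b::{banach, second_countable_topology}"
  assumes "integrable lborel f"
  shows "integrable lborel (\<lambda>x. f (x + c))"
proof -
  have "integrable (distr lborel borel ((+) c)) f" using assms by (simp add: lborel_distr_plus)
  then show ?thesis by (subst (asm) integrable_distr_eq) (use assms in \<open>auto simp: add.commute\<close>)
qed

lemma integral_lborel_shift:
  fixes f :: "'a::euclidean_space \<Rightarrow> 'b::{banach, second_countable_topology}"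
  assumes [measurable]: "f \<in> borel_measurable borel"
  shows "(\<integral>x. f (x + c) \<partial>lborel) = (\<integral>x. f x \<partial>lborel)"
proof -
  have "(\<integral>x. f x \<partial>lborel) = (\<integral>x. f x \<partial>distr lborel borel ((+) c))" by (simp add: lborel_distr_plus)
  also have "\<dots> = (\<integral>x. f (x + c) \<partial>lborel)" by (subst integral_distr) (auto simp: add.commute)
  finally show ?thesis by simp
qed

lemma nn_integral_lborel_shift:
  fixes f :: "'a::euclidean_space \<Rightarrow> ennreal"
  assumes [measurable]: "f \<in> borel_measurable borel"
  shows "(\<integral>\<^sup>+x. f (x + c) \<partial>lborel) = (\<integral>\<^sup>+x. f x \<partial>lborel)"
proof -
  have "(\<integral>\<^sup>+x. f x \<partial>lborel) = (\<integral>\<^sup>+x. f x \<partial>distr lborel borel ((+) c))" by (simp add: lborel_distr_plus)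
  also have "\<dots> = (\<integral>\<^sup>+x. f (x + c) \<partial>lborel)" by (subst nn_integral_distr) (auto simp: add.commute)
  finally show ?thesis by simp
qed

definition seg_int :: "('a::euclidean_space \<Rightarrow> real) \<Rightarrow> 'a \<Rightarrow> 'a \<Rightarrow> real \<Rightarrow> real" where
  "seg_int h i x t = (\<integral>s. indicator {0..t} s * h (x + s *\<^sub>R i) \<partial>lborel)"

text \<open>The counterpart of \<open>weak_partial\<close> for real functions and
  \<open>lborel\<close>. The integrals run over the whole space because test functions vanish
  outside \<open>Q\<close>.\<close>

definition weak_deriv :: "'a::euclidean_space set \<Rightarrow> 'a \<Rightarrow> ('a \<Rightarrow> real) \<Rightarrow> ('a \<Rightarrow> real) \<Rightarrow> bool" where
  "weak_deriv Q i g h \<longleftrightarrow> (\<forall>\<phi>. test_function Q \<phi> \<longrightarrow>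
     (\<integral>x. frechet_derivative \<phi> (at x) i * g x \<partial>lborel) = - (\<integral>x. \<phi> x * h x \<partial>lborel))"

text \<open>Absolute continuity on lines, stated for one length at a time: for each \<open>t\<close>
  the identity is asked for almost all starting points, with a null set that may depend on
  \<open>t\<close>. In this form it can be integrated against test functions.\<close>

definition line_deriv :: "'a::euclidean_space set \<Rightarrow> 'a \<Rightarrow> ('a \<Rightarrow> real) \<Rightarrow> ('a \<Rightarrow> real) \<Rightarrow> bool" where
  "line_deriv Q i g h \<longleftrightarrow> (\<forall>t>0. AE x in lborel. x \<in> Q \<longrightarrow> x + t *\<^sub>R i \<in> Q \<longrightarrow>
     g (x + t *\<^sub>R i) - g x = seg_int h i x t)"

lemma test_function_borel: "test_function Q \<phi> \<Longrightarrow> \<phi> \<in> borel_measurable borel"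
  unfolding test_function_smooth by (auto intro!: borel_measurable_continuous_onI smooth_on_continuous)

lemma integrable_bounded_mult:
  fixes h k :: "'a \<Rightarrow> real"
  assumes "integrable M h" "k \<in> borel_measurable M" "\<And>x. \<bar>k x\<bar> \<le> C"
  shows "integrable M (\<lambda>x. k x * h x)"
proof (rule Bochner_Integration.integrable_bound[where f="\<lambda>x. C * \<bar>h x\<bar>"])
  show "AE x in M. norm (k x * h x) \<le> norm (C * \<bar>h x\<bar>)"
  proof (rule AE_I2)
    fix x
    have "\<bar>k x\<bar> * \<bar>h x\<bar> \<le> \<bar>C\<bar> * \<bar>h x\<bar>"
      using assms(3)[of x] by (intro mult_right_mono) auto
    then show "norm (k x * h x) \<le> norm (C * \<bar>h x\<bar>)" by (simp add: abs_mult)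
  qed
qed (use assms in auto)

lemma seg_integrable_pair:
  fixes h k :: "'a::euclidean_space \<Rightarrow> real"
  assumes h: "integrable lborel h" and k[measurable]: "k \<in> borel_measurable borel" and C: "\<And>x. \<bar>k x\<bar> \<le> C"
  shows "integrable (lborel \<Otimes>\<^sub>M lborel) (\<lambda>(s, x). indicator {0..t} s * (k x * h (x + s *\<^sub>R i)))"
proof (rule lborel_pair.Fubini_integrable)
  have C0: "0 \<le> C" using C[of undefined] by linarith
  have [measurable]: "h \<in> borel_measurable borel" using h by auto
  show "(\<lambda>(s, x). indicator {0..t} s * (k x * h (x + s *\<^sub>R i))) \<in> borel_measurable (lborel \<Otimes>\<^sub>M lborel)"
    by measurable
  have kh: "integrable lborel (\<lambda>x. k x * h (x + s *\<^sub>R i))" for s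
    using integrable_bounded_mult[OF integrable_lborel_shift[OF h] _ C] by simp
  then show "AE s in lborel. integrable lborel (\<lambda>x. case (s, x) of (s, x) \<Rightarrow> indicator {0..t} s * (k x * h (x + s *\<^sub>R i)))"
    by simp
  show "integrable lborel (\<lambda>s. \<integral>x. norm (case (s, x) of (s, x) \<Rightarrow> indicator {0..t} s * (k x * h (x + s *\<^sub>R i))) \<partial>lborel)"
  proof (rule Bochner_Integration.integrable_bound)
    show "integrable lborel (\<lambda>s. indicator {0..t} s * (C * (\<integral>x. \<bar>h x\<bar> \<partial>lborel)))"
      by (intro integrable_mult_left) (auto simp: emeasure_lborel_Icc_eq)
    show "AE s in lborel. norm (\<integral>x. norm (case (s, x) of (s, x) \<Rightarrow> indicator {0..t} s * (k x * h (x + s *\<^sub>R i))) \<partial>lborel)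
      \<le> norm (indicator {0..t} s * (C * (\<integral>x. \<bar>h x\<bar> \<partial>lborel)))"
    proof (rule AE_I2)
      fix s :: real
      have "(\<integral>x. \<bar>k x * h (x + s *\<^sub>R i)\<bar> \<partial>lborel) \<le> (\<integral>x. C * \<bar>h (x + s *\<^sub>R i)\<bar> \<partial>lborel)"
        using kh integrable_lborel_shift[OF h] C
        by (intro integral_mono integrable_abs integrable_mult_right) (auto simp: abs_mult intro: mult_right_mono)
      also have "\<dots> = C * (\<integral>x. \<bar>h x\<bar> \<partial>lborel)"
        using integral_lborel_shift[of "\<lambda>x. \<bar>h x\<bar>" "s *\<^sub>R i"] by simp
      finally have "(\<integral>x. \<bar>k x * h (x + s *\<^sub>R i)\<bar> \<partial>lborel) \<le> C * (\<integral>x. \<bar>h x\<bar> \<partial>lborel)" .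
      moreover have "0 \<le> (\<integral>x. \<bar>k x * h (x + s *\<^sub>R i)\<bar> \<partial>lborel)" by simp
      ultimately show "norm (\<integral>x. norm (case (s, x) of (s, x) \<Rightarrow> indicator {0..t} s * (k x * h (x + s *\<^sub>R i))) \<partial>lborel)
        \<le> norm (indicator {0..t} s * (C * (\<integral>x. \<bar>h x\<bar> \<partial>lborel)))"
        using C0 by (cases "s \<in> {0..t}") (auto simp: abs_mult)
    qed
  qed measurable
qed

text \<open>Fubini's theorem, together with translation invariance, moves the shift from
  \<open>h\<close> to the bounded factor \<open>k\<close>; for a test function \<open>k\<close> the
  shift can then be differentiated.\<close>

lemma seg_int_mult_integral:
  fixes h k :: "'a::euclidean_space \<Rightarrow> real"
  assumes h: "integrable lborel h" and k[measurable]: "k \<in> borel_measurable borel" and C: "\<And>x. \<bar>k x\<bar> \<le> C"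
  shows "integrable lborel (\<lambda>x. k x * seg_int h i x t)"
    and "(\<integral>x. k x * seg_int h i x t \<partial>lborel) = (\<integral>s. indicator {0..t} s * (\<integral>x. k (x - s *\<^sub>R i) * h x \<partial>lborel) \<partial>lborel)"
    and "integrable lborel (\<lambda>s. indicator {0..t} s * (\<integral>x. k (x - s *\<^sub>R i) * h x \<partial>lborel))"
proof -
  have [measurable]: "h \<in> borel_measurable borel" using h by auto
  note P = seg_integrable_pair[OF h k C, of t i]
  have eq: "k x * seg_int h i x t = (\<integral>s. indicator {0..t} s * (k x * h (x + s *\<^sub>R i)) \<partial>lborel)" for x
    unfolding seg_int_def by (simp add: mult.left_commute[of _ "k x"])
  show "integrable lborel (\<lambda>x. k x * seg_int h i x t)"
    unfolding eq using lborel_pair.integrable_snd[OF P] .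
  have sh: "(\<integral>x. indicator {0..t} s * (k x * h (x + s *\<^sub>R i)) \<partial>lborel) =
      indicator {0..t} s * (\<integral>x. k (x - s *\<^sub>R i) * h x \<partial>lborel)" for s
    using integral_lborel_shift[of "\<lambda>x. k (x - s *\<^sub>R i) * h x" "s *\<^sub>R i"] by simp
  show "(\<integral>x. k x * seg_int h i x t \<partial>lborel) = (\<integral>s. indicator {0..t} s * (\<integral>x. k (x - s *\<^sub>R i) * h x \<partial>lborel) \<partial>lborel)"
    unfolding eq using lborel_pair.Fubini_integral[OF P] unfolding sh by simp
  show "integrable lborel (\<lambda>s. indicator {0..t} s * (\<integral>x. k (x - s *\<^sub>R i) * h x \<partial>lborel))"
    using lborel_pair.integrable_fst[OF P] unfolding sh .
qed

text \<open>The starting points of segments with both ends in the box form a box again, so the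
  fundamental lemma applies to exactly these points.\<close>

lemma box_shift:
  fixes a b i x :: "'a::euclidean_space"
  assumes "i \<in> Basis" "0 < t"
  shows "x \<in> box a (b - t *\<^sub>R i) \<longleftrightarrow> x \<in> box a b \<and> x + t *\<^sub>R i \<in> box a b"
proof -
  have pos: "0 \<le> t * (i \<bullet> j)" if "j \<in> Basis" for j
    using assms that by (simp add: inner_Basis)
  show ?thesis
    unfolding box_def inner_add_left inner_diff_left inner_scaleR_left mem_Collect_eq
  proof safe
    fix j :: 'a assume *: "\<forall>i'\<in>Basis. a \<bullet> i' < x \<bullet> i' \<and> x \<bullet> i' < b \<bullet> i' - t * (i \<bullet> i')" "j \<in> Basis"
    show "x \<bullet> j < b \<bullet> j" "a \<bullet> j < x \<bullet> j + t * (i \<bullet> j)" "x \<bullet> j + t * (i \<bullet> j) < b \<bullet> j" "a \<bullet> j < x \<bullet> j"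
      using bspec[OF *(1,2)] pos[OF *(2)] by linarith+
  next
    fix j :: 'a assume *: "\<forall>i'\<in>Basis. a \<bullet> i' < x \<bullet> i' \<and> x \<bullet> i' < b \<bullet> i'"
      "\<forall>i'\<in>Basis. a \<bullet> i' < x \<bullet> i' + t * (i \<bullet> i') \<and> x \<bullet> i' + t * (i \<bullet> i') < b \<bullet> i'" "j \<in> Basis"
    show "a \<bullet> j < x \<bullet> j" "x \<bullet> j < b \<bullet> j - t * (i \<bullet> j)"
      using bspec[OF *(1,3)] bspec[OF *(2,3)] by linarith+
  qed
qed

lemma box_segment:
  fixes a b i x :: "'a::euclidean_space"
  assumes "i \<in> Basis" "x \<in> box a b" "x + t *\<^sub>R i \<in> box a b" "0 \<le> s" "s \<le> t"
  shows "x + s *\<^sub>R i \<in> box a b"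
proof (cases "t = 0")
  case False
  have "x + s *\<^sub>R i = (1 - s / t) *\<^sub>R x + (s / t) *\<^sub>R (x + t *\<^sub>R i)"
    using False by (simp add: algebra_simps)
  then show ?thesis
    using convexD_alt[OF convex_box(2) assms(2,3), of "s / t"] assms(4,5) False by (simp add: divide_simps)
qed (use assms in auto)

lemma test_function_line_integral:
  assumes \<phi>: "test_function Q \<phi>" and t: "0 \<le> t"
  shows "(\<integral>s. indicator {0..t} s * frechet_derivative \<phi> (at (y - s *\<^sub>R i)) i \<partial>lborel) = \<phi> y - \<phi> (y - t *\<^sub>R i)"
proof -
  let ?f = "\<lambda>s. frechet_derivative \<phi> (at (y - s *\<^sub>R i)) i"
  have "continuous_on UNIV (\<lambda>x. frechet_derivative \<phi> (at x) i)"
    using test_function_derivative(2)[OF \<phi>] by (auto simp: test_function_smooth intro: smooth_on_continuous)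
  then have cont: "continuous_on {0..t} ?f"
    by (rule continuous_on_compose2) (auto intro!: continuous_intros)
  have der: "((\<lambda>s. - \<phi> (y - s *\<^sub>R i)) has_vector_derivative ?f s) (at s within {0..t})" for s
  proof -
    have D: "(\<phi> has_derivative frechet_derivative \<phi> (at (y - s *\<^sub>R i))) (at (y - s *\<^sub>R i))"
      by (rule test_function_derivative(1)[OF \<phi>])
    have "((\<lambda>s. y - s *\<^sub>R i) has_derivative (\<lambda>r. - (r *\<^sub>R i))) (at s within {0..t})"
      by (auto intro!: derivative_eq_intros)
    from has_derivative_minus[OF has_derivative_compose[OF this D]]
    show ?thesis
      using linear_neg[OF has_derivative_linear[OF D]] linear_cmul[OF has_derivative_linear[OF D]]
      by (simp add: has_vector_derivative_def)
  qed
  show ?thesis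
    using integral_FTC_Icc[OF t der cont] by simp
qed

text \<open>The weak identity is integrated over the translates of \<open>\<phi>\<close> by
  \<open>s *\<^sub>R i\<close> with \<open>0 \<le> s \<le> t\<close>. This produces the segment
  integral of \<open>h\<close> on one side and, by the fundamental theorem of calculus for
  \<open>\<phi>\<close>, the increment of \<open>g\<close> on the other; the fundamental lemma then
  removes \<open>\<phi>\<close>.\<close>

lemma weak_imp_line_deriv:
  fixes g h :: "'a::euclidean_space \<Rightarrow> real"
  assumes i: "i \<in> Basis" and g: "integrable lborel g" and h: "integrable lborel h"
    and w: "weak_deriv (box a b) i g h"
  shows "line_deriv (box a b) i g h"
  unfolding line_deriv_def
proof (intro allI impI)
  fix t :: real assume t: "0 < t"
  have [measurable]: "g \<in> borel_measurable borel" "h \<in> borel_measurable borel" using g h by auto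
  define u where "u x = g (x + t *\<^sub>R i) - g x - seg_int h i x t" for x
  have si: "integrable lborel (\<lambda>x. seg_int h i x t)"
    using seg_int_mult_integral(1)[OF h, of "\<lambda>_. 1" 1] by simp
  have "AE x in lborel. x \<in> box a (b - t *\<^sub>R i) \<longrightarrow> u x = 0"
  proof (rule test_function_fundamental)
    show "integrable lborel u"
      unfolding u_def using g si integrable_lborel_shift[OF g] by auto
    fix \<phi> assume \<phi>: "test_function (box a (b - t *\<^sub>R i)) \<phi>"
    have [measurable]: "\<phi> \<in> borel_measurable borel" using test_function_borel[OF \<phi>] .
    obtain C where C: "\<And>x. \<bar>\<phi> x\<bar> \<le> C" using test_function_bounded[OF \<phi>] by metis
    let ?d = "\<lambda>x. frechet_derivative \<phi> (at x) i"
    have d: "test_function (box a (b - t *\<^sub>R i)) ?d" using test_function_derivative(2)[OF \<phi>] .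
    have [measurable]: "?d \<in> borel_measurable borel" using test_function_borel[OF d] .
    obtain C' where C': "\<And>x. \<bar>?d x\<bar> \<le> C'" using test_function_bounded[OF d] by metis
    have tr: "(\<integral>x. \<phi> (x - s *\<^sub>R i) * h x \<partial>lborel) = - (\<integral>x. ?d (x - s *\<^sub>R i) * g x \<partial>lborel)"
      if s: "s \<in> {0..t}" for s
    proof -
      \<comment> \<open>The support lies in the box of admissible starting points, so all translates
        up to \<open>t\<close> remain test functions for \<open>box a b\<close>.\<close>
      have sub: "(\<lambda>x. x + s *\<^sub>R i) ` K \<subseteq> box a b" if "K \<subseteq> box a (b - t *\<^sub>R i)" for K
      proof clarify
        fix x assume "x \<in> K"
        then have "x \<in> box a b" "x + t *\<^sub>R i \<in> box a b" using that box_shift[OF i t] by blast+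
        then show "x + s *\<^sub>R i \<in> box a b" using box_segment[OF i] s by auto
      qed
      note T = test_function_translate[OF \<phi> sub]
      have "(\<integral>x. frechet_derivative (\<lambda>x. \<phi> (x - s *\<^sub>R i)) (at x) i * g x \<partial>lborel) =
          - (\<integral>x. \<phi> (x - s *\<^sub>R i) * h x \<partial>lborel)"
        using w T(1) unfolding weak_deriv_def by blast
      then show ?thesis by (simp add: T(2))
    qed
    have "(\<integral>x. \<phi> x * seg_int h i x t \<partial>lborel) = (\<integral>s. indicator {0..t} s * (\<integral>x. \<phi> (x - s *\<^sub>R i) * h x \<partial>lborel) \<partial>lborel)"
      by (rule seg_int_mult_integral(2)[OF h _ C]) measurable
    also have "\<dots> = (\<integral>s. - (indicator {0..t} s * (\<integral>x. ?d (x - s *\<^sub>R i) * g x \<partial>lborel)) \<partial>lborel)"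
      by (rule Bochner_Integration.integral_cong) (auto simp: indicator_def tr)
    also have "\<dots> = - (\<integral>s. indicator {0..t} s * (\<integral>x. ?d (x - s *\<^sub>R i) * g x \<partial>lborel) \<partial>lborel)"
      by simp
    also have "(\<integral>s. indicator {0..t} s * (\<integral>x. ?d (x - s *\<^sub>R i) * g x \<partial>lborel) \<partial>lborel) =
        (\<integral>x. (\<phi> x - \<phi> (x - t *\<^sub>R i)) * g x \<partial>lborel)"
    proof -
      have "(\<integral>s. (\<integral>x. indicator {0..t} s * (?d x * g (x + s *\<^sub>R i)) \<partial>lborel) \<partial>lborel) =
        (\<integral>s. indicator {0..t} s * (\<integral>x. ?d (x - s *\<^sub>R i) * g x \<partial>lborel) \<partial>lborel)"
        using integral_lborel_shift[of "\<lambda>x. ?d (x - s *\<^sub>R i) * g x" "s *\<^sub>R i" for s] by simp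
      have P: "integrable (lborel \<Otimes>\<^sub>M lborel) (\<lambda>(s, x). indicator {0..t} s * (?d (x - s *\<^sub>R i) * g x))"
      proof (rule lborel_pair.Fubini_integrable)
        have kh: "integrable lborel (\<lambda>x. ?d (x - s *\<^sub>R i) * g x)" for s
          using integrable_bounded_mult[OF g _ C', of "\<lambda>x. x - s *\<^sub>R i"] C'
          by (intro integrable_bounded_mult[OF g]) auto
        then show "AE s in lborel. integrable lborel (\<lambda>x. case (s, x) of (s, x) \<Rightarrow> indicator {0..t} s * (?d (x - s *\<^sub>R i) * g x))"
          by simp
        show "integrable lborel (\<lambda>s. \<integral>x. norm (case (s, x) of (s, x) \<Rightarrow> indicator {0..t} s * (?d (x - s *\<^sub>R i) * g x)) \<partial>lborel)"
        proof (rule Bochner_Integration.integrable_bound)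
          show "integrable lborel (\<lambda>s. indicator {0..t} s * (C' * (\<integral>x. \<bar>g x\<bar> \<partial>lborel)))"
            by (intro integrable_mult_left) (auto simp: emeasure_lborel_Icc_eq)
          show "AE s in lborel. norm (\<integral>x. norm (case (s, x) of (s, x) \<Rightarrow> indicator {0..t} s * (?d (x - s *\<^sub>R i) * g x)) \<partial>lborel)
            \<le> norm (indicator {0..t} s * (C' * (\<integral>x. \<bar>g x\<bar> \<partial>lborel)))"
          proof (rule AE_I2)
            fix s :: real
            have "(\<integral>x. \<bar>?d (x - s *\<^sub>R i) * g x\<bar> \<partial>lborel) \<le> (\<integral>x. C' * \<bar>g x\<bar> \<partial>lborel)"
              using kh g C' by (intro integral_mono integrable_abs integrable_mult_right)
                (auto simp: abs_mult intro: mult_right_mono)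
            then have "(\<integral>x. \<bar>?d (x - s *\<^sub>R i) * g x\<bar> \<partial>lborel) \<le> C' * (\<integral>x. \<bar>g x\<bar> \<partial>lborel)" by simp
            moreover have "0 \<le> (\<integral>x. \<bar>?d (x - s *\<^sub>R i) * g x\<bar> \<partial>lborel)" by simp
            ultimately show "norm (\<integral>x. norm (case (s, x) of (s, x) \<Rightarrow> indicator {0..t} s * (?d (x - s *\<^sub>R i) * g x)) \<partial>lborel)
              \<le> norm (indicator {0..t} s * (C' * (\<integral>x. \<bar>g x\<bar> \<partial>lborel)))"
              using C'[of undefined] by (cases "s \<in> {0..t}") (auto simp: abs_mult)
          qed
        qed measurable
      qed measurable
      have "(\<integral>s. indicator {0..t} s * (\<integral>x. ?d (x - s *\<^sub>R i) * g x \<partial>lborel) \<partial>lborel) =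
          (\<integral>x. (\<integral>s. indicator {0..t} s * (?d (x - s *\<^sub>R i) * g x) \<partial>lborel) \<partial>lborel)"
        using lborel_pair.Fubini_integral[OF P] by simp
      also have "\<dots> = (\<integral>x. (\<integral>s. indicator {0..t} s * ?d (x - s *\<^sub>R i) \<partial>lborel) * g x \<partial>lborel)"
        by (simp add: mult.assoc[symmetric])
      also have "\<dots> = (\<integral>x. (\<phi> x - \<phi> (x - t *\<^sub>R i)) * g x \<partial>lborel)"
        using t by (simp add: test_function_line_integral[OF \<phi>])
      finally show ?thesis .
    qed
    finally have H: "(\<integral>x. \<phi> x * seg_int h i x t \<partial>lborel) = - (\<integral>x. (\<phi> x - \<phi> (x - t *\<^sub>R i)) * g x \<partial>lborel)" .
    have S: "(\<integral>x. \<phi> x * g (x + t *\<^sub>R i) \<partial>lborel) = (\<integral>x. \<phi> (x - t *\<^sub>R i) * g x \<partial>lborel)"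
      using integral_lborel_shift[of "\<lambda>x. \<phi> (x - t *\<^sub>R i) * g x" "t *\<^sub>R i"] by simp
    have i1: "integrable lborel (\<lambda>x. \<phi> x * g (x + t *\<^sub>R i))"
      using integrable_bounded_mult[OF integrable_lborel_shift[OF g] _ C] by simp
    have i2: "integrable lborel (\<lambda>x. \<phi> x * g x)"
      using integrable_bounded_mult[OF g _ C] by simp
    have i3: "integrable lborel (\<lambda>x. \<phi> (x - t *\<^sub>R i) * g x)"
      using C by (intro integrable_bounded_mult[OF g]) auto
    have i4: "integrable lborel (\<lambda>x. \<phi> x * seg_int h i x t)"
      by (rule seg_int_mult_integral(1)[OF h _ C]) measurable
    have "(\<integral>x. \<phi> x * u x \<partial>lborel) = (\<integral>x. \<phi> x * g (x + t *\<^sub>R i) - \<phi> x * g x - \<phi> x * seg_int h i x t \<partial>lborel)"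
      by (simp add: u_def algebra_simps)
    also have "\<dots> = 0"
      using i1 i2 i3 i4 H S by (simp add: left_diff_distrib)
    finally show "(\<integral>x. \<phi> x * u x \<partial>lborel) = 0" .
  qed
  then show "AE x in lborel. x \<in> box a b \<longrightarrow> x + t *\<^sub>R i \<in> box a b \<longrightarrow> g (x + t *\<^sub>R i) - g x = seg_int h i x t"
    by eventually_elim (use box_shift[OF i t] in \<open>auto simp: u_def\<close>)
qed

lemma seg_int_measurable:
  assumes [measurable]: "h \<in> borel_measurable borel"
  shows "(\<lambda>(s, x). seg_int h i x s) \<in> borel_measurable (lborel \<Otimes>\<^sub>M lborel)"
proof -
  have "(\<lambda>(p, r). (if 0 \<le> r \<and> r \<le> fst p then 1 else 0) * h (snd p + r *\<^sub>R i))
      \<in> borel_measurable ((lborel \<Otimes>\<^sub>M lborel) \<Otimes>\<^sub>M lborel)"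
    by measurable
  from lborel.borel_measurable_lebesgue_integral[OF this]
  show ?thesis by (simp add: seg_int_def case_prod_unfold indicator_def)
qed

lemma seg_int_measurable1 [measurable]:
  assumes [measurable]: "h \<in> borel_measurable borel"
  shows "(\<lambda>x. seg_int h i x t) \<in> borel_measurable borel"
proof -
  have "(\<lambda>(x, r). indicator {0..t} r * h (x + r *\<^sub>R i)) \<in> borel_measurable (lborel \<Otimes>\<^sub>M lborel)"
    by measurable
  from lborel.borel_measurable_lebesgue_integral[OF this]
  show ?thesis by (simp add: seg_int_def)
qed

text \<open>Exchanging the two quantifiers: for almost every starting point the identity holds for
  almost all lengths at once. The exchange needs \<open>seg_int\<close> to be measurable jointly in
  point and length.\<close>

lemma line_deriv_AE:
  fixes g h :: "'a::euclidean_space \<Rightarrow> real"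
  assumes l: "line_deriv (box a b) i g h"
    and [measurable]: "g \<in> borel_measurable borel" "h \<in> borel_measurable borel"
  shows "AE x in lborel. AE s in lborel. 0 < s \<longrightarrow> x \<in> box a b \<longrightarrow> x + s *\<^sub>R i \<in> box a b \<longrightarrow>
     g (x + s *\<^sub>R i) - g x = seg_int h i x s"
proof -
  let ?P = "\<lambda>s x. 0 < s \<longrightarrow> x \<in> box a b \<longrightarrow> x + s *\<^sub>R i \<in> box a b \<longrightarrow>
     g (x + s *\<^sub>R i) - g x = seg_int h i x s"
  have "AE s in lborel. AE x in lborel. ?P s x"
  proof (rule AE_I2)
    show "AE x in lborel. ?P s x" for s
      using l by (cases "0 < s") (auto simp: line_deriv_def)
  qed
  also have "?this \<longleftrightarrow> ?thesis"
  proof (rule lborel_pair.AE_commute)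
    have [measurable]: "(\<lambda>p. seg_int h i (snd p) (fst p)) \<in> borel_measurable (lborel \<Otimes>\<^sub>M lborel)"
      using seg_int_measurable[of h i] by (simp add: case_prod_unfold)
    show "{p \<in> space (lborel \<Otimes>\<^sub>M lborel). ?P (fst p) (snd p)} \<in> sets (lborel \<Otimes>\<^sub>M lborel)"
      by measurable
  qed
  finally show ?thesis .
qed

lemma seg_AE_integrable:
  fixes h :: "'a::euclidean_space \<Rightarrow> real"
  assumes h: "integrable lborel h"
  shows "AE x in lborel. integrable lborel (\<lambda>s. indicator {0..t} s * h (x + s *\<^sub>R i))"
  using lborel_pair.AE_integrable_snd[OF seg_integrable_pair[OF h, of "\<lambda>_. 1" 1 t i]] by simp

text \<open>Integration by parts for indefinite integrals. The product of the totals is a double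
  integral over the plane, which is split into the halves \<open>r \<le> s\<close> and
  \<open>s \<le> r\<close>; the diagonal is counted twice and is null.\<close>

lemma integral_product_rule:
  fixes \<alpha> \<beta> :: "real \<Rightarrow> real"
  assumes \<alpha>: "integrable lborel \<alpha>" and \<beta>: "integrable lborel \<beta>"
  defines "A \<equiv> \<lambda>s. \<integral>r. indicator {..s} r * \<alpha> r \<partial>lborel" and "B \<equiv> \<lambda>s. \<integral>r. indicator {..s} r * \<beta> r \<partial>lborel"
  shows "(\<integral>s. \<alpha> s \<partial>lborel) * (\<integral>s. \<beta> s \<partial>lborel) = (\<integral>s. \<alpha> s * B s + A s * \<beta> s \<partial>lborel)"
    and "integrable lborel (\<lambda>s. \<alpha> s * B s + A s * \<beta> s)"
proof -
  have [measurable]: "\<alpha> \<in> borel_measurable borel" "\<beta> \<in> borel_measurable borel" using \<alpha> \<beta> by auto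
  have bd: "integrable lborel (\<lambda>r. indicator {..s} r * \<beta> r)" "integrable lborel (\<lambda>r. indicator {..s} r * \<alpha> r)" for s :: real
    using integrable_mult_indicator[OF _ \<beta>, of "{..s}"] integrable_mult_indicator[OF _ \<alpha>, of "{..s}"] by auto
  have prod: "integrable (lborel \<Otimes>\<^sub>M lborel) (\<lambda>(s, r). k s r * (\<alpha> s * \<beta> r))"
    if [measurable]: "(\<lambda>(s, r). k s r) \<in> borel_measurable (lborel \<Otimes>\<^sub>M lborel)" and k: "\<And>s r. \<bar>k s r :: real\<bar> \<le> 1" for k
  proof -
    have "integrable (lborel \<Otimes>\<^sub>M lborel) (\<lambda>(s, r). \<alpha> s * \<beta> r)"
      by (rule lborel_pair.Fubini_integrable) (use \<alpha> \<beta> in \<open>auto simp: abs_mult\<close>)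
    then show ?thesis
      using integrable_bounded_mult[of "lborel \<Otimes>\<^sub>M lborel" "\<lambda>(s, r). \<alpha> s * \<beta> r" "\<lambda>(s, r). k s r" 1] k
      by (simp add: case_prod_unfold)
  qed
  let ?I = "\<lambda>s r :: real. indicator {..s} r :: real" and ?J = "\<lambda>s r :: real. indicator {..r} s :: real"
  have mI[measurable]: "(\<lambda>(s, r). ?I s r) \<in> borel_measurable (lborel \<Otimes>\<^sub>M lborel)"
  proof -
    have "(\<lambda>(s, r). ?I s r) = (\<lambda>p. if snd p \<le> fst p then 1 else 0 :: real)" by (auto simp: indicator_def fun_eq_iff)
    then show ?thesis by (rule ssubst) measurable
  qed
  have mJ[measurable]: "(\<lambda>(s, r). ?J s r) \<in> borel_measurable (lborel \<Otimes>\<^sub>M lborel)"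
  proof -
    have "(\<lambda>(s, r). ?J s r) = (\<lambda>p. if fst p \<le> snd p then 1 else 0 :: real)" by (auto simp: indicator_def fun_eq_iff)
    then show ?thesis by (rule ssubst) measurable
  qed
  have PI: "integrable (lborel \<Otimes>\<^sub>M lborel) (\<lambda>(s, r). ?I s r * (\<alpha> s * \<beta> r))" by (rule prod[OF mI]) auto
  have PJ: "integrable (lborel \<Otimes>\<^sub>M lborel) (\<lambda>(s, r). ?J s r * (\<alpha> s * \<beta> r))" by (rule prod[OF mJ]) auto
  have eI: "(\<integral>r. ?I s r * (\<alpha> s * \<beta> r) \<partial>lborel) = \<alpha> s * B s" for s
    unfolding B_def by (simp add: mult.left_commute[of _ "\<alpha> s"])
  have eJ: "(\<integral>s. ?J s r * (\<alpha> s * \<beta> r) \<partial>lborel) = A r * \<beta> r" for r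
    unfolding A_def by (simp add: mult.assoc[symmetric])
  have i1: "integrable lborel (\<lambda>s. \<alpha> s * B s)" using lborel_pair.integrable_fst[OF PI] by (simp add: eI)
  have i2: "integrable lborel (\<lambda>s. A s * \<beta> s)" using lborel_pair.integrable_snd[OF PJ] by (simp add: eJ)
  show "integrable lborel (\<lambda>s. \<alpha> s * B s + A s * \<beta> s)" using i1 i2 by simp
  have "(\<integral>s. \<alpha> s * B s + A s * \<beta> s \<partial>lborel) = (\<integral>s. \<alpha> s * B s \<partial>lborel) + (\<integral>s. A s * \<beta> s \<partial>lborel)"
    using i1 i2 by simp
  also have "(\<integral>s. A s * \<beta> s \<partial>lborel) = (\<integral>s. (\<integral>r. ?J s r * (\<alpha> s * \<beta> r) \<partial>lborel) \<partial>lborel)"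
    using lborel_pair.Fubini_integral[OF PJ] by (simp add: eJ)
  also have "(\<integral>s. \<alpha> s * B s \<partial>lborel) + \<dots> = (\<integral>s. (\<integral>r. ?I s r * (\<alpha> s * \<beta> r) \<partial>lborel) + (\<integral>r. ?J s r * (\<alpha> s * \<beta> r) \<partial>lborel) \<partial>lborel)"
    using lborel_pair.integrable_fst[OF PI] lborel_pair.integrable_fst[OF PJ]
    by (subst Bochner_Integration.integral_add) (auto simp: eI)
  also have "\<dots> = (\<integral>s. \<alpha> s * (\<integral>r. \<beta> r \<partial>lborel) \<partial>lborel)"
  proof (rule Bochner_Integration.integral_cong[OF refl])
    fix s :: real
    have iJ: "integrable lborel (\<lambda>r. ?J s r * (\<alpha> s * \<beta> r))"
      by (rule integrable_bounded_mult[where C=1]) (use \<beta> in \<open>auto simp: indicator_def\<close>)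
    have iI: "integrable lborel (\<lambda>r. ?I s r * (\<alpha> s * \<beta> r))"
      by (rule integrable_bounded_mult[where C=1]) (use \<beta> in auto)
    have "(\<integral>r. ?I s r * (\<alpha> s * \<beta> r) \<partial>lborel) + (\<integral>r. ?J s r * (\<alpha> s * \<beta> r) \<partial>lborel) =
        (\<integral>r. ?I s r * (\<alpha> s * \<beta> r) + ?J s r * (\<alpha> s * \<beta> r) \<partial>lborel)"
      using iI iJ by simp
    also have "\<dots> = (\<integral>r. \<alpha> s * \<beta> r \<partial>lborel)"
    proof (rule integral_cong_AE)
      show "AE r in lborel. ?I s r * (\<alpha> s * \<beta> r) + ?J s r * (\<alpha> s * \<beta> r) = \<alpha> s * \<beta> r"
        using AE_lborel_singleton[of s] by eventually_elim (auto simp: indicator_def)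
    qed (use iI iJ \<beta> in auto)
    finally show "(\<integral>r. ?I s r * (\<alpha> s * \<beta> r) \<partial>lborel) + (\<integral>r. ?J s r * (\<alpha> s * \<beta> r) \<partial>lborel) = \<alpha> s * (\<integral>r. \<beta> r \<partial>lborel)"
      by simp
  qed
  finally show "(\<integral>s. \<alpha> s \<partial>lborel) * (\<integral>s. \<beta> s \<partial>lborel) = (\<integral>s. \<alpha> s * B s + A s * \<beta> s \<partial>lborel)" by simp
qed

lemma line_deriv_mult:
  fixes g1 g2 h1 h2 :: "'a::euclidean_space \<Rightarrow> real"
  assumes i: "i \<in> Basis"
    and int: "integrable lborel g1" "integrable lborel h1" "integrable lborel g2" "integrable lborel h2"
    and l1: "line_deriv (box a b) i g1 h1" and l2: "line_deriv (box a b) i g2 h2"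
  shows "line_deriv (box a b) i (\<lambda>x. g1 x * g2 x) (\<lambda>x. h1 x * g2 x + g1 x * h2 x)"
  unfolding line_deriv_def
proof (intro allI impI)
  fix t :: real assume t: "0 < t"
  have [measurable]: "g1 \<in> borel_measurable borel" "h1 \<in> borel_measurable borel"
    "g2 \<in> borel_measurable borel" "h2 \<in> borel_measurable borel" using int by auto
  have "AE x in lborel. x \<in> box a b \<longrightarrow> x + t *\<^sub>R i \<in> box a b \<longrightarrow> g1 (x + t *\<^sub>R i) - g1 x = seg_int h1 i x t"
    "AE x in lborel. x \<in> box a b \<longrightarrow> x + t *\<^sub>R i \<in> box a b \<longrightarrow> g2 (x + t *\<^sub>R i) - g2 x = seg_int h2 i x t"
    using l1 l2 t by (auto simp: line_deriv_def)
  moreover have "AE x in lborel. AE s in lborel. 0 < s \<longrightarrow> x \<in> box a b \<longrightarrow> x + s *\<^sub>R i \<in> box a b \<longrightarrow>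
     g1 (x + s *\<^sub>R i) - g1 x = seg_int h1 i x s" "AE x in lborel. AE s in lborel. 0 < s \<longrightarrow> x \<in> box a b \<longrightarrow> x + s *\<^sub>R i \<in> box a b \<longrightarrow>
     g2 (x + s *\<^sub>R i) - g2 x = seg_int h2 i x s"
    by (rule line_deriv_AE[OF l1] line_deriv_AE[OF l2]; measurable)+
  moreover have "AE x in lborel. integrable lborel (\<lambda>s. indicator {0..t} s * h1 (x + s *\<^sub>R i))"
    "AE x in lborel. integrable lborel (\<lambda>s. indicator {0..t} s * h2 (x + s *\<^sub>R i))"
    using seg_AE_integrable int by auto
  ultimately show "AE x in lborel. x \<in> box a b \<longrightarrow> x + t *\<^sub>R i \<in> box a b \<longrightarrow>
      g1 (x + t *\<^sub>R i) * g2 (x + t *\<^sub>R i) - g1 x * g2 x = seg_int (\<lambda>x. h1 x * g2 x + g1 x * h2 x) i x t"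
  proof eventually_elim
    case (elim x)
    show ?case
    proof (intro impI)
      assume x: "x \<in> box a b" "x + t *\<^sub>R i \<in> box a b"
      define \<alpha> where "\<alpha> s = indicator {0..t} s * h1 (x + s *\<^sub>R i)" for s
      define \<beta> where "\<beta> s = indicator {0..t} s * h2 (x + s *\<^sub>R i)" for s
      define A where "A s = (\<integral>r. indicator {..s} r * \<alpha> r \<partial>lborel)" for s
      define B where "B s = (\<integral>r. indicator {..s} r * \<beta> r \<partial>lborel)" for s
      have ab: "integrable lborel \<alpha>" "integrable lborel \<beta>" using elim by (auto simp: \<alpha>_def[abs_def] \<beta>_def[abs_def])
      have [measurable]: "\<alpha> \<in> borel_measurable borel" "\<beta> \<in> borel_measurable borel" using ab by auto
      have "integrable lborel (\<lambda>s. \<alpha> s * B s + A s * \<beta> s)"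
        using integral_product_rule(2)[OF ab] by (simp add: A_def B_def)
      have tot: "(\<integral>s. \<alpha> s \<partial>lborel) = seg_int h1 i x t" "(\<integral>s. \<beta> s \<partial>lborel) = seg_int h2 i x t"
        by (simp_all add: seg_int_def \<alpha>_def \<beta>_def)
      have As: "A s = seg_int h1 i x s" "B s = seg_int h2 i x s" if "s \<in> {0..t}" for s
        unfolding A_def B_def \<alpha>_def \<beta>_def seg_int_def using that
        by (auto intro!: Bochner_Integration.integral_cong simp: indicator_def)
      \<comment> \<open>Along the line both functions are a starting value plus an indefinite
        integral. What remains is the product rule for \<open>\<alpha>\<close> and
        \<open>\<beta>\<close> and two terms linear in them.\<close>
      have "seg_int (\<lambda>x. h1 x * g2 x + g1 x * h2 x) i x t =
          (\<integral>s. (\<alpha> s * B s + A s * \<beta> s) + (g2 x * \<alpha> s + g1 x * \<beta> s) \<partial>lborel)"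
        unfolding seg_int_def
      proof (rule integral_cong_AE)
        have "AE s in lborel. s \<noteq> (0::real)" by (rule AE_lborel_singleton)
        with elim(3,4) show "AE s in lborel. indicator {0..t} s * (h1 (x + s *\<^sub>R i) * g2 (x + s *\<^sub>R i) + g1 (x + s *\<^sub>R i) * h2 (x + s *\<^sub>R i)) =
            (\<alpha> s * B s + A s * \<beta> s) + (g2 x * \<alpha> s + g1 x * \<beta> s)"
        proof eventually_elim
          case (elim s)
          show ?case
          proof (cases "s \<in> {0..t}")
            case True
            then have "x + s *\<^sub>R i \<in> box a b" using box_segment[OF i x] by auto
            then have "g1 (x + s *\<^sub>R i) = g1 x + A s" "g2 (x + s *\<^sub>R i) = g2 x + B s"
              using elim True x As[OF True] by auto
            then show ?thesis using True by (simp add: \<alpha>_def \<beta>_def algebra_simps)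
          qed (simp add: \<alpha>_def \<beta>_def)
        qed
        show "(\<lambda>s. \<alpha> s * B s + A s * \<beta> s + (g2 x * \<alpha> s + g1 x * \<beta> s)) \<in> borel_measurable lborel"
          using \<open>integrable lborel (\<lambda>s. \<alpha> s * B s + A s * \<beta> s)\<close> ab by auto
      qed measurable
      also have "\<dots> = seg_int h1 i x t * seg_int h2 i x t + g2 x * seg_int h1 i x t + g1 x * seg_int h2 i x t"
        using \<open>integrable lborel (\<lambda>s. \<alpha> s * B s + A s * \<beta> s)\<close> ab integral_product_rule(1)[OF ab] tot
        by (simp add: A_def B_def)
      also have "\<dots> = g1 (x + t *\<^sub>R i) * g2 (x + t *\<^sub>R i) - g1 x * g2 x"
      proof -
        have e: "g1 (x + t *\<^sub>R i) = g1 x + seg_int h1 i x t" "g2 (x + t *\<^sub>R i) = g2 x + seg_int h2 i x t"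
          using elim(1,2) x by auto
        show ?thesis unfolding e by (simp add: algebra_simps)
      qed
      finally show "g1 (x + t *\<^sub>R i) * g2 (x + t *\<^sub>R i) - g1 x * g2 x = seg_int (\<lambda>x. h1 x * g2 x + g1 x * h2 x) i x t" by simp
    qed
  qed
qed

text \<open>The line identity for a small length \<open>T\<close> is tested against
  \<open>\<phi>\<close>. Shifting the increment onto \<open>\<phi>\<close> gives difference
  quotients of \<open>\<phi>\<close> on one side and an average over
  \<open>0 \<le> s \<le> T\<close> of integrals against \<open>h\<close> on the other; the weak
  identity is the limit as \<open>T\<close> tends to 0.\<close>

lemma line_imp_weak_deriv:
  fixes g h :: "'a::euclidean_space \<Rightarrow> real"
  assumes i: "i \<in> Basis" and g: "integrable lborel g" and h: "integrable lborel h"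
    and l: "line_deriv (box a b) i g h"
  shows "weak_deriv (box a b) i g h"
  unfolding weak_deriv_def
proof (intro allI impI)
  fix \<phi> assume \<phi>: "test_function (box a b) \<phi>"
  have [measurable]: "g \<in> borel_measurable borel" "h \<in> borel_measurable borel" using g h by auto
  have [measurable]: "\<phi> \<in> borel_measurable borel" using test_function_borel[OF \<phi>] .
  obtain C where C: "\<And>x. \<bar>\<phi> x\<bar> \<le> C" using test_function_bounded[OF \<phi>] by metis
  let ?d = "\<lambda>x. frechet_derivative \<phi> (at x) i"
  have d: "test_function (box a b) ?d" using test_function_derivative(2)[OF \<phi>] .
  have [measurable]: "?d \<in> borel_measurable borel" using test_function_borel[OF d] .
  obtain C' where C': "\<And>x. \<bar>?d x\<bar> \<le> C'" using test_function_bounded[OF d] by metis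
  have \<phi>c: "continuous_on UNIV \<phi>" using \<phi> by (auto simp: test_function_smooth intro: smooth_on_continuous)
  obtain K where K: "compact K" "K \<subseteq> box a b" "\<And>x. x \<notin> K \<Longrightarrow> \<phi> x = 0"
    using \<phi> by (auto simp: test_function_smooth)
  obtain \<delta> where \<delta>: "0 < \<delta>" "\<And>x y. x \<in> K \<Longrightarrow> dist x y < \<delta> \<Longrightarrow> y \<in> box a b"
  proof -
    have "\<exists>\<delta>>0. \<forall>x\<in>K. \<forall>y\<in>- box a b. \<delta> \<le> dist x y"
      using separate_compact_closed[of K "- box a b"] K by auto
    then show ?thesis using that by (metis ComplI linorder_not_le)
  qed
  \<comment> \<open>The denominators start at 2, so every \<open>T n\<close> is strictly below
    \<open>\<delta>\<close> and moving a point of \<open>K\<close> by \<open>T n\<close> never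
    leaves the box.\<close>
  define T where "T n = \<delta> / real (n + 2)" for n
  have T: "0 < T n" "T n < \<delta>" for n
    using \<delta>(1) mult_strict_left_mono[of 1 "real (n + 2)" \<delta>] by (simp_all add: T_def pos_divide_less_eq)
  have Tlim: "T \<longlonglongrightarrow> 0"
    unfolding T_def using LIMSEQ_ignore_initial_segment[OF lim_const_over_n, of \<delta> 2] .
  define \<Psi> where "\<Psi> s = (\<integral>x. \<phi> (x - s *\<^sub>R i) * h x \<partial>lborel)" for s
  have \<Psi>c: "continuous_on UNIV \<Psi>"
    unfolding continuous_on_sequentially
  proof (intro allI ballI impI)
    fix S :: "nat \<Rightarrow> real" and s0 :: real assume S: "(\<forall>n. S n \<in> UNIV) \<and> S \<longlonglongrightarrow> s0"
    have "(\<lambda>n. \<integral>x. \<phi> (x - S n *\<^sub>R i) * h x \<partial>lborel) \<longlonglongrightarrow> (\<integral>x. \<phi> (x - s0 *\<^sub>R i) * h x \<partial>lborel)"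
    proof (rule integral_dominated_convergence[where w="\<lambda>x. C * \<bar>h x\<bar>"])
      show "integrable lborel (\<lambda>x. C * \<bar>h x\<bar>)" using h by simp
      show "AE x in lborel. norm (\<phi> (x - S n *\<^sub>R i) * h x) \<le> C * \<bar>h x\<bar>" for n
        using C by (auto simp: abs_mult intro!: mult_right_mono)
      show "AE x in lborel. (\<lambda>n. \<phi> (x - S n *\<^sub>R i) * h x) \<longlonglongrightarrow> \<phi> (x - s0 *\<^sub>R i) * h x"
      proof (rule AE_I2, rule tendsto_mult_right)
        fix x
        have "(\<lambda>n. x - S n *\<^sub>R i) \<longlonglongrightarrow> x - s0 *\<^sub>R i" using S by (intro tendsto_intros) auto
        then show "(\<lambda>n. \<phi> (x - S n *\<^sub>R i)) \<longlonglongrightarrow> \<phi> (x - s0 *\<^sub>R i)"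
          by (rule continuous_on_tendsto_compose[OF \<phi>c]) auto
      qed
    qed measurable
    then show "(\<Psi> \<circ> S) \<longlonglongrightarrow> \<Psi> s0" by (simp add: \<Psi>_def o_def)
  qed
  have eq: "(\<integral>x. (\<phi> (x - T n *\<^sub>R i) - \<phi> x) * g x \<partial>lborel) = (\<integral>s. indicator {0..T n} s * \<Psi> s \<partial>lborel)" for n
  proof -
    have i1: "integrable lborel (\<lambda>x. \<phi> x * g (x + T n *\<^sub>R i))"
      using integrable_bounded_mult[OF integrable_lborel_shift[OF g] _ C] by simp
    have i2: "integrable lborel (\<lambda>x. \<phi> x * g x)"
      using integrable_bounded_mult[OF g _ C] by simp
    have i3: "integrable lborel (\<lambda>x. \<phi> (x - T n *\<^sub>R i) * g x)"
      using C by (intro integrable_bounded_mult[OF g]) auto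
    have "(\<integral>x. (\<phi> (x - T n *\<^sub>R i) - \<phi> x) * g x \<partial>lborel) = (\<integral>x. \<phi> (x - T n *\<^sub>R i) * g x \<partial>lborel) - (\<integral>x. \<phi> x * g x \<partial>lborel)"
      using i2 i3 by (simp add: left_diff_distrib)
    also have "(\<integral>x. \<phi> (x - T n *\<^sub>R i) * g x \<partial>lborel) = (\<integral>x. \<phi> x * g (x + T n *\<^sub>R i) \<partial>lborel)"
      using integral_lborel_shift[of "\<lambda>x. \<phi> (x - T n *\<^sub>R i) * g x" "T n *\<^sub>R i"] by simp
    also have "\<dots> - (\<integral>x. \<phi> x * g x \<partial>lborel) = (\<integral>x. \<phi> x * g (x + T n *\<^sub>R i) - \<phi> x * g x \<partial>lborel)"
      using i1 i2 by simp
    also have "\<dots> = (\<integral>x. \<phi> x * seg_int h i x (T n) \<partial>lborel)"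
    proof (rule integral_cong_AE)
      have "AE x in lborel. x \<in> box a b \<longrightarrow> x + T n *\<^sub>R i \<in> box a b \<longrightarrow> g (x + T n *\<^sub>R i) - g x = seg_int h i x (T n)"
        using l T by (auto simp: line_deriv_def)
      then show "AE x in lborel. \<phi> x * g (x + T n *\<^sub>R i) - \<phi> x * g x = \<phi> x * seg_int h i x (T n)"
      proof eventually_elim
        case (elim x)
        show ?case
        proof (cases "x \<in> K")
          case True
          then have "x \<in> box a b" "x + T n *\<^sub>R i \<in> box a b"
            using K \<delta>(2)[of x "x + T n *\<^sub>R i"] T[of n] i by (auto simp: dist_norm)
          then show ?thesis using elim by (simp add: right_diff_distrib[symmetric])
        qed (simp add: K)
      qed
    qed (use i1 i2 in measurable)
    also have "\<dots> = (\<integral>s. indicator {0..T n} s * \<Psi> s \<partial>lborel)"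
      unfolding \<Psi>_def by (rule seg_int_mult_integral(2)[OF h _ C]) measurable
    finally show ?thesis .
  qed
  have L: "(\<lambda>n. \<integral>x. ((\<phi> (x - T n *\<^sub>R i) - \<phi> x) / T n) * g x \<partial>lborel) \<longlonglongrightarrow> (\<integral>x. - ?d x * g x \<partial>lborel)"
  proof (rule integral_dominated_convergence[where w="\<lambda>x. C' * \<bar>g x\<bar>"])
    show "integrable lborel (\<lambda>x. C' * \<bar>g x\<bar>)" using g by simp
    show "AE x in lborel. norm ((\<phi> (x - T n *\<^sub>R i) - \<phi> x) / T n * g x) \<le> C' * \<bar>g x\<bar>" for n
    proof (rule AE_I2)
      fix x
      have "\<bar>\<phi> (x - T n *\<^sub>R i) - \<phi> x\<bar> = \<bar>\<integral>s. indicator {0..T n} s * ?d (x - s *\<^sub>R i) \<partial>lborel\<bar>"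
        using test_function_line_integral[OF \<phi>, of "T n" x i] T[of n] by simp
      also have "\<dots> \<le> (\<integral>s. indicator {0..T n} s * C' \<partial>lborel)"
      proof (rule order_trans[OF integral_abs_bound])
        show "(\<integral>s. \<bar>indicator {0..T n} s * ?d (x - s *\<^sub>R i)\<bar> \<partial>lborel) \<le> (\<integral>s. indicator {0..T n} s * C' \<partial>lborel)"
        proof (rule integral_mono')
          show "integrable lborel (\<lambda>s. indicator {0..T n} s * C')"
            using T[of n] by (intro integrable_mult_left) (auto simp: emeasure_lborel_Icc_eq)
          show "\<bar>indicator {0..T n} s * ?d (x - s *\<^sub>R i)\<bar> \<le> indicator {0..T n} s * C'" for s
            using C' by (auto simp: indicator_def)
        qed (use order_trans[OF abs_ge_zero C'] in auto)
      qed
      also have "\<dots> = T n * C'" using T[of n] by simp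
      finally have "\<bar>\<phi> (x - T n *\<^sub>R i) - \<phi> x\<bar> / T n \<le> C'" using T[of n] by (simp add: pos_divide_le_eq mult.commute)
      from mult_right_mono[OF this abs_ge_zero[of "g x"]]
      show "norm ((\<phi> (x - T n *\<^sub>R i) - \<phi> x) / T n * g x) \<le> C' * \<bar>g x\<bar>"
        using T[of n] by (simp add: abs_mult)
    qed
    show "AE x in lborel. (\<lambda>n. (\<phi> (x - T n *\<^sub>R i) - \<phi> x) / T n * g x) \<longlonglongrightarrow> - ?d x * g x"
    proof (rule AE_I2, rule tendsto_mult_right)
      fix x
      have D: "(\<phi> has_derivative frechet_derivative \<phi> (at (x - 0 *\<^sub>R i))) (at (x - 0 *\<^sub>R i))"
        using test_function_derivative(1)[OF \<phi>] .
      have "((\<lambda>s. x - s *\<^sub>R i) has_derivative (\<lambda>r. - (r *\<^sub>R i))) (at 0)"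
        by (auto intro!: derivative_eq_intros)
      note D' = has_derivative_compose[OF this D]
      have "times (- ?d x) = (\<lambda>r. - (r * ?d x))" by (auto simp: fun_eq_iff)
      then have "((\<lambda>s. \<phi> (x - s *\<^sub>R i)) has_real_derivative - ?d x) (at 0)"
        using linear_neg[OF has_derivative_linear[OF D]] linear_cmul[OF has_derivative_linear[OF D]]
D'
        by (simp add: has_field_derivative_def)
      then have "((\<lambda>s. (\<phi> (x - s *\<^sub>R i) - \<phi> x) / s) \<longlongrightarrow> - ?d x) (at 0)"
        by (simp add: DERIV_def)
      moreover have "filterlim T (at 0) sequentially"
        using Tlim T(1) by (auto simp: filterlim_at less_imp_neq[THEN not_sym] eventually_sequentially)
      ultimately show "(\<lambda>n. (\<phi> (x - T n *\<^sub>R i) - \<phi> x) / T n) \<longlonglongrightarrow> - ?d x"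
        by (rule filterlim_compose)
    qed
  qed measurable
  \<comment> \<open>The average of a continuous function over a shrinking interval tends to its
    value at the end point 0.\<close>
  have R: "(\<lambda>n. (\<integral>s. indicator {0..T n} s * \<Psi> s \<partial>lborel) / T n) \<longlonglongrightarrow> \<Psi> 0"
  proof (rule LIMSEQ_I)
    fix e :: real assume e: "0 < e"
    obtain r where r: "0 < r" "\<And>s. \<bar>s\<bar> < r \<Longrightarrow> \<bar>\<Psi> s - \<Psi> 0\<bar> < e / 2"
      using \<Psi>c e unfolding continuous_on_iff dist_real_def by (metis UNIV_I diff_zero half_gt_zero)
    obtain N where N: "\<And>n. N \<le> n \<Longrightarrow> T n < r"
      using LIMSEQ_D[OF Tlim r(1)] T(1) by (metis abs_of_pos diff_zero real_norm_def)
    have int: "integrable lborel (\<lambda>s. indicator {0..T n} s * \<Psi> s)" for n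
      unfolding \<Psi>_def by (rule seg_int_mult_integral(3)[OF h _ C]) measurable
    have "norm ((\<integral>s. indicator {0..T n} s * \<Psi> s \<partial>lborel) / T n - \<Psi> 0) < e" if n: "N \<le> n" for n
    proof -
      have ic: "integrable lborel (\<lambda>s. indicator {0..T n} s * c)" for c :: real
        by (intro integrable_mult_left) (auto simp: emeasure_lborel_Icc_eq)
      have "(\<integral>s. indicator {0..T n} s * \<Psi> s \<partial>lborel) - T n * \<Psi> 0 =
          (\<integral>s. indicator {0..T n} s * \<Psi> s \<partial>lborel) - (\<integral>s. indicator {0..T n} s * \<Psi> 0 \<partial>lborel)"
        using T[of n] by simp
      also have "\<dots> = (\<integral>s. indicator {0..T n} s * \<Psi> s - indicator {0..T n} s * \<Psi> 0 \<partial>lborel)"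
        using int ic by (intro Bochner_Integration.integral_diff[symmetric])
      finally have "\<bar>(\<integral>s. indicator {0..T n} s * \<Psi> s \<partial>lborel) - T n * \<Psi> 0\<bar> \<le>
          (\<integral>s. \<bar>indicator {0..T n} s * \<Psi> s - indicator {0..T n} s * \<Psi> 0\<bar> \<partial>lborel)"
        using integral_abs_bound by metis
      also have "\<dots> \<le> (\<integral>s. indicator {0..T n} s * (e / 2) \<partial>lborel)"
      proof (rule integral_mono'[OF ic])
        fix s
        show "\<bar>indicator {0..T n} s * \<Psi> s - indicator {0..T n} s * \<Psi> 0\<bar> \<le> indicator {0..T n} s * (e / 2)"
          using r(2)[of s] N[OF n] by (auto simp: indicator_def)
        show "0 \<le> indicator {0..T n} s * (e / 2)" using e by auto
      qed
      also have "\<dots> = T n * (e / 2)" using T[of n] by simp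
      also have "\<dots> < T n * e" using T(1)[of n] e by simp
      finally have "\<bar>(\<integral>s. indicator {0..T n} s * \<Psi> s \<partial>lborel) - T n * \<Psi> 0\<bar> / T n < e"
        using T(1)[of n] by (simp add: pos_divide_less_eq mult.commute)
      moreover have "(\<integral>s. indicator {0..T n} s * \<Psi> s \<partial>lborel) / T n - \<Psi> 0 =
          ((\<integral>s. indicator {0..T n} s * \<Psi> s \<partial>lborel) - T n * \<Psi> 0) / T n"
        using T(1)[of n] by (simp add: diff_divide_distrib)
      ultimately show ?thesis using T(1)[of n] by simp
    qed
    then show "\<exists>no. \<forall>n\<ge>no. norm ((\<integral>s. indicator {0..T n} s * \<Psi> s \<partial>lborel) / T n - \<Psi> 0) < e" by blast
  qed
  have "(\<integral>x. ((\<phi> (x - T n *\<^sub>R i) - \<phi> x) / T n) * g x \<partial>lborel) = (\<integral>s. indicator {0..T n} s * \<Psi> s \<partial>lborel) / T n" for n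
    unfolding eq[symmetric] by simp
  from LIMSEQ_unique[OF L[unfolded this] R] have "(\<integral>x. - ?d x * g x \<partial>lborel) = \<Psi> 0" .
  then show "(\<integral>x. ?d x * g x \<partial>lborel) = - (\<integral>x. \<phi> x * h x \<partial>lborel)"
    by (simp add: \<Psi>_def)
qed

section \<open>Sobolev classes\<close>

lemma Lp_on_cong: "(\<And>x. x \<in> \<Omega> \<Longrightarrow> g x = h x) \<Longrightarrow> Lp_on p \<Omega> g \<longleftrightarrow> Lp_on p \<Omega> h"
  unfolding Lp_on_def set_integrable_def
  by (intro conj_cong measurable_cong Bochner_Integration.integrable_cong) (auto simp: indicator_def)

lemma weak_partial_cong:
  assumes "\<And>x. x \<in> \<Omega> \<Longrightarrow> g x = g' x" "\<And>x. x \<in> \<Omega> \<Longrightarrow> h x = h' x"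
  shows "weak_partial \<Omega> i g h \<longleftrightarrow> weak_partial \<Omega> i g' h'"
proof -
  have "(LINT x:\<Omega>|lebesgue. k x *\<^sub>R g x) = (LINT x:\<Omega>|lebesgue. k x *\<^sub>R g' x)"
    "(LINT x:\<Omega>|lebesgue. k x *\<^sub>R h x) = (LINT x:\<Omega>|lebesgue. k x *\<^sub>R h' x)" for k :: "'a \<Rightarrow> real"
    using assms unfolding set_lebesgue_integral_def
    by (auto intro!: Bochner_Integration.integral_cong simp: indicator_def)
  then show ?thesis unfolding weak_partial_def by simp
qed

lemma sobolev_cong: "(\<And>x. x \<in> \<Omega> \<Longrightarrow> g x = h x) \<Longrightarrow> sobolev k p \<Omega> g \<longleftrightarrow> sobolev k p \<Omega> h"
  using Lp_on_cong[of \<Omega> g h p] weak_partial_cong[of \<Omega> g h] by (cases k) auto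

lemma sobolev_Lp: "sobolev k p \<Omega> g \<Longrightarrow> Lp_on p \<Omega> g"
  by (cases k) auto

lemma sobolev_SucD: "sobolev (Suc k) p \<Omega> g \<Longrightarrow> sobolev k p \<Omega> g"
proof (induction k arbitrary: g)
  case (Suc k)
  then show ?case unfolding sobolev.simps(2)[of "Suc k"] sobolev.simps(2)[of k] by blast
qed auto

lemma Lp_on_measurable:
  assumes "open \<Omega>" "Lp_on p \<Omega> g"
  shows "(\<lambda>x. indicator \<Omega> x *\<^sub>R g x) \<in> borel_measurable lebesgue"
  using assms borel_measurable_restrict_space_iff[of \<Omega> lebesgue g] by (simp add: Lp_on_def)

lemma Lp_on_subset:
  assumes "open \<Omega>'" "\<Omega>' \<subseteq> \<Omega>" "Lp_on p \<Omega> g"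
  shows "Lp_on p \<Omega>' g"
  unfolding Lp_on_def
proof
  show "g \<in> borel_measurable (lebesgue_on \<Omega>')"
    using assms measurable_restrict_mono unfolding Lp_on_def by blast
  show "set_integrable lebesgue \<Omega>' (\<lambda>x. norm (g x) powr p)"
    using assms set_integrable_subset unfolding Lp_on_def by (metis lborelD borel_open sets_completionI_sets sets_lborel)
qed

lemma weak_partial_subset:
  assumes "\<Omega>' \<subseteq> \<Omega>" "weak_partial \<Omega> i g h"
  shows "weak_partial \<Omega>' i g h"
  unfolding weak_partial_def
proof (intro allI impI)
  fix \<phi> assume \<phi>: "test_function \<Omega>' \<phi>"
  have eq: "(LINT x:\<Omega>'|lebesgue. \<psi> x *\<^sub>R u x) = (LINT x:\<Omega>|lebesgue. \<psi> x *\<^sub>R u x)"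
    if "test_function \<Omega>' \<psi>" for \<psi> and u :: "'a \<Rightarrow> 'b"
  proof -
    have "\<psi> x = 0" if "x \<notin> \<Omega>'" for x using \<open>test_function \<Omega>' \<psi>\<close> that by (auto simp: test_function_def)
    then show ?thesis using assms(1)
      unfolding set_lebesgue_integral_def by (intro Bochner_Integration.integral_cong) (auto simp: indicator_def)
  qed
  have "test_function \<Omega> \<phi>" using \<phi> assms(1) by (rule test_function_mono)
  then show "(LINT x:\<Omega>'|lebesgue. frechet_derivative \<phi> (at x) i *\<^sub>R g x) = - (LINT x:\<Omega>'|lebesgue. \<phi> x *\<^sub>R h x)"
    using assms(2) eq[OF \<phi>] eq[OF test_function_derivative(2)[OF \<phi>]] by (simp add: weak_partial_def)
qed

lemma sobolev_subset:
  assumes "open \<Omega>'" "\<Omega>' \<subseteq> \<Omega>" "sobolev k p \<Omega> g"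
  shows "sobolev k p \<Omega>' g"
  using assms(3)
proof (induction k arbitrary: g)
  case 0
  then show ?case using Lp_on_subset[OF assms(1,2)] by simp
next
  case (Suc k)
  then show ?case
    using Lp_on_subset[OF assms(1,2)] weak_partial_subset[OF assms(2)] unfolding sobolev.simps by blast
qed

lemma norm_le_1_powr: "1 \<le> p \<Longrightarrow> 0 \<le> y \<Longrightarrow> y \<le> 1 + y powr (p::real)"
  using ge_one_powr_ge_zero[of y p] powr_mono[of 1 p y] by (cases "1 \<le> y") (auto simp: add_increasing2)

text \<open>\<open>\<Omega>\<close> may have infinite measure, so the domination of
  \<open>|g|\<close> by \<open>1 + |g| powr p\<close> is used on the compact support of the test
  function only.\<close>

lemma Lp_on_test_integrable:
  fixes g :: "'a::euclidean_space \<Rightarrow> 'c::euclidean_space"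
  assumes "open \<Omega>" "1 \<le> p" "Lp_on p \<Omega> g" and \<psi>: "test_function \<Omega> \<psi>"
  shows "set_integrable lebesgue \<Omega> (\<lambda>x. \<psi> x *\<^sub>R g x)"
proof -
  obtain C where C: "\<And>x. \<bar>\<psi> x\<bar> \<le> C" "0 \<le> C" using test_function_bounded[OF \<psi>] by metis
  obtain K where K: "compact K" "K \<subseteq> \<Omega>" "\<And>x. x \<notin> K \<Longrightarrow> \<psi> x = 0"
    using \<psi> by (auto simp: test_function_def)
  have [measurable]: "(\<lambda>x. indicator \<Omega> x *\<^sub>R g x) \<in> borel_measurable lebesgue"
    using Lp_on_measurable assms by blast
  have [measurable]: "\<psi> \<in> borel_measurable lebesgue"
    using test_function_borel[OF \<psi>] by (intro measurable_completion) simp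
  have meas: "(\<lambda>x. \<psi> x *\<^sub>R (indicator \<Omega> x *\<^sub>R g x)) \<in> borel_measurable lebesgue" by measurable
  have int: "integrable lebesgue (\<lambda>x. C * (indicator K x + indicator \<Omega> x * norm (g x) powr p))"
  proof (intro integrable_mult_right Bochner_Integration.integrable_add)
    show "integrable lebesgue (indicator K :: 'a \<Rightarrow> real)"
      using lmeasurable_compact[OF K(1)] by (intro integrable_real_indicator) (auto simp: fmeasurable_def)
    show "integrable lebesgue (\<lambda>x. indicator \<Omega> x * norm (g x) powr p)"
      using assms(3) by (simp add: Lp_on_def set_integrable_def)
  qed
  show ?thesis
    unfolding set_integrable_def
  proof (rule Bochner_Integration.integrable_bound[OF int])
    show "(\<lambda>x. indicator \<Omega> x *\<^sub>R \<psi> x *\<^sub>R g x) \<in> borel_measurable lebesgue"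
      using meas by (simp add: mult.commute)
    show "AE x in lebesgue. norm (indicator \<Omega> x *\<^sub>R \<psi> x *\<^sub>R g x) \<le> norm (C * (indicator K x + indicator \<Omega> x * norm (g x) powr p))"
    proof (rule AE_I2)
      fix x
      show "norm (indicator \<Omega> x *\<^sub>R \<psi> x *\<^sub>R g x) \<le> norm (C * (indicator K x + indicator \<Omega> x * norm (g x) powr p))"
      proof (cases "x \<in> K")
        case True
        have "\<bar>\<psi> x\<bar> * norm (g x) \<le> C * (1 + norm (g x) powr p)"
          using C norm_le_1_powr[OF assms(2), of "norm (g x)"] by (intro mult_mono) auto
        then show ?thesis using True K(2) C(2) by (auto simp: subset_iff)
      qed (simp add: K)
    qed
  qed
qed

lemma Lp_on_linear:
  assumes L: "bounded_linear L" and p: "0 \<le> p" and \<Omega>: "open \<Omega>" and g: "Lp_on p \<Omega> g"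
  shows "Lp_on p \<Omega> (\<lambda>x. L (g x))"
proof -
  obtain K where K: "0 < K" "\<And>x. norm (L x) \<le> norm x * K"
    using bounded_linear.pos_bounded[OF L] by blast
  have Lm: "L \<in> borel_measurable borel"
    using L by (intro borel_measurable_continuous_onI bounded_linear.continuous_on[OF L]) (auto intro: continuous_on_id)
  have meas: "(\<lambda>x. L (g x)) \<in> borel_measurable (lebesgue_on \<Omega>)"
    using g measurable_compose[OF _ Lm] by (auto simp: Lp_on_def)
  have "set_integrable lebesgue \<Omega> (\<lambda>x. norm (L (g x)) powr p)"
  proof (rule set_integrable_bound[where f="\<lambda>x. K powr p * norm (g x) powr p"])
    show "set_integrable lebesgue \<Omega> (\<lambda>x. K powr p * norm (g x) powr p)"
      using g by (auto simp: Lp_on_def)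
    show "set_borel_measurable lebesgue \<Omega> (\<lambda>x. norm (L (g x)) powr p)"
      unfolding set_borel_measurable_def
      using meas \<Omega> by (subst borel_measurable_restrict_space_iff[symmetric]) auto
    have "norm (L (g x)) powr p \<le> (norm (g x) * K) powr p" for x
      using K p by (intro powr_mono2) auto
    then show "AE x in lebesgue. x \<in> \<Omega> \<longrightarrow> norm (norm (L (g x)) powr p) \<le> norm (K powr p * norm (g x) powr p)"
      using K by (auto simp: powr_mult mult.commute)
  qed
  with meas show ?thesis by (simp add: Lp_on_def)
qed

lemma Lp_on_add:
  assumes p: "0 \<le> p" and \<Omega>: "open \<Omega>" and g: "Lp_on p \<Omega> g" and h: "Lp_on p \<Omega> h"
  shows "Lp_on p \<Omega> (\<lambda>x. g x + h x)"
proof -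
  have meas: "(\<lambda>x. g x + h x) \<in> borel_measurable (lebesgue_on \<Omega>)"
    using g h by (auto simp: Lp_on_def)
  have "set_integrable lebesgue \<Omega> (\<lambda>x. norm (g x + h x) powr p)"
  proof (rule set_integrable_bound[where f="\<lambda>x. 2 powr p * (norm (g x) powr p + norm (h x) powr p)"])
    show "set_integrable lebesgue \<Omega> (\<lambda>x. 2 powr p * (norm (g x) powr p + norm (h x) powr p))"
      using g h by (auto simp: Lp_on_def)
    show "set_borel_measurable lebesgue \<Omega> (\<lambda>x. norm (g x + h x) powr p)"
      unfolding set_borel_measurable_def
      using meas \<Omega> by (subst borel_measurable_restrict_space_iff[symmetric]) auto
    have "norm (g x + h x) powr p \<le> 2 powr p * (norm (g x) powr p + norm (h x) powr p)" for x
    proof -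
      have "norm (g x + h x) \<le> 2 * max (norm (g x)) (norm (h x))"
        using norm_triangle_ineq[of "g x" "h x"] by linarith
      then have "norm (g x + h x) powr p \<le> (2 * max (norm (g x)) (norm (h x))) powr p"
        using p by (intro powr_mono2) auto
      also have "\<dots> = 2 powr p * max (norm (g x)) (norm (h x)) powr p"
        by (rule powr_mult; simp add: le_max_iff_disj)
      also have "max (norm (g x)) (norm (h x)) powr p \<le> norm (g x) powr p + norm (h x) powr p"
        by (simp add: max_def)
      finally show ?thesis by simp
    qed
    then show "AE x in lebesgue. x \<in> \<Omega> \<longrightarrow> norm (norm (g x + h x) powr p) \<le> norm (2 powr p * (norm (g x) powr p + norm (h x) powr p))"
      by auto
  qed
  with meas show ?thesis by (simp add: Lp_on_def)
qed

lemma weak_partial_linear: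
  assumes L: "bounded_linear L" and "open \<Omega>" "1 \<le> p" "Lp_on p \<Omega> g" "Lp_on p \<Omega> h" "weak_partial \<Omega> i g h"
  shows "weak_partial \<Omega> i (\<lambda>x. L (g x)) (\<lambda>x. L (h x))"
  unfolding weak_partial_def
proof (intro allI impI)
  fix \<phi> assume \<phi>: "test_function \<Omega> \<phi>"
  interpret L: bounded_linear L by fact
  have eq: "(LINT x:\<Omega>|lebesgue. \<psi> x *\<^sub>R L (u x)) = L (LINT x:\<Omega>|lebesgue. \<psi> x *\<^sub>R u x)"
    if "test_function \<Omega> \<psi>" "Lp_on p \<Omega> u" for \<psi> u
  proof -
    have "integrable lebesgue (\<lambda>x. indicator \<Omega> x *\<^sub>R \<psi> x *\<^sub>R u x)"
      using Lp_on_test_integrable[OF assms(2,3) that(2,1)] by (simp add: set_integrable_def)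
    from integral_bounded_linear[OF L this] show ?thesis
      by (simp add: set_lebesgue_integral_def L.scaleR)
  qed
  show "(LINT x:\<Omega>|lebesgue. frechet_derivative \<phi> (at x) i *\<^sub>R L (g x)) = - (LINT x:\<Omega>|lebesgue. \<phi> x *\<^sub>R L (h x))"
    using assms(6) \<phi> eq[OF test_function_derivative(2)[OF \<phi>] assms(4)] eq[OF \<phi> assms(5)]
    by (simp add: weak_partial_def linear_neg[OF bounded_linear.linear[OF L]])
qed

lemma weak_partial_add:
  assumes "open \<Omega>" "1 \<le> p" "Lp_on p \<Omega> g" "Lp_on p \<Omega> h" "Lp_on p \<Omega> g'" "Lp_on p \<Omega> h'"
    and "weak_partial \<Omega> i g h" "weak_partial \<Omega> i g' h'"
  shows "weak_partial \<Omega> i (\<lambda>x. g x + g' x) (\<lambda>x. h x + h' x)"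
  unfolding weak_partial_def
proof (intro allI impI)
  fix \<phi> assume \<phi>: "test_function \<Omega> \<phi>"
  have eq: "(LINT x:\<Omega>|lebesgue. \<psi> x *\<^sub>R (u x + u' x)) = (LINT x:\<Omega>|lebesgue. \<psi> x *\<^sub>R u x) + (LINT x:\<Omega>|lebesgue. \<psi> x *\<^sub>R u' x)"
    if "test_function \<Omega> \<psi>" "Lp_on p \<Omega> u" "Lp_on p \<Omega> u'" for \<psi> and u u' :: "'a \<Rightarrow> 'b"
    unfolding scaleR_add_right
    using Lp_on_test_integrable[OF assms(1,2) that(2,1)] Lp_on_test_integrable[OF assms(1,2) that(3,1)]
    by (rule set_integral_add(2))
  show "(LINT x:\<Omega>|lebesgue. frechet_derivative \<phi> (at x) i *\<^sub>R (g x + g' x)) = - (LINT x:\<Omega>|lebesgue. \<phi> x *\<^sub>R (h x + h' x))"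
    using assms(7,8) \<phi> eq[OF test_function_derivative(2)[OF \<phi>] assms(3,5)] eq[OF \<phi> assms(4,6)]
    by (simp add: weak_partial_def)
qed

lemma sobolev_linear:
  assumes L: "bounded_linear L" and \<Omega>: "open \<Omega>" "1 \<le> p" and "sobolev k p \<Omega> g"
  shows "sobolev k p \<Omega> (\<lambda>x. L (g x))"
  using assms(4)
proof (induction k arbitrary: g)
  case 0
  then show ?case using Lp_on_linear[OF L _ \<Omega>(1), of p g] \<Omega>(2) by simp
next
  case (Suc k)
  have "\<exists>h. weak_partial \<Omega> i (\<lambda>x. L (g x)) h \<and> sobolev k p \<Omega> h" if i: "i \<in> Basis" for i
  proof -
    obtain h where h: "weak_partial \<Omega> i g h" "sobolev k p \<Omega> h" using Suc.prems i by auto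
    show ?thesis
      using weak_partial_linear[OF L \<Omega> sobolev_Lp[OF Suc.prems] sobolev_Lp[OF h(2)] h(1)] Suc.IH[OF h(2)] by blast
  qed
  moreover have "Lp_on p \<Omega> (\<lambda>x. L (g x))"
    using Lp_on_linear[OF L _ \<Omega>(1) sobolev_Lp[OF Suc.prems]] \<Omega>(2) by simp
  ultimately show ?case by simp
qed

lemma sobolev_add:
  assumes \<Omega>: "open \<Omega>" "1 \<le> p" and "sobolev k p \<Omega> g" "sobolev k p \<Omega> h"
  shows "sobolev k p \<Omega> (\<lambda>x. g x + h x)"
  using assms(3,4)
proof (induction k arbitrary: g h)
  case 0
  then show ?case using Lp_on_add[OF _ \<Omega>(1), of p g h] \<Omega>(2) by simp
next
  case (Suc k)
  have "\<exists>u. weak_partial \<Omega> i (\<lambda>x. g x + h x) u \<and> sobolev k p \<Omega> u" if i: "i \<in> Basis" for i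
  proof -
    obtain g' where g': "weak_partial \<Omega> i g g'" "sobolev k p \<Omega> g'" using Suc.prems i by auto
    obtain h' where h': "weak_partial \<Omega> i h h'" "sobolev k p \<Omega> h'" using Suc.prems i by auto
    show ?thesis
      using weak_partial_add[OF \<Omega> _ _ _ _ g'(1) h'(1)] sobolev_Lp Suc.prems g'(2) h'(2) Suc.IH by blast
  qed
  moreover have "Lp_on p \<Omega> (\<lambda>x. g x + h x)"
    using Lp_on_add[OF _ \<Omega>(1) sobolev_Lp[OF Suc.prems(1)] sobolev_Lp[OF Suc.prems(2)]] \<Omega>(2) by simp
  ultimately show ?case by simp
qed

section \<open>Constants and products with smooth functions in Sobolev classes\<close>

lemma test_function_integrable:
  fixes \<psi> :: "'a::euclidean_space \<Rightarrow> real"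
  assumes \<psi>: "test_function \<Omega> \<psi>"
  shows "integrable lborel \<psi>"
proof -
  obtain K where K: "compact K" "\<And>x. x \<notin> K \<Longrightarrow> \<psi> x = 0" using \<psi> by (auto simp: test_function_def)
  have "continuous_on K \<psi>" using \<psi>
    by (auto simp: test_function_smooth intro: smooth_on_continuous continuous_on_subset)
  from borel_integrable_compact[OF K(1) this] have "integrable lborel (\<lambda>x. indicator K x *\<^sub>R \<psi> x)" .
  moreover have "(\<lambda>x. indicator K x *\<^sub>R \<psi> x) = \<psi>" using K(2) by (auto simp: indicator_def fun_eq_iff)
  ultimately show ?thesis by simp
qed

text \<open>The integral of \<open>\<phi> (x + i) - \<phi> x\<close> is 0 by translation invariance;
  by the fundamental theorem of calculus on unit segments it is also the integral of the
  derivative.\<close>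

lemma test_function_integral_derivative:
  assumes \<phi>: "test_function (\<Omega> :: 'a::euclidean_space set) \<phi>" and i: "i \<in> Basis"
  shows "(\<integral>x. frechet_derivative \<phi> (at x) i \<partial>lborel) = 0"
proof -
  let ?d = "\<lambda>x. frechet_derivative \<phi> (at x) i"
  have d: "test_function \<Omega> ?d" using test_function_derivative(2)[OF \<phi>] .
  note \<phi>i = test_function_integrable[OF \<phi>] and di = test_function_integrable[OF d]
  have [measurable]: "\<phi> \<in> borel_measurable borel" "?d \<in> borel_measurable borel"
    using test_function_borel \<phi> d by auto
  have "(\<integral>x. seg_int ?d i x 1 \<partial>lborel) = (\<integral>s. indicator {0..1::real} s * (\<integral>x. ?d x \<partial>lborel) \<partial>lborel)"
    using seg_int_mult_integral(2)[OF di, of "\<lambda>_. 1" 1 i 1] by simp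
  also have "\<dots> = (\<integral>x. ?d x \<partial>lborel)" by simp
  also have "(\<integral>x. seg_int ?d i x 1 \<partial>lborel) = (\<integral>x. \<phi> (x + i) - \<phi> x \<partial>lborel)"
  proof (rule Bochner_Integration.integral_cong[OF refl])
    fix x
    \<comment> \<open>The reflection of \<open>s\<close> to \<open>1 - s\<close> matches the
      orientation of \<open>test_function_line_integral\<close>, which runs backwards from its base
      point.\<close>
    have "(\<integral>s. indicator {0..1} s * ?d (x + s *\<^sub>R i) \<partial>lborel) =
        (\<integral>s. indicator {0..1} (1 - s) * ?d (x + (1 - s) *\<^sub>R i) \<partial>lborel)"
      by (subst lborel_integral_real_affine[where c="-1" and t=1]) auto
    also have "\<dots> = (\<integral>s. indicator {0..1} s * ?d ((x + i) - s *\<^sub>R i) \<partial>lborel)"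
      by (rule Bochner_Integration.integral_cong) (auto simp: indicator_def algebra_simps)
    also have "\<dots> = \<phi> (x + i) - \<phi> x"
      using test_function_line_integral[OF \<phi>, of 1 "x + i" i] by simp
    finally show "seg_int ?d i x 1 = \<phi> (x + i) - \<phi> x" by (simp add: seg_int_def)
  qed
  also have "\<dots> = 0"
    using \<phi>i integrable_lborel_shift[OF \<phi>i, of i] integral_lborel_shift[of \<phi> i] by simp
  finally show ?thesis by simp
qed

lemma sobolev_const:
  fixes c :: "'c::euclidean_space" and \<Omega> :: "'a::euclidean_space set"
  assumes \<Omega>: "open \<Omega>" "bounded \<Omega>"
  shows "sobolev k p \<Omega> (\<lambda>x. c)"
proof (induction k arbitrary: c)
  case 0
  have "emeasure lborel \<Omega> < \<infinity>" using emeasure_bounded_finite[OF \<Omega>(2)] .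
  then have "set_integrable lebesgue \<Omega> (\<lambda>x. norm c powr p)"
    using \<Omega> unfolding set_integrable_def by (intro integrable_scaleR_left) (auto intro!: integrable_real_indicator)
  then show ?case by (simp add: Lp_on_def)
next
  case (Suc k)
  have "weak_partial \<Omega> i (\<lambda>x. c) (\<lambda>x. 0)" if i: "i \<in> Basis" for i
    unfolding weak_partial_def
  proof (intro allI impI)
    fix \<phi> assume \<phi>: "test_function \<Omega> \<phi>"
    let ?d = "\<lambda>x. frechet_derivative \<phi> (at x) i"
    have d: "test_function \<Omega> ?d" using test_function_derivative(2)[OF \<phi>] .
    have "(LINT x:\<Omega>|lebesgue. ?d x *\<^sub>R c) = (LINT x|lebesgue. ?d x *\<^sub>R c)"
      unfolding set_lebesgue_integral_def using d
      by (intro Bochner_Integration.integral_cong) (auto simp: test_function_def indicator_def)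
    also have "\<dots> = (\<integral>x. ?d x *\<^sub>R c \<partial>lborel)"
      using test_function_borel[OF d] by (intro integral_completion) simp
    also have "\<dots> = 0"
      using test_function_integral_derivative[OF \<phi> i] test_function_integrable[OF d] by simp
    finally show "(LINT x:\<Omega>|lebesgue. ?d x *\<^sub>R c) = - (LINT x:\<Omega>|lebesgue. \<phi> x *\<^sub>R 0)" by simp
  qed
  moreover have "Lp_on p \<Omega> (\<lambda>x. c)" using Suc[of c] sobolev_Lp by blast
  ultimately show ?case using Suc[of 0] by auto
qed

text \<open>Smoothness on an open set does not control the derivatives near its boundary, whereas a
  factor preserving L^p should be bounded; the bounds are therefore recorded separately. The
  derivatives are not taken within \<open>\<Omega>\<close>, so the predicate is meant for open
  sets.\<close>

primrec bounded_derivs :: "nat \<Rightarrow> 'a::euclidean_space set \<Rightarrow> ('a \<Rightarrow> real) \<Rightarrow> bool" where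
  "bounded_derivs 0 \<Omega> s \<longleftrightarrow> bounded (s ` \<Omega>)"
| "bounded_derivs (Suc k) \<Omega> s \<longleftrightarrow> bounded (s ` \<Omega>) \<and>
     (\<forall>i\<in>Basis. bounded_derivs k \<Omega> (\<lambda>x. frechet_derivative s (at x) i))"

lemma bounded_derivs_bounded: "bounded_derivs k \<Omega> s \<Longrightarrow> bounded (s ` \<Omega>)"
  by (cases k) auto

lemma bounded_derivs_SucD: "bounded_derivs (Suc k) \<Omega> s \<Longrightarrow> bounded_derivs k \<Omega> s"
  by (induction k arbitrary: s) auto

lemma bounded_derivs_subset: "bounded_derivs k \<Omega> s \<Longrightarrow> \<Omega>' \<subseteq> \<Omega> \<Longrightarrow> bounded_derivs k \<Omega>' s"
  by (induction k arbitrary: s) (auto intro: bounded_subset image_mono)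

lemma bounded_derivs_cong:
  assumes "open \<Omega>" "\<And>x. x \<in> \<Omega> \<Longrightarrow> s x = s' x"
  shows "bounded_derivs k \<Omega> s \<longleftrightarrow> bounded_derivs k \<Omega> s'"
  using assms(2)
proof (induction k arbitrary: s s')
  case 0
  then have "s ` \<Omega> = s' ` \<Omega>" by auto
  then show ?case by simp
next
  case (Suc k)
  have eq: "frechet_derivative s (at x) = frechet_derivative s' (at x)" if x: "x \<in> \<Omega>" for x
  proof -
    have "(s has_derivative D) (at x) = (s' has_derivative D) (at x)" for D
      using has_derivative_transform_within_open[OF _ assms(1) x] Suc.prems by metis
    then show ?thesis by (simp add: frechet_derivative_def)
  qed
  have im: "s ` \<Omega> = s' ` \<Omega>" using Suc.prems by auto
  have "bounded_derivs k \<Omega> (\<lambda>x. frechet_derivative s (at x) i) \<longleftrightarrow>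
      bounded_derivs k \<Omega> (\<lambda>x. frechet_derivative s' (at x) i)" for i
    by (rule Suc.IH) (simp only: eq)
  then show ?case unfolding bounded_derivs.simps im by blast
qed

text \<open>Smoothness reaches up to the points of \<open>X\<close> on the boundary: each derivative
  within \<open>X\<close> is continuous at \<open>x\<close>, hence bounded near \<open>x\<close>,
  and on the interior it is the ordinary derivative.\<close>

lemma bounded_derivs_local:
  assumes X: "full_domain X" and "smooth_on X s" and x: "x \<in> X"
  shows "\<exists>e>0. bounded_derivs k (interior (X \<inter> ball x e)) s"
  using assms(2)
proof (induction k arbitrary: s)
  case 0
  obtain e where e: "0 < e" "\<And>y. y \<in> X \<Longrightarrow> dist y x < e \<Longrightarrow> dist (s y) (s x) < 1"
    using smooth_on_continuous[OF 0] x unfolding continuous_on_iff by (metis zero_less_one)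
  have "s ` interior (X \<inter> ball x e) \<subseteq> ball (s x) 1"
    using e(2) interior_subset[of "X \<inter> ball x e"] by (auto simp: dist_commute)
  then have "bounded (s ` interior (X \<inter> ball x e))" using bounded_ball bounded_subset by blast
  then show ?case using e(1) by auto
next
  case (Suc k)
  let ?s = "\<lambda>i x. frechet_derivative s (at x within X) i"
  have "\<exists>e>0. bounded_derivs k (interior (X \<inter> ball x e)) (?s i)" for i
    using Suc.IH smooth_on_derivative(2)[OF X Suc.prems] by blast
  then obtain r where r: "\<And>i. 0 < r i" "\<And>i. bounded_derivs k (interior (X \<inter> ball x (r i))) (?s i)" by metis
  obtain r0 where r0: "0 < r0" "bounded_derivs k (interior (X \<inter> ball x r0)) s"
    using Suc.IH[OF Suc.prems] by blast
  define e where "e = min r0 (Min (r ` Basis))"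
  have e: "0 < e" "e \<le> r0" "\<And>i. i \<in> Basis \<Longrightarrow> e \<le> r i"
    using r(1) r0(1) by (auto simp: e_def intro: min.coboundedI2)
  let ?\<Omega> = "interior (X \<inter> ball x e)"
  have "bounded (s ` ?\<Omega>)"
    using r0(2) e(2) by (intro bounded_derivs_bounded[OF bounded_derivs_subset]) (auto intro!: interior_mono)
  moreover have "bounded_derivs k ?\<Omega> (\<lambda>x. frechet_derivative s (at x) i)" if i: "i \<in> Basis" for i
  proof -
    have "bounded_derivs k ?\<Omega> (?s i)"
      using r(2)[of i] by (rule bounded_derivs_subset) (use e(3)[OF i] in \<open>auto intro!: interior_mono\<close>)
    moreover have "?s i y = frechet_derivative s (at y) i" if "y \<in> ?\<Omega>" for y
    proof -
      have "y \<in> interior X" using that by (metis interior_Int IntD1)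
      then show ?thesis by (simp add: at_within_interior[of y X])
    qed
    ultimately show ?thesis
      using bounded_derivs_cong[OF open_interior, of "X \<inter> ball x e" "?s i" "\<lambda>x. frechet_derivative s (at x) i"]
      by blast
  qed
  ultimately show ?case using e(1) by auto
qed

lemma Lp_on_mult:
  assumes "open \<Omega>" "0 \<le> p" "continuous_on \<Omega> s" "bounded (s ` \<Omega>)" "Lp_on p \<Omega> g"
  shows "Lp_on p \<Omega> (\<lambda>x. (s x :: real) *\<^sub>R g x)"
proof -
  have sm: "s \<in> borel_measurable (lebesgue_on \<Omega>)"
    using assms(1,3) by (intro continuous_imp_measurable_on_sets_lebesgue) auto
  then have meas: "(\<lambda>x. s x *\<^sub>R g x) \<in> borel_measurable (lebesgue_on \<Omega>)"
    using assms(5) by (auto simp: Lp_on_def)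
  obtain C where C: "\<And>x. x \<in> \<Omega> \<Longrightarrow> \<bar>s x\<bar> \<le> C" using assms(4) by (auto simp: bounded_iff)
  have "set_integrable lebesgue \<Omega> (\<lambda>x. norm (s x *\<^sub>R g x) powr p)"
  proof (rule set_integrable_bound[where f="\<lambda>x. C powr p * norm (g x) powr p"])
    show "set_integrable lebesgue \<Omega> (\<lambda>x. C powr p * norm (g x) powr p)"
      using assms(5) by (auto simp: Lp_on_def)
    have "(\<lambda>x. norm (s x *\<^sub>R g x) powr p) \<in> borel_measurable (lebesgue_on \<Omega>)"
      using meas by measurable
    then show "set_borel_measurable lebesgue \<Omega> (\<lambda>x. norm (s x *\<^sub>R g x) powr p)"
      unfolding set_borel_measurable_def
      using assms(1) by (subst borel_measurable_restrict_space_iff[symmetric]) auto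
    have "norm (s x *\<^sub>R g x) powr p \<le> C powr p * norm (g x) powr p" if "x \<in> \<Omega>" for x
    proof -
      have "norm (s x *\<^sub>R g x) powr p = \<bar>s x\<bar> powr p * norm (g x) powr p" by (simp add: powr_mult)
      also have "\<dots> \<le> C powr p * norm (g x) powr p"
        using C[OF that] assms(2) by (intro mult_right_mono powr_mono2) auto
      finally show ?thesis .
    qed
    then show "AE x in lebesgue. x \<in> \<Omega> \<longrightarrow> norm (norm (s x *\<^sub>R g x) powr p) \<le> norm (C powr p * norm (g x) powr p)"
      by auto
  qed
  with meas show ?thesis by (simp add: Lp_on_def)
qed

lemma smooth_on_open_derivative:
  assumes "open \<Omega>" "smooth_on \<Omega> s"
  shows "x \<in> \<Omega> \<Longrightarrow> (s has_derivative frechet_derivative s (at x)) (at x)"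
    and "smooth_on \<Omega> (\<lambda>x. frechet_derivative s (at x) i)"
proof -
  have w: "at x within \<Omega> = at x" if "x \<in> \<Omega>" for x using at_within_open[OF that assms(1)] .
  show "x \<in> \<Omega> \<Longrightarrow> (s has_derivative frechet_derivative s (at x)) (at x)"
    using smooth_on_derivative(1)[OF full_domain_open[OF assms(1)] assms(2), of x] w[of x] by simp
  show "smooth_on \<Omega> (\<lambda>x. frechet_derivative s (at x) i)"
    using smooth_on_derivative(2)[OF full_domain_open[OF assms(1)] assms(2), of i]
      smooth_on_cong[of \<Omega> "\<lambda>x. frechet_derivative s (at x within \<Omega>) i" "\<lambda>x. frechet_derivative s (at x) i"] w by simp
qed

text \<open>\<open>s\<close> is smooth on \<open>\<Omega>\<close> only. Off the compact support of
  \<open>\<phi>\<close> the product is 0, so its extension by 0 is smooth on the whole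
  space.\<close>

lemma test_function_mult:
  assumes \<Omega>: "open \<Omega>" and s: "smooth_on \<Omega> s" and \<phi>: "test_function \<Omega> \<phi>"
  shows "test_function \<Omega> (\<lambda>x. if x \<in> \<Omega> then s x * \<phi> x else 0)" (is "test_function _ ?\<psi>")
    and "x \<in> \<Omega> \<Longrightarrow> frechet_derivative (\<lambda>x. if x \<in> \<Omega> then s x * \<phi> x else 0) (at x) i =
      s x * frechet_derivative \<phi> (at x) i + frechet_derivative s (at x) i * \<phi> x"
proof -
  obtain K where K: "compact K" "K \<subseteq> \<Omega>" "\<And>x. x \<notin> K \<Longrightarrow> \<phi> x = 0" and sm: "smooth_on UNIV \<phi>"
    using \<phi> by (auto simp: test_function_smooth)
  have sm\<Omega>: "smooth_on \<Omega> ?\<psi>"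
  proof -
    have "smooth_on \<Omega> (\<lambda>x. s x * \<phi> x)"
      using s smooth_on_subset[OF sm] by (intro smooth_on_mult full_domain_open[OF \<Omega>]) auto
    then show ?thesis using smooth_on_cong[of \<Omega> "\<lambda>x. s x * \<phi> x" ?\<psi>] by simp
  qed
  have "smooth_on UNIV ?\<psi>"
  proof (rule smooth_on_local)
    fix x :: 'a
    show "\<exists>e>0. smooth_on (UNIV \<inter> ball x e) ?\<psi>"
    proof (cases "x \<in> \<Omega>")
      case True
      then obtain e where "0 < e" "ball x e \<subseteq> \<Omega>" using \<Omega> openE by blast
      then show ?thesis using smooth_on_subset[OF sm\<Omega>] by auto
    next
      case False
      then have "x \<in> - K" "open (- K)" using K compact_imp_closed by auto
      then obtain e where "0 < e" "ball x e \<subseteq> - K" using openE by blast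
      moreover from this have "smooth_on (ball x e) ?\<psi> \<longleftrightarrow> smooth_on (ball x e) (\<lambda>x. 0::real)"
        by (intro smooth_on_cong) (use K in auto)
      ultimately show ?thesis using smooth_on_const by auto
    qed
  qed simp
  then show "test_function \<Omega> ?\<psi>"
    unfolding test_function_smooth using K by auto
  show "frechet_derivative ?\<psi> (at x) i = s x * frechet_derivative \<phi> (at x) i + frechet_derivative s (at x) i * \<phi> x"
    if x: "x \<in> \<Omega>" for x
  proof -
    have "((\<lambda>x. s x * \<phi> x) has_derivative (\<lambda>v. s x * frechet_derivative \<phi> (at x) v + frechet_derivative s (at x) v * \<phi> x)) (at x)"
      by (intro has_derivative_mult smooth_on_open_derivative(1)[OF \<Omega> s x] test_function_derivative(1)[OF \<phi>])
    then have "(?\<psi> has_derivative (\<lambda>v. s x * frechet_derivative \<phi> (at x) v + frechet_derivative s (at x) v * \<phi> x)) (at x)"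
      by (rule has_derivative_transform_within_open[OF _ \<Omega> x]) simp
    from frechet_derivative_at[OF this] show ?thesis by metis
  qed
qed

text \<open>The weak identity for \<open>g\<close> is tested with \<open>s\<close> times
  \<open>\<phi>\<close>, and the Leibniz term containing the derivative of \<open>s\<close> is moved
  to the other side.\<close>

lemma weak_partial_mult:
  assumes \<Omega>: "open \<Omega>" "1 \<le> p" and s: "smooth_on \<Omega> s" and g: "Lp_on p \<Omega> g" "Lp_on p \<Omega> h" "weak_partial \<Omega> i g h"
  shows "weak_partial \<Omega> i (\<lambda>x. s x *\<^sub>R g x) (\<lambda>x. frechet_derivative s (at x) i *\<^sub>R g x + s x *\<^sub>R h x)"
  unfolding weak_partial_def
proof (intro allI impI)
  fix \<phi> assume \<phi>: "test_function \<Omega> \<phi>"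
  let ?ex = "\<lambda>(r :: 'a \<Rightarrow> real) (\<theta> :: 'a \<Rightarrow> real) x. if x \<in> \<Omega> then r x * \<theta> x else 0"
  let ?ds = "\<lambda>x. frechet_derivative s (at x) i" and ?d = "\<lambda>x. frechet_derivative \<phi> (at x) i"
  have ds: "smooth_on \<Omega> ?ds" using smooth_on_open_derivative(2)[OF \<Omega>(1) s] .
  have d: "test_function \<Omega> ?d" using test_function_derivative(2)[OF \<phi>] .
  note t1 = test_function_mult(1)[OF \<Omega>(1) s \<phi>] and t2 = test_function_mult(1)[OF \<Omega>(1) ds \<phi>]
    and t3 = test_function_mult(1)[OF \<Omega>(1) s d]
  have eq: "(LINT x:\<Omega>|lebesgue. u x) = (LINT x:\<Omega>|lebesgue. v x)" if "\<And>x. x \<in> \<Omega> \<Longrightarrow> u x = v x" for u v :: "'a \<Rightarrow> 'b"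
    unfolding set_lebesgue_integral_def using that
    by (intro Bochner_Integration.integral_cong) (auto simp: indicator_def)
  have "(LINT x:\<Omega>|lebesgue. ?ex s ?d x *\<^sub>R g x + ?ex ?ds \<phi> x *\<^sub>R g x) = - (LINT x:\<Omega>|lebesgue. ?ex s \<phi> x *\<^sub>R h x)"
  proof -
    have "(LINT x:\<Omega>|lebesgue. frechet_derivative (?ex s \<phi>) (at x) i *\<^sub>R g x) = - (LINT x:\<Omega>|lebesgue. ?ex s \<phi> x *\<^sub>R h x)"
      using g(3) t1 unfolding weak_partial_def by blast
    moreover have "(LINT x:\<Omega>|lebesgue. frechet_derivative (?ex s \<phi>) (at x) i *\<^sub>R g x) =
        (LINT x:\<Omega>|lebesgue. ?ex s ?d x *\<^sub>R g x + ?ex ?ds \<phi> x *\<^sub>R g x)"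
      by (rule eq) (simp add: test_function_mult(2)[OF \<Omega>(1) s \<phi>] scaleR_add_left)
    ultimately show ?thesis by simp
  qed
  moreover have "(LINT x:\<Omega>|lebesgue. ?ex s ?d x *\<^sub>R g x + ?ex ?ds \<phi> x *\<^sub>R g x) =
      (LINT x:\<Omega>|lebesgue. ?ex s ?d x *\<^sub>R g x) + (LINT x:\<Omega>|lebesgue. ?ex ?ds \<phi> x *\<^sub>R g x)"
    by (intro set_integral_add(2) Lp_on_test_integrable[OF \<Omega>] g t2 t3)
  moreover have "(LINT x:\<Omega>|lebesgue. ?ex ?ds \<phi> x *\<^sub>R g x + ?ex s \<phi> x *\<^sub>R h x) =
      (LINT x:\<Omega>|lebesgue. ?ex ?ds \<phi> x *\<^sub>R g x) + (LINT x:\<Omega>|lebesgue. ?ex s \<phi> x *\<^sub>R h x)"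
    by (intro set_integral_add(2) Lp_on_test_integrable[OF \<Omega>] g t1 t2)
  moreover have "(LINT x:\<Omega>|lebesgue. ?d x *\<^sub>R s x *\<^sub>R g x) = (LINT x:\<Omega>|lebesgue. ?ex s ?d x *\<^sub>R g x)"
    by (rule eq) (simp add: mult.commute)
  moreover have "(LINT x:\<Omega>|lebesgue. \<phi> x *\<^sub>R (?ds x *\<^sub>R g x + s x *\<^sub>R h x)) =
      (LINT x:\<Omega>|lebesgue. ?ex ?ds \<phi> x *\<^sub>R g x + ?ex s \<phi> x *\<^sub>R h x)"
    by (rule eq) (simp add: scaleR_add_right mult.commute)
  ultimately show "(LINT x:\<Omega>|lebesgue. ?d x *\<^sub>R s x *\<^sub>R g x) = - (LINT x:\<Omega>|lebesgue. \<phi> x *\<^sub>R (?ds x *\<^sub>R g x + s x *\<^sub>R h x))"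
    by (simp add: algebra_simps)
qed

lemma sobolev_mult:
  assumes \<Omega>: "open \<Omega>" "1 \<le> p" and "smooth_on \<Omega> s" "bounded_derivs k \<Omega> s" "sobolev k p \<Omega> g"
  shows "sobolev k p \<Omega> (\<lambda>x. s x *\<^sub>R g x)"
  using assms(3-5)
proof (induction k arbitrary: s g)
  case 0
  then show ?case
    using Lp_on_mult[OF \<Omega>(1) _ smooth_on_continuous[OF 0(1)], of p g] \<Omega>(2) by simp
next
  case (Suc k)
  have "\<exists>h. weak_partial \<Omega> i (\<lambda>x. s x *\<^sub>R g x) h \<and> sobolev k p \<Omega> h" if i: "i \<in> Basis" for i
  proof -
    obtain h where h: "weak_partial \<Omega> i g h" "sobolev k p \<Omega> h" using Suc.prems i by auto
    have "sobolev k p \<Omega> (\<lambda>x. frechet_derivative s (at x) i *\<^sub>R g x + s x *\<^sub>R h x)"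
    proof (intro sobolev_add[OF \<Omega>] Suc.IH h)
      show "smooth_on \<Omega> (\<lambda>x. frechet_derivative s (at x) i)"
        using smooth_on_open_derivative(2)[OF \<Omega>(1) Suc.prems(1)] .
      show "bounded_derivs k \<Omega> (\<lambda>x. frechet_derivative s (at x) i)" using Suc.prems(2) i by simp
      show "sobolev k p \<Omega> g" using sobolev_SucD[OF Suc.prems(3)] .
      show "smooth_on \<Omega> s" "bounded_derivs k \<Omega> s" using Suc.prems(1) bounded_derivs_SucD[OF Suc.prems(2)] by auto
    qed
    then show ?thesis
      using weak_partial_mult[OF \<Omega> Suc.prems(1) sobolev_Lp[OF Suc.prems(3)] sobolev_Lp[OF h(2)] h(1)] by blast
  qed
  moreover have "Lp_on p \<Omega> (\<lambda>x. s x *\<^sub>R g x)"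
    using Lp_on_mult[OF \<Omega>(1) _ smooth_on_continuous[OF Suc.prems(1)] bounded_derivs_bounded[OF Suc.prems(2)] sobolev_Lp[OF Suc.prems(3)]] \<Omega>(2) by simp
  ultimately show ?case by simp
qed

section \<open>Squares of Sobolev functions\<close>

lemma AE_lborel_shift:
  fixes c :: "'a::euclidean_space"
  assumes "AE x in lborel. P x"
  shows "AE x in lborel. P (x + c)"
proof -
  have "AE x in distr lborel borel ((+) c). P x" unfolding lborel_distr_plus using assms .
  from AE_distrD[OF _ this] show ?thesis by (simp add: add.commute)
qed

lemma AE_lborel_negligible:
  assumes "AE x in lborel. P x"
  shows "negligible {x. \<not> P x}"
proof -
  have "AE x in lebesgue. P x" using assms by (rule AE_completion)
  then obtain N where N: "{x \<in> space lebesgue. \<not> P x} \<subseteq> N" "emeasure lebesgue N = 0" "N \<in> sets lebesgue"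
    by (rule AE_E)
  have "N \<in> null_sets lebesgue" using N(2,3) by (rule null_setsI)
  then have "negligible N" unfolding negligible_iff_null_sets .
  moreover have "{x. \<not> P x} \<subseteq> N" using N(1) by simp
  ultimately show ?thesis by (rule negligible_subset)
qed

text \<open>On a line the iterated derivatives are Borel functions \<open>W m\<close>, each almost
  everywhere equal to an indefinite integral of the next. Replacing them by these integrals produces
  a classical chain \<open>v m\<close>, to which the one-dimensional inequality applies; the
  integrals do not see the change.\<close>

lemma line_gn_fiber:
  fixes W :: "nat \<Rightarrow> real \<Rightarrow> real" and \<zeta> :: "real \<Rightarrow> real"
  assumes n: "1 \<le> n" and L: "0 < L" and r: "0 < r" and Dc: "0 \<le> Dc"
    and gn: "\<forall>v w \<zeta> S. deriv_chain n v w 0 L \<longrightarrow> \<zeta> \<in> borel_measurable borel \<longrightarrow>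
     \<zeta> integrable_on {0..L} \<longrightarrow> (\<forall>t. 1 \<le> \<zeta> t) \<longrightarrow> negligible S \<longrightarrow>
     (\<forall>t\<in>{0..L} - S. \<bar>v 0 t\<bar> \<le> K * \<zeta> t powr e0) \<longrightarrow>
     (\<forall>t\<in>{0..L}. \<bar>w t\<bar> \<le> \<zeta> t powr e1) \<longrightarrow>
     integral {0..L} (\<lambda>t. \<bar>v 1 t\<bar> powr r) \<le> Dc * integral {0..L} \<zeta>"
    and W: "\<And>m. m \<le> Suc n \<Longrightarrow> integrable lborel (W m)"
    and rep: "\<And>m. m \<le> n \<Longrightarrow> AE t in lborel. 0 < t \<longrightarrow> t < L \<longrightarrow> W m t = C m + integral {0..t} (W (Suc m))"
    and z: "\<zeta> \<in> borel_measurable borel" "\<And>t. 1 \<le> \<zeta> t" "integrable lborel (\<lambda>t. indicator {0..L} t * \<zeta> t)"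
    and b0: "\<And>t. \<bar>W 0 t\<bar> \<le> K * \<zeta> t powr e0" and b1: "\<And>t. \<bar>W (Suc n) t\<bar> \<le> \<zeta> t powr e1"
  shows "(\<integral>\<^sup>+t. indicator {0..L} t * ennreal (\<bar>W 1 t\<bar> powr r) \<partial>lborel) \<le>
    ennreal Dc * (\<integral>\<^sup>+t. indicator {0..L} t * ennreal (\<zeta> t) \<partial>lborel)"
proof -
  define v where "v m t = C m + integral {0..t} (W (Suc m))" for m t
  have Wi: "W m absolutely_integrable_on {0..L}" if "m \<le> Suc n" for m
  proof -
    have "set_integrable lborel {0..L} (W m)"
      unfolding set_integrable_def using integrable_mult_indicator[OF _ W[OF that], of "{0..L}"] by simp
    then show ?thesis
      by (simp add: set_integrable_def integrable_completion borel_measurable_integrable)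
  qed
  have Wi': "W m integrable_on {0..L}" if "m \<le> Suc n" for m
    using Wi[OF that] by (rule set_lebesgue_integral_eq_integral(1))
  have vc: "continuous_on {0..L} (v m)" if "m \<le> n" for m
    unfolding v_def using Wi'[of "Suc m"] that
    by (intro continuous_intros indefinite_integral_continuous_1) auto
  \<comment> \<open>The representation is only known in the open interval, so the two end points
    join the exceptional set.\<close>
  define S where "S m = {t. \<not> (0 < t \<longrightarrow> t < L \<longrightarrow> W m t = v m t)} \<union> {0, L}" for m
  have S: "negligible (S m)" if "m \<le> n" for m
    unfolding S_def v_def using AE_lborel_negligible[OF rep[OF that]] by (intro negligible_Un) auto
  have WS: "W m t = v m t" if "t \<in> {0..L} - S m" for m t
    using that by (auto simp: S_def)
  have ch: "deriv_chain n v (W (Suc n)) 0 L"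
    unfolding deriv_chain_def
  proof (intro conjI allI ballI impI)
    fix m t assume m: "m < n" and t: "t \<in> {0..L}"
    have eq: "v m s = C m + integral {0..s} (v (Suc m))" if "s \<in> {0..L}" for s
    proof -
      have "integral {0..s} (v (Suc m)) = integral {0..s} (W (Suc m))"
        using that m WS[of _ "Suc m"] by (intro integral_spike[OF S[of "Suc m"]]) auto
      then show ?thesis by (simp add: v_def)
    qed
    have "((\<lambda>s. C m + integral {0..s} (v (Suc m))) has_real_derivative v (Suc m) t) (at t within {0..L})"
      using integral_has_real_derivative[OF vc[of "Suc m"] t] m by (auto intro!: derivative_eq_intros)
    then show "(v m has_real_derivative v (Suc m) t) (at t within {0..L})"
      by (rule has_field_derivative_transform_within[OF _ zero_less_one t]) (simp add: eq)
  next
    show "W (Suc n) absolutely_integrable_on {0..L}" using Wi by simp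
  next
    fix s t :: real assume st: "0 \<le> s" "s \<le> t" "t \<le> L"
    have "W (Suc n) integrable_on {0..t}" using Wi'[of "Suc n"] st by (auto intro: integrable_subinterval_real)
    from Henstock_Kurzweil_Integration.integral_combine[OF st(1,2) this]
    show "v n t - v n s = integral {s..t} (W (Suc n))" by (simp add: v_def)
  qed
  have zi: "set_integrable lborel {0..L} \<zeta>" using z(3) by (simp add: set_integrable_def)
  have "integral {0..L} (\<lambda>t. \<bar>v 1 t\<bar> powr r) \<le> Dc * integral {0..L} \<zeta>"
  proof (rule gn[rule_format, OF ch z(1) _ z(2) S[of 0]])
    show "\<zeta> integrable_on {0..L}" using set_borel_integral_eq_integral(1)[OF zi] .
    show "\<bar>v 0 t\<bar> \<le> K * \<zeta> t powr e0" if "t \<in> {0..L} - S 0" for t using b0[of t] WS[OF that] by simp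
    show "\<bar>W (Suc n) t\<bar> \<le> \<zeta> t powr e1" for t using b1 .
  qed simp
  moreover have "(\<integral>\<^sup>+t. indicator {0..L} t * ennreal (\<zeta> t) \<partial>lborel) = ennreal (integral {0..L} \<zeta>)"
  proof -
    have "(\<integral>\<^sup>+t. indicator {0..L} t * ennreal (\<zeta> t) \<partial>lborel) = (\<integral>\<^sup>+t. ennreal (indicator {0..L} t * \<zeta> t) \<partial>lborel)"
      by (intro nn_integral_cong) (auto simp: indicator_def)
    also have "\<dots> = ennreal (\<integral>t. indicator {0..L} t * \<zeta> t \<partial>lborel)"
      using z(3) order_trans[OF zero_le_one z(2)]
      by (intro nn_integral_eq_integral AE_I2 mult_nonneg_nonneg) auto
    also have "(\<integral>t. indicator {0..L} t * \<zeta> t \<partial>lborel) = integral {0..L} \<zeta>"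
      using set_borel_integral_eq_integral(2)[OF zi] by (simp add: set_lebesgue_integral_def)
    finally show ?thesis .
  qed
  moreover have "(\<integral>\<^sup>+t. indicator {0..L} t * ennreal (\<bar>W 1 t\<bar> powr r) \<partial>lborel) = ennreal (integral {0..L} (\<lambda>t. \<bar>v 1 t\<bar> powr r))"
  proof -
    have cont: "continuous_on {0..L} (\<lambda>t. \<bar>v 1 t\<bar> powr r)"
      using vc[OF n] r by (intro continuous_on_powr' continuous_intros) auto
    have vi: "set_integrable lborel {0..L} (\<lambda>t. \<bar>v 1 t\<bar> powr r)"
      using borel_integrable_atLeastAtMost'[OF cont] .
    have "AE t in lborel. 0 < t \<longrightarrow> t < L \<longrightarrow> W 1 t = v 1 t" using rep[OF n] by (simp add: v_def)
    moreover have "AE t in lborel. t \<noteq> (0::real)" "AE t in lborel. t \<noteq> L" by (rule AE_lborel_singleton)+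
    ultimately have "AE t in lborel. indicator {0..L} t * ennreal (\<bar>W 1 t\<bar> powr r) = ennreal (indicator {0..L} t * \<bar>v 1 t\<bar> powr r)"
      by eventually_elim (auto simp: indicator_def)
    then have "(\<integral>\<^sup>+t. indicator {0..L} t * ennreal (\<bar>W 1 t\<bar> powr r) \<partial>lborel) = (\<integral>\<^sup>+t. ennreal (indicator {0..L} t * \<bar>v 1 t\<bar> powr r) \<partial>lborel)"
      by (rule nn_integral_cong_AE)
    also have "\<dots> = ennreal (\<integral>t. indicator {0..L} t * \<bar>v 1 t\<bar> powr r \<partial>lborel)"
      using vi by (intro nn_integral_eq_integral AE_I2) (auto simp: set_integrable_def)
    also have "(\<integral>t. indicator {0..L} t * \<bar>v 1 t\<bar> powr r \<partial>lborel) = integral {0..L} (\<lambda>t. \<bar>v 1 t\<bar> powr r)"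
      using set_borel_integral_eq_integral(2)[OF vi] by (simp add: set_lebesgue_integral_def)
    finally show ?thesis .
  qed
  ultimately show ?thesis using Dc
    by (simp add: ennreal_mult'[symmetric] ennreal_leI)
qed

lemma box_line:
  fixes a b i x :: "'a::euclidean_space"
  assumes "i \<in> Basis" "x \<in> box a b"
  shows "x + s *\<^sub>R i \<in> box a b \<longleftrightarrow> a \<bullet> i - x \<bullet> i < s \<and> s < b \<bullet> i - x \<bullet> i"
proof
  assume "x + s *\<^sub>R i \<in> box a b"
  then show "a \<bullet> i - x \<bullet> i < s \<and> s < b \<bullet> i - x \<bullet> i"
    using assms by (auto simp: box_def inner_add_left inner_Basis)
next
  assume s: "a \<bullet> i - x \<bullet> i < s \<and> s < b \<bullet> i - x \<bullet> i"
  show "x + s *\<^sub>R i \<in> box a b"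
    unfolding box_def
  proof safe
    fix j :: 'a assume j: "j \<in> Basis"
    show "a \<bullet> j < (x + s *\<^sub>R i) \<bullet> j" "(x + s *\<^sub>R i) \<bullet> j < b \<bullet> j"
      using s assms j by (cases "i = j"; auto simp: box_def inner_add_left inner_Basis)+
  qed
qed

text \<open>A base point lies in the middle of its line, so the part of the line before it needs the
  identity read backwards: the segment starts at \<open>x + s *\<^sub>R i\<close> and ends at
  \<open>x\<close>.\<close>

lemma line_deriv_AE_neg:
  fixes g h :: "'a::euclidean_space \<Rightarrow> real"
  assumes l: "line_deriv (box a b) i g h"
    and [measurable]: "g \<in> borel_measurable borel" "h \<in> borel_measurable borel"
  shows "AE x in lborel. AE s in lborel. s < 0 \<longrightarrow> x \<in> box a b \<longrightarrow> x + s *\<^sub>R i \<in> box a b \<longrightarrow>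
     g x - g (x + s *\<^sub>R i) = seg_int h i (x + s *\<^sub>R i) (- s)"
proof -
  let ?P = "\<lambda>s x. s < 0 \<longrightarrow> x \<in> box a b \<longrightarrow> x + s *\<^sub>R i \<in> box a b \<longrightarrow>
     g x - g (x + s *\<^sub>R i) = seg_int h i (x + s *\<^sub>R i) (- s)"
  have "AE s in lborel. AE x in lborel. ?P s x"
  proof (rule AE_I2)
    fix s :: real
    show "AE x in lborel. ?P s x"
    proof (cases "s < 0")
      case True
      then have "AE x in lborel. x \<in> box a b \<longrightarrow> x + (- s) *\<^sub>R i \<in> box a b \<longrightarrow> g (x + (- s) *\<^sub>R i) - g x = seg_int h i x (- s)"
        using l unfolding line_deriv_def by (meson neg_0_less_iff_less)
      from AE_lborel_shift[OF this, of "s *\<^sub>R i"] show ?thesis by eventually_elim simp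
    qed simp
  qed
  also have "?this \<longleftrightarrow> ?thesis"
  proof (rule lborel_pair.AE_commute)
    have "(\<lambda>p. (- fst p, snd p + fst p *\<^sub>R i)) \<in> (lborel \<Otimes>\<^sub>M lborel) \<rightarrow>\<^sub>M (lborel \<Otimes>\<^sub>M lborel)"
      by measurable
    from measurable_compose[OF this seg_int_measurable[of h i]]
    have [measurable]: "(\<lambda>p. seg_int h i (snd p + fst p *\<^sub>R i) (- fst p)) \<in> borel_measurable (lborel \<Otimes>\<^sub>M lborel)"
      by (simp add: case_prod_unfold)
    show "{p \<in> space (lborel \<Otimes>\<^sub>M lborel). ?P (fst p) (snd p)} \<in> sets (lborel \<Otimes>\<^sub>M lborel)"
      by measurable
  qed
  finally show ?thesis .
qed

text \<open>Every line in direction \<open>i\<close> that meets the box does so in an interval of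
  the same length \<open>L\<close>, so one constant serves almost all of these lines, and
  integrating over the lines gives integrability over the box. The gain is a power of the derivative
  of order \<open>j + 1\<close>, although only the orders \<open>j\<close> and \<open>k\<close> are
  bounded by \<open>\<zeta>\<close>.\<close>

lemma gagliardo_nirenberg_step:
  fixes D :: "nat \<Rightarrow> 'a::euclidean_space \<Rightarrow> real" and \<zeta> :: "'a \<Rightarrow> real"
  assumes i: "i \<in> Basis" and ab: "a \<bullet> i < b \<bullet> i" and p: "1 \<le> p" and n: "1 \<le> n" and k: "k = j + Suc n"
    and K: "0 \<le> K"
    and z: "\<zeta> \<in> borel_measurable borel" "\<And>x. 1 \<le> \<zeta> x" "integrable lborel (\<lambda>x. indicator (box a b) x * \<zeta> x)"
    and D: "\<And>m. m \<le> Suc n \<Longrightarrow> integrable lborel (D m)" "\<And>m x. m \<le> Suc n \<Longrightarrow> x \<notin> box a b \<Longrightarrow> D m x = 0"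
    and l: "\<And>m. m \<le> n \<Longrightarrow> line_deriv (box a b) i (D m) (D (Suc m))"
    and b0: "\<And>x. \<bar>D 0 x\<bar> \<le> K * \<zeta> x powr (real j / (real k * p))"
    and b1: "\<And>x. \<bar>D (Suc n) x\<bar> \<le> \<zeta> x powr (real k / (real k * p))"
  shows "integrable lborel (\<lambda>x. \<bar>D 1 x\<bar> powr (real k * p / real (Suc j)))"
proof -
  define r where "r = real k * p / real (Suc j)"
  have r: "0 < r" using k p by (simp add: r_def)
  define L where "L = b \<bullet> i - a \<bullet> i"
  have L: "0 < L" using ab by (simp add: L_def)
  obtain Dc where Dc: "0 \<le> Dc" and gn: "\<forall>v w \<zeta> S. deriv_chain n v w 0 L \<longrightarrow> \<zeta> \<in> borel_measurable borel \<longrightarrow>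
     \<zeta> integrable_on {0..L} \<longrightarrow> (\<forall>t. 1 \<le> \<zeta> t) \<longrightarrow> negligible S \<longrightarrow>
     (\<forall>t\<in>{0..L} - S. \<bar>v 0 t\<bar> \<le> K * \<zeta> t powr (real j / (real k * p))) \<longrightarrow>
     (\<forall>t\<in>{0..L}. \<bar>w t\<bar> \<le> \<zeta> t powr (real k / (real k * p))) \<longrightarrow>
     integral {0..L} (\<lambda>t. \<bar>v 1 t\<bar> powr r) \<le> Dc * integral {0..L} \<zeta>"
    using gagliardo_nirenberg_line[OF p L K n k] unfolding r_def by blast
  have Dm[measurable]: "D m \<in> borel_measurable borel" if "m \<le> Suc n" for m using D(1)[OF that] by auto
  note [measurable] = z(1)
  define G where "G x = indicator (box a b) x * \<zeta> x" for x
  have Gm[measurable]: "G \<in> borel_measurable borel" unfolding G_def[abs_def] by measurable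
  have G: "integrable lborel G" using z(3) by (simp add: G_def[abs_def])
  have D1m[measurable]: "D 1 \<in> borel_measurable borel" using n by (intro Dm) simp
  define F where "F x = ennreal (\<bar>D 1 x\<bar> powr r)" for x
  have Fm[measurable]: "F \<in> borel_measurable borel" unfolding F_def[abs_def] by measurable
  have F0: "F x = 0" if "x \<notin> box a b" for x using D(2)[of 1 x] that n r by (simp add: F_def)
  have "AE x in lborel. \<forall>m. m \<le> n \<longrightarrow> (AE s in lborel. 0 < s \<longrightarrow> x \<in> box a b \<longrightarrow> x + s *\<^sub>R i \<in> box a b \<longrightarrow>
     D m (x + s *\<^sub>R i) - D m x = seg_int (D (Suc m)) i x s)"
    unfolding AE_all_countable using line_deriv_AE[OF l] Dm by (auto intro!: AE_impI)
  moreover have "AE x in lborel. \<forall>m. m \<le> n \<longrightarrow> (AE s in lborel. s < 0 \<longrightarrow> x \<in> box a b \<longrightarrow> x + s *\<^sub>R i \<in> box a b \<longrightarrow>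
     D m x - D m (x + s *\<^sub>R i) = seg_int (D (Suc m)) i (x + s *\<^sub>R i) (- s))"
    unfolding AE_all_countable using line_deriv_AE_neg[OF l] Dm by (auto intro!: AE_impI)
  \<comment> \<open>A segment of length \<open>2 * L\<close> starting at
    \<open>x - L *\<^sub>R i\<close> contains the whole intersection of the line with the box,
    wherever \<open>x\<close> lies in the box.\<close>
  moreover have "AE x in lborel. \<forall>m. m \<le> Suc n \<longrightarrow> integrable lborel (\<lambda>s. indicator {0..2*L} s * D m (x - L *\<^sub>R i + s *\<^sub>R i))"
    unfolding AE_all_countable
  proof (intro allI AE_impI)
    fix m assume "m \<le> Suc n"
    then have "AE x in lborel. integrable lborel (\<lambda>s. indicator {0..2*L} s * D m (x + (- (L *\<^sub>R i)) + s *\<^sub>R i))"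
      by (intro AE_lborel_shift[OF seg_AE_integrable] D(1))
    then show "AE x in lborel. integrable lborel (\<lambda>s. indicator {0..2*L} s * D m (x - L *\<^sub>R i + s *\<^sub>R i))"
      by simp
  qed
  moreover have "AE x in lborel. integrable lborel (\<lambda>s. indicator {0..2*L} s * G (x - L *\<^sub>R i + s *\<^sub>R i))"
  proof -
    have "AE x in lborel. integrable lborel (\<lambda>s. indicator {0..2*L} s * G (x + (- (L *\<^sub>R i)) + s *\<^sub>R i))"
      by (intro AE_lborel_shift[OF seg_AE_integrable] G)
    then show ?thesis by simp
  qed
  ultimately have fiber: "AE x in lborel. x \<in> box a b \<longrightarrow>
      (\<integral>\<^sup>+s. F (x + s *\<^sub>R i) \<partial>lborel) \<le> ennreal Dc * (\<integral>\<^sup>+s. ennreal (G (x + s *\<^sub>R i)) \<partial>lborel)"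
  proof eventually_elim
    case (elim x)
    show ?case
    proof
      assume x: "x \<in> box a b"
      define \<alpha> where "\<alpha> = a \<bullet> i - x \<bullet> i"
      have \<alpha>: "\<alpha> < 0" "0 < \<alpha> + L" using x i by (auto simp: \<alpha>_def L_def box_def)
      \<comment> \<open>\<open>\<alpha>\<close> is the negative parameter at which the line through
        \<open>x\<close> enters the box. \<open>y\<close> starts there, so the box corresponds to
        \<open>0 < t \<and> t < L\<close>, and \<open>x\<close> itself to
        \<open>t = - \<alpha>\<close>.\<close>
      define y where "y t = x + (t + \<alpha>) *\<^sub>R i" for t
      have y: "y t \<in> box a b \<longleftrightarrow> 0 < t \<and> t < L" for t
        unfolding y_def using box_line[OF i x, of "t + \<alpha>"] by (auto simp: \<alpha>_def L_def)
      have [measurable]: "y \<in> borel_measurable borel" unfolding y_def[abs_def] by measurable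
      define W where "W m t = D m (y t)" for m t
      have W0: "W m t = 0" if "m \<le> Suc n" "\<not> (0 < t \<and> t < L)" for m t
        using D(2)[OF that(1)] y that(2) by (simp add: W_def)
      have shift_eq: "x - L *\<^sub>R i + (t + (\<alpha> + L)) *\<^sub>R i = y t" for t
        by (simp add: y_def algebra_simps)
      have Wi: "integrable lborel (W m)" if m: "m \<le> Suc n" for m
      proof -
        have "integrable lborel (\<lambda>t. indicator {0..2*L} (t + (\<alpha> + L)) * D m (x - L *\<^sub>R i + (t + (\<alpha> + L)) *\<^sub>R i))"
          using integrable_lborel_shift[OF elim(3)[rule_format, OF m], of "\<alpha> + L"] .
        also have "(\<lambda>t. indicator {0..2*L} (t + (\<alpha> + L)) * D m (x - L *\<^sub>R i + (t + (\<alpha> + L)) *\<^sub>R i)) = W m"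
          unfolding shift_eq
        proof
          fix t
          show "indicator {0..2*L} (t + (\<alpha> + L)) * D m (y t) = W m t"
          proof (cases "0 < t \<and> t < L")
            case True
            then show ?thesis using \<alpha> by (simp add: W_def)
          next
            case False
            then show ?thesis using W0[OF m False] by (simp add: W_def)
          qed
        qed
        finally show ?thesis .
      qed
      have Wm[measurable]: "W m \<in> borel_measurable borel" if "m \<le> Suc n" for m using Wi[OF that] by auto
      have seg: "(\<integral>s. indicator {u..v} s * W m s \<partial>lborel) = integral {u..v} (W m)" if "m \<le> Suc n" for m u v
      proof -
        have "set_integrable lborel {u..v} (W m)"
          unfolding set_integrable_def using integrable_mult_indicator[OF _ Wi[OF that], of "{u..v}"] by simp
        from set_borel_integral_eq_integral(2)[OF this] show ?thesis by (simp add: set_lebesgue_integral_def)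
      qed
      have WI: "W m integrable_on {u..v}" if "m \<le> Suc n" for m u v
      proof -
        have "set_integrable lborel {u..v} (W m)"
          unfolding set_integrable_def using integrable_mult_indicator[OF _ Wi[OF that], of "{u..v}"] by simp
        from set_borel_integral_eq_integral(1)[OF this] show ?thesis .
      qed
      \<comment> \<open>The constant is the value extrapolated from \<open>x\<close> to the entry
        point \<open>t = 0\<close>. Parameters after \<open>x\<close> use the forward identity,
        those before it the backward one.\<close>
      have rep: "AE t in lborel. 0 < t \<longrightarrow> t < L \<longrightarrow>
          W m t = (D m x - integral {0..-\<alpha>} (W (Suc m))) + integral {0..t} (W (Suc m))" if m: "m \<le> n" for m
      proof -
        have m': "Suc m \<le> Suc n" using m by simp
        have meas: "(\<lambda>s. D (Suc m) (z + s *\<^sub>R i)) \<in> borel_measurable borel" for z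
          by (rule measurable_compose[OF _ Dm[OF m']]) measurable
        have "AE t in lborel. t \<noteq> - \<alpha>" by (rule AE_lborel_singleton)
        moreover note AE_lborel_shift[OF elim(1)[rule_format, OF m], of \<alpha>] AE_lborel_shift[OF elim(2)[rule_format, OF m], of \<alpha>]
        ultimately show ?thesis
        proof eventually_elim
          case (elim t)
          show ?case
          proof (intro impI)
            assume t: "0 < t" "t < L"
            then have yt: "x + (t + \<alpha>) *\<^sub>R i \<in> box a b" using y[of t] by (simp add: y_def)
            show "W m t = (D m x - integral {0..-\<alpha>} (W (Suc m))) + integral {0..t} (W (Suc m))"
            proof (cases "0 < t + \<alpha>")
              case True
              have "seg_int (D (Suc m)) i x (t + \<alpha>) = (\<integral>s. indicator {0..t+\<alpha>} s * D (Suc m) (x + s *\<^sub>R i) \<partial>lborel)"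
                by (simp add: seg_int_def)
              also have "\<dots> = (\<integral>s. indicator {0..t+\<alpha>} (s + \<alpha>) * D (Suc m) (x + (s + \<alpha>) *\<^sub>R i) \<partial>lborel)"
                by (intro integral_lborel_shift[symmetric] borel_measurable_times borel_measurable_indicator meas) auto
              also have "\<dots> = (\<integral>s. indicator {-\<alpha>..t} s * W (Suc m) s \<partial>lborel)"
                by (intro Bochner_Integration.integral_cong) (auto simp: indicator_def W_def y_def)
              also have "\<dots> = integral {-\<alpha>..t} (W (Suc m))" by (rule seg[OF m'])
              also have "\<dots> = integral {0..t} (W (Suc m)) - integral {0..-\<alpha>} (W (Suc m))"
                using Henstock_Kurzweil_Integration.integral_combine[of 0 "-\<alpha>" t "W (Suc m)"] True \<alpha> WI[OF m'] by simp
              finally show ?thesis using elim(2) True x yt by (simp add: W_def y_def)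
            next
              case False
              then have neg: "t + \<alpha> < 0" using elim(1) by simp
              have "seg_int (D (Suc m)) i (x + (t + \<alpha>) *\<^sub>R i) (- (t + \<alpha>)) =
                  (\<integral>s. indicator {0..-(t+\<alpha>)} s * D (Suc m) (x + (t + \<alpha>) *\<^sub>R i + s *\<^sub>R i) \<partial>lborel)"
                by (simp add: seg_int_def)
              also have "\<dots> = (\<integral>s. indicator {0..-(t+\<alpha>)} (s + (- t)) * D (Suc m) (x + (t + \<alpha>) *\<^sub>R i + (s + (- t)) *\<^sub>R i) \<partial>lborel)"
                by (intro integral_lborel_shift[symmetric] borel_measurable_times borel_measurable_indicator meas) auto
              also have "\<dots> = (\<integral>s. indicator {t..-\<alpha>} s * W (Suc m) s \<partial>lborel)"
                by (intro Bochner_Integration.integral_cong) (auto simp: indicator_def W_def y_def algebra_simps)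
              also have "\<dots> = integral {t..-\<alpha>} (W (Suc m))" by (rule seg[OF m'])
              also have "\<dots> = integral {0..-\<alpha>} (W (Suc m)) - integral {0..t} (W (Suc m))"
                using Henstock_Kurzweil_Integration.integral_combine[of 0 t "-\<alpha>" "W (Suc m)"] neg t WI[OF m'] by simp
              finally show ?thesis using elim(3) neg x yt by (simp add: W_def y_def)
            qed
          qed
        qed
      qed
      have Gi: "integrable lborel (\<lambda>t. G (y t))"
      proof -
        have "integrable lborel (\<lambda>t. indicator {0..2*L} (t + (\<alpha> + L)) * G (x - L *\<^sub>R i + (t + (\<alpha> + L)) *\<^sub>R i))"
          using integrable_lborel_shift[OF elim(4), of "\<alpha> + L"] .
        also have "(\<lambda>t. indicator {0..2*L} (t + (\<alpha> + L)) * G (x - L *\<^sub>R i + (t + (\<alpha> + L)) *\<^sub>R i)) = (\<lambda>t. G (y t))"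
          unfolding shift_eq
        proof
          fix t
          show "indicator {0..2*L} (t + (\<alpha> + L)) * G (y t) = G (y t)"
            using y[of t] \<alpha> by (cases "0 < t \<and> t < L") (auto simp: G_def)
        qed
        finally show ?thesis .
      qed
      have AE_G: "AE t in lborel. G (y t) = indicator {0..L} t * \<zeta> (y t)"
        using AE_lborel_singleton[of "0::real"] AE_lborel_singleton[of L]
        by eventually_elim (auto simp: G_def indicator_def y)
      have zi: "integrable lborel (\<lambda>t. indicator {0..L} t * \<zeta> (y t))"
        using Gi AE_G by (subst integrable_cong_AE[where g="\<lambda>t. G (y t)"]) auto
      have "(\<integral>\<^sup>+t. indicator {0..L} t * ennreal (\<bar>W 1 t\<bar> powr r) \<partial>lborel) \<le>
          ennreal Dc * (\<integral>\<^sup>+t. indicator {0..L} t * ennreal (\<zeta> (y t)) \<partial>lborel)"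
      proof (rule line_gn_fiber[OF n L r Dc gn, where C="\<lambda>m. D m x - integral {0..-\<alpha>} (W (Suc m))"])
        show "integrable lborel (\<lambda>t. indicator {0..L} t * \<zeta> (y t))" by (rule zi)
        show "(\<lambda>t. \<zeta> (y t)) \<in> borel_measurable borel" by measurable
        show "\<bar>W 0 t\<bar> \<le> K * \<zeta> (y t) powr (real j / (real k * p))" for t unfolding W_def by (rule b0)
        show "\<bar>W (Suc n) t\<bar> \<le> \<zeta> (y t) powr (real k / (real k * p))" for t unfolding W_def by (rule b1)
      qed (rule Wi rep z(2); assumption)+
      also have "(\<integral>\<^sup>+t. indicator {0..L} t * ennreal (\<bar>W 1 t\<bar> powr r) \<partial>lborel) = (\<integral>\<^sup>+t. F (x + (t + \<alpha>) *\<^sub>R i) \<partial>lborel)"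
        using W0[of 1] n r by (intro nn_integral_cong) (auto simp: indicator_def F_def W_def y_def)
      also have "\<dots> = (\<integral>\<^sup>+s. F (x + s *\<^sub>R i) \<partial>lborel)"
        by (rule nn_integral_lborel_shift) measurable
      also have "(\<integral>\<^sup>+t. indicator {0..L} t * ennreal (\<zeta> (y t)) \<partial>lborel) = (\<integral>\<^sup>+t. ennreal (G (x + (t + \<alpha>) *\<^sub>R i)) \<partial>lborel)"
        by (rule nn_integral_cong_AE) (use AE_G in eventually_elim, auto simp: indicator_def y_def)
      also have "\<dots> = (\<integral>\<^sup>+s. ennreal (G (x + s *\<^sub>R i)) \<partial>lborel)"
        by (rule nn_integral_lborel_shift) measurable
      finally show "(\<integral>\<^sup>+s. F (x + s *\<^sub>R i) \<partial>lborel) \<le> ennreal Dc * (\<integral>\<^sup>+s. ennreal (G (x + s *\<^sub>R i)) \<partial>lborel)" .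
    qed
  qed
  text \<open>Integrating over all base points of a line counts every point of the box with the length of the line.\<close>
  have sweep: "(\<integral>\<^sup>+x. indicator (box a b) x * (\<integral>\<^sup>+s. H (x + s *\<^sub>R i) \<partial>lborel) \<partial>lborel) = ennreal L * (\<integral>\<^sup>+x. H x \<partial>lborel)"
    if [measurable]: "H \<in> borel_measurable borel" and H0: "\<And>x. x \<notin> box a b \<Longrightarrow> H x = 0" for H :: "'a \<Rightarrow> ennreal"
  proof -
    have "(\<integral>\<^sup>+x. indicator (box a b) x * (\<integral>\<^sup>+s. H (x + s *\<^sub>R i) \<partial>lborel) \<partial>lborel) =
        (\<integral>\<^sup>+x. (\<integral>\<^sup>+s. indicator (box a b) x * H (x + s *\<^sub>R i) \<partial>lborel) \<partial>lborel)"
      by (intro nn_integral_cong nn_integral_cmult[symmetric]) measurable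
    also have "\<dots> = (\<integral>\<^sup>+s. (\<integral>\<^sup>+x. indicator (box a b) x * H (x + s *\<^sub>R i) \<partial>lborel) \<partial>lborel)"
      by (rule lborel_pair.Fubini') measurable
    also have "\<dots> = (\<integral>\<^sup>+s. (\<integral>\<^sup>+x. indicator (box a b) (x - s *\<^sub>R i) * H x \<partial>lborel) \<partial>lborel)"
    proof (rule nn_integral_cong)
      fix s :: real
      show "(\<integral>\<^sup>+x. indicator (box a b) x * H (x + s *\<^sub>R i) \<partial>lborel) = (\<integral>\<^sup>+x. indicator (box a b) (x - s *\<^sub>R i) * H x \<partial>lborel)"
        using nn_integral_lborel_shift[of "\<lambda>x. indicator (box a b) (x - s *\<^sub>R i) * H x" "s *\<^sub>R i"] by simp
    qed
    also have "\<dots> = (\<integral>\<^sup>+x. (\<integral>\<^sup>+s. indicator (box a b) (x - s *\<^sub>R i) * H x \<partial>lborel) \<partial>lborel)"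
      by (rule lborel_pair.Fubini'[symmetric]) measurable
    also have "\<dots> = (\<integral>\<^sup>+x. ennreal L * H x \<partial>lborel)"
    proof (rule nn_integral_cong)
      fix x
      show "(\<integral>\<^sup>+s. indicator (box a b) (x - s *\<^sub>R i) * H x \<partial>lborel) = ennreal L * H x"
      proof (cases "x \<in> box a b")
        case True
        have "indicator (box a b) (x - s *\<^sub>R i) = (indicator {x \<bullet> i - b \<bullet> i <..< x \<bullet> i - a \<bullet> i} s :: ennreal)" for s
          using box_line[OF i True, of "- s"] by (auto simp: indicator_def)
        then have "(\<integral>\<^sup>+s. indicator (box a b) (x - s *\<^sub>R i) * H x \<partial>lborel) =
            emeasure lborel {x \<bullet> i - b \<bullet> i <..< x \<bullet> i - a \<bullet> i} * H x"
          by (simp add: nn_integral_multc)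
        also have "emeasure lborel {x \<bullet> i - b \<bullet> i <..< x \<bullet> i - a \<bullet> i} = ennreal L"
          using ab by (simp add: L_def)
        finally show ?thesis .
      qed (simp add: H0)
    qed
    also have "\<dots> = ennreal L * (\<integral>\<^sup>+x. H x \<partial>lborel)" by (rule nn_integral_cmult) measurable
    finally show ?thesis .
  qed
  have "ennreal L * (\<integral>\<^sup>+x. F x \<partial>lborel) = (\<integral>\<^sup>+x. indicator (box a b) x * (\<integral>\<^sup>+s. F (x + s *\<^sub>R i) \<partial>lborel) \<partial>lborel)"
    by (rule sweep[symmetric]) (use F0 in auto)
  also have "\<dots> \<le> (\<integral>\<^sup>+x. ennreal Dc * (indicator (box a b) x * (\<integral>\<^sup>+s. ennreal (G (x + s *\<^sub>R i)) \<partial>lborel)) \<partial>lborel)"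
    by (rule nn_integral_mono_AE) (use fiber in eventually_elim, auto simp: indicator_def)
  also have "\<dots> = ennreal Dc * (\<integral>\<^sup>+x. indicator (box a b) x * (\<integral>\<^sup>+s. ennreal (G (x + s *\<^sub>R i)) \<partial>lborel) \<partial>lborel)"
    by (rule nn_integral_cmult) measurable
  also have "\<dots> = ennreal Dc * (ennreal L * (\<integral>\<^sup>+x. ennreal (G x) \<partial>lborel))"
    by (subst sweep) (auto simp: G_def)
  also have "\<dots> < \<infinity>"
  proof -
    have "(\<integral>\<^sup>+x. ennreal (G x) \<partial>lborel) < \<infinity>"
      using integrableD(2)[OF G] by (simp add: less_top)
    then show ?thesis by (simp add: ennreal_mult_less_top)
  qed
  finally have "(\<integral>\<^sup>+x. F x \<partial>lborel) < \<infinity>" using L by (auto simp: ennreal_mult_less_top)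
  then show ?thesis
    unfolding r_def[symmetric] by (intro integrableI_nonneg) (auto simp: F_def)
qed

text \<open>Borel representatives of all iterated weak derivatives, indexed by the list of directions
  (the last derivative taken comes first), extended by zero.\<close>

definition deriv_tree :: "nat \<Rightarrow> real \<Rightarrow> 'a::euclidean_space set \<Rightarrow> ('a list \<Rightarrow> 'a \<Rightarrow> real) \<Rightarrow> bool" where
  "deriv_tree k p \<Omega> d \<longleftrightarrow>
     (\<forall>xs. set xs \<subseteq> Basis \<longrightarrow> length xs \<le> k \<longrightarrow>
        d xs \<in> borel_measurable borel \<and> integrable lborel (\<lambda>x. \<bar>d xs x\<bar> powr p) \<and> (\<forall>x. x \<notin> \<Omega> \<longrightarrow> d xs x = 0)) \<and>
     (\<forall>xs. \<forall>i\<in>Basis. set xs \<subseteq> Basis \<longrightarrow> length xs < k \<longrightarrow> weak_deriv \<Omega> i (d xs) (d (i # xs)))"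

text \<open>Fubini arguments and restriction to lines are carried out with Borel functions, so a
  Lebesgue measurable function is first changed on a null set and extended by 0.\<close>

lemma Lp_on_borel_representative:
  fixes g :: "'a::euclidean_space \<Rightarrow> real"
  assumes "open \<Omega>" "Lp_on p \<Omega> g"
  obtains g0 where "g0 \<in> borel_measurable borel" "\<And>x. x \<notin> \<Omega> \<Longrightarrow> g0 x = 0"
    "AE x in lborel. x \<in> \<Omega> \<longrightarrow> g0 x = g x"
proof -
  have "(\<lambda>x. indicator \<Omega> x * g x) \<in> borel_measurable (completion lborel)"
    using Lp_on_measurable[OF assms] by simp
  from completion_ex_borel_measurable_real[OF this]
  obtain u where u: "u \<in> borel_measurable lborel" "AE x in lborel. indicator \<Omega> x * g x = u x" by blast
  show ?thesis
  proof (rule that[of "\<lambda>x. indicator \<Omega> x * u x"])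
    show "(\<lambda>x. indicator \<Omega> x * u x) \<in> borel_measurable borel" using u(1) assms(1) by simp
    show "AE x in lborel. x \<in> \<Omega> \<longrightarrow> indicator \<Omega> x * u x = g x" using u(2) by eventually_elim auto
  qed auto
qed

lemma Lp_on_representative_integrable:
  fixes g :: "'a::euclidean_space \<Rightarrow> real"
  assumes \<Omega>: "open \<Omega>" and p: "0 < p" and g: "Lp_on p \<Omega> g" and g0: "g0 \<in> borel_measurable borel" "\<And>x. x \<notin> \<Omega> \<Longrightarrow> g0 x = 0"
    "AE x in lborel. x \<in> \<Omega> \<longrightarrow> g0 x = g x"
  shows "integrable lborel (\<lambda>x. \<bar>g0 x\<bar> powr p)"
proof -
  have m: "(\<lambda>x. \<bar>g0 x\<bar> powr p) \<in> borel_measurable lborel" using g0(1) by measurable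
  have "integrable lebesgue (\<lambda>x. indicator \<Omega> x * \<bar>g x\<bar> powr p)"
    using g by (simp add: Lp_on_def set_integrable_def)
  moreover have "AE x in lebesgue. indicator \<Omega> x * \<bar>g x\<bar> powr p = \<bar>g0 x\<bar> powr p"
    using AE_completion[OF g0(3)] by eventually_elim (use g0(2) in \<open>auto simp: indicator_def\<close>)
  ultimately have "integrable lebesgue (\<lambda>x. \<bar>g0 x\<bar> powr p)"
    using integrable_cong_AE_imp measurable_completion[OF m] by blast
  then show ?thesis using m by (simp add: integrable_completion)
qed

lemma weak_partial_representative:
  fixes g h :: "'a::euclidean_space \<Rightarrow> real"
  assumes \<Omega>: "open \<Omega>" and L: "Lp_on p \<Omega> g" "Lp_on p \<Omega> h" and w: "weak_partial \<Omega> i g h"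
    and g0: "g0 \<in> borel_measurable borel" "\<And>x. x \<notin> \<Omega> \<Longrightarrow> g0 x = 0" "AE x in lborel. x \<in> \<Omega> \<longrightarrow> g0 x = g x"
    and h0: "h0 \<in> borel_measurable borel" "\<And>x. x \<notin> \<Omega> \<Longrightarrow> h0 x = 0" "AE x in lborel. x \<in> \<Omega> \<longrightarrow> h0 x = h x"
  shows "weak_deriv \<Omega> i g0 h0"
  unfolding weak_deriv_def
proof (intro allI impI)
  fix \<phi> assume \<phi>: "test_function \<Omega> \<phi>"
  have eq: "(LINT x:\<Omega>|lebesgue. \<psi> x *\<^sub>R u x) = (\<integral>x. \<psi> x * u0 x \<partial>lborel)"
    if L: "Lp_on p \<Omega> u" and [measurable]: "\<psi> \<in> borel_measurable borel" "u0 \<in> borel_measurable borel"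
      and u0: "\<And>x. x \<notin> \<Omega> \<Longrightarrow> u0 x = 0" "AE x in lborel. x \<in> \<Omega> \<longrightarrow> u0 x = u x" for \<psi> u u0
  proof -
    have m: "(\<lambda>x. \<psi> x * u0 x) \<in> borel_measurable lborel" by measurable
    have [measurable]: "\<psi> \<in> borel_measurable lebesgue" by (rule measurable_completion) measurable
    have [measurable]: "(\<lambda>x. indicator \<Omega> x * u x) \<in> borel_measurable lebesgue"
      using Lp_on_measurable[OF \<Omega> L] by simp
    have "(LINT x:\<Omega>|lebesgue. \<psi> x *\<^sub>R u x) = (LINT x|lebesgue. \<psi> x * (indicator \<Omega> x * u x))"
      unfolding set_lebesgue_integral_def by (simp add: mult.left_commute)
    also have "\<dots> = (LINT x|lebesgue. \<psi> x * u0 x)"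
    proof (rule integral_cong_AE)
      show "AE x in lebesgue. \<psi> x * (indicator \<Omega> x * u x) = \<psi> x * u0 x"
        using AE_completion[OF u0(2)] by eventually_elim (use u0(1) in \<open>auto simp: indicator_def\<close>)
      show "(\<lambda>x. \<psi> x * u0 x) \<in> borel_measurable lebesgue" using m by (rule measurable_completion)
    qed measurable
    also have "\<dots> = (\<integral>x. \<psi> x * u0 x \<partial>lborel)" by (rule integral_completion[OF m])
    finally show ?thesis .
  qed
  have "(LINT x:\<Omega>|lebesgue. frechet_derivative \<phi> (at x) i *\<^sub>R g x) = - (LINT x:\<Omega>|lebesgue. \<phi> x *\<^sub>R h x)"
    using w \<phi> unfolding weak_partial_def by blast
  then show "(\<integral>x. frechet_derivative \<phi> (at x) i * g0 x \<partial>lborel) = - (\<integral>x. \<phi> x * h0 x \<partial>lborel)"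
    using eq[OF L(1) test_function_borel[OF test_function_derivative(2)[OF \<phi>]] g0]
      eq[OF L(2) test_function_borel[OF \<phi>] h0] by simp
qed

text \<open>By induction there is a tree for each first derivative, and these trees are hung below
  \<open>g0\<close>. The weak derivatives are chosen one at a time, so the choice need not be
  symmetric in the directions; hence lists and not multi-indices as labels.\<close>

lemma deriv_tree_exists:
  fixes g :: "'a::euclidean_space \<Rightarrow> real"
  assumes \<Omega>: "open \<Omega>" and p: "1 \<le> p"
    and "sobolev k p \<Omega> g" "g0 \<in> borel_measurable borel" "\<And>x. x \<notin> \<Omega> \<Longrightarrow> g0 x = 0"
      "AE x in lborel. x \<in> \<Omega> \<longrightarrow> g0 x = g x"
  shows "\<exists>d. deriv_tree k p \<Omega> d \<and> d [] = g0"
  using assms(3-6)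
proof (induction k arbitrary: g g0)
  case 0
  then have "integrable lborel (\<lambda>x. \<bar>g0 x\<bar> powr p)"
    using Lp_on_representative_integrable[OF \<Omega>, of p g g0] p by auto
  with 0 show ?case by (intro exI[of _ "\<lambda>_. g0"]) (auto simp: deriv_tree_def)
next
  case (Suc k)
  have Lg: "Lp_on p \<Omega> g" using sobolev_Lp[OF Suc.prems(1)] .
  have "\<exists>d. deriv_tree k p \<Omega> d \<and> weak_deriv \<Omega> i g0 (d [])" if i: "i \<in> Basis" for i
  proof -
    obtain h where h: "weak_partial \<Omega> i g h" "sobolev k p \<Omega> h" using Suc.prems(1) i by auto
    obtain h0 where h0: "h0 \<in> borel_measurable borel" "\<And>x. x \<notin> \<Omega> \<Longrightarrow> h0 x = 0"
      "AE x in lborel. x \<in> \<Omega> \<longrightarrow> h0 x = h x"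
      using Lp_on_borel_representative[OF \<Omega> sobolev_Lp[OF h(2)]] by metis
    obtain d where d: "deriv_tree k p \<Omega> d" "d [] = h0" using Suc.IH[OF h(2) h0] by blast
    have "weak_deriv \<Omega> i g0 h0"
      by (rule weak_partial_representative[OF \<Omega> Lg sobolev_Lp[OF h(2)] h(1) Suc.prems(2-4) h0])
    with d show ?thesis by blast
  qed
  then obtain D where D: "\<And>i. i \<in> Basis \<Longrightarrow> deriv_tree k p \<Omega> (D i)" "\<And>i. i \<in> Basis \<Longrightarrow> weak_deriv \<Omega> i g0 (D i [])"
    by metis
  \<comment> \<open>The derivative taken first stands at the end of the list, so
    \<open>last xs\<close> selects the subtree and \<open>butlast xs\<close> the position in
    it.\<close>
  define d where "d xs = (if xs = [] then g0 else D (last xs) (butlast xs))" for "xs" :: "'a list"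
  have "deriv_tree (Suc k) p \<Omega> d"
    unfolding deriv_tree_def
  proof (intro conjI allI ballI impI)
    fix "xs" :: "'a list" assume xs: "set xs \<subseteq> Basis" "length xs \<le> Suc k"
    have "d xs \<in> borel_measurable borel \<and> integrable lborel (\<lambda>x. \<bar>d xs x\<bar> powr p) \<and> (\<forall>x. x \<notin> \<Omega> \<longrightarrow> d xs x = 0)"
    proof (cases "xs = []")
      case True
      then show ?thesis
        using Suc.prems(2,3) Lp_on_representative_integrable[OF \<Omega> _ Lg Suc.prems(2-4)] p by (simp add: d_def)
    next
      case False
      then have "last xs \<in> Basis" "set (butlast xs) \<subseteq> Basis" "length (butlast xs) \<le> k"
        using xs last_in_set in_set_butlastD by fastforce+
      then show ?thesis using D(1) False unfolding deriv_tree_def d_def by auto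
    qed
    then show "d xs \<in> borel_measurable borel" "integrable lborel (\<lambda>x. \<bar>d xs x\<bar> powr p)"
      "\<And>x. x \<notin> \<Omega> \<Longrightarrow> d xs x = 0" by auto
  next
    fix "xs" :: "'a list" and i :: 'a
    assume xs: "i \<in> Basis" "set xs \<subseteq> Basis" "length xs < Suc k"
    show "weak_deriv \<Omega> i (d xs) (d (i # xs))"
    proof (cases "xs = []")
      case True
      then show ?thesis using D(2)[OF xs(1)] by (simp add: d_def)
    next
      case False
      then have "0 < length xs" by simp
      then have "length (butlast xs) < k" using xs(3) unfolding length_butlast by linarith
      moreover have l: "last xs \<in> Basis" using last_in_set[OF False] xs(2) by blast
      moreover have "set (butlast xs) \<subseteq> Basis" using xs(2) by (meson in_set_butlastD subset_iff)
      ultimately have "weak_deriv \<Omega> i (D (last xs) (butlast xs)) (D (last xs) (i # butlast xs))"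
        using D(1)[OF l] xs(1) unfolding deriv_tree_def by blast
      then show ?thesis using False by (simp add: d_def)
    qed
  qed
  moreover have "d [] = g0" by (simp add: d_def)
  ultimately show ?case by blast
qed

lemma integrable_if_powr:
  fixes u :: "'a::euclidean_space \<Rightarrow> real"
  assumes "bounded \<Omega>" "\<Omega> \<in> sets borel" "1 \<le> p" "u \<in> borel_measurable borel" "\<And>x. x \<notin> \<Omega> \<Longrightarrow> u x = 0"
    "integrable lborel (\<lambda>x. \<bar>u x\<bar> powr p)"
  shows "integrable lborel u"
proof (rule Bochner_Integration.integrable_bound[where f="\<lambda>x. indicator \<Omega> x + \<bar>u x\<bar> powr p"])
  have "integrable lborel (indicator \<Omega> :: 'a \<Rightarrow> real)"
    using assms(1,2) emeasure_bounded_finite by (intro integrable_real_indicator) auto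
  then show "integrable lborel (\<lambda>x. indicator \<Omega> x + \<bar>u x\<bar> powr p)" using assms(6) by simp
  show "AE x in lborel. norm (u x) \<le> norm (indicator \<Omega> x + \<bar>u x\<bar> powr p)"
  proof (rule AE_I2)
    fix x
    show "norm (u x) \<le> norm (indicator \<Omega> x + \<bar>u x\<bar> powr p)"
      using norm_le_1_powr[OF assms(3), of "\<bar>u x\<bar>"] assms(5)[of x] by (cases "x \<in> \<Omega>") auto
  qed
qed (use assms in auto)

text \<open>Induction on \<open>j\<close>. Interpolation between the bounds for the orders
  \<open>j\<close> and \<open>k\<close> makes the powers
  \<open>|d xs x| powr (N / real (Suc j))\<close> of the derivatives of order \<open>Suc j\<close>
  integrable over the box; once they are added to \<open>\<zeta>\<close>, the bound for this order
  holds by construction. Enlarging \<open>\<zeta>\<close> preserves the bounds already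
  established.\<close>

lemma deriv_tree_bound:
  fixes d :: "'a::euclidean_space list \<Rightarrow> 'a \<Rightarrow> real"
  assumes tree: "deriv_tree k p (box a b) d" and p: "1 \<le> p" and M: "\<And>x. \<bar>d [] x\<bar> \<le> M"
    and ne: "\<And>i. i \<in> Basis \<Longrightarrow> a \<bullet> i < b \<bullet> i"
  defines "N \<equiv> real k * p"
  assumes j: "j < k"
  shows "\<exists>\<zeta>. \<zeta> \<in> borel_measurable borel \<and> (\<forall>x. 1 \<le> \<zeta> x) \<and>
    integrable lborel (\<lambda>x. indicator (box a b) x * \<zeta> x) \<and>
    (\<forall>xs x. set xs \<subseteq> Basis \<longrightarrow> length xs \<le> j \<longrightarrow> \<bar>d xs x\<bar> \<le> max 1 M * \<zeta> x powr (real (length xs) / N)) \<and>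
    (\<forall>xs x. set xs \<subseteq> Basis \<longrightarrow> length xs = k \<longrightarrow> \<bar>d xs x\<bar> \<le> \<zeta> x powr (real k / N))"
  using j
proof (induction j)
  case 0
  then have kN: "real k / N = 1 / p" by (simp add: N_def)
  have tr: "d xs \<in> borel_measurable borel" "integrable lborel (\<lambda>x. \<bar>d xs x\<bar> powr p)"
    if "set xs \<subseteq> Basis" "length xs = k" for "xs"
    using tree that by (auto simp: deriv_tree_def)
  define I where "I = {xs. set xs \<subseteq> (Basis :: 'a set) \<and> length xs = k}"
  have I: "finite I" unfolding I_def by (rule finite_lists_length_eq) simp
  \<comment> \<open>For the order \<open>k\<close> the exponent \<open>real k / N\<close> is
    \<open>1 / p\<close>, so the sum of the \<open>p\<close>-th powers of all top derivatives
    suffices. The summand 1 ensures \<open>\<zeta> \<ge> 1\<close>.\<close>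
  define \<zeta> where "\<zeta> x = 1 + (\<Sum>xs\<in>I. \<bar>d xs x\<bar> powr p)" for x
  have z1: "1 \<le> \<zeta> x" for x by (simp add: \<zeta>_def sum_nonneg)
  have zm: "\<zeta> \<in> borel_measurable borel"
    unfolding \<zeta>_def[abs_def] using tr(1)
    by (intro borel_measurable_add borel_measurable_sum borel_measurable_const) (auto simp: I_def)
  have "integrable lborel (\<lambda>x. indicator (box a b) x * 1 + indicator (box a b) x * (\<Sum>xs\<in>I. \<bar>d xs x\<bar> powr p))"
  proof (intro Bochner_Integration.integrable_add)
    show "integrable lborel (\<lambda>x. indicator (box a b) x * (1::real))"
      by (auto intro!: integrable_real_indicator emeasure_bounded_finite)
    have int: "integrable lborel (\<lambda>x. \<Sum>xs\<in>I. \<bar>d xs x\<bar> powr p)"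
      using tr(2) by (intro Bochner_Integration.integrable_sum) (auto simp: I_def)
    show "integrable lborel (\<lambda>x. indicator (box a b) x * (\<Sum>xs\<in>I. \<bar>d xs x\<bar> powr p))"
      using integrable_mult_indicator[OF _ int, of "box a b"] by simp
  qed
  then have zi: "integrable lborel (\<lambda>x. indicator (box a b) x * \<zeta> x)"
    by (simp add: \<zeta>_def distrib_left)
  have top: "\<bar>d xs x\<bar> \<le> \<zeta> x powr (real k / N)" if "set xs \<subseteq> Basis" "length xs = k" for "xs" x
  proof -
    have "\<bar>d xs x\<bar> powr p \<le> (\<Sum>xs\<in>I. \<bar>d xs x\<bar> powr p)"
      using I that by (intro member_le_sum) (auto simp: I_def)
    then have "\<bar>d xs x\<bar> powr p \<le> \<zeta> x" by (simp add: \<zeta>_def)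
    then have "(\<bar>d xs x\<bar> powr p) powr (1 / p) \<le> \<zeta> x powr (1 / p)" using p by (intro powr_mono2) auto
    then show ?thesis using p kN by (simp add: powr_powr)
  qed
  have bot: "\<bar>d xs x\<bar> \<le> max 1 M * \<zeta> x powr (real (length xs) / N)" if "length xs \<le> 0" for "xs" x
    using that M[of x] z1[of x] by (simp add: max.coboundedI2)
  show ?case using zm z1 zi top bot by blast
next
  case (Suc j)
  then obtain \<zeta> where z: "\<zeta> \<in> borel_measurable borel" "\<And>x. 1 \<le> \<zeta> x"
    "integrable lborel (\<lambda>x. indicator (box a b) x * \<zeta> x)"
    and low: "\<And>xs x. set xs \<subseteq> Basis \<Longrightarrow> length xs \<le> j \<Longrightarrow> \<bar>d xs x\<bar> \<le> max 1 M * \<zeta> x powr (real (length xs) / N)"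
    and top: "\<And>xs x. set xs \<subseteq> Basis \<Longrightarrow> length xs = k \<Longrightarrow> \<bar>d xs x\<bar> \<le> \<zeta> x powr (real k / N)"
    by auto
  define n where "n = k - j - 1"
  have n: "1 \<le> n" "k = j + Suc n" using Suc.prems by (auto simp: n_def)
  define r where "r = N / real (Suc j)"
  have N: "0 < N" using Suc.prems p by (simp add: N_def)
  have r: "0 < r" using N by (simp add: r_def)
  have int: "integrable lborel (\<lambda>x. \<bar>d xs x\<bar> powr r)" if xs: "set xs \<subseteq> Basis" "length xs = Suc j" for "xs"
  proof -
    obtain i js where ijs: "xs = i # js" using xs(2) by (cases "xs") auto
    have i: "i \<in> Basis" and js: "set js \<subseteq> Basis" "length js = j" using xs ijs by auto
    \<comment> \<open>Only the direction \<open>i\<close> is iterated: starting from the derivative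
      of order \<open>j\<close> labelled \<open>js\<close>, the sequence passes through
      \<open>xs\<close> at \<open>m = 1\<close> and reaches the top order at
      \<open>m = Suc n\<close>.\<close>
    define D where "D m = d (replicate m i @ js)" for m
    have ok: "set (replicate m i @ js) \<subseteq> Basis" for m using i js by auto
    have len: "length (replicate m i @ js) \<le> k" if "m \<le> Suc n" for m using that js n by simp
    have Dtree: "D m \<in> borel_measurable borel" "integrable lborel (\<lambda>x. \<bar>D m x\<bar> powr p)" "\<And>x. x \<notin> box a b \<Longrightarrow> D m x = 0"
      if "m \<le> Suc n" for m
      using tree ok[of m] len[OF that] unfolding deriv_tree_def D_def by blast+
    have Di: "integrable lborel (D m)" if "m \<le> Suc n" for m
      by (rule integrable_if_powr[OF bounded_box _ p Dtree(1,3,2)]) (use that in auto)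
    have "integrable lborel (\<lambda>x. \<bar>D 1 x\<bar> powr (real k * p / real (Suc j)))"
    proof (rule gagliardo_nirenberg_step[OF i ne[OF i] p n _ z Di Dtree(3), where K="max 1 M"])
      fix m assume m: "m \<le> n"
      have "weak_deriv (box a b) i (D m) (D (Suc m))"
        using tree ok[of m] i js n m unfolding deriv_tree_def D_def by auto
      then show "line_deriv (box a b) i (D m) (D (Suc m))"
        using m by (intro weak_imp_line_deriv[OF i] Di) auto
    next
      show "\<bar>D 0 x\<bar> \<le> max 1 M * \<zeta> x powr (real j / (real k * p))" for x
        using low[of js x] js by (simp add: D_def N_def)
      show "\<bar>D (Suc n) x\<bar> \<le> \<zeta> x powr (real k / (real k * p))" for x
        using top[OF ok[of "Suc n"], of x] js n i unfolding D_def N_def by simp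
    qed auto
    then show ?thesis by (simp add: D_def ijs r_def N_def)
  qed
  define I where "I = {xs. set xs \<subseteq> (Basis :: 'a set) \<and> length xs = Suc j}"
  have I: "finite I" unfolding I_def by (rule finite_lists_length_eq) simp
  define \<zeta>' where "\<zeta>' x = \<zeta> x + (\<Sum>xs\<in>I. \<bar>d xs x\<bar> powr r)" for x
  have zle: "\<zeta> x \<le> \<zeta>' x" for x by (simp add: \<zeta>'_def sum_nonneg)
  have z1: "1 \<le> \<zeta>' x" for x using z(2)[of x] zle[of x] by simp
  have dm: "d xs \<in> borel_measurable borel" if "xs \<in> I" for "xs"
    using tree that Suc.prems by (auto simp: deriv_tree_def I_def)
  have zm: "\<zeta>' \<in> borel_measurable borel"
    unfolding \<zeta>'_def[abs_def] using dm z(1)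
    by (intro borel_measurable_add borel_measurable_sum) auto
  have zi: "integrable lborel (\<lambda>x. indicator (box a b) x * \<zeta>' x)"
  proof -
    have int: "integrable lborel (\<lambda>x. \<Sum>xs\<in>I. \<bar>d xs x\<bar> powr r)"
      using int by (intro Bochner_Integration.integrable_sum) (auto simp: I_def)
    have "integrable lborel (\<lambda>x. indicator (box a b) x * (\<Sum>xs\<in>I. \<bar>d xs x\<bar> powr r))"
      using integrable_mult_indicator[OF _ int, of "box a b"] by simp
    then show ?thesis using z(3) by (simp add: \<zeta>'_def distrib_left)
  qed
  have mono: "\<zeta> x powr e \<le> \<zeta>' x powr e" if "0 \<le> e" for x e
    using zle[of x] z(2)[of x] that by (intro powr_mono2) auto
  have top': "\<bar>d xs x\<bar> \<le> \<zeta>' x powr (real k / N)" if "set xs \<subseteq> Basis" "length xs = k" for "xs" x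
    using top[OF that, of x] mono[of "real k / N" x] N by simp
  have low': "\<bar>d xs x\<bar> \<le> max 1 M * \<zeta>' x powr (real (length xs) / N)"
    if xs: "set xs \<subseteq> Basis" "length xs \<le> Suc j" for "xs" x
  proof (cases "length xs = Suc j")
    case True
    have "\<bar>d xs x\<bar> powr r \<le> (\<Sum>xs\<in>I. \<bar>d xs x\<bar> powr r)"
      using I xs True by (intro member_le_sum) (auto simp: I_def)
    then have "\<bar>d xs x\<bar> powr r \<le> \<zeta>' x" using z(2)[of x] by (simp add: \<zeta>'_def)
    then have "(\<bar>d xs x\<bar> powr r) powr (1 / r) \<le> \<zeta>' x powr (1 / r)" using r by (intro powr_mono2) auto
    then have "\<bar>d xs x\<bar> \<le> \<zeta>' x powr (1 / r)" using r by (simp add: powr_powr)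
    also have "1 / r = real (length xs) / N" using True by (simp add: r_def)
    also have "\<zeta>' x powr (real (length xs) / N) \<le> max 1 M * \<zeta>' x powr (real (length xs) / N)"
      using mult_right_mono[of 1 "max 1 M" "\<zeta>' x powr (real (length xs) / N)"] by simp
    finally show ?thesis .
  next
    case False
    then have "\<bar>d xs x\<bar> \<le> max 1 M * \<zeta> x powr (real (length xs) / N)" using low xs by simp
    also have "\<dots> \<le> max 1 M * \<zeta>' x powr (real (length xs) / N)"
      using mono[of "real (length xs) / N" x] N by (intro mult_left_mono) auto
    finally show ?thesis .
  qed
  show ?case using zm z1 zi top' low' by blast
qed

lemma Lp_on_borel:
  fixes u :: "'a::euclidean_space \<Rightarrow> real"
  assumes "open \<Omega>" "u \<in> borel_measurable borel" "integrable lborel (\<lambda>x. \<bar>u x\<bar> powr p)"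
  shows "Lp_on p \<Omega> u"
proof -
  have u: "u \<in> borel_measurable lborel" using assms(2) by simp
  have "u \<in> borel_measurable (lebesgue_on \<Omega>)"
    using measurable_completion[OF u] by (rule measurable_restrict_space1)
  moreover have "integrable lebesgue (\<lambda>x. \<bar>u x\<bar> powr p)"
    using assms(3) by (simp add: integrable_completion borel_measurable_integrable)
  then have "set_integrable lebesgue \<Omega> (\<lambda>x. norm (u x) powr p)"
    unfolding set_integrable_def using assms(1) by (intro integrable_mult_indicator) auto
  ultimately show ?thesis by (simp add: Lp_on_def)
qed

lemma weak_partial_borel:
  fixes u v :: "'a::euclidean_space \<Rightarrow> real"
  assumes "u \<in> borel_measurable borel" "v \<in> borel_measurable borel" "weak_deriv \<Omega> i u v"
  shows "weak_partial \<Omega> i u v"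
  unfolding weak_partial_def
proof (intro allI impI)
  fix \<phi> assume \<phi>: "test_function \<Omega> \<phi>"
  have eq: "(LINT x:\<Omega>|lebesgue. \<psi> x *\<^sub>R w x) = (\<integral>x. \<psi> x * w x \<partial>lborel)"
    if \<psi>: "test_function \<Omega> \<psi>" and [measurable]: "w \<in> borel_measurable borel" for \<psi> w
  proof -
    have [measurable]: "\<psi> \<in> borel_measurable borel" using test_function_borel[OF \<psi>] .
    have "(LINT x:\<Omega>|lebesgue. \<psi> x *\<^sub>R w x) = (LINT x|lebesgue. \<psi> x * w x)"
      unfolding set_lebesgue_integral_def using \<psi>
      by (intro Bochner_Integration.integral_cong) (auto simp: test_function_def indicator_def)
    also have "\<dots> = (\<integral>x. \<psi> x * w x \<partial>lborel)" by (rule integral_completion) measurable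
    finally show ?thesis .
  qed
  show "(LINT x:\<Omega>|lebesgue. frechet_derivative \<phi> (at x) i *\<^sub>R u x) = - (LINT x:\<Omega>|lebesgue. \<phi> x *\<^sub>R v x)"
    using assms(3) \<phi> unfolding eq[OF test_function_derivative(2)[OF \<phi>] assms(1)] eq[OF \<phi> assms(2)] weak_deriv_def by blast
qed

lemma sobolev_square_box:
  fixes g :: "'a::euclidean_space \<Rightarrow> real"
  assumes p: "1 \<le> p" and cont: "continuous_on (box a b) g" and M: "\<And>x. x \<in> box a b \<Longrightarrow> \<bar>g x\<bar> \<le> M"
    and ne: "\<And>i. i \<in> Basis \<Longrightarrow> a \<bullet> i < b \<bullet> i" and sob: "sobolev k p (box a b) g" and k: "1 \<le> k"
  shows "sobolev k p (box a b) (\<lambda>x. g x * g x)"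
proof -
  let ?Q = "box a b"
  define g0 where "g0 x = indicator ?Q x * g x" for x
  have g0m: "g0 \<in> borel_measurable borel"
  proof -
    have "g \<in> borel_measurable (restrict_space borel ?Q)" using cont by (rule borel_measurable_continuous_on_restrict)
    then show ?thesis
      unfolding g0_def[abs_def] using borel_measurable_restrict_space_iff[of ?Q borel g] by simp
  qed
  obtain d where tree: "deriv_tree k p ?Q d" and d0: "d [] = g0"
    using deriv_tree_exists[OF open_box p sob g0m] by (auto simp: g0_def)
  \<comment> \<open>The bound is required everywhere, also outside the box, where the extended
    function is 0.\<close>
  have "\<bar>d [] x\<bar> \<le> max 0 M" for x using M[of x] by (auto simp: d0 g0_def indicator_def)
  from deriv_tree_bound[OF tree p this ne, of "k - 1"] k
  obtain \<zeta> where z: "\<zeta> \<in> borel_measurable borel" "\<And>x. 1 \<le> \<zeta> x"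
    "integrable lborel (\<lambda>x. indicator ?Q x * \<zeta> x)"
    and low: "\<And>xs x. set xs \<subseteq> Basis \<Longrightarrow> length xs \<le> k - 1 \<Longrightarrow>
      \<bar>d xs x\<bar> \<le> max 1 (max 0 M) * \<zeta> x powr (real (length xs) / (real k * p))"
    and top: "\<And>xs x. set xs \<subseteq> Basis \<Longrightarrow> length xs = k \<Longrightarrow> \<bar>d xs x\<bar> \<le> \<zeta> x powr (real k / (real k * p))"
    by auto
  define K where "K = max 1 (max 0 M)"
  have K: "1 \<le> K" by (simp add: K_def)
  have bd: "\<bar>d xs x\<bar> \<le> K * \<zeta> x powr (real (length xs) / (real k * p))"
    if "set xs \<subseteq> Basis" "length xs \<le> k" for "xs" x
  proof (cases "length xs = k")
    case True
    then show ?thesis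
      using top[OF that(1) True, of x] K mult_right_mono[of 1 K "\<zeta> x powr (real k / (real k * p))"] by simp
  next
    case False
    then show ?thesis using low[of "xs" x] that by (simp add: K_def)
  qed
  have tr: "d xs \<in> borel_measurable borel" "\<And>x. x \<notin> ?Q \<Longrightarrow> d xs x = 0" "integrable lborel (d xs)"
    if "set xs \<subseteq> Basis" "length xs \<le> k" for "xs"
  proof -
    show *: "d xs \<in> borel_measurable borel" "\<And>x. x \<notin> ?Q \<Longrightarrow> d xs x = 0"
      using tree that unfolding deriv_tree_def by blast+
    have "integrable lborel (\<lambda>x. \<bar>d xs x\<bar> powr p)" using tree that unfolding deriv_tree_def by blast
    from integrable_if_powr[OF bounded_box _ p * this] show "integrable lborel (d xs)" by simp
  qed
  \<comment> \<open>The exponents of \<open>\<zeta>\<close> add. For total order at most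
    \<open>k\<close>, raising to the power \<open>p\<close> leaves an exponent of at most 1, and
    \<open>\<zeta> \<ge> 1\<close> then bounds the result by \<open>\<zeta>\<close> itself.\<close>
  have prodp: "integrable lborel (\<lambda>x. \<bar>d xs x * d js x\<bar> powr p)"
    if xs: "set xs \<subseteq> Basis" "set js \<subseteq> Basis" "length xs + length js \<le> k" for "xs" js
  proof (rule Bochner_Integration.integrable_bound[where f="\<lambda>x. (K * K) powr p * (indicator ?Q x * \<zeta> x)"])
    show "integrable lborel (\<lambda>x. (K * K) powr p * (indicator ?Q x * \<zeta> x))" using z(3) by simp
    have [measurable]: "d xs \<in> borel_measurable borel" "d js \<in> borel_measurable borel" using tr(1) xs by auto
    show "(\<lambda>x. \<bar>d xs x * d js x\<bar> powr p) \<in> borel_measurable lborel" by measurable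
    show "AE x in lborel. norm (\<bar>d xs x * d js x\<bar> powr p) \<le> norm ((K * K) powr p * (indicator ?Q x * \<zeta> x))"
    proof (rule AE_I2)
      fix x
      let ?e = "real (length xs) / (real k * p) + real (length js) / (real k * p)"
      show "norm (\<bar>d xs x * d js x\<bar> powr p) \<le> norm ((K * K) powr p * (indicator ?Q x * \<zeta> x))"
      proof (cases "x \<in> ?Q")
        case True
        have "\<bar>d xs x * d js x\<bar> \<le> (K * \<zeta> x powr (real (length xs) / (real k * p))) * (K * \<zeta> x powr (real (length js) / (real k * p)))"
          unfolding abs_mult using bd[of "xs" x] bd[of js x] xs K by (intro mult_mono) auto
        also have "\<dots> = (K * K) * \<zeta> x powr ?e" by (simp add: powr_add mult_ac)
        finally have "\<bar>d xs x * d js x\<bar> powr p \<le> ((K * K) * \<zeta> x powr ?e) powr p"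
          using p by (intro powr_mono2) auto
        also have "\<dots> = (K * K) powr p * \<zeta> x powr (?e * p)"
          using K by (simp add: powr_mult powr_powr)
        also have "\<dots> \<le> (K * K) powr p * \<zeta> x powr 1"
        proof (rule mult_left_mono[OF powr_mono[OF _ z(2)]])
          have "?e * p = (real (length xs) + real (length js)) / real k"
            using p k by (simp add: add_divide_distrib[symmetric])
          also have "\<dots> \<le> 1" using xs(3) k by (simp add: divide_le_eq)
          finally show "?e * p \<le> 1" .
        qed simp
        finally show ?thesis using True z(2)[of x] by simp
      qed (use tr(2)[of "xs"] xs in auto)
    qed
  qed
  \<comment> \<open>Each further derivative lowers \<open>s\<close> by one and lengthens one of the
    two lists by one, so the total order never exceeds \<open>k\<close> and both Leibniz terms are
    instances of the same claim.\<close>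
  have "sobolev s p ?Q (\<lambda>x. d xs x * d js x)"
    if "set xs \<subseteq> Basis" "set js \<subseteq> Basis" "length xs + length js + s \<le> k" for s "xs" js
    using that
  proof (induction s arbitrary: "xs" js)
    case 0
    have [measurable]: "d xs \<in> borel_measurable borel" "d js \<in> borel_measurable borel" using tr(1) 0 by auto
    show ?case using 0 prodp by (auto intro!: Lp_on_borel)
  next
    case (Suc s)
    have m: "d xs \<in> borel_measurable borel" "d js \<in> borel_measurable borel" using tr(1) Suc.prems by auto
    have "\<exists>h. weak_partial ?Q i (\<lambda>x. d xs x * d js x) h \<and> sobolev s p ?Q h" if i: "i \<in> Basis" for i
    proof (intro exI conjI)
      have ok: "set (i # xs) \<subseteq> Basis" "set (i # js) \<subseteq> Basis" using Suc.prems i by auto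
      have m': "d (i # xs) \<in> borel_measurable borel" "d (i # js) \<in> borel_measurable borel"
        using tr(1)[OF ok(1)] tr(1)[OF ok(2)] Suc.prems by auto
      have li: "line_deriv ?Q i (d xs) (d (i # xs))" "line_deriv ?Q i (d js) (d (i # js))"
        using tree i Suc.prems ok tr(3) unfolding deriv_tree_def by (auto intro!: weak_imp_line_deriv[OF i])
      have prodi: "integrable lborel (\<lambda>x. d xs x * d js x)"
        if "set xs \<subseteq> Basis" "set js \<subseteq> Basis" "length xs + length js \<le> k" for "xs" js
      proof (rule integrable_if_powr[OF bounded_box _ p _ _ prodp[OF that]])
        have len: "length xs \<le> k" "length js \<le> k" using that(3) by auto
        show "(\<lambda>x. d xs x * d js x) \<in> borel_measurable borel"
          by (intro borel_measurable_times tr(1) that(1,2) len)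
        show "d xs x * d js x = 0" if "x \<notin> ?Q" for x
          using tr(2)[OF \<open>set xs \<subseteq> Basis\<close> len(1) that] by simp
      qed simp
      have "weak_deriv ?Q i (\<lambda>x. d xs x * d js x) (\<lambda>x. d (i # xs) x * d js x + d xs x * d (i # js) x)"
      proof (rule line_imp_weak_deriv[OF i])
        show "line_deriv ?Q i (\<lambda>x. d xs x * d js x) (\<lambda>x. d (i # xs) x * d js x + d xs x * d (i # js) x)"
          using Suc.prems ok by (intro line_deriv_mult[OF i _ _ _ _ li] tr(3)) auto
        show "integrable lborel (\<lambda>x. d (i # xs) x * d js x + d xs x * d (i # js) x)"
          using Suc.prems ok by (intro Bochner_Integration.integrable_add prodi) auto
        show "integrable lborel (\<lambda>x. d xs x * d js x)" using Suc.prems by (intro prodi) auto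
      qed
      then show "weak_partial ?Q i (\<lambda>x. d xs x * d js x) (\<lambda>x. d (i # xs) x * d js x + d xs x * d (i # js) x)"
        using m m' by (intro weak_partial_borel) auto
      show "sobolev s p ?Q (\<lambda>x. d (i # xs) x * d js x + d xs x * d (i # js) x)"
        using Suc.prems ok by (intro sobolev_add[OF open_box p] Suc.IH) auto
    qed
    moreover have "Lp_on p ?Q (\<lambda>x. d xs x * d js x)"
      using Suc.prems prodp m by (intro Lp_on_borel) auto
    ultimately show ?case by simp
  qed
  from this[of "[]" "[]" k] have "sobolev k p ?Q (\<lambda>x. d [] x * d [] x)" by simp
  then show ?thesis
    using sobolev_cong[of ?Q "\<lambda>x. d [] x * d [] x" "\<lambda>x. g x * g x" k p] by (simp add: d0 g0_def)
qed

section \<open>Smoothness classes on chart domains\<close>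

text \<open>Chart images of manifolds of dimension 0 lie in \<open>{0}\<close>, a set without
  interior on which derivatives are not unique. That case is kept apart; every class is void
  there.\<close>

definition chart_domain :: "'a::euclidean_space set \<Rightarrow> bool" where
  "chart_domain X \<longleftrightarrow> X \<subseteq> {0} \<or> full_domain X"

lemma chart_domain_models:
  assumes "H \<in> models m" "openin (top_of_set H) X"
  shows "chart_domain X"
proof (cases "m = 0")
  case True
  then show ?thesis
    using assms openin_imp_subset unfolding chart_domain_def models_def by force
next
  case False
  then have "H \<in> half_spaces" using assms(1) by (simp add: models_def half_spaces_def)
  then show ?thesis using assms(2) by (auto simp: chart_domain_def full_domain_def)
qed

lemma chart_domain_openin:
  assumes "chart_domain X" "openin (top_of_set X) Y"
  shows "chart_domain Y"
  using assms full_domain_openin openin_imp_subset[OF assms(2)] unfolding chart_domain_def by blast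

lemma sobolev_empty: "sobolev k p {} g"
  using sobolev_cong[of "{}" g "\<lambda>x. 0" k p] sobolev_const[of "{}"] by simp

lemma class_on_Frechet: "class_on (Frechet_C k) X g \<longleftrightarrow> (\<forall>j. enat j \<le> k \<longrightarrow> holder_Ck_on j 0 X g)"
  by (simp add: frechet_eq_holder_0)

lemma class_on_trivial:
  assumes X: "X \<subseteq> {0}"
  shows "class_on F X g"
proof -
  have int: "interior Y = {}" if "Y \<subseteq> {0}" for Y :: "'a set"
    using interior_mono[OF that] by (simp add: interior_singleton)
  have cont: "continuous_on X h" for h :: "'a \<Rightarrow> 'b"
    using X by (auto simp: subset_singleton_iff)
  show ?thesis
  proof (cases F)
    case (Frechet_C k)
    show ?thesis unfolding Frechet_C class_on_Frechet using holder_Ck_on_trivial[OF X] by blast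
  next
    case (Bastiani_C k)
    have "bastiani_Ck_on k X g"
      unfolding bastiani_Ck_on_def
    proof (intro exI[of _ "\<lambda>j h x. if j = 0 then g x else 0"] conjI allI ballI impI)
      fix j assume "enat j \<le> k"
      have "continuous_on (X \<times> UNIV) (\<lambda>(x, h :: nat \<Rightarrow> 'a). if j = 0 then g x else 0) \<longleftrightarrow>
          continuous_on (X \<times> UNIV) (\<lambda>p :: 'a \<times> (nat \<Rightarrow> 'a). if j = 0 then g 0 else 0)"
        using X by (intro continuous_on_cong) auto
      then show "continuous_on (X \<times> UNIV) (\<lambda>(x, h :: nat \<Rightarrow> 'a). if j = 0 then g x else 0)" by simp
    qed (use int[OF X] in auto)
    then show ?thesis using Bastiani_C by simp
  next
    case (Holder k \<alpha>)
    then show ?thesis using holder_Ck_on_trivial[OF X] by simp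
  next
    case (Sobolev k p)
    have "interior (X \<inter> ball x 1) = {}" for x by (rule int) (use X in auto)
    then have "locally_sobolev_on k p X g"
      unfolding locally_sobolev_on_def using cont sobolev_empty by (auto intro!: exI[of _ 1])
    then show ?thesis using Sobolev by simp
  qed
qed

lemma class_on_Bastiani:
  "full_domain X \<Longrightarrow> class_on (Bastiani_C k) X g \<longleftrightarrow> (\<forall>j. enat j \<le> k \<longrightarrow> holder_Ck_on j 0 X g)"
  by (simp add: bastiani_eq_holder)

lemma class_on_smooth: "class_on (Frechet_C \<infinity>) X g \<longleftrightarrow> smooth_on X g"
  by (simp add: frechet_eq_holder_0 smooth_on_def)

lemma admissible_simps:
  "admissible (Holder k \<alpha>) m \<Longrightarrow> 0 \<le> \<alpha>" "admissible (Holder k \<alpha>) m \<Longrightarrow> \<alpha> \<le> 1"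
  "admissible (Sobolev k p) m \<Longrightarrow> 1 \<le> k" "admissible (Sobolev k p) m \<Longrightarrow> 1 \<le> p"
  by auto

lemma class_on_continuous:
  assumes "chart_domain X" "class_on F X g"
  shows "continuous_on X g"
proof (cases "X \<subseteq> {0}")
  case True
  then show ?thesis by (auto simp: subset_singleton_iff)
next
  case False
  then have X: "full_domain X" using assms(1) by (simp add: chart_domain_def)
  have 0: "enat 0 \<le> k" for k by (simp add: zero_enat_def[symmetric])
  show ?thesis
  proof (cases F)
    case (Frechet_C k)
    show ?thesis using assms(2) 0 holder_Ck_on_continuous unfolding Frechet_C class_on_Frechet by blast
  next
    case (Bastiani_C k)
    show ?thesis using assms(2) 0 holder_Ck_on_continuous unfolding Bastiani_C class_on_Bastiani[OF X] by blast
  next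
    case (Holder k \<alpha>)
    then show ?thesis using assms(2) holder_Ck_on_continuous by auto
  next
    case (Sobolev k p)
    then show ?thesis using assms(2) by (simp add: locally_sobolev_on_def)
  qed
qed

lemma class_on_subset:
  assumes X: "chart_domain X" and Y: "openin (top_of_set X) Y" and g: "class_on F X g"
  shows "class_on F Y g"
proof (cases "X \<subseteq> {0}")
  case True
  then show ?thesis using openin_imp_subset[OF Y] by (intro class_on_trivial) auto
next
  case False
  have sub: "Y \<subseteq> X" using openin_imp_subset[OF Y] .
  have X': "full_domain X" using X False by (simp add: chart_domain_def)
  have Y': "full_domain Y" using full_domain_openin[OF X' Y] .
  show ?thesis
  proof (cases F)
    case (Frechet_C k)
    show ?thesis using g holder_Ck_on_subset[OF _ sub] unfolding Frechet_C class_on_Frechet by blast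
  next
    case (Bastiani_C k)
    show ?thesis using g holder_Ck_on_subset[OF _ sub] unfolding Bastiani_C class_on_Bastiani[OF X'] class_on_Bastiani[OF Y'] by blast
  next
    case (Holder k \<alpha>)
    then show ?thesis using g holder_Ck_on_subset[OF _ sub] by auto
  next
    case (Sobolev k p)
    have "\<exists>e>0. sobolev k p (interior (Y \<inter> ball x e)) g" if x: "x \<in> Y" for x
    proof -
      obtain e where e: "0 < e" "sobolev k p (interior (X \<inter> ball x e)) g"
        using g Sobolev x sub by (auto simp: locally_sobolev_on_def)
      have "interior (Y \<inter> ball x e) \<subseteq> interior (X \<inter> ball x e)"
        using sub by (intro interior_mono) auto
      from sobolev_subset[OF open_interior this e(2)] show ?thesis using e(1) by blast
    qed
    then show ?thesis
      using g Sobolev continuous_on_subset[OF _ sub] by (auto simp: locally_sobolev_on_def)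
  qed
qed

lemma class_on_cong:
  assumes X: "chart_domain X" and eq: "\<And>x. x \<in> X \<Longrightarrow> g x = h x" and g: "class_on F X g"
  shows "class_on F X h"
proof (cases "X \<subseteq> {0}")
  case True
  then show ?thesis by (rule class_on_trivial)
next
  case False
  have X': "full_domain X" using X False by (simp add: chart_domain_def)
  have cong: "holder_Ck_on j \<alpha> X g \<longleftrightarrow> holder_Ck_on j \<alpha> X h" for j \<alpha>
    by (rule holder_Ck_on_cong[OF eq])
  show ?thesis
  proof (cases F)
    case (Frechet_C k)
    show ?thesis using g unfolding Frechet_C class_on_Frechet cong .
  next
    case (Bastiani_C k)
    show ?thesis using g unfolding Bastiani_C class_on_Bastiani[OF X'] cong .
  next
    case (Holder k \<alpha>)
    then show ?thesis using g cong by simp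
  next
    case (Sobolev k p)
    have c: "sobolev k p (interior (X \<inter> ball x e)) g \<longleftrightarrow> sobolev k p (interior (X \<inter> ball x e)) h" for x e
      by (rule sobolev_cong) (use eq interior_subset in blast)
    have "continuous_on X g \<longleftrightarrow> continuous_on X h" by (rule continuous_on_cong[OF refl eq])
    then show ?thesis using g Sobolev c by (simp add: locally_sobolev_on_def)
  qed
qed

lemma class_on_local:
  assumes X: "chart_domain X" and loc: "\<And>x. x \<in> X \<Longrightarrow> \<exists>e>0. class_on F (X \<inter> ball x e) g"
  shows "class_on F X g"
proof (cases "X \<subseteq> {0}")
  case True
  then show ?thesis by (rule class_on_trivial)
next
  case False
  have X': "full_domain X" using X False by (simp add: chart_domain_def)
  show ?thesis
  proof (cases F)
    case (Frechet_C k)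
    have "holder_Ck_on j 0 X g" if "enat j \<le> k" for j
      using loc that unfolding Frechet_C class_on_Frechet by (intro holder_Ck_on_local[OF X']) blast
    then show ?thesis unfolding Frechet_C class_on_Frechet by blast
  next
    case (Bastiani_C k)
    have "holder_Ck_on j 0 X g" if "enat j \<le> k" for j
      using loc that unfolding Bastiani_C class_on_Bastiani[OF full_domain_Int_ball[OF X']]
      by (intro holder_Ck_on_local[OF X']) blast
    then show ?thesis unfolding Bastiani_C class_on_Bastiani[OF X'] by blast
  next
    case (Holder k \<alpha>)
    then show ?thesis using loc by (auto intro: holder_Ck_on_local[OF X'])
  next
    case (Sobolev k p)
    have *: "\<exists>e>0. continuous_on (X \<inter> ball x e) g \<and> sobolev k p (interior (X \<inter> ball x e)) g" if x: "x \<in> X" for x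
    proof -
      obtain e where e: "0 < e" "locally_sobolev_on k p (X \<inter> ball x e) g" using loc[OF x] Sobolev by auto
      then obtain e' where e': "0 < e'" "sobolev k p (interior (X \<inter> ball x e \<inter> ball x e')) g"
        using x unfolding locally_sobolev_on_def by (metis IntI centre_in_ball)
      have "X \<inter> ball x e \<inter> ball x e' = X \<inter> ball x (min e e')" by auto
      moreover have "continuous_on (X \<inter> ball x (min e e')) g"
        using e(2) by (auto simp: locally_sobolev_on_def intro: continuous_on_subset)
      ultimately show ?thesis using e e' by (intro exI[of _ "min e e'"]) auto
    qed
    have "continuous_on X g"
      unfolding continuous_on_eq_continuous_within
    proof
      fix x assume x: "x \<in> X"
      then obtain e where "0 < e" "continuous_on (X \<inter> ball x e) g" using * by blast
      then have "continuous (at x within X \<inter> ball x e) g"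
        using x unfolding continuous_on_eq_continuous_within by auto
      then show "continuous (at x within X) g"
        using at_within_Int_ball[OF \<open>0 < e\<close>, of x X] by simp
    qed
    then show ?thesis using * Sobolev by (auto simp: locally_sobolev_on_def)
  qed
qed

lemma class_on_linear:
  assumes F: "admissible F m" and X: "chart_domain X" and L: "bounded_linear L" and g: "class_on F X g"
  shows "class_on F X (\<lambda>x. L (g x))"
proof (cases "X \<subseteq> {0}")
  case True
  then show ?thesis by (rule class_on_trivial)
next
  case False
  have X': "full_domain X" using X False by (simp add: chart_domain_def)
  show ?thesis
  proof (cases F)
    case (Frechet_C k)
    show ?thesis using g holder_Ck_on_linear[OF L] unfolding Frechet_C class_on_Frechet by blast
  next
    case (Bastiani_C k)
    show ?thesis using g holder_Ck_on_linear[OF L] unfolding Bastiani_C class_on_Bastiani[OF X'] by blast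
  next
    case (Holder k \<alpha>)
    then show ?thesis using g holder_Ck_on_linear[OF L] by auto
  next
    case (Sobolev k p)
    have "\<exists>e>0. sobolev k p (interior (X \<inter> ball x e)) (\<lambda>x. L (g x))" if x: "x \<in> X" for x
    proof -
      obtain e where e: "0 < e" "sobolev k p (interior (X \<inter> ball x e)) g"
        using g x unfolding Sobolev class_on.simps locally_sobolev_on_def by blast
      from sobolev_linear[OF L open_interior admissible_simps(4)[OF F[unfolded Sobolev]] e(2)]
      show ?thesis using e(1) by blast
    qed
    moreover have "continuous_on X (\<lambda>x. L (g x))"
      using class_on_continuous[OF X g] by (intro bounded_linear.continuous_on[OF L])
    ultimately show ?thesis using Sobolev by (simp add: locally_sobolev_on_def)
  qed
qed

lemma class_on_add:
  assumes F: "admissible F m" and X: "chart_domain X" and g: "class_on F X g" and h: "class_on F X h"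
  shows "class_on F X (\<lambda>x. g x + h x)"
proof (cases "X \<subseteq> {0}")
  case True
  then show ?thesis by (rule class_on_trivial)
next
  case False
  have X': "full_domain X" using X False by (simp add: chart_domain_def)
  show ?thesis
  proof (cases F)
    case (Frechet_C k)
    show ?thesis using g h holder_Ck_on_add unfolding Frechet_C class_on_Frechet by blast
  next
    case (Bastiani_C k)
    show ?thesis using g h holder_Ck_on_add unfolding Bastiani_C class_on_Bastiani[OF X'] by blast
  next
    case (Holder k \<alpha>)
    then show ?thesis using g h holder_Ck_on_add by auto
  next
    case (Sobolev k p)
    have p: "1 \<le> p" using admissible_simps(4)[OF F[unfolded Sobolev]] .
    have "\<exists>e>0. sobolev k p (interior (X \<inter> ball x e)) (\<lambda>x. g x + h x)" if x: "x \<in> X" for x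
    proof -
      obtain e d where e: "0 < e" "sobolev k p (interior (X \<inter> ball x e)) g"
        and d: "0 < d" "sobolev k p (interior (X \<inter> ball x d)) h"
        using g h x unfolding Sobolev class_on.simps locally_sobolev_on_def by blast
      have "sobolev k p (interior (X \<inter> ball x (min e d))) g" "sobolev k p (interior (X \<inter> ball x (min e d))) h"
        by (rule sobolev_subset[OF open_interior _ e(2)] sobolev_subset[OF open_interior _ d(2)];
            rule interior_mono; force)+
      from sobolev_add[OF open_interior p this] show ?thesis
        using e(1) d(1) by (intro exI[of _ "min e d"]) simp
    qed
    moreover have "continuous_on X (\<lambda>x. g x + h x)"
      using class_on_continuous[OF X g] class_on_continuous[OF X h] by (rule continuous_on_add)
    ultimately show ?thesis using Sobolev by (simp add: locally_sobolev_on_def)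
  qed
qed

lemma class_on_const:
  assumes X: "chart_domain X"
  shows "class_on F X (\<lambda>x. c)"
proof (cases "X \<subseteq> {0}")
  case True
  then show ?thesis by (rule class_on_trivial)
next
  case False
  have X': "full_domain X" using X False by (simp add: chart_domain_def)
  show ?thesis
  proof (cases F)
    case (Bastiani_C k)
    show ?thesis using holder_Ck_on_const unfolding Bastiani_C class_on_Bastiani[OF X'] by blast
  next
    case (Sobolev k p)
    have "sobolev k p (interior (X \<inter> ball x 1)) (\<lambda>x. c)" for x
      by (rule sobolev_const[OF open_interior bounded_subset[OF bounded_ball]])
         (use interior_subset in fastforce)
    then show ?thesis using Sobolev by (auto simp: locally_sobolev_on_def intro!: exI[of _ 1])
  qed (auto simp: frechet_eq_holder_0 holder_Ck_on_const)
qed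

lemma class_on_sum:
  assumes F: "admissible F m" and X: "chart_domain X" and "finite I" "\<And>i. i \<in> I \<Longrightarrow> class_on F X (g i)"
  shows "class_on F X (\<lambda>x. \<Sum>i\<in>I. g i x)"
  using assms(3,4)
  by (induction I rule: finite_induct) (simp_all add: class_on_const[OF X] class_on_add[OF F X])

lemma class_on_mult_smooth:
  assumes F: "admissible F m" and X: "chart_domain X" and s: "class_on (Frechet_C \<infinity>) X s" and g: "class_on F X g"
  shows "class_on F X (\<lambda>x. s x *\<^sub>R g x)"
proof (cases "X \<subseteq> {0}")
  case True
  then show ?thesis by (rule class_on_trivial)
next
  case False
  have X': "full_domain X" using X False by (simp add: chart_domain_def)
  have s': "smooth_on X s" using s unfolding class_on_smooth .
  then have sj: "holder_Ck_on j 0 X s" for j by (simp add: smooth_on_def)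
  have prod: "holder_Ck_on j 0 X (\<lambda>x. s x *\<^sub>R g x)" if "holder_Ck_on j 0 X g" for j
    using holder_Ck_on_scaleR[OF X' _ _ sj that] by simp
  show ?thesis
  proof (cases F)
    case (Frechet_C k)
    show ?thesis using g prod unfolding Frechet_C class_on_Frechet by blast
  next
    case (Bastiani_C k)
    show ?thesis using g prod unfolding Bastiani_C class_on_Bastiani[OF X'] by blast
  next
    case (Holder k \<alpha>)
    have a: "0 \<le> \<alpha>" "\<alpha> \<le> 1" using F Holder by auto
    \<comment> \<open>A smooth factor has all orders with exponent 0; one spare derivative supplies
      the exponent \<open>\<alpha>\<close>.\<close>
    have "holder_Ck_on k \<alpha> X s" using holder_Ck_on_SucD[OF X' a sj] .
    then show ?thesis using g Holder holder_Ck_on_scaleR[OF X' a] by auto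
  next
    case (Sobolev k p)
    have p: "1 \<le> p" using admissible_simps(4)[OF F[unfolded Sobolev]] .
    have "\<exists>e>0. sobolev k p (interior (X \<inter> ball x e)) (\<lambda>x. s x *\<^sub>R g x)" if x: "x \<in> X" for x
    proof -
      obtain e where e: "0 < e" "sobolev k p (interior (X \<inter> ball x e)) g"
        using g x unfolding Sobolev class_on.simps locally_sobolev_on_def by blast
      obtain d where d: "0 < d" "bounded_derivs k (interior (X \<inter> ball x d)) s"
        using bounded_derivs_local[OF X' s' x] by blast
      let ?\<Omega> = "interior (X \<inter> ball x (min e d))"
      have 1: "sobolev k p ?\<Omega> g" by (rule sobolev_subset[OF open_interior _ e(2)], rule interior_mono, force)
      have 2: "bounded_derivs k ?\<Omega> s" by (rule bounded_derivs_subset[OF d(2)], rule interior_mono, force)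
      have 3: "smooth_on ?\<Omega> s" by (rule smooth_on_subset[OF s']) (use interior_subset in blast)
      from sobolev_mult[OF open_interior p 3 2 1] show ?thesis
        using e(1) d(1) by (intro exI[of _ "min e d"]) simp
    qed
    moreover have "continuous_on X (\<lambda>x. s x *\<^sub>R g x)"
      using class_on_continuous[OF X g] smooth_on_continuous[OF s'] by (intro continuous_on_scaleR)
    ultimately show ?thesis using Sobolev by (simp add: locally_sobolev_on_def)
  qed
qed

text \<open>Local Sobolev regularity is stated on the interior of \<open>X\<close> within balls,
  whereas the inequality on lines needs a box; one is inserted between two such neighbourhoods. It
  may touch the bounding hyperplane, so that at boundary points it still fills the interior
  nearby.\<close>

lemma full_domain_box:
  fixes X :: "'a::euclidean_space set"
  assumes X: "full_domain X" "x \<in> X" and e: "0 < e"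
  obtains a b d where "0 < d" "interior (X \<inter> ball x d) \<subseteq> box a b" "box a b \<subseteq> interior (X \<inter> ball x e)"
    "\<And>i. i \<in> Basis \<Longrightarrow> a \<bullet> i < b \<bullet> i"
proof -
  obtain H e' where H: "H \<in> half_spaces" and e': "0 < e'" "X \<inter> ball x e' = H \<inter> ball x e'" "X \<subseteq> H"
    using full_domain_ball[OF X] .
  \<comment> \<open>The norm is at most the sum of the absolute coordinates; dividing by the
    dimension therefore keeps the box inside the ball.\<close>
  define d where "d = min e e' / real DIM('a)"
  have d: "0 < d" using e e' by (simp add: d_def)
  have small: "y \<in> ball x (min e e')" if "\<And>i. i \<in> Basis \<Longrightarrow> \<bar>(y - x) \<bullet> i\<bar> < d" for y
  proof -
    have "norm (y - x) \<le> (\<Sum>i\<in>Basis. \<bar>(y - x) \<bullet> i\<bar>)" by (rule norm_le_l1)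
    also have "\<dots> < (\<Sum>i\<in>(Basis::'a set). d)" using that by (intro sum_strict_mono) auto
    also have "\<dots> = min e e'" by (simp add: d_def)
    finally show ?thesis by (simp add: dist_norm norm_minus_commute)
  qed
  \<comment> \<open>The lower corner is \<open>x \<bullet> i - d\<close> in each coordinate, cut off
    at 0 in the coordinate that defines the half-space.\<close>
  define c where "c i = (if H = UNIV \<or> H \<noteq> {x. 0 \<le> x \<bullet> i} then x \<bullet> i - d else max 0 (x \<bullet> i - d))" for i
  define a where "a = (\<Sum>i\<in>Basis. c i *\<^sub>R i)"
  define b where "b = x + d *\<^sub>R One"
  have a: "a \<bullet> i = c i" if "i \<in> Basis" for i using that by (simp add: a_def)
  have b: "b \<bullet> i = x \<bullet> i + d" if "i \<in> Basis" for i using that by (simp add: b_def inner_add_left)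
  have xH: "x \<in> H" using X(2) e'(3) by blast
  have c: "x \<bullet> i - d \<le> c i" "c i < x \<bullet> i + d" for i
    using d xH by (auto simp: c_def)
  have box: "y \<in> box a b \<Longrightarrow> y \<in> ball x (min e e')" for y
  proof (rule small)
    fix i :: 'a assume "y \<in> box a b" "i \<in> Basis"
    then show "\<bar>(y - x) \<bullet> i\<bar> < d" using a b c(1)[of i] by (auto simp: box_def inner_diff_left abs_less_iff)
  qed
  have boxH: "y \<in> H" if y: "y \<in> box a b" for y
  proof (cases "H = UNIV")
    case False
    then obtain i where i: "i \<in> Basis" "H = {x. 0 \<le> x \<bullet> i}" using H by (auto simp: half_spaces_def)
    then have "0 \<le> a \<bullet> i" using a False by (simp add: c_def)
    then show ?thesis using y i by (force simp: box_def)
  qed simp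
  show ?thesis
  proof (rule that[OF d, of a b])
    show "box a b \<subseteq> interior (X \<inter> ball x e)"
    proof (rule interior_maximal[OF _ open_box])
      show "box a b \<subseteq> X \<inter> ball x e" using box boxH e'(2) by fastforce
    qed
    show "a \<bullet> i < b \<bullet> i" if "i \<in> Basis" for i using a[OF that] b[OF that] c(2)[of i] by simp
    show "interior (X \<inter> ball x d) \<subseteq> box a b"
    proof
      fix y assume y: "y \<in> interior (X \<inter> ball x d)"
      then have yd: "dist x y < d" using interior_subset by fastforce
      have yH: "y \<in> interior H" using y e'(3) interior_mono[of "X \<inter> ball x d" H] by blast
      show "y \<in> box a b"
        unfolding box_def
      proof safe
        fix i :: 'a assume i: "i \<in> Basis"
        have "\<bar>(y - x) \<bullet> i\<bar> < d"
          using Basis_le_norm[OF i, of "y - x"] yd by (simp add: dist_norm norm_minus_commute)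
        then have *: "x \<bullet> i - d < y \<bullet> i" "y \<bullet> i < x \<bullet> i + d" by (auto simp: inner_diff_left abs_less_iff)
        then show "y \<bullet> i < b \<bullet> i" using b[OF i] by simp
        have "0 < y \<bullet> i" if "H = {x. 0 \<le> x \<bullet> i}"
        proof -
          have "interior {x. 0 \<le> x \<bullet> i} = {x. 0 < x \<bullet> i}"
            using interior_halfspace_ge[of i 0] nonzero_Basis[OF i] by (simp add: inner_commute)
          then show ?thesis using yH that by auto
        qed
        then show "a \<bullet> i < y \<bullet> i" using * a[OF i] by (auto simp: c_def)
      qed
    qed
  qed
qed

lemma class_on_square:
  fixes g :: "'a::euclidean_space \<Rightarrow> real"
  assumes F: "admissible F m" and X: "chart_domain X" and g: "class_on F X g"
  shows "class_on F X (\<lambda>x. g x * g x)"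
proof (cases "X \<subseteq> {0}")
  case True
  then show ?thesis by (rule class_on_trivial)
next
  case False
  have X': "full_domain X" using X False by (simp add: chart_domain_def)
  have prod: "holder_Ck_on j \<alpha> X (\<lambda>x. g x * g x)" if "holder_Ck_on j \<alpha> X g" "0 \<le> \<alpha>" "\<alpha> \<le> 1" for j \<alpha>
    using holder_Ck_on_scaleR[OF X' that(2,3,1,1)] by simp
  show ?thesis
  proof (cases F)
    case (Frechet_C k)
    show ?thesis using g prod[of _ 0] unfolding Frechet_C class_on_Frechet by simp
  next
    case (Bastiani_C k)
    then show ?thesis using g prod[of _ 0] unfolding Bastiani_C class_on_Bastiani[OF X'] by simp
  next
    case (Holder k \<alpha>)
    have a: "0 \<le> \<alpha>" "\<alpha> \<le> 1" using F Holder by auto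
    then show ?thesis using g prod[of k \<alpha>] Holder by simp
  next
    case (Sobolev k p)
    have p: "1 \<le> p" and k: "1 \<le> k" using admissible_simps(3,4)[OF F[unfolded Sobolev]] by auto
    have cont: "continuous_on X g" using class_on_continuous[OF X g] .
    have "\<exists>e>0. sobolev k p (interior (X \<inter> ball x e)) (\<lambda>x. g x * g x)" if x: "x \<in> X" for x
    proof -
      obtain e where e: "0 < e" "sobolev k p (interior (X \<inter> ball x e)) g"
        using g x unfolding Sobolev class_on.simps locally_sobolev_on_def by blast
      obtain e' where e': "0 < e'" "\<And>y. y \<in> X \<Longrightarrow> dist y x < e' \<Longrightarrow> dist (g y) (g x) < 1"
        using cont x unfolding continuous_on_iff by (metis zero_less_one)
      obtain a b d where d: "0 < d" "interior (X \<inter> ball x d) \<subseteq> box a b" "box a b \<subseteq> interior (X \<inter> ball x (min e e'))"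
        "\<And>i. i \<in> Basis \<Longrightarrow> a \<bullet> i < b \<bullet> i"
        using full_domain_box[OF X' x, of "min e e'"] e(1) e'(1) by (metis min_less_iff_conj)
      have sub: "box a b \<subseteq> X \<inter> ball x (min e e')" using d(3) interior_subset by blast
      have "sobolev k p (box a b) (\<lambda>x. g x * g x)"
      proof (rule sobolev_square_box[OF p _ _ d(4) _ k])
        show "continuous_on (box a b) g" using cont sub by (auto intro: continuous_on_subset)
        show "\<bar>g y\<bar> \<le> \<bar>g x\<bar> + 1" if "y \<in> box a b" for y
          using e'(2)[of y] sub that by (auto simp: dist_real_def dist_commute subset_iff)
        show "sobolev k p (box a b) g"
        proof (rule sobolev_subset[OF open_box _ e(2)])
          show "box a b \<subseteq> interior (X \<inter> ball x e)"
            using d(3) interior_mono[of "X \<inter> ball x (min e e')" "X \<inter> ball x e"] by force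
        qed
      qed
      from sobolev_subset[OF open_interior d(2) this] show ?thesis using d(1) by blast
    qed
    moreover have "continuous_on X (\<lambda>x. g x * g x)" using cont by (intro continuous_intros)
    ultimately show ?thesis using Sobolev by (simp add: locally_sobolev_on_def)
  qed
qed

section \<open>Functions on manifolds\<close>

lemma manifold_chartD:
  assumes "smooth_manifold m V A" "(U, c) \<in> A"
  shows "openin V U" "U \<subseteq> topspace V" "chart_domain (c ` U)"
    "homeomorphic_map (subtopology V U) (top_of_set (c ` U)) c" "inj_on c U"
    "\<exists>H\<in>models m. openin (top_of_set H) (c ` U)"
proof -
  have mc: "manifold_chart m V (U, c)" using assms by (auto simp: smooth_manifold_def)
  then show U: "openin V U" and hom: "homeomorphic_map (subtopology V U) (top_of_set (c ` U)) c"
    and H: "\<exists>H\<in>models m. openin (top_of_set H) (c ` U)"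
    by (auto simp: manifold_chart_def)
  show sub: "U \<subseteq> topspace V" using openin_subset[OF U] .
  show "chart_domain (c ` U)" using H chart_domain_models by blast
  show "inj_on c U" using homeomorphic_imp_injective_map[OF hom] sub by (simp add: Int_absorb1)
qed

lemma manifold_covers:
  assumes "smooth_manifold m V A" "v \<in> topspace V"
  obtains U c where "(U, c) \<in> A" "v \<in> U"
proof -
  have "(\<Union>(U, c)\<in>A. U) = topspace V" using assms(1) by (simp add: smooth_manifold_def)
  then show ?thesis using assms(2) that by blast
qed

lemma chart_image_openin:
  assumes "smooth_manifold m V A" "(U, c) \<in> A" "openin V S" "S \<subseteq> U"
  shows "openin (top_of_set (c ` U)) (c ` S)"
proof -
  note ch = manifold_chartD[OF assms(1,2)]
  have "openin (subtopology V U) S" using assms(3,4) by (simp add: openin_open_subtopology ch(1))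
  then show ?thesis
    using homeomorphic_imp_open_map[OF ch(4)] by (simp add: open_map_def)
qed

lemma chart_preimage_openin:
  assumes "smooth_manifold m V A" "(U, c) \<in> A" "openin (top_of_set (c ` U)) S"
  shows "openin V {v \<in> U. c v \<in> S}"
proof -
  note ch = manifold_chartD[OF assms(1,2)]
  have "openin (subtopology V U) {v \<in> topspace (subtopology V U). c v \<in> S}"
    using homeomorphic_imp_continuous_map[OF ch(4)] assms(3) by (rule openin_continuous_map_preimage)
  moreover have "{v \<in> topspace (subtopology V U). c v \<in> S} = {v \<in> U. c v \<in> S}" using ch(2) by auto
  ultimately have "openin (subtopology V U) {v \<in> U. c v \<in> S}" by (simp only:)
  then show ?thesis using ch(1) by (simp add: openin_open_subtopology)
qed

text \<open>For maps into a Euclidean space \<open>F_map\<close> reduces to this chart condition, as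
  continuity follows from it. Values off the carrier do not enter, so pointwise expressions can be
  used without restricting them.\<close>

definition F_fun ::
  "smoothness \<Rightarrow> ('v, 'a::euclidean_space) chart set \<Rightarrow> ('v \<Rightarrow> 'e::euclidean_space) \<Rightarrow> bool" where
  "F_fun F A x \<longleftrightarrow> (\<forall>(U, c)\<in>A. class_on F (c ` U) (x \<circ> inv_into U c))"

lemma F_funD: "F_fun F A x \<Longrightarrow> (U, c) \<in> A \<Longrightarrow> class_on F (c ` U) (\<lambda>y. x (inv_into U c y))"
  by (auto simp: F_fun_def o_def)

lemma F_funI: "(\<And>U c. (U, c) \<in> A \<Longrightarrow> class_on F (c ` U) (\<lambda>y. x (inv_into U c y))) \<Longrightarrow> F_fun F A x"
  by (auto simp: F_fun_def o_def)

lemma F_fun_continuous: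
  assumes M: "smooth_manifold m V A" and x: "F_fun F A x"
  shows "continuous_map V euclidean x"
  unfolding continuous_map
proof (intro conjI allI impI)
  fix T :: "'c set" assume "openin euclidean T"
  then have T: "open T" by simp
  show "openin V {v \<in> topspace V. x v \<in> T}"
  proof (subst openin_subopen, intro ballI)
    fix v assume v: "v \<in> {v \<in> topspace V. x v \<in> T}"
    then obtain U c where c: "(U, c) \<in> A" "v \<in> U" using manifold_covers[OF M] by blast
    note ch = manifold_chartD[OF M c(1)]
    have "continuous_on (c ` U) (\<lambda>y. x (inv_into U c y))"
      using class_on_continuous[OF ch(3) F_funD[OF x c(1)]] .
    then have "openin (top_of_set (c ` U)) (c ` U \<inter> (\<lambda>y. x (inv_into U c y)) -` T)"
      using T by (rule continuous_openin_preimage_gen)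
    from chart_preimage_openin[OF M c(1) this]
    have "openin V {v \<in> U. c v \<in> c ` U \<inter> (\<lambda>y. x (inv_into U c y)) -` T}" .
    moreover have "{v \<in> U. c v \<in> c ` U \<inter> (\<lambda>y. x (inv_into U c y)) -` T} = {v \<in> U. x v \<in> T}"
      by (intro Collect_cong conj_cong refl) (simp add: inv_into_f_f[OF ch(5)])
    ultimately have "openin V {v \<in> U. x v \<in> T}" by simp
    then show "\<exists>S. openin V S \<and> v \<in> S \<and> S \<subseteq> {v \<in> topspace V. x v \<in> T}"
      using v c(2) ch(2) by (intro exI[of _ "{v \<in> U. x v \<in> T}"]) auto
  qed
qed simp

lemma F_map_iff_F_fun:
  assumes "smooth_manifold m V A"
  shows "F_map F V A euclidean {(UNIV, id)} x \<longleftrightarrow> F_fun F A x"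
  using F_fun_continuous[OF assms, of F x] by (auto simp: F_map_def F_fun_def)

lemma F_fun_cong:
  assumes M: "smooth_manifold m V A" and "F_fun F A x" "\<And>v. v \<in> topspace V \<Longrightarrow> x v = y v"
  shows "F_fun F A y"
proof (rule F_funI)
  fix U c assume c: "(U, c) \<in> A"
  note ch = manifold_chartD[OF M c]
  show "class_on F (c ` U) (\<lambda>z. y (inv_into U c z))"
  proof (rule class_on_cong[OF ch(3) _ F_funD[OF assms(2) c]])
    show "x (inv_into U c z) = y (inv_into U c z)" if "z \<in> c ` U" for z
      using assms(3) ch(2) inv_into_into[OF that] by blast
  qed
qed

lemma F_fun_const: "smooth_manifold m V A \<Longrightarrow> F_fun F A (\<lambda>v. a)"
  by (rule F_funI) (auto intro: class_on_const dest: manifold_chartD(3))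

lemma F_fun_add:
  assumes "smooth_manifold m V A" "admissible F m" "F_fun F A x" "F_fun F A y"
  shows "F_fun F A (\<lambda>v. x v + y v)"
  by (rule F_funI, rule class_on_add[OF assms(2) manifold_chartD(3)[OF assms(1)]
        F_funD[OF assms(3)] F_funD[OF assms(4)]])

lemma F_fun_linear:
  assumes "smooth_manifold m V A" "admissible F m" "bounded_linear L" "F_fun F A x"
  shows "F_fun F A (\<lambda>v. L (x v))"
  by (rule F_funI, rule class_on_linear[OF assms(2) manifold_chartD(3)[OF assms(1)] assms(3)
        F_funD[OF assms(4)]])

lemma F_fun_mult_smooth:
  assumes "smooth_manifold m V A" "admissible F m" "F_fun (Frechet_C \<infinity>) A s" "F_fun F A x"
  shows "F_fun F A (\<lambda>v. s v *\<^sub>R x v)"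
  by (rule F_funI, rule class_on_mult_smooth[OF assms(2) manifold_chartD(3)[OF assms(1)]
        F_funD[OF assms(3)] F_funD[OF assms(4)]])

lemma F_fun_square:
  fixes x :: "'v \<Rightarrow> real"
  assumes "smooth_manifold m V A" "admissible F m" "F_fun F A x"
  shows "F_fun F A (\<lambda>v. x v * x v)"
  by (rule F_funI, rule class_on_square[OF assms(2) manifold_chartD(3)[OF assms(1)] F_funD[OF assms(3)]])

lemma F_fun_sum:
  assumes "smooth_manifold m V A" "admissible F m" "finite I" "\<And>i. i \<in> I \<Longrightarrow> F_fun F A (x i)"
  shows "F_fun F A (\<lambda>v. \<Sum>i\<in>I. x i v)"
  using assms(3,4)
  by (induction I rule: finite_induct) (simp_all add: F_fun_const[OF assms(1)] F_fun_add[OF assms(1,2)])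

section \<open>Smooth cutoffs, functions with a single zero, and global coordinates\<close>

lemma models_closed: "H \<in> models m \<Longrightarrow> closed H"
  using closed_halfspace_component_ge[of 0] by (auto simp: models_def split: if_splits)

text \<open>Turns locality in the chart image, which is formulated with balls, into locality on the
  manifold, where neighbourhoods can be chosen in terms of other charts and of preimages.\<close>

lemma class_on_chart_local:
  assumes M: "smooth_manifold m V A" and c: "(U, c) \<in> A" and S: "openin V S" "S \<subseteq> U"
    and loc: "\<And>u. u \<in> S \<Longrightarrow> \<exists>R. openin V R \<and> u \<in> R \<and> R \<subseteq> S \<and> class_on F (c ` R) g"
  shows "class_on F (c ` S) g"
proof (rule class_on_local)
  note ch = manifold_chartD[OF M c]
  show cd: "chart_domain (c ` S)" by (rule chart_domain_openin[OF ch(3) chart_image_openin[OF M c S]])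
  fix y assume "y \<in> c ` S"
  then obtain u where u: "u \<in> S" "y = c u" by blast
  obtain R where R: "openin V R" "u \<in> R" "R \<subseteq> S" "class_on F (c ` R) g" using loc[OF u(1)] by blast
  have RU: "R \<subseteq> U" using R(3) S(2) by blast
  note RI = chart_image_openin[OF M c R(1) RU]
  obtain T where T: "open T" "c ` R = c ` U \<inter> T" using RI by (auto simp: openin_open)
  then obtain e where e: "0 < e" "ball (c u) e \<subseteq> T" using R(2) openE by blast
  have eq: "c ` S \<inter> ball y e = c ` R \<inter> ball y e" using T(2) e(2) R(3) S(2) u(2) by blast
  have "class_on F (c ` R \<inter> ball y e) g"
    by (rule class_on_subset[OF chart_domain_openin[OF ch(3) RI] _ R(4)]) (simp add: openin_open_Int)
  then show "\<exists>e>0. class_on F (c ` S \<inter> ball y e) g" unfolding eq[symmetric] using e(1) by blast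
qed

text \<open>Hausdorffness enters here: compact subsets of a chart domain are closed in the manifold.\<close>

lemma smooth_extension_by_zero:
  assumes M: "smooth_manifold m V A" and c: "(U, c) \<in> A" "v \<in> U" and S: "openin V S" "v \<in> S"
  obtains e where "0 < e" "\<And>u. u \<in> U \<Longrightarrow> dist (c u) (c v) < e \<Longrightarrow> u \<in> S"
    "\<And>\<sigma>. smooth_on UNIV \<sigma> \<Longrightarrow> (\<And>y. e \<le> dist y (c v) \<Longrightarrow> \<sigma> y = (0::real)) \<Longrightarrow>
       F_fun (Frechet_C \<infinity>) A (\<lambda>u. if u \<in> U then \<sigma> (c u) else 0)"
proof -
  note ch = manifold_chartD[OF M c(1)]
  obtain H where H: "H \<in> models m" "openin (top_of_set H) (c ` U)" using ch(6) by blast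
  obtain T where T: "open T" "c ` U = H \<inter> T" using H(2) by (auto simp: openin_open)
  have "openin (top_of_set (c ` U)) (c ` (U \<inter> S))"
    using chart_image_openin[OF M c(1), of "U \<inter> S"] S(1) ch(1) by auto
  then obtain T' where T': "open T'" "c ` (U \<inter> S) = c ` U \<inter> T'" by (auto simp: openin_open)
  have cv: "c v \<in> T \<inter> T'" using T' T c(2) S(2) by blast
  obtain e' where e': "0 < e'" "cball (c v) e' \<subseteq> T \<inter> T'"
    using open_contains_cball[of "T \<inter> T'"] T(1) T'(1) cv by (meson open_Int)
  define K where "K = {u \<in> U. c u \<in> cball (c v) e'}"
  have K: "closedin V K"
  proof (rule compactin_imp_closedin)
    show "Hausdorff_space V" using M by (simp add: smooth_manifold_def)
    obtain g where g: "homeomorphic_maps (subtopology V U) (top_of_set (c ` U)) c g"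
      using ch(4) homeomorphic_map_maps by blast
    \<comment> \<open>Inside the closed ball the chart image is all of the closed model set, so the
      intersection is compact although the image need not be closed.\<close>
    have "c ` U \<inter> cball (c v) e' = H \<inter> cball (c v) e'" using T(2) e'(2) by blast
    then have "compact (c ` U \<inter> cball (c v) e')"
      using models_closed[OF H(1)] by (simp add: closed_Int_compact)
    then have "compactin (top_of_set (c ` U)) (c ` U \<inter> cball (c v) e')"
      by (simp add: compactin_subtopology)
    then have "compactin (subtopology V U) (g ` (c ` U \<inter> cball (c v) e'))"
      using g unfolding homeomorphic_maps_def by (blast intro: image_compactin)
    moreover have "g ` (c ` U \<inter> cball (c v) e') = K"
    proof -
      have "g (c u) = u" if "u \<in> U" for u
        using g that ch(2) by (auto simp: homeomorphic_maps_def)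
      then show ?thesis by (force simp: K_def)
    qed
    ultimately show "compactin V K" by (simp add: compactin_subtopology)
  qed
  show ?thesis
  proof (rule that[OF e'(1)])
    fix u assume u: "u \<in> U" "dist (c u) (c v) < e'"
    then have "c u \<in> c ` U \<inter> T'" using e'(2) by (auto simp: dist_commute subset_eq)
    then obtain u' where "u' \<in> U" "u' \<in> S" "c u = c u'" using T'(2) by blast
    then show "u \<in> S" using ch(5) u(1) by (metis inj_onD)
  next
    fix \<sigma> :: "'b \<Rightarrow> real"
    assume \<sigma>: "smooth_on UNIV \<sigma>" "\<And>y. e' \<le> dist y (c v) \<Longrightarrow> \<sigma> y = 0"
    let ?s = "\<lambda>u. if u \<in> U then \<sigma> (c u) else 0"
    show "F_fun (Frechet_C \<infinity>) A ?s"
    proof (rule F_funI)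
      fix U' c' assume c': "(U', c') \<in> A"
      note ch' = manifold_chartD[OF M c']
      let ?g = "\<lambda>y. ?s (inv_into U' c' y)"
      show "class_on (Frechet_C \<infinity>) (c' ` U') ?g"
      proof (rule class_on_chart_local[OF M c' ch'(1) subset_refl])
        fix u assume u: "u \<in> U'"
        show "\<exists>R. openin V R \<and> u \<in> R \<and> R \<subseteq> U' \<and> class_on (Frechet_C \<infinity>) (c' ` R) ?g"
        \<comment> \<open>On \<open>U' \<inter> U\<close> the function is \<open>\<sigma>\<close>
          after a transition map. A point outside \<open>U\<close> has the neighbourhood
          \<open>U' - K\<close>, open because \<open>K\<close> is closed, and there the function is
          0.\<close>
        proof (cases "u \<in> U")
          case True
          let ?R = "U' \<inter> U"
          have R: "openin V ?R" using ch(1) ch'(1) by auto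
          have cd: "chart_domain (c' ` ?R)"
            by (rule chart_domain_openin[OF ch'(3) chart_image_openin[OF M c' R]]) blast
          have tr: "class_on (Frechet_C \<infinity>) (c' ` ?R) (c \<circ> inv_into U' c')"
            using M c' c(1) by (auto simp only: smooth_manifold_def)
          have "class_on (Frechet_C \<infinity>) (c' ` ?R) (\<lambda>y. \<sigma> ((c \<circ> inv_into U' c') y))"
          proof (cases "c' ` ?R \<subseteq> {0}")
            case True
            then show ?thesis by (rule class_on_trivial)
          next
            case False
            then have "full_domain (c' ` ?R)" using cd by (simp add: chart_domain_def)
            from smooth_on_compose[OF this tr[unfolded class_on_smooth] subset_UNIV \<sigma>(1)]
            show ?thesis unfolding class_on_smooth .
          qed
          then have "class_on (Frechet_C \<infinity>) (c' ` ?R) ?g"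
          proof (rule class_on_cong[OF cd, rotated])
            fix y assume "y \<in> c' ` ?R"
            then show "\<sigma> ((c \<circ> inv_into U' c') y) = ?g y" using ch'(5) by auto
          qed
          then show ?thesis
            using R(1) True u by (intro exI[of _ ?R]) blast
        next
          case False
          let ?R = "U' - K"
          have R: "openin V ?R" using ch'(1) K by (rule openin_diff)
          have cd: "chart_domain (c' ` ?R)"
            by (rule chart_domain_openin[OF ch'(3) chart_image_openin[OF M c' R]]) blast
          have "class_on (Frechet_C \<infinity>) (c' ` ?R) ?g"
          proof (rule class_on_cong[OF cd _ class_on_const[OF cd, of _ 0]])
            fix y assume "y \<in> c' ` ?R"
            then obtain u where u: "u \<in> U'" "u \<notin> K" "y = c' u" by blast
            then have "inv_into U' c' y = u" using ch'(5) by simp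
            moreover have "?s u = 0" using u(2) \<sigma>(2)[of "c u"] by (auto simp: K_def dist_commute)
            ultimately show "0 = ?g y" by (simp only:)
          qed
          then show ?thesis
            using R False u by (intro exI[of _ ?R]) (simp add: K_def)
        qed
      qed
    qed
  qed
qed

lemma smooth_bump:
  assumes M: "smooth_manifold m V A" and S: "openin V S" "v \<in> S"
  obtains s :: "'v \<Rightarrow> real" where "F_fun (Frechet_C \<infinity>) A s" "s v = 1" "\<And>u. u \<notin> S \<Longrightarrow> s u = 0"
proof -
  obtain U c where c: "(U, c) \<in> A" "v \<in> U"
    using manifold_covers[OF M, of v] openin_subset[OF S(1)] S(2) by blast
  obtain e where e: "0 < e" "\<And>u. u \<in> U \<Longrightarrow> dist (c u) (c v) < e \<Longrightarrow> u \<in> S"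
    "\<And>\<sigma>. smooth_on UNIV \<sigma> \<Longrightarrow> (\<And>y. e \<le> dist y (c v) \<Longrightarrow> \<sigma> y = (0::real)) \<Longrightarrow>
       F_fun (Frechet_C \<infinity>) A (\<lambda>u. if u \<in> U then \<sigma> (c u) else 0)"
    by (rule smooth_extension_by_zero[OF M c S]) (rule that; blast)
  obtain \<theta> where \<theta>: "smooth_on UNIV \<theta>" "\<And>y. dist y (c v) \<le> e / 2 \<Longrightarrow> \<theta> y = (1::real)" "\<And>y. e \<le> dist y (c v) \<Longrightarrow> \<theta> y = 0"
    using smooth_plateau[OF e(1), of "c v"] by metis
  show ?thesis
  proof (rule that[OF e(3)[OF \<theta>(1,3)]])
    show "(if v \<in> U then \<theta> (c v) else 0) = 1" using c(2) \<theta>(2)[of "c v"] e(1) by simp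
    show "(if u \<in> U then \<theta> (c u) else 0) = 0" if "u \<notin> S" for u
      using e(2)[of u] \<theta>(3)[of "c u"] that by force
  qed
qed

text \<open>The function is 1 minus a bump that attains its maximum 1 at \<open>v\<close> only:
  multiplying a plateau by \<open>1 - \<rho>\<close>, with \<open>\<rho>\<close> the squared chart
  distance divided by the square of \<open>e\<close>, sharpens it to a single point. Away from the
  chart the value is 1, so no further zero can appear.\<close>

lemma smooth_unique_zero:
  assumes M: "smooth_manifold m V A" and v: "v \<in> topspace V"
  obtains k :: "'v \<Rightarrow> real" where "F_fun (Frechet_C \<infinity>) A k" "\<And>u. 0 \<le> k u" "k v = 0" "\<And>u. k u = 0 \<Longrightarrow> u = v"
proof -
  obtain U c where c: "(U, c) \<in> A" "v \<in> U" using manifold_covers[OF M v] by blast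
  note ch = manifold_chartD[OF M c(1)]
  obtain e where e: "0 < e" "\<And>u. u \<in> U \<Longrightarrow> dist (c u) (c v) < e \<Longrightarrow> u \<in> topspace V"
    "\<And>\<sigma>. smooth_on UNIV \<sigma> \<Longrightarrow> (\<And>y. e \<le> dist y (c v) \<Longrightarrow> \<sigma> y = (0::real)) \<Longrightarrow>
       F_fun (Frechet_C \<infinity>) A (\<lambda>u. if u \<in> U then \<sigma> (c u) else 0)"
    by (rule smooth_extension_by_zero[OF M c openin_topspace v]) (rule that; blast)
  obtain \<theta> where \<theta>: "smooth_on UNIV \<theta>" "\<And>y. 0 \<le> \<theta> y" "\<And>y. \<theta> y \<le> (1::real)"
    "\<And>y. dist y (c v) \<le> e / 2 \<Longrightarrow> \<theta> y = 1" "\<And>y. e \<le> dist y (c v) \<Longrightarrow> \<theta> y = 0"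
    using smooth_plateau[OF e(1), of "c v"] by metis
  define \<rho> where "\<rho> y = (\<Sum>i\<in>Basis. ((y - c v) \<bullet> i) * ((y - c v) \<bullet> i)) * inverse (e\<^sup>2)" for y
  have \<rho>: "\<rho> y = (dist y (c v))\<^sup>2 / e\<^sup>2" for y
    by (simp add: \<rho>_def dist_norm power2_norm_eq_inner euclidean_inner[of "y - c v" "y - c v"] divide_inverse)
  have \<rho>sm: "smooth_on UNIV \<rho>"
    unfolding \<rho>_def
    by (intro smooth_on_mult smooth_on_sum smooth_on_inner smooth_on_diff smooth_on_id smooth_on_const) auto
  define \<sigma> where "\<sigma> y = \<theta> y * (1 - \<rho> y)" for y
  have \<sigma>sm: "smooth_on UNIV \<sigma>"
    unfolding \<sigma>_def by (intro smooth_on_mult smooth_on_diff smooth_on_const \<rho>sm \<theta>(1)) auto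
  have \<sigma>0: "\<sigma> y = 0" if "e \<le> dist y (c v)" for y using \<theta>(5)[OF that] by (simp add: \<sigma>_def)
  have \<rho>pos: "0 \<le> \<rho> y" for y by (simp add: \<rho>)
  have \<sigma>le: "\<sigma> y \<le> 1" for y
  proof -
    have "\<theta> y * (1 - \<rho> y) \<le> \<theta> y * 1" using \<theta>(2) \<rho>pos by (intro mult_left_mono) auto
    then show ?thesis using \<theta>(3)[of y] by (simp add: \<sigma>_def)
  qed
  have \<sigma>1: "y = c v" if "\<sigma> y = 1" for y
  proof -
    have "1 = \<theta> y - \<theta> y * \<rho> y" using that by (simp add: \<sigma>_def algebra_simps)
    moreover have "0 \<le> \<theta> y * \<rho> y" using \<theta>(2) \<rho>pos by simp
    ultimately have "\<theta> y = 1" "\<theta> y * \<rho> y = 0" using \<theta>(3)[of y] by linarith+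
    then have "\<rho> y = 0" by simp
    then show ?thesis using e(1) by (simp add: \<rho>)
  qed
  let ?s = "\<lambda>u. if u \<in> U then \<sigma> (c u) else 0"
  have "F_fun (Frechet_C \<infinity>) A (\<lambda>u. 1 + (- ?s u))"
    by (intro F_fun_add[OF M] F_fun_const[OF M] F_fun_linear[OF M _ bounded_linear_minus[OF bounded_linear_ident]]
      e(3)[OF \<sigma>sm \<sigma>0]) auto
  then show ?thesis
  proof (rule that)
    show "0 \<le> 1 + - ?s u" for u using \<sigma>le by simp
    show "1 + - ?s v = 0" using c(2) \<theta>(4)[of "c v"] e(1) by (simp add: \<sigma>_def \<rho>)
    show "u = v" if "1 + - ?s u = 0" for u
      using that \<sigma>1[of "c u"] ch(5) c(2) by (auto split: if_splits dest: inj_onD)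
  qed
qed

text \<open>Chart coordinates multiplied by a plateau extend to smooth functions on the whole
  manifold, so that a map into the manifold can be examined through such functions.\<close>

lemma smooth_coordinates:
  assumes M: "smooth_manifold m V A" and c: "(U, c) \<in> A" "v \<in> U"
  obtains R s where "openin V R" "v \<in> R" "R \<subseteq> U" "\<And>i. F_fun (Frechet_C \<infinity>) A (s i :: _ \<Rightarrow> real)"
    "\<And>i u. u \<in> R \<Longrightarrow> s i u = c u \<bullet> i"
proof -
  note ch = manifold_chartD[OF M c(1)]
  obtain e where e: "0 < e" "\<And>u. u \<in> U \<Longrightarrow> dist (c u) (c v) < e \<Longrightarrow> u \<in> topspace V"
    "\<And>\<sigma>. smooth_on UNIV \<sigma> \<Longrightarrow> (\<And>y. e \<le> dist y (c v) \<Longrightarrow> \<sigma> y = (0::real)) \<Longrightarrow>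
       F_fun (Frechet_C \<infinity>) A (\<lambda>u. if u \<in> U then \<sigma> (c u) else 0)"
    by (rule smooth_extension_by_zero[OF M c openin_topspace subsetD[OF ch(2) c(2)]]) (rule that; blast)
  obtain \<theta> where \<theta>: "smooth_on UNIV \<theta>" "\<And>y. dist y (c v) \<le> e / 2 \<Longrightarrow> \<theta> y = (1::real)" "\<And>y. e \<le> dist y (c v) \<Longrightarrow> \<theta> y = 0"
    using smooth_plateau[OF e(1), of "c v"] by metis
  show ?thesis
  proof (rule that)
    show "openin V {u \<in> U. c u \<in> c ` U \<inter> ball (c v) (e / 2)}"
      by (rule chart_preimage_openin[OF M c(1)]) (simp add: openin_open_Int)
    show "F_fun (Frechet_C \<infinity>) A (\<lambda>u. if u \<in> U then \<theta> (c u) * (c u \<bullet> i) else 0)" for i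
      by (rule e(3)) (auto intro!: smooth_on_mult smooth_on_inner smooth_on_id \<theta>)
    show "(if u \<in> U then \<theta> (c u) * (c u \<bullet> i) else 0) = c u \<bullet> i"
      if "u \<in> {u \<in> U. c u \<in> c ` U \<inter> ball (c v) (e / 2)}" for i u
      using that \<theta>(2)[of "c u"] by (auto simp: dist_commute)
  qed (use c e(1) in auto)
qed

section \<open>The point map of a linear bijection\<close>

text \<open>The argument that an endomorphism all of whose nonzero vectors are eigenvectors is
  scalar, relative to the injective \<open>G\<close>: comparing the factors of \<open>a0\<close>,
  \<open>b\<close> and \<open>a0 + b\<close> shows that they agree unless \<open>b\<close> is a
  multiple of \<open>a0\<close>, where linearity suffices.\<close>

lemma linear_all_eigen:
  fixes M G :: "'a::real_vector \<Rightarrow> 'b::real_vector"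
  assumes M: "linear M" and G: "linear G" "inj G" and e: "\<And>a. \<exists>c. M a = c *\<^sub>R G a"
  shows "\<exists>c. \<forall>a. M a = c *\<^sub>R G a"
proof (cases "\<exists>a0 :: 'a. a0 \<noteq> 0")
  case False
  then have "a = 0" for a :: 'a by blast
  then show ?thesis using linear_0[OF M] linear_0[OF G(1)] by (metis scaleR_zero_right)
next
  case True
  then obtain a0 :: 'a where a0: "a0 \<noteq> 0" by blast
  obtain c0 where c0: "M a0 = c0 *\<^sub>R G a0" using e by blast
  have "M b = c0 *\<^sub>R G b" for b
  proof -
    obtain c d where c: "M b = c *\<^sub>R G b" and d: "M (a0 + b) = d *\<^sub>R G (a0 + b)" using e by meson
    have "c0 *\<^sub>R G a0 + c *\<^sub>R G b = d *\<^sub>R G a0 + d *\<^sub>R G b"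
      using d by (simp add: linear_add[OF M] linear_add[OF G(1)] c c0 scaleR_add_right)
    then have "G ((c0 - d) *\<^sub>R a0) = G ((d - c) *\<^sub>R b)"
      by (simp add: linear_cmul[OF G(1)] linear_diff[OF G(1)] algebra_simps)
    then have eq: "(c0 - d) *\<^sub>R a0 = (d - c) *\<^sub>R b" using G(2) by (simp add: inj_eq)
    show ?thesis
    proof (cases "d = c")
      case True
      then show ?thesis using eq a0 c by simp
    next
      case False
      then have "b = ((c0 - d) / (d - c)) *\<^sub>R a0"
        using eq by (metis (no_types, lifting) divide_inverse_commute eq_iff_diff_eq_0 scaleR_one scaleR_scaleR left_inverse)
      then show ?thesis by (simp add: linear_cmul[OF M] linear_cmul[OF G(1)] c0)
    qed
  qed
  then show ?thesis by blast
qed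

definition const_map :: "'v topology \<Rightarrow> 'e \<Rightarrow> 'v \<Rightarrow> 'e" where
  "const_map V a = (\<lambda>v\<in>topspace V. a)"

lemma F_space_iff:
  assumes "smooth_manifold m V A"
  shows "x \<in> F_space F V A \<longleftrightarrow> x \<in> extensional (topspace V) \<and> F_fun F A x"
  by (simp add: F_space_def F_map_iff_F_fun[OF assms])

lemma F_space_restrict:
  assumes "smooth_manifold m V A" "F_fun F A x"
  shows "(\<lambda>v\<in>topspace V. x v) \<in> F_space F V A"
  using F_fun_cong[OF assms, of "\<lambda>v\<in>topspace V. x v"] by (simp add: F_space_iff[OF assms(1)])

lemma point_map_exists:
  fixes V :: "'v topology" and A :: "('v, 'a::euclidean_space) chart set"
    and W :: "'w topology" and B :: "('w, 'b::euclidean_space) chart set"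
    and f :: "('v \<Rightarrow> real ^ 'n) \<Rightarrow> ('w \<Rightarrow> real ^ 'n)"
  assumes V: "smooth_manifold mV V A" and W: "smooth_manifold mW W B"
    and FV: "admissible F mV" and FW: "admissible F mW"
    and bij: "bij_betw f (F_space F V A) (F_space F W B)"
    and lin: "linear_on_F F V A W f"
    and nz: "f ` F_space_nz F V A = F_space_nz F W B"
  shows "\<And>w. w \<in> topspace W \<Longrightarrow> linear (\<lambda>a. f (const_map V a) w)"
    and "\<And>w. w \<in> topspace W \<Longrightarrow> inj (\<lambda>a. f (const_map V a) w)"
    and "\<exists>\<phi>. \<forall>w\<in>topspace W. \<phi> w \<in> topspace V \<and>
       (\<forall>x\<in>F_space F V A. f x w = f (const_map V (x (\<phi> w))) w)"
proof -
  define E where "E = (F_space F V A :: ('v \<Rightarrow> real ^ 'n) set)"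
  define \<Gamma> where "\<Gamma> w a = f (const_map V a) w" for w and a :: "real ^ 'n"
  have E: "(\<lambda>v\<in>topspace V. x v) \<in> E" if "F_fun F A x" for x
    unfolding E_def using F_space_restrict[OF V that] .
  have EF: "F_fun F A x" and Eext: "x \<in> extensional (topspace V)" if "x \<in> E" for x
    using that by (auto simp: E_def F_space_iff[OF V])
  have cE: "const_map V a \<in> E" for a unfolding const_map_def by (rule E[OF F_fun_const[OF V]])
  have fadd: "f (\<lambda>v\<in>topspace V. x v + y v) w = f x w + f y w"
    if "x \<in> E" "y \<in> E" "w \<in> topspace W" for x y w
    using lin that by (simp add: linear_on_F_def E_def)
  have fscale: "f (\<lambda>v\<in>topspace V. r *\<^sub>R x v) w = r *\<^sub>R f x w" if "x \<in> E" "w \<in> topspace W" for r x w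
    using lin that by (simp add: linear_on_F_def E_def)
  have \<Gamma>lin: "linear (\<Gamma> w)" if w: "w \<in> topspace W" for w
  proof (rule linearI)
    fix a b :: "real ^ 'n"
    have "const_map V (a + b) = (\<lambda>v\<in>topspace V. const_map V a v + const_map V b v)"
      by (auto simp: const_map_def)
    then show "\<Gamma> w (a + b) = \<Gamma> w a + \<Gamma> w b" using fadd[OF cE cE w] by (simp add: \<Gamma>_def)
  next
    fix r and a :: "real ^ 'n"
    have "const_map V (r *\<^sub>R a) = (\<lambda>v\<in>topspace V. r *\<^sub>R const_map V a v)"
      by (auto simp: const_map_def)
    then show "\<Gamma> w (r *\<^sub>R a) = r *\<^sub>R \<Gamma> w a" using fscale[OF cE w] by (simp add: \<Gamma>_def)
  qed
  have \<Gamma>inj: "inj (\<Gamma> w)" if w: "w \<in> topspace W" for w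
  proof -
    have "a = 0" if "\<Gamma> w a = 0" for a
    proof (rule ccontr)
      assume "a \<noteq> 0"
      then have "const_map V a \<in> F_space_nz F V A"
        using cE[of a] by (auto simp: F_space_nz_def E_def const_map_def)
      then have "f (const_map V a) \<in> F_space_nz F W B" using nz by blast
      then show False using that w by (simp add: F_space_nz_def \<Gamma>_def)
    qed
    then show ?thesis using linear_injective_0[OF \<Gamma>lin[OF w]] by blast
  qed
  have \<Gamma>0: "a = 0" if "w \<in> topspace W" "\<Gamma> w a = 0" for w a
    using linear_injective_0[OF \<Gamma>lin[OF that(1)]] \<Gamma>inj[OF that(1)] that(2) by blast
  have sub: "\<exists>y\<in>E. (\<forall>v\<in>topspace V. y v = x v - a) \<and> (\<forall>w\<in>topspace W. f y w = f x w - \<Gamma> w a)"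
    if x: "x \<in> E" for x a
  proof
    let ?y = "\<lambda>v\<in>topspace V. x v + const_map V (- a) v"
    show "?y \<in> E" using E[OF F_fun_add[OF V FV EF[OF x] EF[OF cE]]] .
    show "(\<forall>v\<in>topspace V. ?y v = x v - a) \<and> (\<forall>w\<in>topspace W. f ?y w = f x w - \<Gamma> w a)"
      using fadd[OF x cE, of _ "- a"] linear_neg[OF \<Gamma>lin] by (simp add: const_map_def \<Gamma>_def)
  qed
  have R1: "\<exists>v\<in>topspace V. f x w = \<Gamma> w (x v)" if x: "x \<in> E" and w: "w \<in> topspace W" for x w
  proof -
    \<comment> \<open>Domain and range have the same finite dimension, so injectivity provides the
      constant \<open>a\<close> to subtract from \<open>x\<close>. The image of the difference has a
      zero, hence the difference itself has one, and that is the point sought.\<close>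
    have "surj (\<Gamma> w)" using \<Gamma>lin[OF w] \<Gamma>inj[OF w] by (rule linear_injective_imp_surjective) simp
    then obtain a where a: "f x w = \<Gamma> w a" by (metis surjD)
    obtain y where y: "y \<in> E" "\<And>v. v \<in> topspace V \<Longrightarrow> y v = x v - a" "f y w = 0"
      using sub[OF x, of a] w a by auto
    have "y \<notin> F_space_nz F V A"
    proof
      assume "y \<in> F_space_nz F V A"
      then have "f y \<in> F_space_nz F W B" using nz by blast
      then show False using w y(3) by (simp add: F_space_nz_def)
    qed
    then obtain v where "v \<in> topspace V" "y v = 0" using y(1) by (auto simp: F_space_nz_def E_def)
    then show ?thesis using y(2) a by auto
  qed
  have R2: "\<exists>w\<in>topspace W. f x w = \<Gamma> w (x v)" if x: "x \<in> E" and v: "v \<in> topspace V" for x v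
  proof -
    obtain y where y: "y \<in> E" "\<And>u. u \<in> topspace V \<Longrightarrow> y u = x u - x v"
      "\<And>w. w \<in> topspace W \<Longrightarrow> f y w = f x w - \<Gamma> w (x v)"
      using sub[OF x, of "x v"] by auto
    \<comment> \<open>Otherwise \<open>f y\<close> would also be the image of a nowhere vanishing
      map. By injectivity of \<open>f\<close> this map is \<open>y\<close>, but
      \<open>y v = 0\<close>.\<close>
    have "f y \<notin> F_space_nz F W B"
    proof
      assume "f y \<in> F_space_nz F W B"
      then obtain y' where y': "y' \<in> F_space_nz F V A" "f y = f y'" using nz by blast
      then have "y' \<in> E" by (simp add: F_space_nz_def E_def)
      then have "y = y'" using y'(2) y(1) bij by (auto simp: bij_betw_def E_def dest: inj_onD)
      then show False using y'(1) v y(2)[OF v] by (simp add: F_space_nz_def)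
    qed
    moreover have "f y \<in> F_space F W B" using bij y(1) by (auto simp: bij_betw_def E_def)
    ultimately obtain w where "w \<in> topspace W" "f y w = 0" by (auto simp: F_space_nz_def)
    then show ?thesis using y(3) by auto
  qed
  define S where "S s a = (\<lambda>v\<in>topspace V. s v *\<^sub>R a)" for s :: "'v \<Rightarrow> real" and a :: "real ^ 'n"
  have SE: "S s a \<in> E" if "F_fun F A s" for s a
    unfolding S_def by (intro E F_fun_linear[OF V FV bounded_linear_scaleR_left that])
  \<comment> \<open>At \<open>w\<close> each \<open>S s a\<close> is sent to
    \<open>s v *\<^sub>R \<Gamma> w a\<close>, with a point \<open>v\<close> that may depend on
    \<open>a\<close>; linearity in \<open>a\<close> makes the factor common.\<close>
  have ex: "\<exists>c. \<forall>a. f (S s a) w = c *\<^sub>R \<Gamma> w a" if s: "F_fun F A s" and w: "w \<in> topspace W" for s w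
  proof (rule linear_all_eigen[OF _ \<Gamma>lin[OF w] \<Gamma>inj[OF w]])
    show "linear (\<lambda>a. f (S s a) w)"
    proof (rule linearI)
      fix a b
      have "S s (a + b) = (\<lambda>v\<in>topspace V. S s a v + S s b v)" by (auto simp: S_def scaleR_add_right)
      then show "f (S s (a + b)) w = f (S s a) w + f (S s b) w" using fadd[OF SE[OF s] SE[OF s] w] by simp
    next
      fix r a
      have "S s (r *\<^sub>R a) = (\<lambda>v\<in>topspace V. r *\<^sub>R S s a v)" by (auto simp: S_def mult.commute)
      then show "f (S s (r *\<^sub>R a)) w = r *\<^sub>R f (S s a) w" using fscale[OF SE[OF s] w] by simp
    qed
    show "\<exists>c. f (S s a) w = c *\<^sub>R \<Gamma> w a" for a
    proof -
      obtain v where v: "v \<in> topspace V" "f (S s a) w = \<Gamma> w (S s a v)" using R1[OF SE[OF s] w] by blast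
      then have "f (S s a) w = s v *\<^sub>R \<Gamma> w a" by (simp add: S_def linear_cmul[OF \<Gamma>lin[OF w]])
      then show ?thesis by blast
    qed
  qed
  define G where "G s w = (SOME c. \<forall>a. f (S s a) w = c *\<^sub>R \<Gamma> w a)" for s w
  have G: "f (S s a) w = G s w *\<^sub>R \<Gamma> w a" if "F_fun F A s" "w \<in> topspace W" for s a w
    unfolding G_def using someI_ex[OF ex[OF that]] by blast
  \<comment> \<open>Some fixed nonzero vector, used to read off the scalar factor.\<close>
  define e :: "real ^ 'n" where "e = axis undefined 1"
  have e: "e \<noteq> 0" by (simp add: e_def axis_eq_0_iff)
  have \<Gamma>e: "\<Gamma> w e \<noteq> 0" if "w \<in> topspace W" for w using \<Gamma>0[OF that] e by blast
  have Ge: "G s w = c" if "F_fun F A s" "w \<in> topspace W" "f (S s e) w = c *\<^sub>R \<Gamma> w e" for s w c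
    using G[OF that(1,2), of e] that(3) \<Gamma>e[OF that(2)] by simp
  have Gran: "\<exists>v\<in>topspace V. G s w = s v" if s: "F_fun F A s" and w: "w \<in> topspace W" for s w
  proof -
    obtain v where v: "v \<in> topspace V" "f (S s e) w = \<Gamma> w (S s e v)" using R1[OF SE[OF s] w] by blast
    then have "f (S s e) w = s v *\<^sub>R \<Gamma> w e" by (simp add: S_def linear_cmul[OF \<Gamma>lin[OF w]])
    then show ?thesis using Ge[OF s w] v(1) by blast
  qed
  have Gran': "\<exists>w\<in>topspace W. G s w = s v" if s: "F_fun F A s" and v: "v \<in> topspace V" for s v
  proof -
    obtain w where w: "w \<in> topspace W" "f (S s e) w = \<Gamma> w (S s e v)" using R2[OF SE[OF s] v] by blast
    then have "f (S s e) w = s v *\<^sub>R \<Gamma> w e" using v by (simp add: S_def linear_cmul[OF \<Gamma>lin[OF w(1)]])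
    then show ?thesis using Ge[OF s w(1)] w(1) by blast
  qed
  have Gadd: "G (\<lambda>v. s v + t v) w = G s w + G t w"
    if s: "F_fun F A s" and t: "F_fun F A t" and w: "w \<in> topspace W" for s t w
  proof (rule Ge[OF F_fun_add[OF V FV s t] w])
    have "S (\<lambda>v. s v + t v) e = (\<lambda>v\<in>topspace V. S s e v + S t e v)" by (auto simp: S_def scaleR_add_left)
    then show "f (S (\<lambda>v. s v + t v) e) w = (G s w + G t w) *\<^sub>R \<Gamma> w e"
      using fadd[OF SE[OF s] SE[OF t] w] G[OF s w] G[OF t w] by (simp add: scaleR_add_left)
  qed
  have Gscale: "G (\<lambda>v. r * s v) w = r * G s w" if s: "F_fun F A s" and w: "w \<in> topspace W" for r s w
  proof (rule Ge[OF _ w])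
    show "F_fun F A (\<lambda>v. r * s v)" by (rule F_fun_linear[OF V FV bounded_linear_mult_right s])
    have "S (\<lambda>v. r * s v) e = (\<lambda>v\<in>topspace V. r *\<^sub>R S s e v)" by (auto simp: S_def)
    then show "f (S (\<lambda>v. r * s v) e) w = (r * G s w) *\<^sub>R \<Gamma> w e"
      using fscale[OF SE[OF s] w] G[OF s w] by simp
  qed
  have Gconst: "G (\<lambda>v. r) w = r" if w: "w \<in> topspace W" for r w
  proof (rule Ge[OF F_fun_const[OF V] w])
    have "S (\<lambda>v. r) e = const_map V (r *\<^sub>R e)" by (simp add: S_def const_map_def)
    then show "f (S (\<lambda>v. r) e) w = r *\<^sub>R \<Gamma> w e"
      using linear_cmul[OF \<Gamma>lin[OF w], of r e] by (simp add: \<Gamma>_def)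
  qed
  have main: "\<exists>v\<in>topspace V. \<forall>x. F_fun F A x \<longrightarrow> G x w = x v" if w: "w \<in> topspace W" for w
  proof -
    obtain k :: "'w \<Rightarrow> real" where k: "F_fun (Frechet_C \<infinity>) B k" "\<And>u. 0 \<le> k u" "k w = 0" "\<And>u. k u = 0 \<Longrightarrow> u = w"
      using smooth_unique_zero[OF W w] by metis
    have fe: "F_fun F B (f (const_map V e))"
      using bij cE[of e] by (auto simp: bij_betw_def E_def F_space_iff[OF W])
    have "(\<lambda>w\<in>topspace W. k w *\<^sub>R f (const_map V e) w) \<in> F_space F W B"
      by (intro F_space_restrict[OF W] F_fun_mult_smooth[OF W FW k(1) fe])
    then have "(\<lambda>w\<in>topspace W. k w *\<^sub>R f (const_map V e) w) \<in> f ` E"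
      using bij by (simp only: bij_betw_def E_def)
    then obtain y where y: "y \<in> E" "f y = (\<lambda>w\<in>topspace W. k w *\<^sub>R f (const_map V e) w)"
      by (rule imageE) (rule that, assumption, erule sym)
    have fy: "f y u = k u *\<^sub>R \<Gamma> u e" if "u \<in> topspace W" for u using y(2) that by (simp add: \<Gamma>_def)
    define s where "s v = (y v \<bullet> e) / (e \<bullet> e)" for v
    \<comment> \<open>The value \<open>y v\<close> is seen at some \<open>u\<close>, where
      \<open>f y\<close> is known to be \<open>\<Gamma> u (k u *\<^sub>R e)\<close>. Injectivity of
      \<open>\<Gamma> u\<close> makes \<open>y v\<close> a nonnegative multiple of \<open>e\<close>,
      so \<open>y\<close> comes from the scalar function \<open>s\<close>.\<close>
    have ys: "y v = s v *\<^sub>R e \<and> 0 \<le> s v" if v: "v \<in> topspace V" for v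
    proof -
      obtain u where u: "u \<in> topspace W" "f y u = \<Gamma> u (y v)" using R2[OF y(1) v] by blast
      then have "\<Gamma> u (y v) = \<Gamma> u (k u *\<^sub>R e)" using fy by (simp add: linear_cmul[OF \<Gamma>lin])
      then have "y v = k u *\<^sub>R e" using \<Gamma>inj[OF u(1)] by (simp add: inj_eq)
      then show ?thesis using e k(2)[of u] by (simp add: s_def)
    qed
    have sF: "F_fun F A s"
      unfolding s_def divide_inverse
      by (rule F_fun_linear[OF V FV bounded_linear_compose[OF bounded_linear_mult_left bounded_linear_inner_left] EF[OF y(1)]])
    have Gs: "G s u = k u" if u: "u \<in> topspace W" for u
    proof (rule Ge[OF sF u])
      have "S s e v = y v" for v
        using ys[of v] extensional_arb[OF Eext[OF y(1)]] by (cases "v \<in> topspace V") (simp_all add: S_def)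
      then have "S s e = y" by blast
      then show "f (S s e) u = k u *\<^sub>R \<Gamma> u e" using fy[OF u] by simp
    qed
    obtain v where v: "v \<in> topspace V" "s v = 0" using Gran[OF sF w] Gs[OF w] k(3) by auto
    have zero: "G x w = 0" if x: "F_fun F A x" and xv: "x v = 0" for x
    proof -
      let ?q = "\<lambda>v. x v * x v"
      have q: "F_fun F A ?q" using F_fun_square[OF V FV x] .
      obtain u where u: "u \<in> topspace W" "G (\<lambda>v. ?q v + s v) u = ?q v + s v"
        using Gran'[OF F_fun_add[OF V FV q sF] v(1)] by blast
      have "G ?q u + k u = 0" using u Gadd[OF q sF u(1)] Gs[OF u(1)] xv v(2) by simp
      moreover have "0 \<le> G ?q u" using Gran[OF q u(1)] by auto
      ultimately have "k u = 0" "G ?q u = 0" using k(2)[of u] by linarith+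
      then have Gq: "G ?q w = 0" using k(4) by blast
      \<comment> \<open>The Cauchy-Schwarz step as a discriminant: the square of
        \<open>x + r\<close> has the nonnegative image \<open>2 * r * G x w + r * r\<close>, whose
        minimum over \<open>r\<close> is attained here and is minus the square of
        \<open>G x w\<close>.\<close>
      define r where "r = - G x w"
      have x2: "F_fun F A (\<lambda>v. (2 * r) * x v)" by (rule F_fun_linear[OF V FV bounded_linear_mult_right x])
      have "G (\<lambda>v. (?q v + (2 * r) * x v) + r * r) w = 2 * r * G x w + r * r"
        using Gadd[OF F_fun_add[OF V FV q x2] F_fun_const[OF V] w] Gadd[OF q x2 w] Gscale[OF x w] Gconst[OF w] Gq by simp
      moreover have "F_fun F A (\<lambda>v. (?q v + (2 * r) * x v) + r * r)"
        by (intro F_fun_add[OF V FV] q x2 F_fun_const[OF V])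
      from Gran[OF this w] obtain u' where "G (\<lambda>v. (?q v + (2 * r) * x v) + r * r) w = (x u' * x u' + (2 * r) * x u') + r * r"
        by (rule bexE)
      then have "G (\<lambda>v. (?q v + (2 * r) * x v) + r * r) w = (x u' + r) * (x u' + r)"
        by (simp only: algebra_simps)
      then have "0 \<le> G (\<lambda>v. (?q v + (2 * r) * x v) + r * r) w"
        by (simp only: zero_le_square)
      ultimately have "0 \<le> - (G x w * G x w)" by (simp add: r_def)
      then show ?thesis by (auto simp: mult_le_0_iff)
    qed
    have "G x w = x v" if x: "F_fun F A x" for x
    proof -
      have "F_fun F A (\<lambda>u. x u + - x v)" by (intro F_fun_add[OF V FV] x F_fun_const[OF V])
      from zero[OF this] have "G (\<lambda>u. x u + - x v) w = 0" by simp
      then show ?thesis using Gadd[OF x F_fun_const[OF V] w, of "- x v"] Gconst[OF w, of "- x v"] by simp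
    qed
    then show ?thesis using v(1) by blast
  qed
  \<comment> \<open>Additivity holds for members of the function space, which are
    \<open>undefined\<close> off the carrier; hence the restriction around every partial
    sum.\<close>
  have fsum: "f (\<lambda>v\<in>topspace V. \<Sum>i\<in>I. g i v) w = (\<Sum>i\<in>I. f (g i) w)"
    if "finite I" "\<And>i. i \<in> I \<Longrightarrow> g i \<in> E" and w: "w \<in> topspace W" for I and g :: "'n \<Rightarrow> 'v \<Rightarrow> real ^ 'n" and w
    using that(1,2)
  proof (induction I rule: finite_induct)
    case empty
    have "(\<lambda>v\<in>topspace V. 0) = const_map V (0 :: real ^ 'n)" by (simp add: const_map_def)
    then show ?case using linear_0[OF \<Gamma>lin[OF w]] by (simp add: \<Gamma>_def)
  next
    case (insert i I)
    have gI: "(\<lambda>v\<in>topspace V. \<Sum>i\<in>I. g i v) \<in> E"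
      using insert by (intro E F_fun_sum[OF V FV]) (auto intro: EF)
    have eq: "(\<lambda>v\<in>topspace V. \<Sum>i\<in>insert i I. g i v) = (\<lambda>v\<in>topspace V. g i v + (\<lambda>v\<in>topspace V. \<Sum>i\<in>I. g i v) v)"
      using insert by (auto simp: restrict_def)
    have IH: "f (\<lambda>v\<in>topspace V. \<Sum>i\<in>I. g i v) w = (\<Sum>i\<in>I. f (g i) w)" using insert by blast
    have gi: "g i \<in> E" using insert by blast
    have "f (\<lambda>v\<in>topspace V. \<Sum>i\<in>insert i I. g i v) w = f (g i) w + f (\<lambda>v\<in>topspace V. \<Sum>i\<in>I. g i v) w"
      unfolding eq by (rule fadd[OF gi gI w])
    then show ?case by (simp only: IH sum.insert[OF insert(1,2)])
  qed
  have "\<exists>v. v \<in> topspace V \<and> (\<forall>x\<in>E. f x w = \<Gamma> w (x v))" if w: "w \<in> topspace W" for w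
  proof -
    obtain v where v: "v \<in> topspace V" "\<And>x. F_fun F A x \<Longrightarrow> G x w = x v" using main[OF w] by blast
    have "f x w = \<Gamma> w (x v)" if x: "x \<in> E" for x
    proof -
      \<comment> \<open>Splitting \<open>x\<close> into coordinates leaves scalar functions times
        fixed vectors, on which \<open>f\<close> acts through \<open>G\<close>.\<close>
      define g where "g i = S (\<lambda>v. x v $ i) (axis i 1)" for i
      have comp: "F_fun F A (\<lambda>v. x v $ i)" for i
        by (rule F_fun_linear[OF V FV bounded_linear_vec_nth EF[OF x]])
      have "x = (\<lambda>v\<in>topspace V. \<Sum>i\<in>UNIV. g i v)"
      proof
        fix u
        show "x u = (\<lambda>v\<in>topspace V. \<Sum>i\<in>UNIV. g i v) u"
          using extensional_arb[OF Eext[OF x], of u] basis_expansion[of "x u"]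
          by (cases "u \<in> topspace V") (simp_all add: g_def S_def scalar_mult_eq_scaleR)
      qed
      then have "f x w = (\<Sum>i\<in>UNIV. f (g i) w)"
        using fsum[of UNIV g w] SE[OF comp] w by (simp add: g_def)
      also have "\<dots> = (\<Sum>i\<in>UNIV. (x v $ i) *\<^sub>R \<Gamma> w (axis i 1))"
        unfolding g_def using G[OF comp w] v(2)[OF comp] by simp
      also have "\<dots> = \<Gamma> w (\<Sum>i\<in>UNIV. (x v $ i) *\<^sub>R axis i 1)"
        by (simp add: linear_sum[OF \<Gamma>lin[OF w]] linear_cmul[OF \<Gamma>lin[OF w]] o_def)
      also have "(\<Sum>i\<in>UNIV. (x v $ i) *\<^sub>R axis i 1) = x v"
        using basis_expansion[of "x v"] by (simp add: scalar_mult_eq_scaleR)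
      finally show ?thesis .
    qed
    then show ?thesis using v(1) by blast
  qed
  then show "\<exists>\<phi>. \<forall>w\<in>topspace W. \<phi> w \<in> topspace V \<and>
       (\<forall>x\<in>F_space F V A. f x w = f (const_map V (x (\<phi> w))) w)"
    unfolding \<Gamma>_def E_def by metis
  show "linear (\<lambda>a. f (const_map V a) w)" "inj (\<lambda>a. f (const_map V a) w)" if "w \<in> topspace W" for w
    using \<Gamma>lin[OF that] \<Gamma>inj[OF that] by (simp_all add: \<Gamma>_def[abs_def])
qed

section \<open>The point map and its inverse as maps of the class\<close>

lemma F_mapI:
  assumes "continuous_map V W g"
    "\<And>U c U' c'. (U, c) \<in> A \<Longrightarrow> (U', c') \<in> B \<Longrightarrow>
      class_on F (c ` {v \<in> U. g v \<in> U'}) (c' \<circ> g \<circ> inv_into U c)"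
  shows "F_map F V A W B g"
  using assms by (auto simp only: F_map_def)

lemma F_mapD:
  assumes "F_map F V A W B g"
  shows "continuous_map V W g"
    "(U, c) \<in> A \<Longrightarrow> (U', c') \<in> B \<Longrightarrow> class_on F (c ` {v \<in> U. g v \<in> U'}) (c' \<circ> g \<circ> inv_into U c)"
  using assms by (auto simp only: F_map_def)

lemma F_map_cong:
  assumes V: "smooth_manifold m V A" and W: "smooth_manifold m' W B" and g: "F_map F V A W B g"
    and eq: "\<And>v. v \<in> topspace V \<Longrightarrow> g v = h v"
  shows "F_map F V A W B h"
proof (rule F_mapI)
  show "continuous_map V W h" using F_mapD(1)[OF g] eq by (rule continuous_map_eq)
next
  fix U c U' c' assume c: "(U, c) \<in> A" "(U', c') \<in> B"
  note ch = manifold_chartD[OF V c(1)]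
  have eqs: "{v \<in> U. h v \<in> U'} = {v \<in> U. g v \<in> U'}" using eq ch(2) by auto
  have "openin V {v \<in> topspace V. g v \<in> U'}"
    by (rule openin_continuous_map_preimage[OF F_mapD(1)[OF g] manifold_chartD(1)[OF W c(2)]])
  then have "openin V (U \<inter> {v \<in> topspace V. g v \<in> U'})" using ch(1) by (rule openin_Int[rotated])
  moreover have "U \<inter> {v \<in> topspace V. g v \<in> U'} = {v \<in> U. g v \<in> U'}" using ch(2) by blast
  ultimately have S: "openin V {v \<in> U. g v \<in> U'}" by (simp only:)
  have cd: "chart_domain (c ` {v \<in> U. g v \<in> U'})"
    by (rule chart_domain_openin[OF ch(3) chart_image_openin[OF V c(1) S]]) blast
  have "class_on F (c ` {v \<in> U. g v \<in> U'}) (c' \<circ> g \<circ> inv_into U c)"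
    using F_mapD(2)[OF g c] .
  then have "class_on F (c ` {v \<in> U. g v \<in> U'}) (c' \<circ> h \<circ> inv_into U c)"
  proof (rule class_on_cong[OF cd, rotated])
    fix y assume "y \<in> c ` {v \<in> U. g v \<in> U'}"
    then have "inv_into U c y \<in> U" by (blast intro: inv_into_into)
    then show "(c' \<circ> g \<circ> inv_into U c) y = (c' \<circ> h \<circ> inv_into U c) y" using eq ch(2) by auto
  qed
  then show "class_on F (c ` {v \<in> U. h v \<in> U'}) (c' \<circ> h \<circ> inv_into U c)" by (simp only: eqs)
qed

text \<open>For continuity: \<open>\<phi> w\<close> lies in an open set \<open>T\<close> wherever
  the pullback of a bump vanishing off \<open>T\<close> is nonzero. Once preimages are open, the
  chart expression of \<open>\<phi>\<close> near a point is assembled from the pullbacks of cut-off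
  coordinates.\<close>

lemma F_map_if_pullback_smooth:
  assumes V: "smooth_manifold mV V A" and W: "smooth_manifold mW W B" and FW: "admissible F mW"
    and \<phi>: "\<And>w. w \<in> topspace W \<Longrightarrow> \<phi> w \<in> topspace V"
    and pb: "\<And>s :: 'v \<Rightarrow> real. F_fun (Frechet_C \<infinity>) A s \<Longrightarrow> F_fun F B (\<lambda>w. s (\<phi> w))"
  shows "F_map F W B V A \<phi>"
proof -
  have pre: "openin W {w \<in> topspace W. \<phi> w \<in> T}" if T: "openin V T" for T
  proof (subst openin_subopen, intro ballI)
    fix w assume w: "w \<in> {w \<in> topspace W. \<phi> w \<in> T}"
    then have wT: "\<phi> w \<in> T" by blast
    obtain s :: "'v \<Rightarrow> real" where s: "F_fun (Frechet_C \<infinity>) A s" "s (\<phi> w) = 1" "\<And>u. u \<notin> T \<Longrightarrow> s u = 0"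
      by (rule smooth_bump[OF V T wT]) (rule that, assumption, assumption, blast)
    have "openin W {w \<in> topspace W. s (\<phi> w) \<in> - {0}}"
      by (rule openin_continuous_map_preimage[OF F_fun_continuous[OF W pb[OF s(1)]]]) auto
    moreover have "{w \<in> topspace W. s (\<phi> w) \<in> - {0}} \<subseteq> {w \<in> topspace W. \<phi> w \<in> T}" using s(3) by blast
    ultimately show "\<exists>S. openin W S \<and> w \<in> S \<and> S \<subseteq> {w \<in> topspace W. \<phi> w \<in> T}"
      using w s(2) by (intro exI[of _ "{w \<in> topspace W. s (\<phi> w) \<in> - {0}}"]) simp
  qed
  show ?thesis
  proof (rule F_mapI)
    show "continuous_map W V \<phi>" using \<phi> pre by (auto simp: continuous_map)
  next
    fix U c U' c' assume c: "(U, c) \<in> B" "(U', c') \<in> A"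
    note ch = manifold_chartD[OF W c(1)]
    have int: "openin W {w \<in> U. \<phi> w \<in> T}" if "openin V T" for T
    proof -
      have "openin W (U \<inter> {w \<in> topspace W. \<phi> w \<in> T})" using ch(1) pre[OF that] by (rule openin_Int)
      moreover have "U \<inter> {w \<in> topspace W. \<phi> w \<in> T} = {w \<in> U. \<phi> w \<in> T}" using ch(2) by blast
      ultimately show ?thesis by (simp only:)
    qed
    show "class_on F (c ` {w \<in> U. \<phi> w \<in> U'}) (c' \<circ> \<phi> \<circ> inv_into U c)"
    proof (rule class_on_chart_local[OF W c(1) int[OF manifold_chartD(1)[OF V c(2)]]])
      fix w assume w: "w \<in> {w \<in> U. \<phi> w \<in> U'}"
      then have wU: "\<phi> w \<in> U'" by blast
      show "\<exists>R. openin W R \<and> w \<in> R \<and> R \<subseteq> {w \<in> U. \<phi> w \<in> U'} \<and> class_on F (c ` R) (c' \<circ> \<phi> \<circ> inv_into U c)"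
      proof (rule smooth_coordinates[OF V c(2) wU])
        fix R s assume R: "openin V R" "\<phi> w \<in> R" "R \<subseteq> U'"
          and s: "\<And>i. F_fun (Frechet_C \<infinity>) A (s i :: 'v \<Rightarrow> real)" "\<And>i u. u \<in> R \<Longrightarrow> s i u = c' u \<bullet> i"
        let ?N = "{w \<in> U. \<phi> w \<in> R}"
        have N: "openin W ?N" using int[OF R(1)] .
        note NI = chart_image_openin[OF W c(1) N Collect_restrict]
        have cd: "chart_domain (c ` ?N)" by (rule chart_domain_openin[OF ch(3) NI])
        have "class_on F (c ` ?N) (\<lambda>y. \<Sum>i\<in>Basis. s i (\<phi> (inv_into U c y)) *\<^sub>R i)"
          by (rule class_on_sum[OF FW cd finite_Basis])
             (rule class_on_subset[OF ch(3) NI class_on_linear[OF FW ch(3) bounded_linear_scaleR_left F_funD[OF pb[OF s(1)] c(1)]]])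
        then have "class_on F (c ` ?N) (c' \<circ> \<phi> \<circ> inv_into U c)"
        proof (rule class_on_cong[OF cd, rotated])
          fix y assume "y \<in> c ` ?N"
          then obtain u where u: "u \<in> U" "\<phi> u \<in> R" "y = c u" by blast
          have "inv_into U c y = u" using inv_into_f_f[OF ch(5) u(1)] u(3) by simp
          then show "(\<Sum>i\<in>Basis. s i (\<phi> (inv_into U c y)) *\<^sub>R i) = (c' \<circ> \<phi> \<circ> inv_into U c) y"
            by (simp add: s(2)[OF u(2)] euclidean_representation)
        qed
        then show ?thesis using N w R(2,3) by (intro exI[of _ ?N]) blast
      qed
    qed blast
  qed
qed

lemma linear_on_F_inv_into:
  fixes f :: "('v \<Rightarrow> 'e::euclidean_space) \<Rightarrow> ('w \<Rightarrow> 'e)"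
  assumes V: "smooth_manifold mV V A" and FV: "admissible F mV"
    and bij: "bij_betw f (F_space F V A) (F_space F W B)" and lin: "linear_on_F F V A W f"
  shows "linear_on_F F W B V (inv_into (F_space F V A) f)"
proof -
  let ?g = "inv_into (F_space F V A) f"
  have g: "?g x \<in> F_space F V A" "f (?g x) = x" if "x \<in> F_space F W B" for x
    using bij that by (auto simp: bij_betw_def inv_into_into f_inv_into_f)
  have FF: "F_fun F A (?g x)" if "x \<in> F_space F W B" for x
    using g(1)[OF that] by (simp add: F_space_iff[OF V])
  have inj: "inj_on f (F_space F V A)" using bij by (simp add: bij_betw_def)
  have add: "f (\<lambda>v\<in>topspace V. x v + y v) = (\<lambda>w\<in>topspace W. f x w + f y w)"
    if "x \<in> F_space F V A" "y \<in> F_space F V A" for x y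
    using lin that by (simp only: linear_on_F_def)
  have scale: "f (\<lambda>v\<in>topspace V. r *\<^sub>R x v) = (\<lambda>w\<in>topspace W. r *\<^sub>R f x w)" if "x \<in> F_space F V A" for r x
    using lin that by (simp only: linear_on_F_def)
  show ?thesis
    unfolding linear_on_F_def
  proof (intro conjI ballI allI)
    fix x y :: "'w \<Rightarrow> 'e" assume x: "x \<in> F_space F W B" and y: "y \<in> F_space F W B"
    show "?g (\<lambda>w\<in>topspace W. x w + y w) = (\<lambda>v\<in>topspace V. ?g x v + ?g y v)"
    proof (rule inv_into_f_eq[OF inj])
      show "(\<lambda>v\<in>topspace V. ?g x v + ?g y v) \<in> F_space F V A"
        by (rule F_space_restrict[OF V F_fun_add[OF V FV FF[OF x] FF[OF y]]])
      show "f (\<lambda>v\<in>topspace V. ?g x v + ?g y v) = (\<lambda>w\<in>topspace W. x w + y w)"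
        unfolding add[OF g(1)[OF x] g(1)[OF y]] g(2)[OF x] g(2)[OF y] ..
    qed
  next
    fix r and x :: "'w \<Rightarrow> 'e" assume x: "x \<in> F_space F W B"
    show "?g (\<lambda>w\<in>topspace W. r *\<^sub>R x w) = (\<lambda>v\<in>topspace V. r *\<^sub>R ?g x v)"
    proof (rule inv_into_f_eq[OF inj])
      show "(\<lambda>v\<in>topspace V. r *\<^sub>R ?g x v) \<in> F_space F V A"
        by (rule F_space_restrict[OF V F_fun_linear[OF V FV bounded_linear_scaleR_right FF[OF x]]])
      show "f (\<lambda>v\<in>topspace V. r *\<^sub>R ?g x v) = (\<lambda>w\<in>topspace W. r *\<^sub>R x w)"
        unfolding scale[OF g(1)[OF x]] g(2)[OF x] ..
    qed
  qed
qed

lemma const_map_in_F_space: "smooth_manifold m V A \<Longrightarrow> const_map V a \<in> F_space F V A"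
  unfolding const_map_def by (rule F_space_restrict[OF _ F_fun_const])

lemma point_map_F_map:
  fixes V :: "'v topology" and A :: "('v, 'a::euclidean_space) chart set"
    and W :: "'w topology" and B :: "('w, 'b::euclidean_space) chart set"
    and f :: "('v \<Rightarrow> real ^ 'n) \<Rightarrow> ('w \<Rightarrow> real ^ 'n)"
  assumes V: "smooth_manifold mV V A" and W: "smooth_manifold mW W B"
    and FV: "admissible F mV" and FW: "admissible F mW"
    and bij: "bij_betw f (F_space F V A) (F_space F W B)"
    and lin: "\<And>w. w \<in> topspace W \<Longrightarrow> linear (\<lambda>a. f (const_map V a) w)"
    and \<phi>: "\<And>w. w \<in> topspace W \<Longrightarrow> \<phi> w \<in> topspace V"
    and f: "\<And>w x. w \<in> topspace W \<Longrightarrow> x \<in> F_space F V A \<Longrightarrow> f x w = f (const_map V (x (\<phi> w))) w"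
  shows "F_map F W B V A \<phi>"
proof (rule F_map_if_pullback_smooth[OF V W FW \<phi>])
  fix s :: "'v \<Rightarrow> real" assume s: "F_fun (Frechet_C \<infinity>) A s"
  define e :: "real ^ 'n" where "e = axis undefined 1"
  have e: "e \<noteq> 0" by (simp add: e_def axis_eq_0_iff)
  have "const_map W e \<in> f ` F_space F V A"
    using bij const_map_in_F_space[OF W] by (simp add: bij_betw_def)
  then obtain z where z: "z \<in> F_space F V A" "f z = const_map W e"
    by (rule imageE) (rule that, assumption, erule sym)
  define y where "y = (\<lambda>v\<in>topspace V. s v *\<^sub>R z v)"
  have y: "y \<in> F_space F V A"
    unfolding y_def using z(1)
    by (intro F_space_restrict[OF V] F_fun_mult_smooth[OF V FV s]) (simp add: F_space_iff[OF V])
  have fy: "f y w = s (\<phi> w) *\<^sub>R e" if w: "w \<in> topspace W" for w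
  proof -
    have "f y w = f (const_map V (s (\<phi> w) *\<^sub>R z (\<phi> w))) w"
      using f[OF w y] \<phi>[OF w] by (simp add: y_def)
    also have "\<dots> = s (\<phi> w) *\<^sub>R f (const_map V (z (\<phi> w))) w" by (rule linear_cmul[OF lin[OF w]])
    also have "f (const_map V (z (\<phi> w))) w = f z w" by (rule f[OF w z(1), symmetric])
    finally show ?thesis using w by (simp add: z(2) const_map_def)
  qed
  have "f y \<in> F_space F W B" using bij y by (auto simp: bij_betw_def)
  then have "F_fun F B (f y)" by (simp add: F_space_iff[OF W])
  then have "F_fun F B (\<lambda>w. (f y w \<bullet> e) * inverse (e \<bullet> e))"
    by (rule F_fun_linear[OF W FW bounded_linear_compose[OF bounded_linear_mult_left bounded_linear_inner_left]])
  then show "F_fun F B (\<lambda>w. s (\<phi> w))"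
    by (rule F_fun_cong[OF W]) (simp add: fy e)
qed

text \<open>Smooth functions separate points: a bump at \<open>v\<close> that vanishes at
  \<open>\<phi> (\<psi> v)\<close> would be sent to 0 at \<open>v\<close> by \<open>f\<close>
  followed by \<open>g\<close>, although this composite is the identity. Used with exchanged roles,
  the statement gives the other composite too.\<close>

lemma point_map_inverse:
  fixes V :: "'v topology" and A :: "('v, 'a::euclidean_space) chart set"
    and f :: "('v \<Rightarrow> real ^ 'n) \<Rightarrow> ('w \<Rightarrow> real ^ 'n)"
  assumes V: "smooth_manifold mV V A" and FV: "admissible F mV"
    and lin: "\<And>w. w \<in> topspace W \<Longrightarrow> linear (\<lambda>a. f (const_map V a) w)"
    and lin': "\<And>v. v \<in> topspace V \<Longrightarrow> linear (\<lambda>a. g (const_map W a) v)"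
    and inv: "\<And>x. x \<in> F_space F V A \<Longrightarrow> f x \<in> F_space F W B" "\<And>x. x \<in> F_space F V A \<Longrightarrow> g (f x) = x"
    and \<phi>: "\<And>w. w \<in> topspace W \<Longrightarrow> \<phi> w \<in> topspace V"
    and f: "\<And>w x. w \<in> topspace W \<Longrightarrow> x \<in> F_space F V A \<Longrightarrow> f x w = f (const_map V (x (\<phi> w))) w"
    and \<psi>: "\<And>v. v \<in> topspace V \<Longrightarrow> \<psi> v \<in> topspace W"
    and g: "\<And>v y. v \<in> topspace V \<Longrightarrow> y \<in> F_space F W B \<Longrightarrow> g y v = g (const_map W (y (\<psi> v))) v"
    and v: "v \<in> topspace V"
  shows "\<phi> (\<psi> v) = v"
proof (rule ccontr)
  assume ne: "\<phi> (\<psi> v) \<noteq> v"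
  have "closedin V {\<phi> (\<psi> v)}"
    using V \<phi>[OF \<psi>[OF v]] by (simp add: smooth_manifold_def closedin_Hausdorff_singleton)
  then have T: "openin V (topspace V - {\<phi> (\<psi> v)})" by blast
  have vT: "v \<in> topspace V - {\<phi> (\<psi> v)}" using v ne by simp
  obtain s :: "'v \<Rightarrow> real" where s: "F_fun (Frechet_C \<infinity>) A s" "s v = 1"
    "\<And>u. u \<notin> topspace V - {\<phi> (\<psi> v)} \<Longrightarrow> s u = 0"
    by (rule smooth_bump[OF V T vT]) (rule that, assumption, assumption, blast)
  define e :: "real ^ 'n" where "e = axis undefined 1"
  have e: "e \<noteq> 0" by (simp add: e_def axis_eq_0_iff)
  define x where "x = (\<lambda>v\<in>topspace V. s v *\<^sub>R e)"
  have x: "x \<in> F_space F V A"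
    unfolding x_def by (intro F_space_restrict[OF V] F_fun_mult_smooth[OF V FV s(1)] F_fun_const[OF V])
  have "x (\<phi> (\<psi> v)) = 0" using \<phi>[OF \<psi>[OF v]] s(3) by (simp add: x_def)
  then have "f x (\<psi> v) = 0"
    using f[OF \<psi>[OF v] x] linear_0[OF lin[OF \<psi>[OF v]]] by simp
  then have "g (f x) v = 0"
    using g[OF v inv(1)[OF x]] linear_0[OF lin'[OF v]] by simp
  then have "x v = 0" using inv(2)[OF x] by simp
  then show False using v s(2) e by (simp add: x_def)
qed

lemma F_map_GL:
  fixes \<Gamma> :: "'w \<Rightarrow> real ^ 'n \<Rightarrow> real ^ 'n"
  assumes W: "smooth_manifold m W B" and F: "admissible F m"
    and lin: "\<And>w. w \<in> topspace W \<Longrightarrow> linear (\<Gamma> w)" "\<And>w. w \<in> topspace W \<Longrightarrow> inj (\<Gamma> w)"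
    and \<Gamma>: "\<And>a. F_fun F B (\<lambda>w. \<Gamma> w a)"
  shows "F_map F W B (top_of_set GL) {(GL, id)} (\<lambda>w. matrix (\<Gamma> w))"
proof -
  \<comment> \<open>\<open>L j x\<close> has \<open>x\<close> as column \<open>j\<close> and zeros
    elsewhere, so the matrix of \<open>\<Gamma> w\<close> is a sum of bounded linear images of its
    columns.\<close>
  define L :: "'n \<Rightarrow> real ^ 'n \<Rightarrow> real ^ 'n ^ 'n" where "L j x = (\<chi> i k. if k = j then x $ i else 0)" for j x
  have L: "bounded_linear (L j)" for j
    unfolding linear_conv_bounded_linear[symmetric] by (rule linearI) (auto simp: L_def vec_eq_iff)
  have "F_fun F B (\<lambda>w. \<Sum>j\<in>UNIV. L j (\<Gamma> w (axis j 1)))"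
    by (intro F_fun_sum[OF W F] F_fun_linear[OF W F L] \<Gamma>) simp
  moreover have "(\<Sum>j\<in>UNIV. L j (\<Gamma> w (axis j 1))) = matrix (\<Gamma> w)" for w
    by (simp add: vec_eq_iff L_def matrix_def)
  ultimately have FF: "F_fun F B (\<lambda>w. matrix (\<Gamma> w))" by simp
  have GL: "matrix (\<Gamma> w) \<in> GL" if w: "w \<in> topspace W" for w
  proof -
    have "inj (\<lambda>x. matrix (\<Gamma> w) *v x)" using lin(2)[OF w] by (simp add: matrix_vector_mul(2)[OF lin(1)[OF w]])
    then show ?thesis by (simp add: GL_def invertible_left_inverse matrix_left_invertible_injective)
  qed
  show ?thesis
  proof (rule F_mapI)
    show "continuous_map W (top_of_set GL) (\<lambda>w. matrix (\<Gamma> w))"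
      using F_fun_continuous[OF W FF] GL by (auto simp: continuous_map_in_subtopology)
  next
    fix U c G' and c' :: "real ^ 'n ^ 'n \<Rightarrow> real ^ 'n ^ 'n" assume c: "(U, c) \<in> B" and "(G', c') \<in> {(GL :: (real ^ 'n ^ 'n) set, id)}"
    then have G': "G' = GL" "c' = id" by simp_all
    have "{w \<in> U. matrix (\<Gamma> w) \<in> GL} = U" using GL manifold_chartD(2)[OF W c] by blast
    then show "class_on F (c ` {w \<in> U. matrix (\<Gamma> w) \<in> G'}) (c' \<circ> (\<lambda>w. matrix (\<Gamma> w)) \<circ> inv_into U c)"
      using F_funD[OF FF c] by (simp only: G' comp_def id_apply)
  qed
qed

theorem theorem8p1:
  fixes V :: "'v topology" and A :: "('v, 'a::euclidean_space) chart set" and mV :: nat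
    and W :: "'w topology" and B :: "('w, 'b::euclidean_space) chart set" and mW :: nat
    and F :: smoothness
    and f :: "('v \<Rightarrow> real ^ 'n) \<Rightarrow> ('w \<Rightarrow> real ^ 'n)"
  assumes "smooth_manifold mV V A"
    and "smooth_manifold mW W B"
    and "admissible F mV"
    and "admissible F mW"
    and "bij_betw f (F_space F V A) (F_space F W B)"
    and "linear_on_F F V A W f"
    and "f ` F_space_nz F V A = F_space_nz F W B"
  shows "\<exists>(\<phi> :: 'w \<Rightarrow> 'v) (\<gamma> :: 'w \<Rightarrow> real ^ 'n ^ 'n).
    bi_F_map F W B V A \<phi> \<and>
    F_map F W B (top_of_set GL) {(GL, id)} \<gamma> \<and>
    (\<forall>x \<in> F_space F V A. \<forall>w \<in> topspace W. f x w = \<gamma> w *v x (\<phi> w))"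
proof -
  note V = assms(1) and W = assms(2) and FV = assms(3) and FW = assms(4) and bij = assms(5)
  define g where "g = inv_into (F_space F V A) f"
  have bij': "bij_betw g (F_space F W B) (F_space F V A)"
    unfolding g_def by (rule bij_betw_inv_into[OF bij])
  have lin': "linear_on_F F W B V g" unfolding g_def by (rule linear_on_F_inv_into[OF V FV bij assms(6)])
  have "F_space_nz F V A \<subseteq> F_space F V A" by (simp add: F_space_nz_def)
  \<comment> \<open>The hypotheses carry over to the inverse, so a point map exists in both
    directions.\<close>
  then have nz': "g ` F_space_nz F W B = F_space_nz F V A"
    unfolding g_def assms(7)[symmetric]
    using bij by (intro inv_into_image_cancel) (simp_all add: bij_betw_def)
  note P = point_map_exists[OF V W FV FW bij assms(6,7)]
  note Q = point_map_exists[OF W V FW FV bij' lin' nz']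
  obtain \<phi> where \<phi>: "\<And>w. w \<in> topspace W \<Longrightarrow> \<phi> w \<in> topspace V"
    "\<And>w x. w \<in> topspace W \<Longrightarrow> x \<in> F_space F V A \<Longrightarrow> f x w = f (const_map V (x (\<phi> w))) w"
    using P(3) by meson
  obtain \<psi> where \<psi>: "\<And>v. v \<in> topspace V \<Longrightarrow> \<psi> v \<in> topspace W"
    "\<And>v y. v \<in> topspace V \<Longrightarrow> y \<in> F_space F W B \<Longrightarrow> g y v = g (const_map W (y (\<psi> v))) v"
    using Q(3) by meson
  have maps: "f x \<in> F_space F W B" "g (f x) = x" if "x \<in> F_space F V A" for x
    using bij that by (auto simp: bij_betw_def g_def)
  have maps': "g y \<in> F_space F V A" "f (g y) = y" if "y \<in> F_space F W B" for y
    using bij that by (auto simp: bij_betw_def g_def inv_into_into f_inv_into_f)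
  have inv: "\<phi> (\<psi> v) = v" if "v \<in> topspace V" for v
    by (rule point_map_inverse[where f = f and g = g and \<phi> = \<phi> and \<psi> = \<psi> and W = W and B = B, OF V FV P(1) Q(1) maps \<phi> \<psi> that])
  have inv': "\<psi> (\<phi> w) = w" if "w \<in> topspace W" for w
    by (rule point_map_inverse[where f = g and g = f and \<phi> = \<psi> and \<psi> = \<phi> and W = V and B = A, OF W FW Q(1) P(1) maps' \<psi> \<phi> that])
  have b: "bij_betw \<phi> (topspace W) (topspace V)"
    by (rule bij_betw_byWitness[of _ \<psi>]) (use inv inv' \<phi>(1) \<psi>(1) in auto)
  have "F_map F W B V A \<phi>" by (rule point_map_F_map[where f = f and \<phi> = \<phi>, OF V W FV FW bij P(1) \<phi>])
  moreover have "F_map F V A W B (inv_into (topspace W) \<phi>)"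
  \<comment> \<open>\<open>inv_into (topspace W) \<phi>\<close> and \<open>\<psi>\<close> are only
    known to agree on the carrier of \<open>V\<close>.\<close>
  proof (rule F_map_cong[OF V W point_map_F_map[where f = g and \<phi> = \<psi>, OF W V FW FV bij' Q(1) \<psi>]])
    show "\<psi> v = inv_into (topspace W) \<phi> v" if "v \<in> topspace V" for v
      using inv_into_f_f[OF bij_betw_imp_inj_on[OF b] \<psi>(1)[OF that]] inv[OF that] by simp
  qed
  ultimately have "bi_F_map F W B V A \<phi>" using b by (simp add: bi_F_map_def)
  moreover have "F_map F W B (top_of_set GL) {(GL, id)} (\<lambda>w. matrix (\<lambda>a. f (const_map V a) w))"
  proof (rule F_map_GL[OF W FW P(1,2)])
    fix a
    show "F_fun F B (\<lambda>w. f (const_map V a) w)"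
      using maps(1)[OF const_map_in_F_space[OF V]] by (simp add: F_space_iff[OF W])
  qed
  moreover have "f x w = matrix (\<lambda>a. f (const_map V a) w) *v x (\<phi> w)"
    if "x \<in> F_space F V A" "w \<in> topspace W" for x w
    using \<phi>(2)[OF that(2,1)] by (simp add: fun_cong[OF matrix_vector_mul(2)[OF P(1)[OF that(2)]]])
  ultimately show ?thesis by blast
qed

end
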